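(* Let $n$ be a positive integer, and let $\mathcal{C}_n$, $\mathbf{Q}=\mathbf{Q}_{n-1}$, the functors $\mathrm{G}_{i}$, the category $\mathcal{X}$, the $2$-category $\mathscr{G}_n$, the set $\mathcal{S}[\mathscr{G}_n]$ and the Grothendieck category $\mathrm{Gr}(\mathscr{G}_n)$ be as defined in the context. Then: (a) Composition of $1$-morphisms defines on $\mathcal{S}[\mathscr{G}_n]$ the structure of a semigroup. (b) There is an isomorphism of monoids $\Phi:\mathcal{C}_n\to\mathcal{S}[\mathscr{G}_n]$. (c) The morphism space of the Grothendieck category $\mathrm{Gr}(\mathscr{G}_n)$ (that is, the endomorphism ring of its unique object) is isomorphic to the integral monoid algebra $\mathbb{Z}[\mathcal{C}_n]$. (d) The action of $\mathrm{Gr}(\mathscr{G}_n)$ on the Grothendieck group $\mathrm{Gr}(\mathcal{X})$ gives rise to the natural linear representation of $\mathcal{C}_n$: the assignment sending $\alpha_i$ to the action of $[\mathrm{G}_i]$ on $\mathrm{Gr}(\mathcal{X})$, $i=1,\dots,n-1$, extends to a representation of $\mathcal{C}_n$ on $\mathrm{Gr}(\mathcal{X})$ which is isomorphic to the representation on $\mathbb{Z}^{n-1}$ with standard basis $e_1,\dots,e_{n-1}$ in which $\alpha_i$ acts by $e_j\mapsto e_j$ for $j\neq i$ and $e_i\mapsto e_{i-1}$, where $e_0:=0$.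
   Context: $\mathcal{C}_n$ is the monoid, under composition of maps (from right to left), of all maps $f:\{1,\dots,n\}\to\{1,\dots,n\}$ that are order-decreasing ($f(i)\le i$ for all $i$) and order-preserving ($i\le j$ implies $f(i)\le f(j)$). For $1\le i\le n-1$, $\alpha_i\in\mathcal{C}_n$ is given by $\alpha_i(i+1)=i$ and $\alpha_i(j)=j$ for $j\ne i+1$; the elements $\alpha_1,\dots,\alpha_{n-1}$ generate $\mathcal{C}_n$. $\Bbbk$ is an algebraically closed field. $\mathbf{Q}=\mathbf{Q}_{n-1}$ is the quiver $1\to2\to\cdots\to n-1$. $A$ is its path algebra over $\Bbbk$, with product $fg=f\circ g$ (first traverse $g$, then $f$), and $A\text{-mod}$ is the category of finite dimensional left $A$-modules (equivalently, of finite dimensional representations of $\mathbf{Q}$, i.e. covariant functors from the $\Bbbk$-linear path category to finite dimensional vector spaces). $L_i$ is the simple module at the vertex $i$. For modules $M,N$, $\mathrm{Tr}_M(N)$ is the sum of the images of all homomorphisms $M\to N$; $\mathrm{Tr}_M$ is a subfunctor of the identity functor. The projection functor at $i$ is $\mathrm{F}_i:=\mathrm{Id}/\mathrm{Tr}_{L_i}$. Let $I:=\mathrm{Hom}_{\Bbbk}(A,\Bbbk)$ be the dual $A$-$A$-bimodule. By functoriality $\mathrm{F}_i I$ (with $I$ regarded as a left module) is a quotient bimodule of $I$. Put $\mathrm{G}_i:=\mathrm{Hom}_A((\mathrm{F}_i I)^*,{}_-)$, an endofunctor of $A\text{-mod}$, where $*$ is $\Bbbk$-duality and $\mathrm{Hom}_A$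 is Hom of left $A$-modules. The functors $\mathrm{G}_i$ are exact. $\mathcal{X}$ is a small category equivalent to $A\text{-mod}$; via a fixed equivalence the functors $\mathrm{G}_i$ act on $\mathcal{X}$ (up to isomorphism of functors). The $2$-category $\mathscr{G}_n$ has one object, identified with $\mathcal{X}$; its $1$-morphisms are all endofunctors of $\mathcal{X}$ isomorphic to finite direct sums of functors each of which is isomorphic to a direct summand of a (possibly empty) composition of functors each isomorphic to some $\mathrm{G}_i$; its $2$-morphisms are natural transformations. $\mathcal{S}[\mathscr{G}_n]$ is the set of isomorphism classes of indecomposable $1$-morphisms in $\mathscr{G}_n$. The Grothendieck category $\mathrm{Gr}(\mathscr{G}_n)$ has one object, whose endomorphism ring is the split Grothendieck group of the additive category $\mathscr{G}_n(\mathcal{X},\mathcal{X})$ with multiplication induced by composition of functors. $\mathrm{Gr}(\mathcal{X})$ is the Grothendieck group of the abelian category $\mathcal{X}$. Since all $1$-morphisms are exact functors, the ring $\mathrm{Gr}(\mathscr{G}_n)(\mathcal{X},\mathcal{X})$ acts on $\mathrm{Gr}(\mathcal{X})$ by $[\mathrm{G}][M]=[\mathrm{G}M]$.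
   Formalization: In (c), Z[C_n] is replaced by its quotient by the span of the constant map 1 (zero of C_n), since that element corresponds to the zero functor, whose class is 0 (for n=2 the ring is Z, not of rank 2); in (a),(b) the zero functor counts as indecomposable. *)

theory Defs
  imports "HOL-Algebra.Module" "HOL-Algebra.QuotRing" "HOL-Algebra.Free_Abelian_Groups" "HOL-Computational_Algebra.Polynomial"
begin

section \<open>The Catalan monoid\<close>

definition catalan_monoid :: "nat \<Rightarrow> (nat \<Rightarrow> nat) monoid" where
  "catalan_monoid n =
    \<lparr>carrier = {f \<in> {1..n} \<rightarrow>\<^sub>E {1..n}. (\<forall>i\<in>{1..n}. f i \<le> i) \<and> mono_on {1..n} f},
     monoid.mult = compose {1..n},
     monoid.one = restrict id {1..n}\<rparr>"

definition alpha :: "nat \<Rightarrow> nat \<Rightarrow> nat \<Rightarrow> nat" where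
  "alpha n i = (\<lambda>j\<in>{1..n}. if j = i + 1 then i else j)"

text \<open>
  The constant map with value \<open>1\<close> is, for \<open>n \<ge> 1\<close>, the zero element of the monoid. It corresponds
  to the zero functor, whose class in a split Grothendieck group is \<open>0\<close>; so the Grothendieck ring
  is compared with the monoid ring in which this element is set to \<open>0\<close>.
\<close>

definition catalan_zero :: "nat \<Rightarrow> nat \<Rightarrow> nat" where
  "catalan_zero n = (\<lambda>j\<in>{1..n}. 1)"


section \<open>Integral monoid rings and representations of monoids\<close>

definition frag_mult :: "('a \<Rightarrow> 'b \<Rightarrow> 'c) \<Rightarrow> ('a \<Rightarrow>\<^sub>0 int) \<Rightarrow> ('b \<Rightarrow>\<^sub>0 int) \<Rightarrow> ('c \<Rightarrow>\<^sub>0 int)" where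
  "frag_mult m a b = frag_extend (\<lambda>x. frag_extend (\<lambda>y. frag_of (m x y)) b) a"

definition int_monoid_ring :: "('a, 'm) monoid_scheme \<Rightarrow> ('a \<Rightarrow>\<^sub>0 int) ring" where
  "int_monoid_ring M =
    \<lparr>carrier = {c. Poly_Mapping.keys c \<subseteq> carrier M},
     monoid.mult = frag_mult (monoid.mult M),
     monoid.one = frag_of \<one>\<^bsub>M\<^esub>,
     ring.zero = 0,
     ring.add = (+)\<rparr>"

definition end_monoid :: "('a, 'm) monoid_scheme \<Rightarrow> ('a \<Rightarrow> 'a) monoid" where
  "end_monoid G =
    \<lparr>carrier = hom G G \<inter> extensional (carrier G),
     monoid.mult = compose (carrier G),
     monoid.one = restrict id (carrier G)\<rparr>"

definition representation ::
  "('m, 'r) monoid_scheme \<Rightarrow> ('a, 's) monoid_scheme \<Rightarrow> ('m \<Rightarrow> 'a \<Rightarrow> 'a) \<Rightarrow> bool" where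
  "representation M G \<rho> \<longleftrightarrow>
    \<rho> \<in> hom M (end_monoid G) \<and> \<rho> \<one>\<^bsub>M\<^esub> = \<one>\<^bsub>end_monoid G\<^esub>"

definition rep_isomorphic ::
  "('m, 'r) monoid_scheme \<Rightarrow> ('a, 's) monoid_scheme \<Rightarrow> ('m \<Rightarrow> 'a \<Rightarrow> 'a) \<Rightarrow>
   ('b, 't) monoid_scheme \<Rightarrow> ('m \<Rightarrow> 'b \<Rightarrow> 'b) \<Rightarrow> bool" where
  "rep_isomorphic M G \<rho> H \<sigma> \<longleftrightarrow>
    (\<exists>\<psi>\<in>iso G H. \<forall>f\<in>carrier M. \<forall>x\<in>carrier G. \<psi> (\<rho> f x) = \<sigma> f (\<psi> x))"


section \<open>Path algebras\<close>

text \<open>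
  A quiver without parallel arrows is given by its vertex set \<open>V\<close> and its set of arrows
  \<open>R \<subseteq> V \<times> V\<close>; a path is the nonempty list of the vertices it visits, in the order of
  traversal. In the product \<open>f g\<close> the path \<open>g\<close> is traversed first. A \<open>\<kk>\<close>-algebra is a record of
  type \<open>module\<close>, with \<open>smult\<close> the action of the scalars; it is also a \<open>ring\<close> record.
\<close>

definition quiver_paths :: "'q set \<Rightarrow> ('q \<times> 'q) set \<Rightarrow> 'q list set" where
  "quiver_paths V R = {p. p \<noteq> [] \<and> set p \<subseteq> V \<and> successively (\<lambda>u v. (u, v) \<in> R) p}"

definition path_algebra ::
  "'q set \<Rightarrow> ('q \<times> 'q) set \<Rightarrow> ('k::field, 'q list \<Rightarrow> 'k) module" where
  "path_algebra V R =
    \<lparr>carrier = {f. finite {p. f p \<noteq> 0} \<and> {p. f p \<noteq> 0} \<subseteq> quiver_paths V R},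
     monoid.mult = (\<lambda>f g p. \<Sum>m<length p. f (drop m p) * g (take (Suc m) p)),
     monoid.one = (\<lambda>p. if \<exists>v\<in>V. p = [v] then 1 else 0),
     ring.zero = (\<lambda>p. 0),
     ring.add = (\<lambda>f g p. f p + g p),
     module.smult = (\<lambda>c f p. c * f p)\<rparr>"

text \<open>The path algebra of \<open>1 \<rightarrow> 2 \<rightarrow> \<dots> \<rightarrow> n - 1\<close>.\<close>

definition linear_path_algebra :: "nat \<Rightarrow> ('k::field, nat list \<Rightarrow> 'k) module" where
  "linear_path_algebra n =
    path_algebra {1..n-1} {(u, v). u \<in> {1..n-1} \<and> v \<in> {1..n-1} \<and> v = Suc u}"


section \<open>Modules and bimodules\<close>

locale left_module = R?: ring R + M?: abelian_group M
  for R :: "('a, 'r) ring_scheme" (structure) and M :: "('a, 'b, 's) module_scheme" (structure) +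
  assumes smult_closed:
      "\<lbrakk>a \<in> carrier R; x \<in> carrier M\<rbrakk> \<Longrightarrow> a \<odot>\<^bsub>M\<^esub> x \<in> carrier M"
    and smult_l_distr:
      "\<lbrakk>a \<in> carrier R; b \<in> carrier R; x \<in> carrier M\<rbrakk> \<Longrightarrow>
        (a \<oplus>\<^bsub>R\<^esub> b) \<odot>\<^bsub>M\<^esub> x = a \<odot>\<^bsub>M\<^esub> x \<oplus>\<^bsub>M\<^esub> b \<odot>\<^bsub>M\<^esub> x"
    and smult_r_distr:
      "\<lbrakk>a \<in> carrier R; x \<in> carrier M; y \<in> carrier M\<rbrakk> \<Longrightarrow>
        a \<odot>\<^bsub>M\<^esub> (x \<oplus>\<^bsub>M\<^esub> y) = a \<odot>\<^bsub>M\<^esub> x \<oplus>\<^bsub>M\<^esub> a \<odot>\<^bsub>M\<^esub> y"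
    and smult_assoc:
      "\<lbrakk>a \<in> carrier R; b \<in> carrier R; x \<in> carrier M\<rbrakk> \<Longrightarrow>
        (a \<otimes>\<^bsub>R\<^esub> b) \<odot>\<^bsub>M\<^esub> x = a \<odot>\<^bsub>M\<^esub> (b \<odot>\<^bsub>M\<^esub> x)"
    and smult_one:
      "x \<in> carrier M \<Longrightarrow> \<one>\<^bsub>R\<^esub> \<odot>\<^bsub>M\<^esub> x = x"

text \<open>The scalars act on a module through \<open>c \<mapsto> c \<sqdot> 1\<^sub>A\<close>.\<close>

definition scalar_act ::
  "('k, 'a, 'r) module_scheme \<Rightarrow> ('a, 'b, 's) module_scheme \<Rightarrow> 'k \<Rightarrow> 'b \<Rightarrow> 'b" where
  "scalar_act A M c x = (c \<odot>\<^bsub>A\<^esub> \<one>\<^bsub>A\<^esub>) \<odot>\<^bsub>M\<^esub> x"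

definition fin_dim :: "('k, 'a, 'r) module_scheme \<Rightarrow> ('a, 'b, 's) module_scheme \<Rightarrow> bool" where
  "fin_dim A M \<longleftrightarrow>
    (\<exists>B. finite B \<and> B \<subseteq> carrier M \<and>
      (\<forall>x\<in>carrier M. \<exists>c. x = (\<Oplus>\<^bsub>M\<^esub>b\<in>B. scalar_act A M (c b) b)))"

definition mod_hom ::
  "('a, 'r) ring_scheme \<Rightarrow> ('a, 'b, 's) module_scheme \<Rightarrow> ('a, 'c, 't) module_scheme \<Rightarrow>
   ('b \<Rightarrow> 'c) set" where
  "mod_hom A M N = {f \<in> carrier M \<rightarrow>\<^sub>E carrier N.
    (\<forall>x\<in>carrier M. \<forall>y\<in>carrier M. f (x \<oplus>\<^bsub>M\<^esub> y) = f x \<oplus>\<^bsub>N\<^esub> f y) \<and>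
    (\<forall>a\<in>carrier A. \<forall>x\<in>carrier M. f (a \<odot>\<^bsub>M\<^esub> x) = a \<odot>\<^bsub>N\<^esub> f x)}"

definition mod_iso ::
  "('a, 'r) ring_scheme \<Rightarrow> ('a, 'b, 's) module_scheme \<Rightarrow> ('a, 'c, 't) module_scheme \<Rightarrow>
   ('b \<Rightarrow> 'c) set" where
  "mod_iso A M N = {f \<in> mod_hom A M N. bij_betw f (carrier M) (carrier N)}"

text \<open>The trace \<open>Tr\<^sub>M(N)\<close>: all finite sums of elements of images of homomorphisms \<open>M \<rightarrow> N\<close>.\<close>

definition trace ::
  "('a, 'r) ring_scheme \<Rightarrow> ('a, 'b, 's) module_scheme \<Rightarrow> ('a, 'c, 't) module_scheme \<Rightarrow>
   'c set" where
  "trace A M N = {\<Oplus>\<^bsub>N\<^esub>h\<in>H. h (m h) | H m.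
    finite H \<and> H \<subseteq> mod_hom A M N \<and> m \<in> H \<rightarrow> carrier M}"

record ('a, 'b) bimodule = "('a, 'b) module" +
  rsmult :: "'b \<Rightarrow> 'a \<Rightarrow> 'b"

definition regular_bimodule :: "('k, 'a, 'r) module_scheme \<Rightarrow> ('a, 'a) bimodule" where
  "regular_bimodule A =
    \<lparr>carrier = carrier A, monoid.mult = monoid.mult A, monoid.one = \<one>\<^bsub>A\<^esub>, ring.zero = \<zero>\<^bsub>A\<^esub>,
     ring.add = ring.add A,
     module.smult = monoid.mult A, rsmult = monoid.mult A\<rparr>"

text \<open>
  The \<open>\<kk>\<close>-dual \<open>Hom\<^sub>\<kk>(B, \<kk>)\<close> of a bimodule with the actions
  \<open>(a \<phi>)(x) = \<phi>(x a)\<close> and \<open>(\<phi> a)(x) = \<phi>(a x)\<close>. Here and below the fields \<open>mult\<close> and \<open>one\<close>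
  of a module record carry no meaning.
\<close>

definition dual_bimodule ::
  "('k::field, 'a, 'r) module_scheme \<Rightarrow> ('a, 'b, 's) bimodule_scheme \<Rightarrow> ('a, 'b \<Rightarrow> 'k) bimodule" where
  "dual_bimodule A B =
    \<lparr>carrier = {\<phi> \<in> extensional (carrier B).
       (\<forall>x\<in>carrier B. \<forall>y\<in>carrier B. \<phi> (x \<oplus>\<^bsub>B\<^esub> y) = \<phi> x + \<phi> y) \<and>
       (\<forall>c. \<forall>x\<in>carrier B. \<phi> (scalar_act A B c x) = c * \<phi> x)},
     monoid.mult = undefined, monoid.one = undefined,
     ring.zero = (\<lambda>x\<in>carrier B. 0),
     ring.add = (\<lambda>\<phi> \<psi>. \<lambda>x\<in>carrier B. \<phi> x + \<psi> x),
     module.smult = (\<lambda>a \<phi>. \<lambda>x\<in>carrier B. \<phi> (rsmult B x a)),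
     rsmult = (\<lambda>\<phi> a. \<lambda>x\<in>carrier B. \<phi> (a \<odot>\<^bsub>B\<^esub> x))\<rparr>"

text \<open>The quotient of a bimodule by a subbimodule \<open>T\<close>, with carrier the cosets of \<open>T\<close>.\<close>

definition quot_bimodule ::
  "('a, 'b, 's) bimodule_scheme \<Rightarrow> 'b set \<Rightarrow> ('a, 'b set) bimodule" where
  "quot_bimodule B T =
    \<lparr>carrier = a_rcosets\<^bsub>B\<^esub> T,
     monoid.mult = undefined, monoid.one = undefined,
     ring.zero = T,
     ring.add = set_add B,
     module.smult = (\<lambda>a C. \<Union>x\<in>C. T +>\<^bsub>B\<^esub> (a \<odot>\<^bsub>B\<^esub> x)),
     rsmult = (\<lambda>C a. \<Union>x\<in>C. T +>\<^bsub>B\<^esub> (rsmult B x a))\<rparr>"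

text \<open>
  For an \<open>A\<close>-\<open>A\<close>-bimodule \<open>B\<close> and a left module \<open>M\<close>, the left module \<open>Hom\<^sub>A(B, M)\<close> of
  homomorphisms of left modules, with the action \<open>(a h)(x) = h(x a)\<close>.
\<close>

definition hom_module ::
  "('a, 'r) ring_scheme \<Rightarrow> ('a, 'b, 's) bimodule_scheme \<Rightarrow> ('a, 'c, 't) module_scheme \<Rightarrow>
   ('a, 'b \<Rightarrow> 'c) module" where
  "hom_module A B M =
    \<lparr>carrier = mod_hom A B M,
     monoid.mult = undefined, monoid.one = undefined,
     ring.zero = (\<lambda>x\<in>carrier B. \<zero>\<^bsub>M\<^esub>),
     ring.add = (\<lambda>h h'. \<lambda>x\<in>carrier B. h x \<oplus>\<^bsub>M\<^esub> h' x),
     module.smult = (\<lambda>a h. \<lambda>x\<in>carrier B. h (rsmult B x a))\<rparr>"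


section \<open>Categories and functors\<close>

record ('o, 'm) category =
  Obj :: "'o set"
  Arr :: "'m set"
  Dom :: "'m \<Rightarrow> 'o"
  Cod :: "'m \<Rightarrow> 'o"
  Ident :: "'o \<Rightarrow> 'm"
  Comp :: "'m \<Rightarrow> 'm \<Rightarrow> 'm"  (infixl \<open>\<bullet>\<index>\<close> 70)

definition Homset :: "('o, 'm, 'z) category_scheme \<Rightarrow> 'o \<Rightarrow> 'o \<Rightarrow> 'm set" where
  "Homset C x y = {f \<in> Arr C. Dom C f = x \<and> Cod C f = y}"

locale category =
  fixes C :: "('o, 'm, 'z) category_scheme" (structure)
  assumes dom_obj: "f \<in> Arr C \<Longrightarrow> Dom C f \<in> Obj C"
    and cod_obj: "f \<in> Arr C \<Longrightarrow> Cod C f \<in> Obj C"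
    and ident: "x \<in> Obj C \<Longrightarrow> Ident C x \<in> Homset C x x"
    and comp: "\<lbrakk>f \<in> Homset C x y; g \<in> Homset C y z\<rbrakk> \<Longrightarrow> g \<bullet> f \<in> Homset C x z"
    and comp_ident_right: "f \<in> Homset C x y \<Longrightarrow> f \<bullet> Ident C x = f"
    and comp_ident_left: "f \<in> Homset C x y \<Longrightarrow> Ident C y \<bullet> f = f"
    and comp_assoc:
      "\<lbrakk>f \<in> Homset C w x; g \<in> Homset C x y; h \<in> Homset C y z\<rbrakk> \<Longrightarrow>
        (h \<bullet> g) \<bullet> f = h \<bullet> (g \<bullet> f)"

record ('o1, 'm1, 'o2, 'm2) cfunctor =
  on_obj :: "'o1 \<Rightarrow> 'o2"
  on_arr :: "'m1 \<Rightarrow> 'm2"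

type_synonym ('o, 'm) endofunctor = "('o, 'm, 'o, 'm) cfunctor"

definition is_functor ::
  "('o1, 'm1, 'y) category_scheme \<Rightarrow> ('o2, 'm2, 'z) category_scheme \<Rightarrow>
   ('o1, 'm1, 'o2, 'm2) cfunctor \<Rightarrow> bool" where
  "is_functor C D F \<longleftrightarrow>
    (\<forall>x\<in>Obj C. on_obj F x \<in> Obj D) \<and>
    (\<forall>f\<in>Arr C. on_arr F f \<in> Homset D (on_obj F (Dom C f)) (on_obj F (Cod C f))) \<and>
    (\<forall>x\<in>Obj C. on_arr F (Ident C x) = Ident D (on_obj F x)) \<and>
    (\<forall>f\<in>Arr C. \<forall>g\<in>Arr C. Dom C g = Cod C f \<longrightarrow>
      on_arr F (g \<bullet>\<^bsub>C\<^esub> f) = on_arr F g \<bullet>\<^bsub>D\<^esub> on_arr F f)"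

definition id_functor :: "('o, 'm) endofunctor" where
  "id_functor = \<lparr>on_obj = id, on_arr = id\<rparr>"

definition comp_functor ::
  "('o2, 'm2, 'o3, 'm3) cfunctor \<Rightarrow> ('o1, 'm1, 'o2, 'm2) cfunctor \<Rightarrow>
   ('o1, 'm1, 'o3, 'm3) cfunctor"  (infixr \<open>\<circ>\<^sub>F\<close> 75) where
  "F \<circ>\<^sub>F G = \<lparr>on_obj = on_obj F \<circ> on_obj G, on_arr = on_arr F \<circ> on_arr G\<rparr>"

definition nat_trans ::
  "('o1, 'm1, 'y) category_scheme \<Rightarrow> ('o2, 'm2, 'z) category_scheme \<Rightarrow>
   ('o1, 'm1, 'o2, 'm2) cfunctor \<Rightarrow> ('o1, 'm1, 'o2, 'm2) cfunctor \<Rightarrow> ('o1 \<Rightarrow> 'm2) \<Rightarrow> bool" where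
  "nat_trans C D F G \<eta> \<longleftrightarrow>
    is_functor C D F \<and> is_functor C D G \<and>
    (\<forall>x\<in>Obj C. \<eta> x \<in> Homset D (on_obj F x) (on_obj G x)) \<and>
    (\<forall>f\<in>Arr C. \<eta> (Cod C f) \<bullet>\<^bsub>D\<^esub> on_arr F f = on_arr G f \<bullet>\<^bsub>D\<^esub> \<eta> (Dom C f))"

definition is_iso_arr :: "('o, 'm, 'z) category_scheme \<Rightarrow> 'm \<Rightarrow> bool" where
  "is_iso_arr C f \<longleftrightarrow> f \<in> Arr C \<and>
    (\<exists>g\<in>Homset C (Cod C f) (Dom C f).
      g \<bullet>\<^bsub>C\<^esub> f = Ident C (Dom C f) \<and> f \<bullet>\<^bsub>C\<^esub> g = Ident C (Cod C f))"

definition functors_iso ::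
  "('o1, 'm1, 'y) category_scheme \<Rightarrow> ('o2, 'm2, 'z) category_scheme \<Rightarrow>
   ('o1, 'm1, 'o2, 'm2) cfunctor \<Rightarrow> ('o1, 'm1, 'o2, 'm2) cfunctor \<Rightarrow> bool" where
  "functors_iso C D F G \<longleftrightarrow>
    (\<exists>\<eta>. nat_trans C D F G \<eta> \<and> (\<forall>x\<in>Obj C. is_iso_arr D (\<eta> x)))"

definition is_equivalence ::
  "('o1, 'm1, 'y) category_scheme \<Rightarrow> ('o2, 'm2, 'z) category_scheme \<Rightarrow>
   ('o1, 'm1, 'o2, 'm2) cfunctor \<Rightarrow> bool" where
  "is_equivalence C D F \<longleftrightarrow> is_functor C D F \<and>
    (\<exists>G. is_functor D C G \<and>
      functors_iso C C (G \<circ>\<^sub>F F) id_functor \<and> functors_iso D D (F \<circ>\<^sub>F G) id_functor)"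


section \<open>The category of finite dimensional modules\<close>

type_synonym ('a, 'b) mod_arr = "('a, 'b) module \<times> ('b \<Rightarrow> 'b) \<times> ('a, 'b) module"

definition arr_map :: "('a, 'b) mod_arr \<Rightarrow> 'b \<Rightarrow> 'b" where
  "arr_map f = fst (snd f)"

text \<open>
  The finite dimensional left \<open>A\<close>-modules whose underlying set is contained in the type \<open>'b\<close>; an
  arrow is a homomorphism together with its domain and codomain.
\<close>

definition fdmod :: "('k, 'a) module \<Rightarrow> (('a, 'b) module, ('a, 'b) mod_arr) category" where
  "fdmod A =
    \<lparr>Obj = {M. left_module A M \<and> fin_dim A M},
     Arr = {(M, f, N). left_module A M \<and> fin_dim A M \<and> left_module A N \<and> fin_dim A N \<and>
              f \<in> mod_hom A M N},
     Dom = (\<lambda>(M, f, N). M),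
     Cod = (\<lambda>(M, f, N). N),
     Ident = (\<lambda>M. (M, restrict id (carrier M), M)),
     Comp = (\<lambda>(M', g, N) (M, f, N'). (M, compose (carrier M) g f, N))\<rparr>"

text \<open>
  For the universe of underlying sets we take the type \<open>nat \<Rightarrow> \<kk>\<close>: it contains a copy of every
  \<open>\<kk>\<^sup>d\<close>, so every finite dimensional \<open>A\<close>-module is isomorphic to an object of
  \<open>fdmod (linear_path_algebra n)\<close>.
\<close>

type_synonym 'k amod = "(nat list \<Rightarrow> 'k, nat \<Rightarrow> 'k) module"
type_synonym 'k amod_arr = "(nat list \<Rightarrow> 'k, nat \<Rightarrow> 'k) mod_arr"
type_synonym ('o, 'm, 'k) amod_functor = "('o, 'm, 'k amod, 'k amod_arr) cfunctor"


section \<open>The functors \<open>G\<^sub>i\<close>\<close>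

text \<open>On \<open>L\<^sub>i\<close> an element of the path algebra acts by its coefficient at the trivial path at \<open>i\<close>.\<close>

definition simple_module :: "nat \<Rightarrow> (nat list \<Rightarrow> 'k::field, 'k) module" where
  "simple_module i =
    \<lparr>carrier = UNIV, monoid.mult = undefined, monoid.one = undefined, ring.zero = 0, ring.add = (+),
     module.smult = (\<lambda>a x. a [i] * x)\<rparr>"

definition dual_A :: "nat \<Rightarrow> (nat list \<Rightarrow> 'k::field, (nat list \<Rightarrow> 'k) \<Rightarrow> 'k) bimodule" where
  "dual_A n =
    dual_bimodule (linear_path_algebra n)
      (regular_bimodule (linear_path_algebra n :: ('k, _) module))"

text \<open>
  \<open>F\<^sub>i I = I / Tr(I)\<close>, the trace being that of \<open>L\<^sub>i\<close>. The right action of \<open>a\<close> is the one obtained by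
  applying \<open>F\<^sub>i\<close> to the left module endomorphism \<open>\<phi> \<mapsto> \<phi> a\<close> of \<open>I\<close>.
\<close>

definition F_dual_A ::
  "nat \<Rightarrow> nat \<Rightarrow> (nat list \<Rightarrow> 'k::field, ((nat list \<Rightarrow> 'k) \<Rightarrow> 'k) set) bimodule" where
  "F_dual_A n i =
    quot_bimodule (dual_A n)
      (trace (linear_path_algebra n :: ('k, _) module) (simple_module i) (dual_A n))"

definition G_bimodule ::
  "nat \<Rightarrow> nat \<Rightarrow> (nat list \<Rightarrow> 'k::field, ((nat list \<Rightarrow> 'k) \<Rightarrow> 'k) set \<Rightarrow> 'k) bimodule" where
  "G_bimodule n i = dual_bimodule (linear_path_algebra n) (F_dual_A n i)"

definition G_obj ::
  "nat \<Rightarrow> nat \<Rightarrow> (nat list \<Rightarrow> 'k::field, 'v) module \<Rightarrow>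
   (nat list \<Rightarrow> 'k, (((nat list \<Rightarrow> 'k) \<Rightarrow> 'k) set \<Rightarrow> 'k) \<Rightarrow> 'v) module" where
  "G_obj n i M = hom_module (linear_path_algebra n :: ('k, _) module) (G_bimodule n i) M"

definition G_arr ::
  "nat \<Rightarrow> nat \<Rightarrow> (nat list \<Rightarrow> 'k::field, 'v) mod_arr \<Rightarrow>
   ((((nat list \<Rightarrow> 'k) \<Rightarrow> 'k) set \<Rightarrow> 'k) \<Rightarrow> 'v) \<Rightarrow> ((((nat list \<Rightarrow> 'k) \<Rightarrow> 'k) set \<Rightarrow> 'k) \<Rightarrow> 'v)" where
  "G_arr n i f =
    (\<lambda>h\<in>carrier (G_obj n i (fst f)).
      compose (carrier (G_bimodule n i :: (_, _ \<Rightarrow> 'k) bimodule)) (arr_map f) h)"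

text \<open>
  The endofunctor \<open>H\<close> of \<open>Xcat\<close> is isomorphic to the functor induced by \<open>G\<^sub>i\<close> via the equivalence \<open>E\<close>,
  i.e. there is a natural isomorphism \<open>E H \<cong> G\<^sub>i E\<close>. It is spelled out here since the underlying
  sets of \<open>E (H x)\<close> and \<open>G\<^sub>i (E x)\<close> live in different types.
\<close>

definition acts_as_G ::
  "nat \<Rightarrow> ('o, 'm) category \<Rightarrow> ('o, 'm, 'k::field) amod_functor \<Rightarrow> nat \<Rightarrow>
   ('o, 'm) endofunctor \<Rightarrow> bool" where
  "acts_as_G n Xcat E i H \<longleftrightarrow> is_functor Xcat Xcat H \<and>
    (\<exists>\<eta>. (\<forall>x\<in>Obj Xcat.
            \<eta> x \<in> mod_iso (linear_path_algebra n :: ('k, _) module)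
                    (on_obj E (on_obj H x)) (G_obj n i (on_obj E x))) \<and>
         (\<forall>f\<in>Arr Xcat. \<forall>v\<in>carrier (on_obj E (on_obj H (Dom Xcat f))).
            \<eta> (Cod Xcat f) (arr_map (on_arr E (on_arr H f)) v) =
            G_arr n i (on_arr E f) (\<eta> (Dom Xcat f) v)))"


section \<open>The 1-morphisms\<close>

text \<open>
  The category \<open>Xcat\<close> is equivalent to a category of modules via \<open>E\<close>, and the additive structure and
  the short exact sequences of \<open>Xcat\<close> are those of modules, transported along \<open>E\<close>.
\<close>

definition zero_functor ::
  "('o, 'm) category \<Rightarrow> ('o, 'm, 'k) amod_functor \<Rightarrow> ('o, 'm) endofunctor \<Rightarrow> bool" where
  "zero_functor Xcat E F \<longleftrightarrow> is_functor Xcat Xcat F \<and>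
    (\<forall>x\<in>Obj Xcat. carrier (on_obj E (on_obj F x)) = {\<zero>\<^bsub>on_obj E (on_obj F x)\<^esub>})"

text \<open>\<open>H\<close> is a direct sum (biproduct) of \<open>F\<close> and \<open>G\<close> in the category of endofunctors of \<open>Xcat\<close>.\<close>

definition direct_sum ::
  "('o, 'm) category \<Rightarrow> ('o, 'm, 'k) amod_functor \<Rightarrow>
   ('o, 'm) endofunctor \<Rightarrow> ('o, 'm) endofunctor \<Rightarrow> ('o, 'm) endofunctor \<Rightarrow> bool" where
  "direct_sum Xcat E H F G \<longleftrightarrow>
    (\<exists>i j p q. nat_trans Xcat Xcat F H i \<and> nat_trans Xcat Xcat G H j \<and>
       nat_trans Xcat Xcat H F p \<and> nat_trans Xcat Xcat H G q \<and>
       (\<forall>x\<in>Obj Xcat.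
          p x \<bullet>\<^bsub>Xcat\<^esub> i x = Ident Xcat (on_obj F x) \<and>
          q x \<bullet>\<^bsub>Xcat\<^esub> j x = Ident Xcat (on_obj G x) \<and>
          (let M = on_obj E (on_obj H x) in
            \<forall>v\<in>carrier M.
              arr_map (on_arr E (i x \<bullet>\<^bsub>Xcat\<^esub> p x)) v \<oplus>\<^bsub>M\<^esub>
              arr_map (on_arr E (j x \<bullet>\<^bsub>Xcat\<^esub> q x)) v = v)))"

primrec direct_sum_list ::
  "('o, 'm) category \<Rightarrow> ('o, 'm, 'k) amod_functor \<Rightarrow>
   ('o, 'm) endofunctor list \<Rightarrow> ('o, 'm) endofunctor \<Rightarrow> bool" where
  "direct_sum_list Xcat E [] H \<longleftrightarrow> zero_functor Xcat E H"
| "direct_sum_list Xcat E (F # Fs) H \<longleftrightarrow>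
    (\<exists>K. direct_sum Xcat E H F K \<and> direct_sum_list Xcat E Fs K)"

inductive_set G_compositions ::
  "nat \<Rightarrow> ('o, 'm) category \<Rightarrow> ('o, 'm, 'k::field) amod_functor \<Rightarrow> ('o, 'm) endofunctor set"
  for n Xcat E where
  empty: "id_functor \<in> G_compositions n Xcat E"
| step: "\<lbrakk>i \<in> {1..n-1}; acts_as_G n Xcat E i H; C \<in> G_compositions n Xcat E\<rbrakk> \<Longrightarrow>
    H \<circ>\<^sub>F C \<in> G_compositions n Xcat E"

definition one_morphisms ::
  "nat \<Rightarrow> ('o, 'm) category \<Rightarrow> ('o, 'm, 'k::field) amod_functor \<Rightarrow> ('o, 'm) endofunctor set" where
  "one_morphisms n Xcat E = {H. is_functor Xcat Xcat H \<and>
    (\<exists>Fs. direct_sum_list Xcat E Fs H \<and>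
      (\<forall>F\<in>set Fs. \<exists>C\<in>G_compositions n Xcat E. \<exists>K. direct_sum Xcat E C F K))}"

definition one_morphism_monoid ::
  "nat \<Rightarrow> ('o, 'm) category \<Rightarrow> ('o, 'm, 'k::field) amod_functor \<Rightarrow> ('o, 'm) endofunctor monoid" where
  "one_morphism_monoid n Xcat E =
    \<lparr>carrier = one_morphisms n Xcat E, monoid.mult = (\<circ>\<^sub>F), monoid.one = id_functor\<rparr>"

text \<open>
  A 1-morphism is indecomposable if it is not a direct sum of two nonzero 1-morphisms. The zero
  functor is not excluded: it is itself a composition of functors \<open>G\<^sub>i\<close> (for \<open>n = 1\<close>, the empty one), so
  without it the classes of indecomposable 1-morphisms would not form a monoid.
\<close>

definition indecomposable ::
  "nat \<Rightarrow> ('o, 'm) category \<Rightarrow> ('o, 'm, 'k::field) amod_functor \<Rightarrow> ('o, 'm) endofunctor \<Rightarrow> bool" where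
  "indecomposable n Xcat E H \<longleftrightarrow> H \<in> one_morphisms n Xcat E \<and>
    (\<forall>F\<in>one_morphisms n Xcat E. \<forall>G\<in>one_morphisms n Xcat E.
      direct_sum Xcat E H F G \<longrightarrow> zero_functor Xcat E F \<or> zero_functor Xcat E G)"

definition iso_class ::
  "nat \<Rightarrow> ('o, 'm) category \<Rightarrow> ('o, 'm, 'k::field) amod_functor \<Rightarrow> ('o, 'm) endofunctor \<Rightarrow>
   ('o, 'm) endofunctor set" where
  "iso_class n Xcat E F = {H \<in> one_morphisms n Xcat E. functors_iso Xcat Xcat F H}"

text \<open>
  The product of two classes is the union of the classes of all composites of representatives. That
  it is well defined on isomorphism classes of indecomposable 1-morphisms amounts to its being a
  single such class.
\<close>

definition indec_monoid ::
  "nat \<Rightarrow> ('o, 'm) category \<Rightarrow> ('o, 'm, 'k::field) amod_functor \<Rightarrow>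
   ('o, 'm) endofunctor set monoid" where
  "indec_monoid n Xcat E =
    \<lparr>carrier = iso_class n Xcat E ` {F. indecomposable n Xcat E F},
     monoid.mult = (\<lambda>U V. \<Union>F\<in>U. \<Union>G\<in>V. iso_class n Xcat E (F \<circ>\<^sub>F G)),
     monoid.one = iso_class n Xcat E id_functor\<rparr>"


section \<open>Grothendieck groups\<close>

definition split_relations ::
  "nat \<Rightarrow> ('o, 'm) category \<Rightarrow> ('o, 'm, 'k::field) amod_functor \<Rightarrow>
   (('o, 'm) endofunctor \<Rightarrow>\<^sub>0 int) set" where
  "split_relations n Xcat E =
    generate (free_Abelian_group (one_morphisms n Xcat E))
      {frag_of H - frag_of F - frag_of G | H F G.
         H \<in> one_morphisms n Xcat E \<and> F \<in> one_morphisms n Xcat E \<and> G \<in> one_morphisms n Xcat E \<and>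
         direct_sum Xcat E H F G}"

definition Gr_ring ::
  "nat \<Rightarrow> ('o, 'm) category \<Rightarrow> ('o, 'm, 'k::field) amod_functor \<Rightarrow>
   (('o, 'm) endofunctor \<Rightarrow>\<^sub>0 int) set ring" where
  "Gr_ring n Xcat E = int_monoid_ring (one_morphism_monoid n Xcat E) Quot split_relations n Xcat E"

definition Gr_ring_class ::
  "nat \<Rightarrow> ('o, 'm) category \<Rightarrow> ('o, 'm, 'k::field) amod_functor \<Rightarrow> ('o, 'm) endofunctor \<Rightarrow>
   (('o, 'm) endofunctor \<Rightarrow>\<^sub>0 int) set" where
  "Gr_ring_class n Xcat E H =
    split_relations n Xcat E +>\<^bsub>int_monoid_ring (one_morphism_monoid n Xcat E)\<^esub> frag_of H"

definition short_exact ::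
  "('o, 'm) category \<Rightarrow> ('o, 'm, 'k) amod_functor \<Rightarrow> 'm \<Rightarrow> 'm \<Rightarrow> bool" where
  "short_exact Xcat E f g \<longleftrightarrow> f \<in> Arr Xcat \<and> g \<in> Arr Xcat \<and> Cod Xcat f = Dom Xcat g \<and>
    (let A = on_obj E (Dom Xcat f); B = on_obj E (Cod Xcat f); C = on_obj E (Cod Xcat g);
         f' = arr_map (on_arr E f); g' = arr_map (on_arr E g)
     in inj_on f' (carrier A) \<and> f' ` carrier A = {b \<in> carrier B. g' b = \<zero>\<^bsub>C\<^esub>} \<and>
        g' ` carrier B = carrier C)"

definition exact_relations ::
  "('o, 'm) category \<Rightarrow> ('o, 'm, 'k) amod_functor \<Rightarrow> ('o \<Rightarrow>\<^sub>0 int) set" where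
  "exact_relations Xcat E =
    generate (free_Abelian_group (Obj Xcat))
      {frag_of (Cod Xcat f) - frag_of (Dom Xcat f) - frag_of (Cod Xcat g) | f g. short_exact Xcat E f g}"

definition Gr_group ::
  "('o, 'm) category \<Rightarrow> ('o, 'm, 'k) amod_functor \<Rightarrow> ('o \<Rightarrow>\<^sub>0 int) set monoid" where
  "Gr_group Xcat E = free_Abelian_group (Obj Xcat) Mod exact_relations Xcat E"

text \<open>The action of the Grothendieck ring on \<open>Gr(Xcat)\<close>, induced by \<open>[G][M] = [G M]\<close>.\<close>

definition Gr_action ::
  "('o, 'm) category \<Rightarrow> ('o, 'm, 'k) amod_functor \<Rightarrow>
   (('o, 'm) endofunctor \<Rightarrow>\<^sub>0 int) set \<Rightarrow> ('o \<Rightarrow>\<^sub>0 int) set \<Rightarrow> ('o \<Rightarrow>\<^sub>0 int) set" where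
  "Gr_action Xcat E U =
    (\<lambda>V\<in>carrier (Gr_group Xcat E).
      \<Union>a\<in>U. \<Union>b\<in>V. exact_relations Xcat E #>\<^bsub>free_Abelian_group (Obj Xcat)\<^esub> frag_mult on_obj a b)"

end

theory Submission
 imports Defs
begin

text \<open>
 The proof replaces modules by their components. A module over the path algebra of
 \<open>1 \<rightarrow> 2 \<rightarrow> \<dots> \<rightarrow> n - 1\<close> is a family of vector spaces \<open>V 1, \<dots>, V (n - 1)\<close> with compatible
 transition maps \<open>V u \<rightarrow> V v\<close> for \<open>u \<le> v\<close>; for other indices, in particular for \<open>n\<close>, the
 component is zero. Evaluation of functionals identifies the bimodule \<open>(F\<^sub>i I)\<^sup>*\<close> with the ideal
 spanned by all paths except the trivial one at \<open>i\<close> (\<open>T_eq\<close>, \<open>G_eq_ev\<close>). The elements of this ideal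
 that start at \<open>u\<close> form a left module that is free on the shortest path among them, which ends at
 \<open>gi i u\<close>, where \<open>gi i i = i + 1\<close> and \<open>gi i u = u\<close> otherwise. So the component of
 \<open>G\<^sub>i M\<close> at \<open>u\<close> is the component of \<open>M\<close> at \<open>gi i u\<close> (\<open>theta_liso\<close>): the functor \<open>G\<^sub>i\<close> reindexes
 components along \<open>gi i\<close>.

 A map \<open>f\<close> in the Catalan monoid has an upper adjoint \<open>gal f\<close>, with \<open>f w \<le> u\<close> iff
 \<open>w \<le> gal f u\<close>. The adjoint of \<open>\<alpha>\<^sub>i\<close> is \<open>gi i\<close>, and taking adjoints reverses compositions, as
 does reindexing. Hence the functors that reindex along \<open>gal f\<close> compose like the elements \<open>f\<close>, and
 since the \<open>\<alpha>\<^sub>i\<close> generate (\<open>catalan_factor\<close>), these functors are, up to isomorphism, the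
 compositions of the \<open>G\<^sub>i\<close>. The functor of \<open>f\<close> vanishes iff \<open>gal f 1 = n\<close>, which is the case
 only for the zero of the monoid. By Yoneda's lemma the endomorphisms of such a functor are scalars
 (\<open>natural_scalar\<close>), so it has no proper summands, and the 1-morphisms are the finite direct sums of
 functors of this kind (\<open>one_morphisms_iff\<close>).

 The number of summands of each isomorphism type is an invariant. Let \<open>J\<close> be the module with
 one-dimensional components and bijective transition maps, and \<open>\<pi> v : J \<rightarrow> P v\<close> its quotient
 with support \<open>{1..v}\<close>. For a functor \<open>H\<close>, the elements of the component of \<open>H J\<close> at \<open>1\<close> that
 become zero in \<open>H (P (w - 1))\<close> after transition to \<open>f w\<close>, for all \<open>w \<ge> 2\<close>, form a space
 whose dimension counts the nonzero summands of \<open>H\<close> that belong to elements below \<open>f\<close> (\<open>NN_dim\<close>).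
 These numbers determine the multiplicities (\<open>multiplicity_unique\<close>). Parts (a) and (b) follow. For
 (c), a 1-morphism is sent to the formal sum of the elements of its summands: this is well defined
 up to multiples of the zero of the monoid, multiplicative, and its kernel is generated by the split
 relations (\<open>SR_iff\<close>).

 For (d), the simple module at the first vertex of the support of a module is one of its quotients,
 so the class of a module in the Grothendieck group is determined by its dimension vector
 (\<open>ER_iff\<close>). If \<open>e\<^sub>j\<close> denotes the class of a module with dimension one at the vertices up to \<open>j\<close> and
 zero elsewhere, then the coefficients of the class of a module at \<open>e\<^sub>u\<close>, \<open>e\<^sub>u\<^sub>+\<^sub>1\<close> and so on sum up to its
 dimension at \<open>u\<close>. The functor of \<open>f\<close> moves the dimension at \<open>gal f u\<close> to \<open>u\<close>, and the linear map
 with the same effect on these sums is \<open>e\<^sub>j \<mapsto> e\<^sub>k\<close> with \<open>k = f (j + 1) - 1\<close> (\<open>tail_nact\<close>).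
 For \<open>f = \<alpha>\<^sub>i\<close> this is the natural representation.
\<close>

abbreviation supp where "supp \<equiv> Poly_Mapping.keys"

text \<open>The value of a functor at an object.\<close>

notation on_obj (\<open>_$_\<close> [1000, 1000] 1000)

section \<open>Vector spaces on a carrier set\<close>

record ('k, 'b) vs =
 car :: "'b set"
 pls :: "'b => 'b => 'b"
 zer :: 'b
 scl :: "'k => 'b => 'b"

text \<open>The modules of this development are records whose elements form a subset of a type, and so do their
 components; hence vector spaces, too, are records with a carrier set.\<close>

locale vspace =
 fixes S :: "('k::field, 'b) vs"
 assumes zer_mem [simp]: "zer S \<in> car S"
  and pls_mem [simp]: "[|a \<in> car S; b \<in> car S|] ==> pls S a b \<in> car S"
  and scl_mem [simp]: "a \<in> car S ==> scl S c a \<in> car S"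
  and pls_assoc: "[|a \<in> car S; b \<in> car S; w \<in> car S|] ==> pls S (pls S a b) w = pls S a (pls S b w)"
  and pls_comm: "[|a \<in> car S; b \<in> car S|] ==> pls S a b = pls S b a"
  and pls_zer [simp]: "a \<in> car S ==> pls S a (zer S) = a"
  and scl_0 [simp]: "a \<in> car S ==> scl S 0 a = zer S"
  and scl_1 [simp]: "a \<in> car S ==> scl S 1 a = a"
  and scl_add: "a \<in> car S ==> scl S (c + d) a = pls S (scl S c a) (scl S d a)"
  and scl_pls: "[|a \<in> car S; b \<in> car S|] ==> scl S c (pls S a b) = pls S (scl S c a) (scl S c b)"
  and scl_scl: "a \<in> car S ==> scl S c (scl S d a) = scl S (c * d) a"
begin

lemma zer_pls [simp]: "a \<in> car S ==> pls S (zer S) a = a"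
 using pls_comm[of "zer S" a] by simp

lemma scl_zer [simp]: "scl S c (zer S) = zer S"
 using scl_scl[of "zer S" c 0] by simp

lemma pls_left_comm:
 "[|a \<in> car S; b \<in> car S; d \<in> car S|] ==> pls S a (pls S b d) = pls S b (pls S a d)"
 by (metis pls_assoc pls_comm)

lemma pls_swap:
 assumes "a \<in> car S" "b \<in> car S" "x \<in> car S" "y \<in> car S"
 shows "pls S (pls S a b) (pls S x y) = pls S (pls S a x) (pls S b y)"
 using assms by (simp add: pls_assoc pls_left_comm[of b x y])

lemma pls_neg [simp]: "a \<in> car S ==> pls S a (scl S (-1) a) = zer S"
 using scl_add[of a 1 "-1"] by simp

lemma pls_neg' [simp]: "a \<in> car S ==> pls S (scl S (-1) a) a = zer S"
 using pls_neg[of a] pls_comm[of a "scl S (-1) a"] by simp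

lemma pls_cancel:
 assumes "a \<in> car S" "b \<in> car S" "d \<in> car S" "pls S a b = pls S a d"
 shows "b = d"
proof -
 have "pls S (scl S (-1) a) (pls S a b) = pls S (scl S (-1) a) (pls S a d)"
  using assms by simp
 then show ?thesis using assms(1-3) by (simp flip: pls_assoc)
qed

lemma eq_iff_diff_zer:
 assumes "a \<in> car S" "b \<in> car S"
 shows "a = b \<longleftrightarrow> pls S a (scl S (-1) b) = zer S"
proof
 assume "pls S a (scl S (-1) b) = zer S"
 then have "pls S (pls S a (scl S (-1) b)) b = pls S (zer S) b" by simp
 then show "a = b" using assms by (simp add: pls_assoc)
qed (use assms in simp)

lemma idempotent_zer: "[|a \<in> car S; pls S a a = a|] ==> a = zer S"
 by (rule pls_cancel[of a]) auto

lemma scl_eq_zer: "[|a \<in> car S; scl S c a = zer S; c \<noteq> 0|] ==> a = zer S"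
 by (metis left_inverse scl_1 scl_scl scl_zer)

lemma subspace:
 assumes "W \<subseteq> car S" "zer S \<in> W"
  "\<And>a b. [|a \<in> W; b \<in> W|] ==> pls S a b \<in> W" "\<And>a c. a \<in> W ==> scl S c a \<in> W"
 shows "vspace (S\<lparr>car := W\<rparr>)"
 by unfold_locales
  (use assms in \<open>auto simp: pls_assoc scl_add scl_pls scl_scl subset_iff intro: pls_comm\<close>)

end

definition lin :: "('k, 'b) vs => ('k, 'c) vs => ('b => 'c) => bool" where
 "lin S S' \<phi> \<longleftrightarrow> (\<forall>a\<in>car S. \<phi> a \<in> car S') \<and>
  (\<forall>a\<in>car S. \<forall>b\<in>car S. \<phi> (pls S a b) = pls S' (\<phi> a) (\<phi> b)) \<and>
  (\<forall>c. \<forall>a\<in>car S. \<phi> (scl S c a) = scl S' c (\<phi> a))"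

lemma linI:
 assumes "\<And>a. a \<in> car S ==> \<phi> a \<in> car S'"
  and "\<And>a b. [|a \<in> car S; b \<in> car S|] ==> \<phi> (pls S a b) = pls S' (\<phi> a) (\<phi> b)"
  and "\<And>c a. a \<in> car S ==> \<phi> (scl S c a) = scl S' c (\<phi> a)"
 shows "lin S S' \<phi>"
 using assms by (simp add: lin_def)

lemma lin_mem: "[|lin S S' \<phi>; a \<in> car S|] ==> \<phi> a \<in> car S'"
 and lin_pls: "[|lin S S' \<phi>; a \<in> car S; b \<in> car S|] ==> \<phi> (pls S a b) = pls S' (\<phi> a) (\<phi> b)"
 and lin_scl: "[|lin S S' \<phi>; a \<in> car S|] ==> \<phi> (scl S c a) = scl S' c (\<phi> a)"
 by (simp_all add: lin_def)

lemma lin_zer: "[|lin S S' \<phi>; vspace S; vspace S'|] ==> \<phi> (zer S) = zer S'"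
 using lin_scl[of S S' \<phi> "zer S" 0] by (simp add: vspace.scl_0 vspace.zer_mem vspace.scl_zer lin_mem)

lemma lin_comp: "[|lin S S' \<phi>; lin S' S'' \<psi>|] ==> lin S S'' (\<lambda>x. \<psi> (\<phi> x))"
 by (simp add: lin_def)

lemma lin_id: "lin S S (\<lambda>x. x)"
 by (simp add: lin_def)

lemma lin_inj:
 assumes "lin S S' \<phi>" "vspace S" "vspace S'"
  and "\<And>x. [|x \<in> car S; \<phi> x = zer S'|] ==> x = zer S"
 shows "inj_on \<phi> (car S)"
proof (rule inj_onI)
 fix x y assume xy: "x \<in> car S" "y \<in> car S" "\<phi> x = \<phi> y"
 interpret S: vspace S by fact
 interpret S': vspace S' by fact
 have "\<phi> (pls S x (scl S (-1) y)) = zer S'"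
  using xy assms(1) by (simp add: lin_pls lin_scl lin_mem)
 with xy(1,2) have "pls S x (scl S (-1) y) = zer S" by (intro assms(4)) auto
 then show "x = y" by (simp only: S.eq_iff_diff_zer[OF xy(1,2)])
qed

definition liso :: "('k, 'b) vs => ('k, 'c) vs => ('b => 'c) => bool" where
 "liso S S' \<phi> \<longleftrightarrow> lin S S' \<phi> \<and> bij_betw \<phi> (car S) (car S')"

lemma liso_lin: "liso S S' \<phi> ==> lin S S' \<phi>"
 and liso_bij: "liso S S' \<phi> ==> bij_betw \<phi> (car S) (car S')"
 by (simp_all add: liso_def)

lemma liso_comp: "[|liso S S' \<phi>; liso S' S'' \<psi>|] ==> liso S S'' (\<lambda>x. \<psi> (\<phi> x))"
 unfolding liso_def using lin_comp[of S S' \<phi> S'' \<psi>] bij_betw_trans[of \<phi> "car S" "car S'" \<psi> "car S''"]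
 by (auto simp: comp_def)

lemma liso_id: "liso S S (\<lambda>x. x)"
 by (simp add: liso_def lin_id bij_betw_def)

lemma liso_mem: "[|liso S S' \<phi>; a \<in> car S|] ==> \<phi> a \<in> car S'"
 using lin_mem by (auto simp: liso_def)

lemma liso_inv_right: "[|liso S S' \<phi>; y \<in> car S'|] ==> \<phi> (inv_into (car S) \<phi> y) = y"
 by (metis bij_betw_inv_into_right liso_bij)

lemma liso_inv_left: "[|liso S S' \<phi>; x \<in> car S|] ==> inv_into (car S) \<phi> (\<phi> x) = x"
 by (metis bij_betw_inv_into_left liso_bij)

lemma liso_eq_iff: "[|liso S S' \<phi>; x \<in> car S; y \<in> car S|] ==> \<phi> x = \<phi> y \<longleftrightarrow> x = y"
 by (metis liso_inv_left)

lemma liso_inv: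
 assumes "liso S S' \<phi>" "vspace S"
 shows "liso S' S (inv_into (car S) \<phi>)"
proof -
 interpret S: vspace S by fact
 let ?i = "inv_into (car S) \<phi>"
 have b: "bij_betw ?i (car S') (car S)" using assms(1) by (simp add: bij_betw_inv_into liso_bij)
 then have m: "?i y \<in> car S" if "y \<in> car S'" for y using that by (auto simp: bij_betw_def)
 have "lin S' S ?i"
 proof (rule linI)
  fix a b assume a: "a \<in> car S'" "b \<in> car S'"
  have "\<phi> (pls S (?i a) (?i b)) = pls S' a b"
   using assms(1) a m by (simp add: lin_pls[OF liso_lin] liso_inv_right)
  then show "?i (pls S' a b) = pls S (?i a) (?i b)"
   using liso_inv_left[OF assms(1), of "pls S (?i a) (?i b)"] a m by simp
 next
  fix c a assume a: "a \<in> car S'"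
  have "\<phi> (scl S c (?i a)) = scl S' c a"
   using assms(1) a m by (simp add: lin_scl[OF liso_lin] liso_inv_right)
  then show "?i (scl S' c a) = scl S c (?i a)"
   using liso_inv_left[OF assms(1), of "scl S c (?i a)"] a m by simp
 qed (use m in auto)
 then show ?thesis using b by (simp add: liso_def)
qed

lemma liso_zer_iff:
 "[|liso S S' \<phi>; vspace S; vspace S'; x \<in> car S|] ==> \<phi> x = zer S' \<longleftrightarrow> x = zer S"
 by (metis liso_eq_iff liso_lin lin_zer vspace.zer_mem)

subsection \<open>Linear combinations, bases and dimension\<close>

primrec lc :: "('k, 'b) vs => (nat => 'b) => nat => (nat => 'k) => 'b" where
 "lc S b 0 c = zer S"
| "lc S b (Suc d) c = pls S (lc S b d c) (scl S (c d) (b d))"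

lemma lc_car_update [simp]: "lc (S\<lparr>car := W\<rparr>) b d c = lc S b d c"
 by (induction d) auto

lemma lc_cong: "[|\<And>i. i < d ==> b i = b' i; \<And>i. i < d ==> c i = c' i|] ==> lc S b d c = lc S b' d c'"
 by (induction d) auto

lemma lc_lin: "[|lin S S' \<phi>; vspace S; vspace S'; \<forall>i<d. b i \<in> car S|] ==>
 lc S b d c \<in> car S \<and> \<phi> (lc S b d c) = lc S' (\<lambda>i. \<phi> (b i)) d c"
 by (induction d) (auto simp: lin_zer vspace.zer_mem vspace.pls_mem vspace.scl_mem lin_pls lin_scl)

context vspace begin

lemma lc_mem [simp]: "\<forall>i<d. b i \<in> car S ==> lc S b d c \<in> car S"
 by (induction d) auto

lemma lc_add: "\<forall>i<d. b i \<in> car S ==> lc S b d (\<lambda>i. c i + e i) = pls S (lc S b d c) (lc S b d e)"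
proof (induction d)
 case (Suc d)
 have m: "lc S b d c \<in> car S" "lc S b d e \<in> car S" "scl S (c d) (b d) \<in> car S" "scl S (e d) (b d) \<in> car S"
  using Suc.prems by (auto intro: lc_mem)
 have "lc S b (Suc d) (\<lambda>i. c i + e i) =
   pls S (pls S (lc S b d c) (lc S b d e)) (pls S (scl S (c d) (b d)) (scl S (e d) (b d)))"
  using Suc by (simp add: scl_add)
 also have "\<dots> = pls S (pls S (lc S b d c) (scl S (c d) (b d))) (pls S (lc S b d e) (scl S (e d) (b d)))"
  using m by (intro pls_swap)
 finally show ?case by simp
qed simp

lemma lc_scl: "\<forall>i<d. b i \<in> car S ==> lc S b d (\<lambda>i. e * c i) = scl S e (lc S b d c)"
 by (induction d) (auto simp: scl_pls scl_scl)

lemma lc_zer: "\<forall>i<d. b i \<in> car S ==> lc S b d (\<lambda>i. 0) = zer S"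
 by (induction d) auto

lemma lc_zer': "[|\<forall>i<d. b i \<in> car S; \<forall>i<d. c i = 0|] ==> lc S b d c = zer S"
 by (induction d) auto

lemma lc_split:
 "\<forall>i<d + e. b i \<in> car S ==>
  lc S b (d + e) c = pls S (lc S b d c) (lc S (\<lambda>i. b (d + i)) e (\<lambda>i. c (d + i)))"
 by (induction e) (auto simp: pls_assoc)

lemma lc_single: "[|\<forall>i<d. b i \<in> car S; j < d|] ==> lc S b d (\<lambda>i. if i = j then 1 else 0) = b j"
proof (induction d)
 case (Suc d)
 show ?case
 proof (cases "j = d")
  case True
  have "lc S b d (\<lambda>i. if i = j then 1 else 0) = zer S"
   by (rule lc_zer') (use Suc True in auto)
  then show ?thesis using True Suc.prems by simp
 qed (use Suc in auto)
qed simp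

lemma lc_lc:
 assumes "\<forall>j<e. b' j \<in> car S" "\<forall>i<d. b i = lc S b' e (m i)"
 shows "lc S b d c = lc S b' e (\<lambda>j. \<Sum>i<d. c i * m i j)"
 using assms(2)
proof (induction d)
 case 0
 then show ?case using assms(1) by (simp add: lc_zer)
next
 case (Suc d)
 then show ?case using assms(1) by (simp add: lc_add lc_scl)
qed

end

definition basis :: "('k::field, 'b) vs => (nat => 'b) => nat => bool" where
 "basis S b d \<longleftrightarrow> (\<forall>i<d. b i \<in> car S) \<and> (\<forall>v\<in>car S. \<exists>c. v = lc S b d c) \<and>
  (\<forall>c. lc S b d c = zer S --> (\<forall>i<d. c i = 0))"

text \<open>A relation, so that the existence of a dimension expresses finite dimensionality.\<close>

definition vdim :: "('k::field, 'b) vs => nat => bool" where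
 "vdim S d \<longleftrightarrow> (\<exists>b. basis S b d)"

text \<open>Elimination of one unknown by a pivot gives a nonzero solution of a homogeneous system with
 more unknowns than equations.\<close>

lemma homogeneous_system:
 fixes m :: "'i => nat => 'k::field"
 assumes "finite I" "card I > e"
 shows "\<exists>c. (\<exists>i\<in>I. c i \<noteq> 0) \<and> (\<forall>j<e. (\<Sum>i\<in>I. c i * m i j) = 0)"
 using assms
proof (induction e arbitrary: I m)
 case 0
 then obtain i where "i \<in> I" by (metis card_gt_0_iff ex_in_conv)
 then show ?case by (intro exI[of _ "\<lambda>_. 1"]) auto
next
 case (Suc e)
 show ?case
 proof (cases "\<forall>i\<in>I. m i e = 0")
  case True
  obtain c where "\<exists>i\<in>I. c i \<noteq> 0" "\<forall>j<e. (\<Sum>i\<in>I. c i * m i j) = 0"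
   using Suc.IH[of I m] Suc.prems by auto
  with True show ?thesis by (intro exI[of _ c]) (auto simp: less_Suc_eq)
 next
  case False
  then obtain p where p: "p \<in> I" "m p e \<noteq> 0" by blast
  let ?I = "I - {p}"
  let ?m = "\<lambda>i j. m i j - m i e / m p e * m p j"
  have "finite ?I" "e < card ?I" using Suc.prems p by auto
  from Suc.IH[OF this, of ?m]
  obtain c where c: "\<exists>i\<in>?I. c i \<noteq> 0" "\<forall>j<e. (\<Sum>i\<in>?I. c i * ?m i j) = 0"
   by blast
  let ?s = "\<Sum>i\<in>?I. c i * (m i e / m p e)"
  let ?c = "c(p := - ?s)"
  have eq: "(\<Sum>i\<in>I. ?c i * m i j) = (\<Sum>i\<in>?I. c i * ?m i j)" for j
  proof -
   have "(\<Sum>i\<in>I. ?c i * m i j) = - ?s * m p j + (\<Sum>i\<in>?I. ?c i * m i j)"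
    using p Suc.prems by (subst sum.remove[of _ p]) auto
   also have "(\<Sum>i\<in>?I. ?c i * m i j) = (\<Sum>i\<in>?I. c i * m i j)"
    by (rule sum.cong) auto
   also have "- ?s * m p j + \<dots> = (\<Sum>i\<in>?I. c i * ?m i j)"
    by (simp add: algebra_simps sum_subtractf sum_distrib_right sum_distrib_left)
   finally show ?thesis .
  qed
  have "(\<Sum>i\<in>I. ?c i * m i j) = 0" if "j < Suc e" for j
   unfolding eq using c(2) that p by (cases "j = e") (auto simp: less_Suc_eq)
  moreover have "\<exists>i\<in>I. ?c i \<noteq> 0" using c(1) by auto
  ultimately show ?thesis by blast
 qed
qed

context vspace begin

lemma independent_le_spanning:
 assumes b: "\<forall>i<d. b i \<in> car S" "\<And>c. lc S b d c = zer S ==> \<forall>i<d. c i = 0"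
  and b': "\<forall>i<e. b' i \<in> car S" "\<forall>v\<in>car S. \<exists>c. v = lc S b' e c"
 shows "d \<le> e"
proof (rule ccontr)
 assume "\<not> d \<le> e"
 have "\<forall>i. \<exists>m. i < d --> b i = lc S b' e m" using b(1) b'(2) by auto
 then obtain m where m: "\<forall>i<d. b i = lc S b' e (m i)" by metis
 obtain c where c: "\<exists>i<d. c i \<noteq> 0" "\<forall>j<e. (\<Sum>i<d. c i * m i j) = 0"
  using homogeneous_system[of "{..<d}" e m] \<open>\<not> d \<le> e\<close> by auto
 have "lc S b d c = zer S"
  using lc_lc[OF b'(1) m] lc_zer'[OF b'(1)] c(2) by simp
 then show False using b(2) c(1) by blast
qed

text \<open>Two bases have the same size since an independent family is never longer than a spanning one.\<close>

lemma vdim_unique: "[|vdim S d; vdim S e|] ==> d = e"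
proof -
 have "x \<le> y" if bb: "basis S b x" "basis S b' y" for b b' x y
  by (rule independent_le_spanning[of x b y b']) (use bb in \<open>auto simp: basis_def\<close>)
 then show "[|vdim S d; vdim S e|] ==> d = e"
  unfolding vdim_def by (meson order_antisym)
qed

end

lemma vdim_liso:
 assumes "liso S S' \<phi>" "vspace S" "vspace S'" "vdim S d"
 shows "vdim S' d"
proof -
 interpret S: vspace S by fact
 interpret S': vspace S' by fact
 obtain b where b: "basis S b d" using assms(4) by (auto simp: vdim_def)
 then have bm: "\<forall>i<d. b i \<in> car S" by (simp add: basis_def)
 note l = lc_lin[OF liso_lin[OF assms(1)] assms(2,3) bm]
 have "basis S' (\<lambda>i. \<phi> (b i)) d"
  unfolding basis_def
 proof (intro conjI ballI allI impI)
  fix v assume v: "v \<in> car S'"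
  then obtain w where w: "w \<in> car S" "v = \<phi> w"
   using liso_bij[OF assms(1)] by (auto simp: bij_betw_def)
  then obtain c where "w = lc S b d c" using b by (auto simp: basis_def)
  then show "\<exists>c. v = lc S' (\<lambda>i. \<phi> (b i)) d c" using l w by metis
 next
  fix c i assume "lc S' (\<lambda>i. \<phi> (b i)) d c = zer S'" "i < d"
  then show "c i = 0" using l[of c] b liso_zer_iff[OF assms(1-3)] by (auto simp: basis_def)
 qed (use bm liso_mem[OF assms(1)] in auto)
 then show ?thesis by (auto simp: vdim_def)
qed

text \<open>Dimension is additive: a basis of the middle term of a short exact sequence consists of the
 image of one of the left term and a lift of one of the right term.\<close>

lemma vdim_exact:
 assumes vs: "vspace A" "vspace B" "vspace C" and i: "lin A B i" and p: "lin B C p"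
  and inj: "inj_on i (car A)" and ker: "i ` car A = {b \<in> car B. p b = zer C}"
  and surj: "p ` car B = car C" and A: "vdim A d" and C: "vdim C e"
 shows "vdim B (d + e)"
proof -
 interpret A: vspace A by fact
 interpret B: vspace B by fact
 interpret C: vspace C by fact
 obtain a where a: "basis A a d" using A by (auto simp: vdim_def)
 obtain c where c: "basis C c e" using C by (auto simp: vdim_def)
 have "\<forall>k\<in>{..<e}. \<exists>b. b \<in> car B \<and> p b = c k"
 proof
  fix k assume "k \<in> {..<e}"
  then have "c k \<in> p ` car B" using c surj by (simp add: basis_def)
  then show "\<exists>b. b \<in> car B \<and> p b = c k" by auto
 qed
 from bchoice[OF this] obtain l where l: "\<forall>k<e. l k \<in> car B \<and> p (l k) = c k" by auto
 have am: "\<forall>k<d. a k \<in> car A" and cm: "\<forall>k<e. c k \<in> car C" using a c by (auto simp: basis_def)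
 define b where "b k = (if k < d then i (a k) else l (k - d))" for k
 have bm: "\<forall>k<d + e. b k \<in> car B" using am l lin_mem[OF i] by (auto simp: b_def)
 have lcb: "lc B b (d + e) x = pls B (i (lc A a d x)) (lc B l e (\<lambda>k. x (d + k)))" for x
 proof -
  have "lc B b d x = i (lc A a d x)"
   using lc_lin[OF i vs(1,2) am] by (auto simp: b_def intro!: lc_cong)
  moreover have "lc B (\<lambda>k. b (d + k)) e (\<lambda>k. x (d + k)) = lc B l e (\<lambda>k. x (d + k))"
   by (auto simp: b_def intro!: lc_cong)
  ultimately show ?thesis using B.lc_split[OF bm] by simp
 qed
 have pl: "p (lc B l e x) = lc C c e x" and lm: "lc B l e x \<in> car B" for x
 proof -
  have "\<forall>k<e. l k \<in> car B" using l by simp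
  from lc_lin[OF p vs(2,3) this]
  have "lc B l e x \<in> car B" "p (lc B l e x) = lc C (\<lambda>i. p (l i)) e x" by auto
  moreover have "lc C (\<lambda>i. p (l i)) e x = lc C c e x" by (rule lc_cong) (use l in auto)
  ultimately show "lc B l e x \<in> car B" and "p (lc B l e x) = lc C c e x" by simp_all
 qed
 have pi: "p (i x) = zer C" if "x \<in> car A" for x using ker that by auto
 have im: "i x \<in> car B" if "x \<in> car A" for x using lin_mem[OF i] that by auto
 have "basis B b (d + e)"
  unfolding basis_def
 proof (intro conjI ballI allI impI)
  fix v assume v: "v \<in> car B"
  then have "p v \<in> car C" by (rule lin_mem[OF p])
  then obtain x where x: "p v = lc C c e x" using c unfolding basis_def by blast
  let ?w = "pls B v (scl B (-1) (lc B l e x))"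
  have "p ?w = zer C"
   using v x lm pl lin_mem[OF p v] by (simp add: lin_pls[OF p] lin_scl[OF p])
  then have "?w \<in> i ` car A" using ker v lm by auto
  then obtain y where y: "?w = i (lc A a d y)" using a by (auto simp: basis_def)
  let ?z = "\<lambda>k. if k < d then y k else x (k - d)"
  have "lc B b (d + e) ?z = pls B ?w (lc B l e x)"
  proof -
   have "lc A a d ?z = lc A a d y" by (rule lc_cong) auto
   then show ?thesis unfolding lcb y by simp
  qed
  also have "\<dots> = v" using v lm by (simp add: B.pls_assoc)
  finally show "\<exists>c. v = lc B b (d + e) c" by metis
 next
  fix x k assume x: "lc B b (d + e) x = zer B" and k: "k < d + e"
  have ia: "i (lc A a d x) \<in> car B" using im A.lc_mem[OF am] by blast
  have "zer C = p (pls B (i (lc A a d x)) (lc B l e (\<lambda>k. x (d + k))))"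
   using x lin_zer[OF p vs(2,3)] by (simp add: lcb)
  also have "\<dots> = lc C c e (\<lambda>k. x (d + k))"
   using ia lm pl pi[OF A.lc_mem[OF am]] C.lc_mem[OF cm] by (simp add: lin_pls[OF p])
  finally have "lc C c e (\<lambda>k. x (d + k)) = zer C" by (rule sym)
  then have xe: "\<forall>k<e. x (d + k) = 0"
   using c unfolding basis_def by (elim conjE allE[of _ "\<lambda>k. x (d + k)"]) blast
  then have "lc B l e (\<lambda>k. x (d + k)) = zer B"
   using l by (intro B.lc_zer') auto
  then have "i (lc A a d x) = zer B" using x ia by (simp add: lcb)
  then have "lc A a d x = zer A"
   using lin_zer[OF i vs(1,2)] A.lc_mem[OF am] by (intro inj_onD[OF inj]) auto
  then have "\<forall>k<d. x k = 0" using a by (simp add: basis_def)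
  then show "x k = 0" using xe k by (metis add_diff_inverse_nat nat_add_left_cancel_less)
 qed (use bm in auto)
 then show ?thesis by (auto simp: vdim_def)
qed

lemma vdim_0_iff: "vspace S ==> vdim S 0 \<longleftrightarrow> car S = {zer S}"
 by (auto simp: vdim_def basis_def vspace.zer_mem)

context vspace begin

text \<open>This is the induction step for the dimension of the span of a finite set: the added vector lies in
 the subspace already or extends a basis of it.\<close>

lemma vdim_extend:
 assumes W: "W \<subseteq> car S" "vdim (S\<lparr>car := W\<rparr>) d" and b: "b \<in> car S"
  and W': "W' = {pls S w (scl S c b) | w c. w \<in> W}"
  and vW: "vspace (S\<lparr>car := W\<rparr>)"
 shows "\<exists>d'. vdim (S\<lparr>car := W'\<rparr>) d'"
proof (cases "b \<in> W")
 case True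
 interpret W: vspace "S\<lparr>car := W\<rparr>" by fact
 have "W' = W"
 proof
  show "W' \<subseteq> W" using True W.pls_mem W.scl_mem by (auto simp: W')
  show "W \<subseteq> W'"
  proof
   fix w assume "w \<in> W"
   then have "w = pls S w (scl S 0 b)" using W(1) b by auto
   then show "w \<in> W'" using \<open>w \<in> W\<close> unfolding W' by blast
  qed
 qed
 then show ?thesis using W(2) by auto
next
 case False
 interpret W: vspace "S\<lparr>car := W\<rparr>" by fact
 obtain a where a: "basis (S\<lparr>car := W\<rparr>) a d" using W(2) by (auto simp: vdim_def)
 then have am: "\<forall>i<d. a i \<in> W" by (simp add: basis_def)
 then have am': "\<forall>i<d. a i \<in> car S" using W(1) by auto
 let ?a = "a(d := b)"
 have e: "lc S ?a d c = lc S a d c" for c by (rule lc_cong) auto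
 have lm: "lc S a d c \<in> W" for c using W.lc_mem[of d a c] am by simp
 have "basis (S\<lparr>car := W'\<rparr>) ?a (Suc d)"
  unfolding basis_def
 proof (intro conjI ballI allI impI)
  fix i assume i: "i < Suc d"
  show "?a i \<in> car (S\<lparr>car := W'\<rparr>)"
  proof (cases "i = d")
   case True
   have "b = pls S (zer S) (scl S 1 b)" using b by simp
   then show ?thesis using True W.zer_mem by (auto simp: W')
  next
   case False
   then have "a i = pls S (a i) (scl S 0 b)" "a i \<in> W" using b am am' i by auto
   then show ?thesis using False unfolding W' by auto
  qed
 next
  fix v assume "v \<in> car (S\<lparr>car := W'\<rparr>)"
  then obtain w c where v: "v = pls S w (scl S c b)" "w \<in> W" by (auto simp: W')
  then obtain x where "w = lc S a d x" using a by (auto simp: basis_def)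
  moreover have "lc S a d (x(d := c)) = lc S a d x" by (rule lc_cong) auto
  ultimately have "v = lc (S\<lparr>car := W'\<rparr>) ?a (Suc d) (x(d := c))"
   using v by (simp add: e)
  then show "\<exists>c. v = lc (S\<lparr>car := W'\<rparr>) ?a (Suc d) c" by blast
 next
  fix c i assume z: "lc (S\<lparr>car := W'\<rparr>) ?a (Suc d) c = zer (S\<lparr>car := W'\<rparr>)" and i: "i < Suc d"
  then have z': "pls S (lc S a d c) (scl S (c d) b) = zer S" by (simp add: e)
  have cd: "c d = 0"
  proof (rule ccontr)
   assume n: "c d \<noteq> 0"
   have "scl S (- 1) (lc S a d c) = pls S (scl S (-1) (lc S a d c)) (pls S (lc S a d c) (scl S (c d) b))"
    using z' lc_mem[OF am'] by simp
   also have "\<dots> = scl S (c d) b" using lc_mem[OF am', of c] b by (simp flip: pls_assoc)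
   finally have "scl S (inverse (c d)) (scl S (-1) (lc S a d c)) = b"
    using b n by (simp add: scl_scl)
   moreover have "scl S (inverse (c d)) (scl S (-1) (lc S a d c)) \<in> W"
    using W.scl_mem lm by simp
   ultimately show False using False by simp
  qed
  then have "lc S a d c = zer S" using z' lc_mem[OF am'] b by simp
  then have "\<forall>i<d. c i = 0" using a by (simp add: basis_def)
  then show "c i = 0" using cd i by (auto simp: less_Suc_eq)
 qed
 then show ?thesis by (auto simp: vdim_def)
qed

end

section \<open>The path algebra of the linear quiver\<close>

abbreviation LA :: "nat => ('k::field, nat list => 'k) module" where
 "LA \<equiv> linear_path_algebra"

declare upt_Suc [simp del]

text \<open>A path in this quiver is determined by its end points. The convention that the element is zero when
 there is no path from \<open>u\<close> to \<open>v\<close> allows arbitrary indices.\<close>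

definition ee :: "nat => nat => nat => nat list => 'k::field" where
 "ee n u v = (\<lambda>p. if 1 \<le> u \<and> u \<le> v \<and> v < n \<and> p = [u..<Suc v] then 1 else 0)"

lemma successively_Suc_iff:
 "p \<noteq> [] ==> successively (\<lambda>u v. v = Suc u) p \<longleftrightarrow> p = [hd p..<hd p + length p]"
proof (induction p)
 case (Cons x p)
 show ?case
 proof (cases p)
  case (Cons y q)
  have "p \<noteq> []" using Cons by simp
  then have "successively (\<lambda>u v. v = Suc u) (x # p) \<longleftrightarrow> hd p = Suc x \<and> p = [hd p..<hd p + length p]"
   using Cons.IH Cons by (auto simp: successively_Cons)
  also have "\<dots> \<longleftrightarrow> x # p = [x..<x + length (x # p)]"
  proof
   assume h: "hd p = Suc x \<and> p = [hd p..<hd p + length p]"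
   have "[x..<x + length (x # p)] = x # [Suc x..<Suc x + length p]"
    by (subst upt_conv_Cons) auto
   also have "[Suc x..<Suc x + length p] = p" using h by metis
   finally show "x # p = [x..<x + length (x # p)]" by simp
  next
   assume "x # p = [x..<x + length (x # p)]"
   also have "\<dots> = x # [Suc x..<Suc x + length p]"
    by (subst upt_conv_Cons) auto
   finally have p: "p = [Suc x..<Suc x + length p]" by simp
   moreover have "hd [Suc x..<Suc x + length p] = Suc x" using \<open>p \<noteq> []\<close> by (simp add: upt_conv_Cons)
   ultimately show "hd p = Suc x \<and> p = [hd p..<hd p + length p]" by metis
  qed
  finally show ?thesis by simp
 qed (simp add: upt_conv_Cons)
qed simp

lemma linear_quiver_paths:
 "p \<in> quiver_paths {1..n-1} {(u, v). u \<in> {1..n-1} \<and> v \<in> {1..n-1} \<and> v = Suc u} \<longleftrightarrow>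
  (\<exists>u v. 1 \<le> u \<and> u \<le> v \<and> v < n \<and> p = [u..<Suc v])" (is "?L \<longleftrightarrow> ?R")
proof
 assume ?L
 then have p: "p \<noteq> []" "set p \<subseteq> {1..n-1}" "successively (\<lambda>u v. v = Suc u) p"
  by (auto simp: quiver_paths_def elim: successively_mono)
 then have "p = [hd p..<hd p + length p]" using successively_Suc_iff[of p] by simp
 moreover have "hd p + length p = Suc (hd p + length p - 1)" using p(1) by (cases p) auto
 ultimately have e: "p = [hd p..<Suc (hd p + length p - 1)]" by metis
 let ?v = "hd p + length p - 1"
 have le: "hd p \<le> ?v" using p(1) by (cases p) auto
 have "set p = {hd p..?v}" by (subst (1) e) auto
 then have "hd p \<in> set p" "?v \<in> set p" using le by auto
 then have "1 \<le> hd p" "?v \<le> n - 1" using p(2) by auto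
 then have "1 \<le> hd p \<and> hd p \<le> ?v \<and> ?v < n \<and> p = [hd p..<Suc ?v]" using e le by simp
 then show ?R by blast
next
 assume ?R
 then obtain u v where uv: "1 \<le> u" "u \<le> v" "v < n" "p = [u..<Suc v]" by blast
 have "successively (\<lambda>u v. v = Suc u) p"
  using successively_Suc_iff[of p] uv by (auto simp: upt_conv_Cons)
 then have "successively (\<lambda>u v. (u, v) \<in> {(u, v). u \<in> {1..n-1} \<and> v \<in> {1..n-1} \<and> v = Suc u}) p"
  by (rule successively_mono) (use uv in auto)
 then show ?L using uv by (auto simp: quiver_paths_def)
qed

lemma LA_carrier:
 "a \<in> carrier (LA n) \<longleftrightarrow> (\<forall>p. a p \<noteq> 0 --> (\<exists>u v. 1 \<le> u \<and> u \<le> v \<and> v < n \<and> p = [u..<Suc v]))"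
 (is "_ \<longleftrightarrow> ?R")
proof -
 have "a \<in> carrier (LA n) \<longleftrightarrow> finite {p. a p \<noteq> 0} \<and>
   (\<forall>p. a p \<noteq> 0 --> p \<in> quiver_paths {1..n-1} {(u, v). u \<in> {1..n-1} \<and> v \<in> {1..n-1} \<and> v = Suc u})"
  unfolding linear_path_algebra_def path_algebra_def by (simp only: partial_object.simps) blast
 then have e: "a \<in> carrier (LA n) \<longleftrightarrow> finite {p. a p \<noteq> 0} \<and> ?R"
  by (simp only: linear_quiver_paths)
 have "finite {p. a p \<noteq> 0}" if ?R
 proof (rule finite_subset)
  show "{p. a p \<noteq> 0} \<subseteq> (\<lambda>(u, v). [u..<Suc v]) ` ({..<n} \<times> {..<n})" using that by force
 qed auto
 then show ?thesis using e by blast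
qed

lemma LA_add [simp]: "a \<oplus>\<^bsub>LA n\<^esub> b = (\<lambda>p. a p + b p)"
 and LA_zero [simp]: "\<zero>\<^bsub>LA n\<^esub> = (\<lambda>p. 0)"
 and LA_smult [simp]: "c \<odot>\<^bsub>LA n\<^esub> a = (\<lambda>p. c * a p)"
 by (simp_all add: linear_path_algebra_def path_algebra_def)

lemma LA_one: "\<one>\<^bsub>LA n\<^esub> = (\<lambda>p. if \<exists>v\<in>{1..n-1}. p = [v] then 1 else 0)"
 by (simp add: linear_path_algebra_def path_algebra_def)

lemma LA_mult: "a \<otimes>\<^bsub>LA n\<^esub> b = (\<lambda>p. \<Sum>m<length p. a (drop m p) * b (take (Suc m) p))"
 by (simp add: linear_path_algebra_def path_algebra_def)

text \<open>The path from \<open>u\<close> to \<open>v\<close> factors at each of the vertices that it visits.\<close>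

lemma LA_mult_cf:
 assumes "u \<le> v"
 shows "(a \<otimes>\<^bsub>LA n\<^esub> b) [u..<Suc v] = (\<Sum>w\<in>{u..v}. a [w..<Suc v] * b [u..<Suc w])"
proof -
 have "(a \<otimes>\<^bsub>LA n\<^esub> b) [u..<Suc v] = (\<Sum>m<Suc v - u. a [u + m..<Suc v] * b [u..<Suc (u + m)])"
  unfolding LA_mult using assms
  by (intro sum.cong) (auto simp: take_upt drop_upt)
 also have "\<dots> = (\<Sum>w\<in>{u..v}. a [w..<Suc v] * b [u..<Suc w])"
  by (rule sum.reindex_bij_witness[of _ "\<lambda>w. w - u" "\<lambda>m. u + m"]) (use assms in auto)
 finally show ?thesis .
qed

lemma LA_eqI:
 assumes "a \<in> carrier (LA n)" "b \<in> carrier (LA n)"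
  and "\<And>u v. [|1 \<le> u; u \<le> v; v < n|] ==> a [u..<Suc v] = b [u..<Suc v]"
 shows "a = b"
proof
 fix p
 show "a p = b p"
 proof (cases "\<exists>u v. 1 \<le> u \<and> u \<le> v \<and> v < n \<and> p = [u..<Suc v]")
  case False
  then have "a p = 0" "b p = 0" using assms(1,2) unfolding LA_carrier by blast+
  then show ?thesis by simp
 qed (use assms(3) in auto)
qed

lemma upt_Suc_eq_iff: "u \<le> v ==> u' \<le> v' ==> [u..<Suc v] = [u'..<Suc v'] \<longleftrightarrow> u = u' \<and> v = v'"
proof
 assume "u \<le> v" "u' \<le> v'" and e: "[u..<Suc v] = [u'..<Suc v']"
 have "hd [u..<Suc v] = hd [u'..<Suc v']" "last [u..<Suc v] = last [u'..<Suc v']" using e by simp_all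
 then show "u = u' \<and> v = v'" using \<open>u \<le> v\<close> \<open>u' \<le> v'\<close> by simp
qed simp

lemma upt_Suc_eq_single [simp]: "[u..<Suc v] = [w] \<longleftrightarrow> u = w \<and> v = w"
proof (cases "u \<le> v")
 case True
 have "[w] = [w..<Suc w]" by (simp add: upt_conv_Cons)
 then show ?thesis using upt_Suc_eq_iff[of u v w w] True by simp
qed auto

lemma ee_cf: "u \<le> v ==> ee n x y [u..<Suc v] = (if 1 \<le> u \<and> v < n \<and> x = u \<and> y = v then 1 else 0)"
 by (auto simp: ee_def upt_Suc_eq_iff)

lemma ee_carrier [simp]: "ee n u v \<in> carrier (LA n)"
 by (auto simp: LA_carrier ee_def)

lemma ee_zero: "\<not> (1 \<le> u \<and> u \<le> v \<and> v < n) ==> ee n u v = \<zero>\<^bsub>LA n\<^esub>"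
 by (auto simp: ee_def)

lemma LA_add_closed: "[|a \<in> carrier (LA n); b \<in> carrier (LA n)|] ==> (\<lambda>p. a p + b p) \<in> carrier (LA n)"
 unfolding LA_carrier by (metis add_cancel_left_left)

lemma LA_scale_closed: "a \<in> carrier (LA n) ==> (\<lambda>p. c * a p) \<in> carrier (LA n)"
 unfolding LA_carrier by auto

lemma LA_one_closed: "\<one>\<^bsub>LA n\<^esub> \<in> carrier (LA n)"
proof -
 have "\<exists>u v. 1 \<le> u \<and> u \<le> v \<and> v < n \<and> [w] = [u..<Suc v]" if "w \<in> {1..n-1}" for w
  using that by (intro exI[of _ w]) (auto simp: upt_conv_Cons)
 then show ?thesis unfolding LA_carrier LA_one by auto
qed

lemma LA_mult_closed:
 assumes "a \<in> carrier (LA n)" "b \<in> carrier (LA n)"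
 shows "a \<otimes>\<^bsub>LA n\<^esub> b \<in> carrier (LA n)"
 unfolding LA_carrier
proof (intro allI impI)
 fix p assume "(a \<otimes>\<^bsub>LA n\<^esub> b) p \<noteq> 0"
 then obtain m where m: "m < length p" "a (drop m p) \<noteq> 0" "b (take (Suc m) p) \<noteq> 0"
  unfolding LA_mult by (metis (no_types, lifting) lessThan_iff mult_not_zero sum.not_neutral_contains_not_neutral)
 then obtain u v u' v' where uv: "1 \<le> u" "u \<le> v" "v < n" "drop m p = [u..<Suc v]"
   "1 \<le> u'" "u' \<le> v'" "v' < n" "take (Suc m) p = [u'..<Suc v']"
  using assms unfolding LA_carrier by blast
 have "hd (drop m p) = p ! m" "last (take (Suc m) p) = p ! m"
  using m(1) by (simp_all add: hd_drop_conv_nth take_Suc_conv_app_nth)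
 then have "hd [u..<Suc v] = last [u'..<Suc v']" using uv by metis
 then have u: "u = v'" using uv by simp
 have "p = take (Suc m) p @ tl (drop m p)" by (metis append_take_drop_id drop_Suc tl_drop)
 also have "tl (drop m p) = [Suc u..<Suc v]" using uv(2,4) by (simp add: upt_conv_Cons)
 also have "take (Suc m) p @ \<dots> = [u'..<Suc v]" using uv(8,6,2) u upt_add_eq_append[of u' "Suc u" "v - u"]
  by (simp)
 finally show "\<exists>u v. 1 \<le> u \<and> u \<le> v \<and> v < n \<and> p = [u..<Suc v]" using uv u by (metis le_trans)
qed

lemma LA_mult_assoc:
 assumes a: "a \<in> carrier (LA n)" and b: "b \<in> carrier (LA n)" and c: "c \<in> carrier (LA n)"
 shows "a \<otimes>\<^bsub>LA n\<^esub> b \<otimes>\<^bsub>LA n\<^esub> c = a \<otimes>\<^bsub>LA n\<^esub> (b \<otimes>\<^bsub>LA n\<^esub> c)"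
proof (rule LA_eqI)
 fix u v :: nat assume uv: "1 \<le> u" "u \<le> v" "v < n"
 let ?g = "\<lambda>w x. a [x..<Suc v] * b [w..<Suc x] * c [u..<Suc w]"
 have "(a \<otimes>\<^bsub>LA n\<^esub> b \<otimes>\<^bsub>LA n\<^esub> c) [u..<Suc v] = (\<Sum>w\<in>{u..v}. \<Sum>x\<in>{w..v}. ?g w x)"
  using uv by (simp add: LA_mult_cf sum_distrib_right)
 also have "\<dots> = (\<Sum>w\<in>{u..v}. \<Sum>x | x \<in> {u..v} \<and> w \<le> x. ?g w x)"
  by (intro sum.cong) auto
 also have "\<dots> = (\<Sum>x\<in>{u..v}. \<Sum>w | w \<in> {u..v} \<and> w \<le> x. ?g w x)"
  by (rule sum.swap_restrict) auto
 also have "\<dots> = (\<Sum>x\<in>{u..v}. \<Sum>w\<in>{u..x}. ?g w x)"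
  by (intro sum.cong) auto
 also have "\<dots> = (a \<otimes>\<^bsub>LA n\<^esub> (b \<otimes>\<^bsub>LA n\<^esub> c)) [u..<Suc v]"
  using uv by (simp add: LA_mult_cf sum_distrib_left mult.assoc)
 finally show "(a \<otimes>\<^bsub>LA n\<^esub> b \<otimes>\<^bsub>LA n\<^esub> c) [u..<Suc v] = (a \<otimes>\<^bsub>LA n\<^esub> (b \<otimes>\<^bsub>LA n\<^esub> c)) [u..<Suc v]" .
qed (simp_all add: a b c LA_mult_closed)

lemma LA_one_cf: "u \<le> v ==> (\<one>\<^bsub>LA n\<^esub>) [u..<Suc v] = (if u = v \<and> 1 \<le> u \<and> v < n then 1 else 0)"
 by (auto simp: LA_one)

lemma LA_one_left: "a \<in> carrier (LA n) ==> \<one>\<^bsub>LA n\<^esub> \<otimes>\<^bsub>LA n\<^esub> a = a"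
proof (rule LA_eqI[of _ n])
 fix u v :: nat assume uv: "1 \<le> u" "u \<le> v" "v < n"
 have "(\<one>\<^bsub>LA n\<^esub> \<otimes>\<^bsub>LA n\<^esub> a) [u..<Suc v] = (\<Sum>w\<in>{u..v}. if w = v then a [u..<Suc v] else 0)"
  using uv by (auto simp: LA_mult_cf LA_one_cf if_distrib[of "\<lambda>x. x * _"] if_distrib[of "\<lambda>x. _ * x"] cong: if_cong intro!: sum.cong)
 then show "(\<one>\<^bsub>LA n\<^esub> \<otimes>\<^bsub>LA n\<^esub> a) [u..<Suc v] = a [u..<Suc v]" using uv by simp
qed (simp_all add: LA_mult_closed LA_one_closed)

lemma LA_one_right: "a \<in> carrier (LA n) ==> a \<otimes>\<^bsub>LA n\<^esub> \<one>\<^bsub>LA n\<^esub> = a"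
proof (rule LA_eqI[of _ n])
 fix u v :: nat assume uv: "1 \<le> u" "u \<le> v" "v < n"
 have "(a \<otimes>\<^bsub>LA n\<^esub> \<one>\<^bsub>LA n\<^esub>) [u..<Suc v] = (\<Sum>w\<in>{u..v}. if w = u then a [u..<Suc v] else 0)"
  using uv by (auto simp: LA_mult_cf LA_one_cf if_distrib[of "\<lambda>x. x * _"] if_distrib[of "\<lambda>x. _ * x"] cong: if_cong intro!: sum.cong)
 then show "(a \<otimes>\<^bsub>LA n\<^esub> \<one>\<^bsub>LA n\<^esub>) [u..<Suc v] = a [u..<Suc v]" using uv by simp
qed (simp_all add: LA_mult_closed LA_one_closed)

lemma LA_distr_l: "(a \<oplus>\<^bsub>LA n\<^esub> b) \<otimes>\<^bsub>LA n\<^esub> c = a \<otimes>\<^bsub>LA n\<^esub> c \<oplus>\<^bsub>LA n\<^esub> b \<otimes>\<^bsub>LA n\<^esub> c"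
 by (simp add: LA_mult sum.distrib distrib_right)

lemma LA_distr_r: "a \<otimes>\<^bsub>LA n\<^esub> (b \<oplus>\<^bsub>LA n\<^esub> c) = a \<otimes>\<^bsub>LA n\<^esub> b \<oplus>\<^bsub>LA n\<^esub> a \<otimes>\<^bsub>LA n\<^esub> c"
 by (simp add: LA_mult sum.distrib distrib_left)

lemma ring_LA: "ring (LA n :: ('k::field, _) module)"
proof (intro ringI abelian_groupI monoidI)
 fix x :: "nat list => 'k" assume "x \<in> carrier (LA n)"
 then show "\<exists>y\<in>carrier (LA n). y \<oplus>\<^bsub>LA n\<^esub> x = \<zero>\<^bsub>LA n\<^esub>"
  using LA_scale_closed[of x n "-1"] by (intro bexI[of _ "\<lambda>p. -1 * x p"]) auto
qed (simp_all add: LA_add_closed LA_mult_closed LA_one_closed LA_mult_assoc LA_one_left LA_one_right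
 LA_distr_l[simplified] LA_distr_r[simplified] add.assoc, auto simp: LA_carrier add.commute)

lemma LA_scale_mult: "(\<lambda>p. c * a p) \<otimes>\<^bsub>LA n\<^esub> b = (\<lambda>p. c * (a \<otimes>\<^bsub>LA n\<^esub> b) p)"
 and LA_mult_scale: "a \<otimes>\<^bsub>LA n\<^esub> (\<lambda>p. c * b p) = (\<lambda>p. c * (a \<otimes>\<^bsub>LA n\<^esub> b) p)"
 by (simp_all add: LA_mult sum_distrib_left mult.assoc mult.left_commute)

lemma LA_zero_mult [simp]: "(\<lambda>p. 0) \<otimes>\<^bsub>LA n\<^esub> b = (\<lambda>p. 0)"
 and LA_mult_zero [simp]: "b \<otimes>\<^bsub>LA n\<^esub> (\<lambda>p. 0) = (\<lambda>p. 0)"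
 by (simp_all add: LA_mult)

lemma ee_mult: "[|u \<le> v; v \<le> w|] ==> ee n v w \<otimes>\<^bsub>LA n\<^esub> ee n u v = (ee n u w :: _ => 'k::field)"
proof (rule LA_eqI[of _ n])
 fix x y assume uvw: "u \<le> v" "v \<le> w" and xy: "1 \<le> x" "x \<le> y" "y < n"
 have "(ee n v w \<otimes>\<^bsub>LA n\<^esub> ee n u v) [x..<Suc y] = (\<Sum>z\<in>{x..y}. if z = v then if x = u \<and> y = w then 1 else 0 else (0::'k))"
  using xy by (auto simp: LA_mult_cf ee_cf if_distrib[of "\<lambda>x. x * _"] if_distrib[of "\<lambda>x. _ * x"] cong: if_cong intro!: sum.cong)
 then show "(ee n v w \<otimes>\<^bsub>LA n\<^esub> ee n u v) [x..<Suc y] = (ee n u w [x..<Suc y] :: 'k)"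
  using xy uvw by (auto simp: ee_cf)
qed (auto simp: LA_mult_closed)

lemma ee_mult_0: "v \<noteq> x ==> ee n v w \<otimes>\<^bsub>LA n\<^esub> ee n u x = \<zero>\<^bsub>LA n\<^esub>"
proof (rule LA_eqI[of _ n])
 fix r s assume "v \<noteq> x" and xy: "1 \<le> r" "r \<le> s" "s < n"
 then show "(ee n v w \<otimes>\<^bsub>LA n\<^esub> ee n u x) [r..<Suc s] = \<zero>\<^bsub>LA n\<^esub> [r..<Suc s]"
  by (auto simp: LA_mult_cf ee_cf intro!: sum.neutral)
qed (auto simp: LA_mult_closed, auto simp: LA_carrier)

text \<open>The path algebra is spanned by the paths.\<close>

lemma LA_induct [consumes 1, case_names zero path add]:
 assumes "a \<in> carrier (LA n)" and z: "P (\<zero>\<^bsub>LA n\<^esub>)"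
  and e: "\<And>u v c. [|1 \<le> u; u \<le> v; v < n|] ==> P (c \<odot>\<^bsub>LA n\<^esub> ee n u v)"
  and add: "\<And>a b. [|a \<in> carrier (LA n); b \<in> carrier (LA n); P a; P b|] ==> P (a \<oplus>\<^bsub>LA n\<^esub> b)"
 shows "P a"
proof -
 have "P a" if "finite F" "{p. a p \<noteq> 0} \<subseteq> F" "a \<in> carrier (LA n)" for F a
  using that
 proof (induction F arbitrary: a)
  case empty
  then have "a = \<zero>\<^bsub>LA n\<^esub>" by auto
  then show ?case using z by simp
 next
  case (insert p F)
  show ?case
  proof (cases "a p = 0")
   case True
   then show ?thesis using insert by (intro insert.IH) auto
  next
   case False
   then obtain u v where uv: "1 \<le> u" "u \<le> v" "v < n" "p = [u..<Suc v]"
    using insert.prems by (auto simp: LA_carrier)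
   let ?b = "a(p := 0)"
   have b: "?b \<in> carrier (LA n)" using insert.prems by (auto simp: LA_carrier)
   have "P ?b" by (rule insert.IH[OF _ b]) (use insert.prems in auto)
   moreover have "P (a p \<odot>\<^bsub>LA n\<^esub> ee n u v)" by (rule e[OF uv(1-3)])
   moreover have "a p \<odot>\<^bsub>LA n\<^esub> ee n u v \<in> carrier (LA n)" by (simp add: LA_scale_closed)
   ultimately have "P (?b \<oplus>\<^bsub>LA n\<^esub> (a p \<odot>\<^bsub>LA n\<^esub> ee n u v))"
    using b add by blast
   also have "?b \<oplus>\<^bsub>LA n\<^esub> (a p \<odot>\<^bsub>LA n\<^esub> ee n u v) = a"
    using uv by (auto simp: ee_def)
   finally show ?thesis .
  qed
 qed
 moreover have "finite {p. a p \<noteq> 0}"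
  using assms(1) by (auto simp: linear_path_algebra_def path_algebra_def)
 ultimately show ?thesis using assms(1) by blast
qed

section \<open>Modules over the path algebra as representations of the quiver\<close>

primrec vsum :: "('k, 'b) vs => (nat => 'b) => nat => 'b" where
 "vsum S f 0 = zer S"
| "vsum S f (Suc d) = pls S (vsum S f d) (f d)"

lemma vsum_cong: "(\<And>i. i < d ==> f i = g i) ==> vsum S f d = vsum S g d"
 by (induction d) auto

context vspace begin

lemma vsum_mem [simp]: "(\<And>i. f i \<in> car S) ==> vsum S f d \<in> car S"
 by (induction d) auto

lemma vsum_pls:
 assumes "\<And>i. f i \<in> car S" "\<And>i. g i \<in> car S"
 shows "vsum S (\<lambda>i. pls S (f i) (g i)) d = pls S (vsum S f d) (vsum S g d)"
 by (induction d) (simp_all add: assms pls_swap)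

lemma vsum_scl: "(\<And>i. f i \<in> car S) ==> vsum S (\<lambda>i. scl S c (f i)) d = scl S c (vsum S f d)"
 by (induction d) (auto simp: scl_pls)

lemma vsum_single:
 assumes "\<And>i. f i \<in> car S" "\<And>i. i \<noteq> j ==> f i = zer S" "j < d \<or> f j = zer S"
 shows "vsum S f d = f j"
proof -
 have "vsum S f d = (if j < d then f j else zer S)"
 proof (induction d)
  case (Suc d)
  then show ?case using assms(1) assms(2)[of d] by (cases "j = d") auto
 qed simp
 then show ?thesis using assms(3) by auto
qed

end

lemma lin_vsum:
 assumes "lin S S' \<phi>" "vspace S" "vspace S'" "\<And>i. f i \<in> car S"
 shows "\<phi> (vsum S f d) = vsum S' (\<lambda>i. \<phi> (f i)) d"
 by (induction d) (simp_all add: assms lin_zer[OF assms(1-3)] lin_pls[OF assms(1)] vspace.vsum_mem)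

definition Wh :: "nat => (nat list => 'k::field, 'b, 'm) module_scheme => ('k, 'b) vs" where
 "Wh n M = \<lparr>car = carrier M, pls = ring.add M, zer = \<zero>\<^bsub>M\<^esub>, scl = scalar_act (LA n) M\<rparr>"

text \<open>The component of a module at \<open>u\<close> is the image of the idempotent given by the trivial path at \<open>u\<close>,
 and the path from \<open>u\<close> to \<open>v\<close> acts as the transition map.\<close>

definition Sp :: "nat => (nat list => 'k::field, 'b, 'm) module_scheme => nat => ('k, 'b) vs" where
 "Sp n M u = (Wh n M)\<lparr>car := {x \<in> carrier M. ee n u u \<odot>\<^bsub>M\<^esub> x = x}\<rparr>"

definition Tr :: "nat => (nat list => 'k::field, 'b, 'm) module_scheme => nat => nat => 'b => 'b" where
 "Tr n M u v x = ee n u v \<odot>\<^bsub>M\<^esub> x"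

lemma Wh_simps [simp]:
 "car (Wh n M) = carrier M" "pls (Wh n M) = ring.add M" "zer (Wh n M) = \<zero>\<^bsub>M\<^esub>"
 "scl (Wh n M) = scalar_act (LA n) M"
 by (simp_all add: Wh_def)

lemma Sp_simps [simp]:
 "pls (Sp n M u) = ring.add M" "zer (Sp n M u) = \<zero>\<^bsub>M\<^esub>" "scl (Sp n M u) = scalar_act (LA n) M"
 by (simp_all add: Sp_def)

lemma Sp_car: "x \<in> car (Sp n M u) \<longleftrightarrow> x \<in> carrier M \<and> Tr n M u u x = x"
 by (simp add: Sp_def Tr_def)

locale LA_mod =
 fixes n :: nat and M :: "(nat list => 'k::field, 'b, 'm) module_scheme"
 assumes lm: "left_module (LA n) M"
begin

sublocale L: left_module "LA n" M
 by (rule lm)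

lemma smult_add: "[|a \<in> carrier (LA n); b \<in> carrier (LA n); x \<in> carrier M|] ==>
  (\<lambda>p. a p + b p) \<odot>\<^bsub>M\<^esub> x = a \<odot>\<^bsub>M\<^esub> x \<oplus>\<^bsub>M\<^esub> b \<odot>\<^bsub>M\<^esub> x"
 using L.smult_l_distr by simp

lemma smult_scale: "[|a \<in> carrier (LA n); x \<in> carrier M|] ==>
  (\<lambda>p. c * a p) \<odot>\<^bsub>M\<^esub> x = scalar_act (LA n) M c (a \<odot>\<^bsub>M\<^esub> x)"
 using L.smult_assoc[of "\<lambda>p. c * \<one>\<^bsub>LA n\<^esub> p" a x]
 by (simp add: scalar_act_def LA_scale_closed LA_one_closed LA_scale_mult LA_one_left)

lemma smult_scalar: "[|a \<in> carrier (LA n); x \<in> carrier M|] ==>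
  a \<odot>\<^bsub>M\<^esub> scalar_act (LA n) M c x = scalar_act (LA n) M c (a \<odot>\<^bsub>M\<^esub> x)"
 using L.smult_assoc[of a "\<lambda>p. c * \<one>\<^bsub>LA n\<^esub> p" x] smult_scale[of a x c]
 by (simp add: scalar_act_def LA_scale_closed LA_one_closed LA_mult_scale LA_one_right)

lemma scalar_one: "x \<in> carrier M ==> scalar_act (LA n) M 1 x = x"
 using L.smult_one by (simp add: scalar_act_def)

lemma scalar_mem: "x \<in> carrier M ==> scalar_act (LA n) M c x \<in> carrier M"
 by (simp add: scalar_act_def L.smult_closed LA_scale_closed LA_one_closed)

lemma smult_zero_right: "a \<in> carrier (LA n) ==> a \<odot>\<^bsub>M\<^esub> \<zero>\<^bsub>M\<^esub> = \<zero>\<^bsub>M\<^esub>"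
 using L.smult_r_distr[of a "\<zero>\<^bsub>M\<^esub>" "\<zero>\<^bsub>M\<^esub>"] L.smult_closed[of a "\<zero>\<^bsub>M\<^esub>"]
 by (metis L.M.add.l_cancel_one L.M.zero_closed L.M.r_zero)

lemma smult_zero_left: "x \<in> carrier M ==> (\<lambda>p. 0) \<odot>\<^bsub>M\<^esub> x = \<zero>\<^bsub>M\<^esub>"
proof -
 assume x: "x \<in> carrier M"
 have z: "(\<lambda>p. 0) \<in> carrier (LA n)" by (simp add: LA_carrier)
 then have "(\<lambda>p. 0) \<odot>\<^bsub>M\<^esub> x = (\<lambda>p. 0) \<odot>\<^bsub>M\<^esub> x \<oplus>\<^bsub>M\<^esub> (\<lambda>p. 0) \<odot>\<^bsub>M\<^esub> x"
  using smult_add[OF z z x] by simp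
 then show ?thesis using L.smult_closed[OF z x] by (metis L.M.add.l_cancel_one)
qed

lemma scalar_add_right: "[|x \<in> carrier M; y \<in> carrier M|] ==>
  scalar_act (LA n) M c (x \<oplus>\<^bsub>M\<^esub> y) = scalar_act (LA n) M c x \<oplus>\<^bsub>M\<^esub> scalar_act (LA n) M c y"
 by (simp add: scalar_act_def L.smult_r_distr LA_scale_closed LA_one_closed)

sublocale W: vspace "Wh n M"
proof
 fix a c d assume a: "a \<in> car (Wh n M)"
 then have a': "a \<in> carrier M" by simp
 have o: "\<one>\<^bsub>LA n\<^esub> \<in> carrier (LA n)" by (rule LA_one_closed)
 show "scl (Wh n M) 0 a = zer (Wh n M)" using a' smult_zero_left by (simp add: scalar_act_def)
 show "scl (Wh n M) (c + d) a = pls (Wh n M) (scl (Wh n M) c a) (scl (Wh n M) d a)"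
  using smult_add[of "\<lambda>p. c * \<one>\<^bsub>LA n\<^esub> p" "\<lambda>p. d * \<one>\<^bsub>LA n\<^esub> p" a] a' o
  by (simp add: scalar_act_def LA_scale_closed distrib_right)
 show "scl (Wh n M) c (scl (Wh n M) d a) = scl (Wh n M) (c * d) a"
  using smult_scale[of "\<lambda>p. d * \<one>\<^bsub>LA n\<^esub> p" a c] a' o
  by (simp add: scalar_act_def LA_scale_closed mult.assoc)
qed (auto simp: scalar_one scalar_mem L.M.a_assoc scalar_add_right intro: L.M.a_comm)

lemma lin_smult: "a \<in> carrier (LA n) ==> lin (Wh n M) (Wh n M) (\<lambda>x. a \<odot>\<^bsub>M\<^esub> x)"
 by (rule linI) (simp_all add: L.smult_closed L.smult_r_distr smult_scalar)

lemma lin_Tr: "lin (Wh n M) (Wh n M) (Tr n M u v)"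
 using lin_smult[OF ee_carrier] by (simp add: Tr_def[abs_def])

lemma Tr_mem [simp]: "x \<in> carrier M ==> Tr n M u v x \<in> carrier M"
 using lin_mem[OF lin_Tr] by simp

lemma Tr_pls: "[|x \<in> carrier M; y \<in> carrier M|] ==> Tr n M u v (x \<oplus>\<^bsub>M\<^esub> y) = Tr n M u v x \<oplus>\<^bsub>M\<^esub> Tr n M u v y"
 using lin_pls[OF lin_Tr] by simp

lemma Tr_scl: "x \<in> carrier M ==>
  Tr n M u v (scalar_act (LA n) M c x) = scalar_act (LA n) M c (Tr n M u v x)"
 using lin_scl[OF lin_Tr] by simp

lemma Tr_zero [simp]: "Tr n M u v \<zero>\<^bsub>M\<^esub> = \<zero>\<^bsub>M\<^esub>"
 using lin_zer[OF lin_Tr] W.vspace_axioms by simp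

lemma Sp_vspace: "vspace (Sp n M u)"
 unfolding Sp_def
 by (rule W.subspace) (auto simp: Tr_scl[unfolded Tr_def] Tr_zero[unfolded Tr_def]
  L.smult_r_distr scalar_mem)

lemma Tr_Tr: "[|u \<le> v; v \<le> w; x \<in> carrier M|] ==> Tr n M v w (Tr n M u v x) = Tr n M u w x"
 using L.smult_assoc[of "ee n v w" "ee n u v" x] by (simp add: Tr_def ee_mult)

lemma Tr_Tr_0: "[|v \<noteq> v'; x \<in> carrier M|] ==> Tr n M v w (Tr n M u v' x) = \<zero>\<^bsub>M\<^esub>"
 using L.smult_assoc[of "ee n v w" "ee n u v'" x] smult_zero_left[of x]
 by (simp add: Tr_def ee_mult_0)

lemma Tr_outside: "[|\<not> (1 \<le> u \<and> u \<le> v \<and> v < n); x \<in> carrier M|] ==> Tr n M u v x = \<zero>\<^bsub>M\<^esub>"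
 unfolding Tr_def by (subst ee_zero) (auto simp: smult_zero_left)

lemma Tr_Sp: "x \<in> carrier M ==> Tr n M u v x \<in> car (Sp n M v)"
proof (cases "u \<le> v")
 case False
 then have "\<not> (1 \<le> u \<and> u \<le> v \<and> v < n)" by simp
 then show "x \<in> carrier M ==> Tr n M u v x \<in> car (Sp n M v)"
  by (simp add: Tr_outside Sp_car del: One_nat_def)
qed (simp add: Sp_car Tr_Tr)

lemma Sp_carrier: "x \<in> car (Sp n M u) ==> x \<in> carrier M"
 by (simp add: Sp_car)

lemma Tr_id: "x \<in> car (Sp n M u) ==> Tr n M u u x = x"
 by (simp add: Sp_car)

lemma Tr_Sp_0: "[|x \<in> car (Sp n M w); w \<noteq> u|] ==> Tr n M u v x = \<zero>\<^bsub>M\<^esub>"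
 using Tr_Tr_0[of u w x v w] by (metis Sp_car)

lemma lin_Tr_Sp: "lin (Sp n M u) (Sp n M v) (Tr n M u v)"
 by (rule linI) (auto simp: Tr_Sp Tr_pls Tr_scl Sp_carrier)

lemma Sp_outside: "\<not> (1 \<le> u \<and> u < n) ==> car (Sp n M u) = {\<zero>\<^bsub>M\<^esub>}"
 using Tr_outside[of u u] by (force simp: Sp_car)

lemma Sp_zero [simp]: "\<zero>\<^bsub>M\<^esub> \<in> car (Sp n M u)"
 by (simp add: Sp_car)

text \<open>The trivial paths are orthogonal idempotents with sum one.\<close>

lemma vsum_components: "x \<in> carrier M ==> vsum (Wh n M) (\<lambda>u. Tr n M u u x) n = x"
proof -
 assume x: "x \<in> carrier M"
 have c: "(\<lambda>p. \<Sum>u<d. ee n u u p :: 'k) \<in> carrier (LA n)" for d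
  by (induction d) (auto simp: LA_add_closed, simp add: LA_carrier)
 have v: "vsum (Wh n M) (\<lambda>u. Tr n M u u x) d = (\<lambda>p. \<Sum>u<d. ee n u u p) \<odot>\<^bsub>M\<^esub> x" for d
  by (induction d) (simp_all add: smult_zero_left x smult_add c Tr_def)
 have "(\<lambda>p. \<Sum>u<n. ee n u u p :: 'k) = \<one>\<^bsub>LA n\<^esub>"
 proof (rule LA_eqI[OF c LA_one_closed])
  fix u v :: nat assume uv: "1 \<le> u" "u \<le> v" "v < n"
  then have "(\<Sum>w<n. ee n w w [u..<Suc v] :: 'k) = (\<Sum>w<n. if w = u then if u = v then 1 else 0 else 0)"
   by (intro sum.cong) (auto simp: ee_cf)
  then show "(\<Sum>w<n. ee n w w [u..<Suc v] :: 'k) = \<one>\<^bsub>LA n\<^esub> [u..<Suc v]"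
   using uv by (simp add: LA_one_cf)
 qed
 then show ?thesis unfolding v by (simp only: L.smult_one[OF x])
qed

lemma eq_if_components_eq:
 assumes "x \<in> carrier M" "y \<in> carrier M" "\<And>u. Tr n M u u x = Tr n M u u y"
 shows "x = y"
proof -
 have "x = vsum (Wh n M) (\<lambda>u. Tr n M u u x) n" by (rule vsum_components[OF assms(1), symmetric])
 also have "\<dots> = vsum (Wh n M) (\<lambda>u. Tr n M u u y) n" using assms(3) by (intro vsum_cong)
 also have "\<dots> = y" by (rule vsum_components[OF assms(2)])
 finally show ?thesis .
qed

lemma trivial_iff: "carrier M = {\<zero>\<^bsub>M\<^esub>} \<longleftrightarrow> (\<forall>u. car (Sp n M u) = {\<zero>\<^bsub>M\<^esub>})"
proof
 assume r: "\<forall>u. car (Sp n M u) = {\<zero>\<^bsub>M\<^esub>}"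
 have "x = \<zero>\<^bsub>M\<^esub>" if "x \<in> carrier M" for x
  by (rule eq_if_components_eq) (use r Tr_Sp[OF that] that in auto)
 then show "carrier M = {\<zero>\<^bsub>M\<^esub>}" by auto
qed (use Sp_carrier in force)

end

locale LA_mod2 = M: LA_mod n M + N: LA_mod n N
 for n :: nat and M :: "(nat list => 'k::field, 'b, 'm) module_scheme"
  and N :: "(nat list => 'k::field, 'c, 'l) module_scheme"
begin

lemma mod_hom_lin: "f \<in> mod_hom (LA n) M N ==> lin (Wh n M) (Wh n N) f"
 by (rule linI) (auto simp: mod_hom_def scalar_act_def LA_scale_closed LA_one_closed)

lemma mod_hom_Tr: "[|f \<in> mod_hom (LA n) M N; x \<in> carrier M|] ==> f (Tr n M u v x) = Tr n N u v (f x)"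
 by (auto simp: mod_hom_def Tr_def)

lemma mod_hom_mem: "[|f \<in> mod_hom (LA n) M N; x \<in> carrier M|] ==> f x \<in> carrier N"
 by (auto simp: mod_hom_def)

lemma mod_hom_lin_Sp: "f \<in> mod_hom (LA n) M N ==> lin (Sp n M u) (Sp n N u) f"
proof (rule linI)
 assume f: "f \<in> mod_hom (LA n) M N"
 note l = mod_hom_lin[OF f]
 fix a b c assume a: "a \<in> car (Sp n M u)"
 show "f a \<in> car (Sp n N u)"
  using a mod_hom_Tr[OF f, of a u u] lin_mem[OF l, of a] by (simp add: Sp_car)
 show "f (scl (Sp n M u) c a) = scl (Sp n N u) c (f a)"
  using a lin_scl[OF l, of a] by (simp add: Sp_car)
 assume "b \<in> car (Sp n M u)"
 then show "f (pls (Sp n M u) a b) = pls (Sp n N u) (f a) (f b)"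
  using a lin_pls[OF l, of a b] by (simp add: Sp_car)
qed

lemma mod_hom_eqI:
 assumes f: "f \<in> mod_hom (LA n) M N" and g: "g \<in> mod_hom (LA n) M N"
  and "\<And>u x. x \<in> car (Sp n M u) ==> f x = g x" and x: "x \<in> carrier M"
 shows "f x = g x"
proof (rule N.eq_if_components_eq)
 fix u
 have "f (Tr n M u u x) = g (Tr n M u u x)" using assms(3) M.Tr_Sp x by blast
 then show "Tr n N u u (f x) = Tr n N u u (g x)" using mod_hom_Tr[OF f x] mod_hom_Tr[OF g x] by simp
qed (use assms mod_hom_mem in auto)

lemma mod_hom_eqI':
 assumes "f \<in> mod_hom (LA n) M N" "g \<in> mod_hom (LA n) M N"
  and "\<And>u x. x \<in> car (Sp n M u) ==> f x = g x"
 shows "f = g"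
proof (rule PiE_ext)
 show "f \<in> carrier M \<rightarrow>\<^sub>E carrier N" "g \<in> carrier M \<rightarrow>\<^sub>E carrier N"
  using assms(1,2) by (simp_all add: mod_hom_def)
qed (rule mod_hom_eqI[OF assms])

text \<open>The linear maps between the components that commute with the arrows are the components of a
 homomorphism.\<close>

lemma assemble:
 assumes \<phi>: "\<And>u. lin (Sp n M u) (Sp n N u) (\<phi> u)"
  and T: "\<And>u v x. [|u \<le> v; x \<in> car (Sp n M u)|] ==> \<phi> v (Tr n M u v x) = Tr n N u v (\<phi> u x)"
 shows "\<exists>f\<in>mod_hom (LA n) M N. \<forall>u. \<forall>x\<in>car (Sp n M u). f x = \<phi> u x"
proof -
 define F where "F x = vsum (Wh n N) (\<lambda>u. \<phi> u (Tr n M u u x)) n" for x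
 have m: "\<phi> u (Tr n M u u x) \<in> carrier N" if "x \<in> carrier M" for u x
  using lin_mem[OF \<phi> M.Tr_Sp[OF that]] N.Sp_carrier by blast
 have z: "\<phi> u \<zero>\<^bsub>M\<^esub> = \<zero>\<^bsub>N\<^esub>" for u
  using lin_zer[OF \<phi> M.Sp_vspace N.Sp_vspace] by simp
 have Fm: "F x \<in> carrier N" if "x \<in> carrier M" for x
  using N.W.vsum_mem[of "\<lambda>u. \<phi> u (Tr n M u u x)"] m that by (simp add: F_def)
 have Fp: "F (x \<oplus>\<^bsub>M\<^esub> y) = F x \<oplus>\<^bsub>N\<^esub> F y" if "x \<in> carrier M" "y \<in> carrier M" for x y
 proof -
  have "\<phi> u (Tr n M u u (x \<oplus>\<^bsub>M\<^esub> y)) = \<phi> u (Tr n M u u x) \<oplus>\<^bsub>N\<^esub> \<phi> u (Tr n M u u y)" for u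
   using that lin_pls[OF \<phi>[of u] M.Tr_Sp[OF that(1), of u u] M.Tr_Sp[OF that(2), of u u]] by (simp add: M.Tr_pls)
  then show ?thesis
   using N.W.vsum_pls[of "\<lambda>u. \<phi> u (Tr n M u u x)" "\<lambda>u. \<phi> u (Tr n M u u y)"] m that
   by (simp add: F_def)
 qed
 have Fs: "F (scalar_act (LA n) M c x) = scalar_act (LA n) N c (F x)" if "x \<in> carrier M" for c x
 proof -
  have "\<phi> u (Tr n M u u (scalar_act (LA n) M c x)) = scalar_act (LA n) N c (\<phi> u (Tr n M u u x))" for u
   using that lin_scl[OF \<phi>[of u] M.Tr_Sp[OF that, of u u], of c] by (simp add: M.Tr_scl)
  then show ?thesis
   using N.W.vsum_scl[of "\<lambda>u. \<phi> u (Tr n M u u x)"] m that by (simp add: F_def)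
 qed
 have Fc: "F x = \<phi> u x" if x: "x \<in> car (Sp n M u)" for u x
 proof -
  have "F x = \<phi> u (Tr n M u u x)"
   unfolding F_def
  proof (rule N.W.vsum_single)
   show "u < n \<or> \<phi> u (Tr n M u u x) = zer (Wh n N)"
    using M.Tr_outside[of u u x] z M.Sp_carrier[OF x] by (cases "u < n") auto
  qed (use m M.Sp_carrier[OF x] M.Tr_Sp_0[OF x] z in auto)
  then show ?thesis using x by (simp add: M.Tr_id)
 qed
 have Fe: "F (Tr n M u v x) = Tr n N u v (F x)" if x: "x \<in> carrier M" for u v x
 proof (cases "u \<le> v")
  case True
  have "F (Tr n M u v x) = \<phi> v (Tr n M u v x)" using M.Tr_Sp[OF x] by (rule Fc)
  also have "\<dots> = \<phi> v (Tr n M u v (Tr n M u u x))" using M.Tr_Tr[of u u v x] x True by simp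
  also have "\<dots> = Tr n N u v (\<phi> u (Tr n M u u x))" using T[OF True M.Tr_Sp[OF x]] .
  also have "\<dots> = vsum (Wh n N) (\<lambda>w. Tr n N u v (\<phi> w (Tr n M w w x))) n"
  proof (rule N.W.vsum_single[symmetric])
   show "Tr n N u v (\<phi> w (Tr n M w w x)) = zer (Wh n N)" if "w \<noteq> u" for w
    using N.Tr_Sp_0[of _ w u v] lin_mem[OF \<phi> M.Tr_Sp[OF x]] that by simp
   show "u < n \<or> Tr n N u v (\<phi> u (Tr n M u u x)) = zer (Wh n N)"
    using M.Tr_outside[of u u x] z x by (cases "u < n") auto
  qed (use m x in auto)
  also have "\<dots> = Tr n N u v (F x)"
   unfolding F_def using m x by (intro lin_vsum[OF N.lin_Tr, symmetric]) (auto intro: N.W.vspace_axioms)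
  finally show ?thesis .
 next
  case False
  then have "Tr n M u v x = \<zero>\<^bsub>M\<^esub>" "Tr n N u v (F x) = \<zero>\<^bsub>N\<^esub>"
   using M.Tr_outside[of u v x] N.Tr_outside[of u v "F x"] x Fm by auto
  then show ?thesis using Fc[of "\<zero>\<^bsub>M\<^esub>" u] z by simp
 qed
 have Fa: "F (a \<odot>\<^bsub>M\<^esub> x) = a \<odot>\<^bsub>N\<^esub> F x" if a: "a \<in> carrier (LA n)" and x: "x \<in> carrier M" for a x
  using a
 proof (induction a rule: LA_induct)
  case zero
  then show ?case using Fc[of "\<zero>\<^bsub>M\<^esub>" 0] z x Fm[OF x] by (simp add: M.smult_zero_left N.smult_zero_left)
 next
  case (path u v c)
  have "F (scalar_act (LA n) M c (ee n u v \<odot>\<^bsub>M\<^esub> x)) = scalar_act (LA n) N c (ee n u v \<odot>\<^bsub>N\<^esub> F x)"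
   using Fs[of "Tr n M u v x" c] Fe[OF x, of u v] M.Tr_mem[OF x] by (simp add: Tr_def)
  then show ?case using x Fm[OF x] by (simp add: M.smult_scale N.smult_scale)
 next
  case (add a b)
  then show ?case using x Fm[OF x] Fp[of "a \<odot>\<^bsub>M\<^esub> x" "b \<odot>\<^bsub>M\<^esub> x"]
   by (simp add: M.smult_add N.smult_add M.L.smult_closed)
 qed
 have "restrict F (carrier M) \<in> mod_hom (LA n) M N"
  using Fm Fp Fa by (auto simp: mod_hom_def M.L.smult_closed)
 moreover have "\<forall>u. \<forall>x\<in>car (Sp n M u). restrict F (carrier M) x = \<phi> u x"
  using Fc M.Sp_carrier by auto
 ultimately show ?thesis by blast
qed

lemma mod_hom_image:
 assumes f: "f \<in> mod_hom (LA n) M N" and y: "y \<in> carrier N"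
  and c: "\<And>u. Tr n N u u y \<in> f ` car (Sp n M u)"
 shows "y \<in> f ` carrier M"
proof -
 note l = mod_hom_lin[OF f]
 obtain x where x: "\<And>u. x u \<in> car (Sp n M u)" "\<And>u. Tr n N u u y = f (x u)" using c unfolding image_iff by metis
 have xc: "x u \<in> car (Wh n M)" for u using x(1)[of u] M.Sp_carrier by simp
 have "f (vsum (Wh n M) x n) = y"
  using lin_vsum[OF l M.W.vspace_axioms N.W.vspace_axioms xc] N.vsum_components[OF y] by (simp add: x(2))
 then show ?thesis using M.W.vsum_mem[of x] xc by auto
qed

lemma mod_hom_ker:
 assumes f: "f \<in> mod_hom (LA n) M N" and x: "x \<in> carrier M"
  and c: "\<And>u. f (Tr n M u u x) = \<zero>\<^bsub>N\<^esub>"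
 shows "f x = \<zero>\<^bsub>N\<^esub>"
 using c mod_hom_Tr[OF f x] N.eq_if_components_eq[OF mod_hom_mem[OF f x], of "\<zero>\<^bsub>N\<^esub>"] by simp

text \<open>A homomorphism is the direct sum of its restrictions to the components.\<close>

lemma mod_hom_bij_iff:
 assumes f: "f \<in> mod_hom (LA n) M N"
 shows "bij_betw f (carrier M) (carrier N) \<longleftrightarrow> (\<forall>u. bij_betw f (car (Sp n M u)) (car (Sp n N u)))"
proof
 assume b: "bij_betw f (carrier M) (carrier N)"
 show "\<forall>u. bij_betw f (car (Sp n M u)) (car (Sp n N u))"
 proof
  fix u
  have "inj_on f (car (Sp n M u))"
   using b M.Sp_carrier by (auto simp: bij_betw_def intro: inj_on_subset)
  moreover have "y \<in> f ` car (Sp n M u)" if y: "y \<in> car (Sp n N u)" for y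
  proof -
   obtain x where x: "x \<in> carrier M" "y = f x"
    using b N.Sp_carrier[OF y] by (auto simp: bij_betw_def)
   then have "y = f (Tr n M u u x)" using y mod_hom_Tr[OF f x(1)] by (simp add: Sp_car)
   then show ?thesis using M.Tr_Sp[OF x(1)] by blast
  qed
  ultimately show "bij_betw f (car (Sp n M u)) (car (Sp n N u))"
   using lin_mem[OF mod_hom_lin_Sp[OF f]] by (auto simp: bij_betw_def)
 qed
next
 assume b: "\<forall>u. bij_betw f (car (Sp n M u)) (car (Sp n N u))"
 note l = mod_hom_lin[OF f]
 have "inj_on f (car (Wh n M))"
 proof (rule lin_inj[OF l M.W.vspace_axioms N.W.vspace_axioms])
  fix x assume "x \<in> car (Wh n M)" and fx: "f x = zer (Wh n N)"
  then have x: "x \<in> carrier M" by simp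
  have "Tr n M u u x = \<zero>\<^bsub>M\<^esub>" for u
  proof -
   have "f (Tr n M u u x) = \<zero>\<^bsub>N\<^esub>" using mod_hom_Tr[OF f x, of u u] fx by simp
   also have "\<dots> = f \<zero>\<^bsub>M\<^esub>" using lin_zer[OF l M.W.vspace_axioms N.W.vspace_axioms] by simp
   finally show ?thesis
    using b M.Tr_Sp[OF x, of u u] by (intro inj_onD[of f "car (Sp n M u)"]) (auto simp: bij_betw_def)
  qed
  then have "x = \<zero>\<^bsub>M\<^esub>" using x M.eq_if_components_eq[of x "\<zero>\<^bsub>M\<^esub>"] by simp
  then show "x = zer (Wh n M)" by simp
 qed
 moreover have "y \<in> f ` carrier M" if y: "y \<in> carrier N" for y
  by (rule mod_hom_image[OF f y]) (use b N.Tr_Sp[OF y] in \<open>simp add: bij_betw_def\<close>)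
 ultimately show "bij_betw f (carrier M) (carrier N)"
  using mod_hom_mem[OF f] by (auto simp: bij_betw_def)
qed

end

text \<open>A spanning set of a module is mapped by the projection to a component to a spanning set.\<close>

lemma (in LA_mod) vdim_Sp:
 assumes "fin_dim (LA n) M"
 shows "\<exists>d. vdim (Sp n M u) d"
proof -
 obtain B where B: "finite B" "B \<subseteq> carrier M"
   "\<And>x. x \<in> carrier M ==> \<exists>c. x = (\<Oplus>\<^bsub>M\<^esub>b\<in>B. scalar_act (LA n) M (c b) b)"
  using assms unfolding fin_dim_def by blast
 let ?W = "\<lambda>B. {Tr n M u u (\<Oplus>\<^bsub>M\<^esub>b\<in>B. scalar_act (LA n) M (c b) b) | c. True}"
 interpret S: vspace "Sp n M u" by (rule Sp_vspace)
 have "?W B \<subseteq> car (Sp n M u) \<and> vspace (Sp n M u\<lparr>car := ?W B\<rparr>) \<and> (\<exists>d. vdim (Sp n M u\<lparr>car := ?W B\<rparr>) d)"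
  using B(1,2)
 proof (induction B)
  case empty
  have "?W {} = {\<zero>\<^bsub>M\<^esub>}" by simp
  moreover have "vspace (Sp n M u\<lparr>car := {\<zero>\<^bsub>M\<^esub>}\<rparr>)"
   by (rule S.subspace) (use S.scl_zer in auto)
  ultimately show ?case using vdim_0_iff[of "Sp n M u\<lparr>car := {\<zero>\<^bsub>M\<^esub>}\<rparr>"] by auto
 next
  case (insert b B)
  let ?b = "Tr n M u u b"
  have b: "b \<in> carrier M" "B \<subseteq> carrier M" using insert.prems by auto
  have fm: "(\<lambda>b. scalar_act (LA n) M (c b) b) \<in> B \<rightarrow> carrier M" for c
   using b scalar_mem by auto
  have s: "Tr n M u u (\<Oplus>\<^bsub>M\<^esub>b\<in>insert b B. scalar_act (LA n) M (c b) b) =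
    Tr n M u u (\<Oplus>\<^bsub>M\<^esub>b\<in>B. scalar_act (LA n) M (c b) b) \<oplus>\<^bsub>M\<^esub> scalar_act (LA n) M (c b) ?b" for c
   using insert.hyps b fm[of c]
   by (simp add: L.M.finsum_insert scalar_mem Tr_pls Tr_scl L.M.finsum_closed L.M.a_comm)
  have eq: "?W (insert b B) = {pls (Sp n M u) w (scl (Sp n M u) c ?b) | w c. w \<in> ?W B}"
  proof (intro equalityI subsetI)
   fix y assume "y \<in> ?W (insert b B)"
   then show "y \<in> {pls (Sp n M u) w (scl (Sp n M u) c ?b) | w c. w \<in> ?W B}"
    unfolding s by auto
  next
   fix y assume "y \<in> {pls (Sp n M u) w (scl (Sp n M u) c ?b) | w c. w \<in> ?W B}"
   then obtain c k where y: "y = Tr n M u u (\<Oplus>\<^bsub>M\<^esub>b\<in>B. scalar_act (LA n) M (c b) b) \<oplus>\<^bsub>M\<^esub>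
     scalar_act (LA n) M k ?b" by auto
   have "(\<Oplus>\<^bsub>M\<^esub>b\<in>B. scalar_act (LA n) M (c b) b) = (\<Oplus>\<^bsub>M\<^esub>b'\<in>B. scalar_act (LA n) M ((c(b := k)) b') b')"
    using fm[of "c(b := k)"] insert.hyps(2) by (intro L.M.finsum_cong') auto
   then have "y = Tr n M u u (\<Oplus>\<^bsub>M\<^esub>b'\<in>insert b B. scalar_act (LA n) M ((c(b := k)) b') b')"
    unfolding s y by simp
   then show "y \<in> ?W (insert b B)" by blast
  qed
  have IH: "?W B \<subseteq> car (Sp n M u)" "vspace (Sp n M u\<lparr>car := ?W B\<rparr>)"
    "\<exists>d. vdim (Sp n M u\<lparr>car := ?W B\<rparr>) d"
   using insert.IH b by auto
  have bS: "?b \<in> car (Sp n M u)" by (rule Tr_Sp[OF b(1)])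
  interpret W: vspace "Sp n M u\<lparr>car := ?W B\<rparr>" by (rule IH(2))
  have "?W (insert b B) \<subseteq> car (Sp n M u)"
   unfolding eq using IH(1) by (blast intro: S.pls_mem S.scl_mem[OF bS])
  moreover have "vspace (Sp n M u\<lparr>car := ?W (insert b B)\<rparr>)"
  proof (rule S.subspace)
   show "?W (insert b B) \<subseteq> car (Sp n M u)" by fact
   have "zer (Sp n M u) = pls (Sp n M u) (zer (Sp n M u)) (scl (Sp n M u) 0 ?b)"
    using S.scl_0[OF bS] S.pls_zer[OF S.zer_mem] by simp
   then show "zer (Sp n M u) \<in> ?W (insert b B)" unfolding eq using W.zer_mem by auto
  next
   fix x y assume "x \<in> ?W (insert b B)" "y \<in> ?W (insert b B)"
   then obtain w c w' c' where w: "x = pls (Sp n M u) w (scl (Sp n M u) c ?b)" "w \<in> ?W B"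
     "y = pls (Sp n M u) w' (scl (Sp n M u) c' ?b)" "w' \<in> ?W B" unfolding eq by blast
   then have wS: "w \<in> car (Sp n M u)" "w' \<in> car (Sp n M u)" using IH(1) by blast+
   have "pls (Sp n M u) x y = pls (Sp n M u) (pls (Sp n M u) w w') (scl (Sp n M u) (c + c') ?b)"
    unfolding w(1,3) S.scl_add[OF bS] using wS S.scl_mem[OF bS] by (intro S.pls_swap)
   moreover have "pls (Sp n M u) w w' \<in> ?W B" using W.pls_mem[of w w'] w by simp
   ultimately show "pls (Sp n M u) x y \<in> ?W (insert b B)" unfolding eq by blast
  next
   fix x c assume "x \<in> ?W (insert b B)"
   then obtain w c' where w: "x = pls (Sp n M u) w (scl (Sp n M u) c' ?b)" "w \<in> ?W B"
    unfolding eq by blast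
   then have wS: "w \<in> car (Sp n M u)" using IH(1) by blast
   have "scl (Sp n M u) c x = pls (Sp n M u) (scl (Sp n M u) c w) (scl (Sp n M u) (c * c') ?b)"
    unfolding w(1) using S.scl_pls[OF wS S.scl_mem[OF bS]] S.scl_scl[OF bS] by simp
   moreover have "scl (Sp n M u) c w \<in> ?W B" using W.scl_mem[of w c] w by simp
   ultimately show "scl (Sp n M u) c x \<in> ?W (insert b B)" unfolding eq by blast
  qed
  moreover have "\<exists>d. vdim (Sp n M u\<lparr>car := ?W (insert b B)\<rparr>) d"
  proof -
   obtain d where "vdim (Sp n M u\<lparr>car := ?W B\<rparr>) d" using IH(3) by blast
   from S.vdim_extend[OF IH(1) this bS eq IH(2)] show ?thesis .
  qed
  ultimately show ?case by blast
 qed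
 moreover have "?W B = car (Sp n M u)"
 proof (intro equalityI subsetI)
  fix x assume x: "x \<in> car (Sp n M u)"
  obtain c where "x = (\<Oplus>\<^bsub>M\<^esub>b\<in>B. scalar_act (LA n) M (c b) b)" using B(3) Sp_carrier[OF x] by blast
  then have "x = Tr n M u u (\<Oplus>\<^bsub>M\<^esub>b\<in>B. scalar_act (LA n) M (c b) b)" using Tr_id[OF x] by simp
  then show "x \<in> ?W B" by blast
 qed (use calculation in blast)
 ultimately have "\<exists>d. vdim (Sp n M u\<lparr>car := car (Sp n M u)\<rparr>) d" by simp
 then show ?thesis by simp
qed

section \<open>Realizing representations as modules\<close>

text \<open>Representations of the quiver in spaces over any type. The transition maps along all paths are part
 of the data.\<close>

locale qrep =
 fixes n :: nat and W :: "nat => ('k::field, 'b) vs" and T :: "nat => nat => 'b => 'b"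
 assumes W_vspace: "[|1 \<le> u; u < n|] ==> vspace (W u)"
  and T_lin: "[|1 \<le> u; u \<le> v; v < n|] ==> lin (W u) (W v) (T u v)"
  and T_id: "[|1 \<le> u; u < n; x \<in> car (W u)|] ==> T u u x = x"
  and T_T: "[|1 \<le> u; u \<le> v; v \<le> w; w < n; x \<in> car (W u)|] ==> T v w (T u v x) = T u w x"
  and W_fd: "[|1 \<le> u; u < n|] ==> \<exists>d. vdim (W u) d"
begin

definition bs where "bs = (SOME bd. \<forall>u. 1 \<le> u \<and> u < n --> basis (W u) (fst (bd u)) (snd (bd u)))"

abbreviation "b u \<equiv> fst (bs u)"
abbreviation "d u \<equiv> snd (bs u)"

lemma basis_b: "[|1 \<le> u; u < n|] ==> basis (W u) (b u) (d u)"
proof -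
 have "\<exists>bd. 1 \<le> u \<and> u < n --> basis (W u) (fst bd) (snd bd)" for u
  using W_fd[of u] unfolding vdim_def by auto
 then have "\<exists>bd. \<forall>u. 1 \<le> u \<and> u < n --> basis (W u) (fst (bd u)) (snd (bd u))"
  by (intro choice) auto
 from someI_ex[OF this] show "[|1 \<le> u; u < n|] ==> basis (W u) (b u) (d u)" by (simp add: bs_def)
qed

definition emb :: "nat => (nat => 'k) => 'b" where
 "emb u c = lc (W u) (b u) (d u) c"

text \<open>Coordinates are cut off at the dimension, which makes them unique.\<close>

definition co :: "nat => 'b => nat => 'k" where
 "co u w = (SOME c. emb u c = w \<and> (\<forall>i\<ge>d u. c i = 0))"

definition tau :: "nat => nat => (nat => 'k) => nat => 'k" where
 "tau u v c = co v (T u v (emb u c))"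

lemma b_mem: "[|1 \<le> u; u < n|] ==> \<forall>i<d u. b u i \<in> car (W u)"
 using basis_b by (auto simp: basis_def)

lemma emb_mem: "[|1 \<le> u; u < n|] ==> emb u c \<in> car (W u)"
 unfolding emb_def by (rule vspace.lc_mem[OF W_vspace b_mem])

lemma emb_add: "[|1 \<le> u; u < n|] ==> emb u (\<lambda>i. c i + e i) = pls (W u) (emb u c) (emb u e)"
 unfolding emb_def by (rule vspace.lc_add[OF W_vspace b_mem])

lemma emb_scl: "[|1 \<le> u; u < n|] ==> emb u (\<lambda>i. k * c i) = scl (W u) k (emb u c)"
 unfolding emb_def by (rule vspace.lc_scl[OF W_vspace b_mem])

lemma co_ex: "[|1 \<le> u; u < n; w \<in> car (W u)|] ==> \<exists>c. emb u c = w \<and> (\<forall>i\<ge>d u. c i = 0)"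
proof -
 assume u: "1 \<le> u" "u < n" and "w \<in> car (W u)"
 then obtain c where c: "w = emb u c" using basis_b[OF u] by (auto simp: basis_def emb_def)
 have "emb u (\<lambda>i. if i < d u then c i else 0) = emb u c"
  unfolding emb_def by (rule lc_cong) auto
 then show ?thesis using c by (intro exI[of _ "\<lambda>i. if i < d u then c i else 0"]) auto
qed

lemma emb_co: "[|1 \<le> u; u < n; w \<in> car (W u)|] ==> emb u (co u w) = w"
 and co_zero: "[|1 \<le> u; u < n; w \<in> car (W u); i \<ge> d u|] ==> co u w i = 0"
 using someI_ex[OF co_ex] unfolding co_def by blast+

lemma emb_inj:
 assumes u: "1 \<le> u" "u < n" and e: "emb u c = emb u e" and "\<forall>i\<ge>d u. c i = 0" "\<forall>i\<ge>d u. e i = 0"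
 shows "c = e"
proof
 fix i
 interpret vspace "W u" by (rule W_vspace[OF u])
 have "emb u (\<lambda>i. c i + -1 * e i) = zer (W u)"
  using emb_add[OF u, of c "\<lambda>i. -1 * e i"] emb_scl[OF u, of "-1" e] e emb_mem[OF u, of e] by simp
 then have "\<forall>i<d u. c i + -1 * e i = 0" using basis_b[OF u] unfolding basis_def emb_def by blast
 then show "c i = e i" using assms(4,5) by (cases "i < d u") auto
qed

lemma co_emb: "[|1 \<le> u; u < n; \<forall>i\<ge>d u. c i = 0|] ==> co u (emb u c) = c"
 by (rule emb_inj[of u]) (auto simp: emb_co emb_mem co_zero)

lemma co_add: "[|1 \<le> u; u < n; x \<in> car (W u); y \<in> car (W u)|] ==>
  co u (pls (W u) x y) = (\<lambda>i. co u x i + co u y i)"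
 by (rule emb_inj[of u])
  (auto simp: emb_co emb_add co_zero vspace.pls_mem[OF W_vspace])

lemma co_scl: "[|1 \<le> u; u < n; x \<in> car (W u)|] ==> co u (scl (W u) k x) = (\<lambda>i. k * co u x i)"
 by (rule emb_inj[of u])
  (auto simp: emb_co emb_scl co_zero vspace.scl_mem[OF W_vspace])

lemma T_emb_mem: "[|1 \<le> u; u \<le> v; v < n|] ==> T u v (emb u c) \<in> car (W v)"
 using lin_mem[OF T_lin] emb_mem by simp

lemma tau_add: "[|1 \<le> u; u \<le> v; v < n|] ==> tau u v (\<lambda>i. c i + e i) = (\<lambda>i. tau u v c i + tau u v e i)"
 unfolding tau_def using lin_pls[OF T_lin[of u v] emb_mem emb_mem, of c e]
 by (simp add: emb_add co_add T_emb_mem)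

lemma tau_scl: "[|1 \<le> u; u \<le> v; v < n|] ==> tau u v (\<lambda>i. k * c i) = (\<lambda>i. k * tau u v c i)"
 unfolding tau_def using lin_scl[OF T_lin[of u v] emb_mem, of k c]
 by (simp add: emb_scl co_scl T_emb_mem)

lemma tau_sum:
 assumes uv: "1 \<le> u" "u \<le> v" "v < n" and "finite X"
 shows "tau u v (\<lambda>i. \<Sum>x\<in>X. k x * c x i) j = (\<Sum>x\<in>X. k x * tau u v (c x) j)"
 using assms(4)
proof (induction X rule: finite_induct)
 case empty
 then show ?case using tau_scl[OF uv, of 0 "\<lambda>_. 0"] by (simp add: fun_eq_iff)
next
 case (insert x X)
 then show ?case
  using tau_add[OF uv, of "\<lambda>i. k x * c x i" "\<lambda>i. \<Sum>x\<in>X. k x * c x i"] tau_scl[OF uv, of "k x" "c x"]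
  by (simp add: fun_eq_iff)
qed

lemma tau_zero: "[|1 \<le> u; u \<le> v; v < n; i \<ge> d v|] ==> tau u v c i = 0"
 unfolding tau_def by (rule co_zero) (auto simp: T_emb_mem)

lemma tau_tau: "[|1 \<le> u; u \<le> v; v \<le> w; w < n|] ==> tau v w (tau u v c) = tau u w c"
 unfolding tau_def by (simp add: emb_co T_emb_mem T_T emb_mem)

lemma tau_id: "[|1 \<le> u; u < n; \<forall>i\<ge>d u. c i = 0|] ==> tau u u c = c"
 unfolding tau_def by (simp add: T_id emb_mem co_emb)

text \<open>Elements of the realizing module have to be functions on the natural numbers. A pair of a vertex and
 the number of a basis vector is coded as one number, so such a function carries the coordinates of
 all components.\<close>

definition sl :: "nat => (nat => 'k) => nat => 'k" where
 "sl u \<phi> = (\<lambda>i. \<phi> (prod_encode (u, i)))"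

definition J :: "nat set" where
 "J = {prod_encode (u, i) | u i. 1 \<le> u \<and> u < n \<and> i < d u}"

definition join :: "(nat => nat => 'k) => nat => 'k" where
 "join C = (\<lambda>j. C (fst (prod_decode j)) (snd (prod_decode j)))"

text \<open>An algebra element acts on coordinate vectors by the matrices of the transition maps, weighted with
 its coefficients.\<close>

definition realmod :: "'k amod" where
 "realmod = \<lparr>carrier = {\<phi>. \<forall>j. j \<notin> J --> \<phi> j = 0}, monoid.mult = undefined, monoid.one = undefined,
   ring.zero = (\<lambda>_. 0), ring.add = (\<lambda>\<phi> \<psi> j. \<phi> j + \<psi> j),
   module.smult = (\<lambda>a \<phi>. join (\<lambda>v i. if 1 \<le> v \<and> v < n
    then \<Sum>u\<in>{1..v}. a [u..<Suc v] * tau u v (sl u \<phi>) i else 0))\<rparr>"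

lemma sl_join [simp]: "sl u (join C) = C u"
 by (simp add: sl_def join_def)

lemma sl_eqI: "(\<And>u. sl u \<phi> = sl u \<psi>) ==> \<phi> = \<psi>"
proof
 fix j assume "\<And>u. sl u \<phi> = sl u \<psi>"
 then have "sl (fst (prod_decode j)) \<phi> (snd (prod_decode j)) = sl (fst (prod_decode j)) \<psi> (snd (prod_decode j))"
  by simp
 then show "\<phi> j = \<psi> j" by (simp add: sl_def)
qed

lemma finite_J: "finite J"
proof (rule finite_subset)
 show "J \<subseteq> prod_encode ` (SIGMA u:{..<n}. {..<d u})" by (auto simp: J_def)
qed auto

lemma mem_carrier: "\<phi> \<in> carrier realmod \<longleftrightarrow> (\<forall>u i. \<not> (1 \<le> u \<and> u < n \<and> i < d u) --> sl u \<phi> i = 0)"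
proof -
 have "prod_encode (u, i) \<in> J \<longleftrightarrow> 1 \<le> u \<and> u < n \<and> i < d u" for u i
  by (auto simp: J_def)
 moreover have "(\<forall>j. j \<notin> J --> \<phi> j = 0) \<longleftrightarrow> (\<forall>u i. prod_encode (u, i) \<notin> J --> \<phi> (prod_encode (u, i)) = 0)"
  by (metis prod_decode_inverse surj_pair)
 ultimately show ?thesis by (simp add: realmod_def sl_def)
qed

lemma sl_smult: "sl v (a \<odot>\<^bsub>realmod\<^esub> \<phi>) = (\<lambda>i. if 1 \<le> v \<and> v < n
  then \<Sum>u\<in>{1..v}. a [u..<Suc v] * tau u v (sl u \<phi>) i else 0)"
 by (simp add: realmod_def)

lemma sl_add: "sl v (\<phi> \<oplus>\<^bsub>realmod\<^esub> \<psi>) = (\<lambda>i. sl v \<phi> i + sl v \<psi> i)"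
 by (simp add: realmod_def sl_def)

lemma smult_mem: "a \<odot>\<^bsub>realmod\<^esub> \<phi> \<in> carrier realmod"
 unfolding mem_carrier sl_smult by (auto simp: tau_zero intro!: sum.neutral)

lemma realmod_abelian: "abelian_group realmod"
proof (rule abelian_groupI)
 fix \<phi> assume "\<phi> \<in> carrier realmod"
 then show "\<exists>\<psi>\<in>carrier realmod. \<psi> \<oplus>\<^bsub>realmod\<^esub> \<phi> = \<zero>\<^bsub>realmod\<^esub>"
  by (intro bexI[of _ "\<lambda>j. - \<phi> j"]) (auto simp: realmod_def)
qed (auto simp: realmod_def)

lemma realmod_smult_assoc:
 "(a \<otimes>\<^bsub>LA n\<^esub> a') \<odot>\<^bsub>realmod\<^esub> \<phi> = a \<odot>\<^bsub>realmod\<^esub> (a' \<odot>\<^bsub>realmod\<^esub> \<phi>)"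
proof (rule sl_eqI, rule ext)
 fix w i
 show "sl w ((a \<otimes>\<^bsub>LA n\<^esub> a') \<odot>\<^bsub>realmod\<^esub> \<phi>) i = sl w (a \<odot>\<^bsub>realmod\<^esub> (a' \<odot>\<^bsub>realmod\<^esub> \<phi>)) i"
 proof (cases "1 \<le> w \<and> w < n")
  case True
  let ?g = "\<lambda>u v. a [v..<Suc w] * (a' [u..<Suc v] * tau u w (sl u \<phi>) i)"
  have "sl w ((a \<otimes>\<^bsub>LA n\<^esub> a') \<odot>\<^bsub>realmod\<^esub> \<phi>) i = (\<Sum>u\<in>{1..w}. \<Sum>v\<in>{u..w}. ?g u v)"
   using True by (simp add: sl_smult LA_mult_cf sum_distrib_right mult.assoc)
  also have "\<dots> = (\<Sum>u\<in>{1..w}. \<Sum>v | v \<in> {1..w} \<and> u \<le> v. ?g u v)"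
   by (intro sum.cong) auto
  also have "\<dots> = (\<Sum>v\<in>{1..w}. \<Sum>u | u \<in> {1..w} \<and> u \<le> v. ?g u v)"
   by (rule sum.swap_restrict) auto
  also have "\<dots> = (\<Sum>v\<in>{1..w}. \<Sum>u\<in>{1..v}. ?g u v)"
   by (intro sum.cong) auto
  also have "\<dots> = (\<Sum>v\<in>{1..w}. a [v..<Suc w] * tau v w (sl v (a' \<odot>\<^bsub>realmod\<^esub> \<phi>)) i)"
  proof (rule sum.cong)
   fix v assume v: "v \<in> {1..w}"
   then have "sl v (a' \<odot>\<^bsub>realmod\<^esub> \<phi>) = (\<lambda>i. \<Sum>u\<in>{1..v}. a' [u..<Suc v] * tau u v (sl u \<phi>) i)"
    using True by (simp add: sl_smult)
   then have "tau v w (sl v (a' \<odot>\<^bsub>realmod\<^esub> \<phi>)) i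
     = (\<Sum>u\<in>{1..v}. a' [u..<Suc v] * tau v w (tau u v (sl u \<phi>)) i)"
    using v True by (simp add: tau_sum)
   also have "\<dots> = (\<Sum>u\<in>{1..v}. a' [u..<Suc v] * tau u w (sl u \<phi>) i)"
    using v True by (intro sum.cong) (auto simp: tau_tau)
   finally show "(\<Sum>u\<in>{1..v}. ?g u v) = a [v..<Suc w] * tau v w (sl v (a' \<odot>\<^bsub>realmod\<^esub> \<phi>)) i"
    by (simp add: sum_distrib_left)
  qed simp
  also have "\<dots> = sl w (a \<odot>\<^bsub>realmod\<^esub> (a' \<odot>\<^bsub>realmod\<^esub> \<phi>)) i"
   using True by (subst (2) sl_smult) simp
  finally show ?thesis .
 qed (auto simp: sl_smult)
qed

lemma realmod_one: "\<phi> \<in> carrier realmod ==> \<one>\<^bsub>LA n\<^esub> \<odot>\<^bsub>realmod\<^esub> \<phi> = \<phi>"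
proof (rule sl_eqI, rule ext)
 fix v i assume \<phi>: "\<phi> \<in> carrier realmod"
 show "sl v (\<one>\<^bsub>LA n\<^esub> \<odot>\<^bsub>realmod\<^esub> \<phi>) i = sl v \<phi> i"
 proof (cases "1 \<le> v \<and> v < n")
  case True
  have "(\<Sum>u\<in>{1..v}. \<one>\<^bsub>LA n\<^esub> [u..<Suc v] * tau u v (sl u \<phi>) i) = (\<Sum>u\<in>{1..v}. if u = v then tau u v (sl u \<phi>) i else 0)"
   using True by (intro sum.cong) (auto simp: LA_one_cf)
  then show ?thesis using True \<phi> by (simp add: sl_smult tau_id mem_carrier)
 next
  case False
  then show ?thesis using \<phi> by (auto simp: sl_smult mem_carrier)
 qed
qed

lemma realmod_left_module: "left_module (LA n) realmod"
proof (intro left_module.intro left_module_axioms.intro ring_LA realmod_abelian)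
 fix a a' :: "nat list => 'k" and \<phi> \<psi>
 show "(a \<oplus>\<^bsub>LA n\<^esub> a') \<odot>\<^bsub>realmod\<^esub> \<phi> = a \<odot>\<^bsub>realmod\<^esub> \<phi> \<oplus>\<^bsub>realmod\<^esub> a' \<odot>\<^bsub>realmod\<^esub> \<phi>"
  by (rule sl_eqI) (auto simp: sl_add sl_smult fun_eq_iff distrib_right sum.distrib)
 show "a \<odot>\<^bsub>realmod\<^esub> (\<phi> \<oplus>\<^bsub>realmod\<^esub> \<psi>) = a \<odot>\<^bsub>realmod\<^esub> \<phi> \<oplus>\<^bsub>realmod\<^esub> a \<odot>\<^bsub>realmod\<^esub> \<psi>"
  by (rule sl_eqI) (auto simp: sl_add sl_smult fun_eq_iff tau_add distrib_left sum.distrib)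
qed (simp_all add: smult_mem realmod_smult_assoc realmod_one)

sublocale R: LA_mod n realmod
 by (rule LA_mod.intro[OF realmod_left_module])

lemma realmod_scalar: "\<phi> \<in> carrier realmod ==> scalar_act (LA n) realmod k \<phi> = (\<lambda>j. k * \<phi> j)"
proof (rule sl_eqI, rule ext)
 fix v i assume \<phi>: "\<phi> \<in> carrier realmod"
 show "sl v (scalar_act (LA n) realmod k \<phi>) i = sl v (\<lambda>j. k * \<phi> j) i"
 proof (cases "1 \<le> v \<and> v < n")
  case True
  have "(\<Sum>u\<in>{1..v}. k * \<one>\<^bsub>LA n\<^esub> [u..<Suc v] * tau u v (sl u \<phi>) i) = (\<Sum>u\<in>{1..v}. if u = v then k * tau u v (sl u \<phi>) i else 0)"
   using True by (intro sum.cong) (auto simp: LA_one_cf)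
  also have "\<dots> = k * sl v \<phi> i" using True \<phi> by (simp add: tau_id mem_carrier)
  finally show ?thesis using True by (simp add: sl_smult scalar_act_def) (simp add: sl_def)
 next
  case False
  then show ?thesis using \<phi> by (auto simp: sl_smult mem_carrier scalar_act_def) (auto simp: sl_def)
 qed
qed

lemma realmod_finsum:
 "[|finite B; \<And>x. x \<in> B ==> f x \<in> carrier realmod|] ==> (\<Oplus>\<^bsub>realmod\<^esub>x\<in>B. f x) = (\<lambda>j. \<Sum>x\<in>B. f x j)"
proof (induction B rule: finite_induct)
 case empty
 show ?case unfolding R.L.M.finsum_empty by (simp add: realmod_def)
next
 case (insert x B)
 have "(\<Oplus>\<^bsub>realmod\<^esub>x\<in>insert x B. f x) = f x \<oplus>\<^bsub>realmod\<^esub> (\<Oplus>\<^bsub>realmod\<^esub>x\<in>B. f x)"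
  using insert by (intro R.L.M.finsum_insert) auto
 then show ?case using insert by (simp add: realmod_def)
qed

lemma realmod_fin_dim: "fin_dim (LA n) realmod"
proof -
 define unit :: "nat => nat => 'k" where "unit j = (\<lambda>j'. if j' = j then 1 else 0)" for j
 have inj: "inj_on unit J" by (rule inj_onI) (metis unit_def zero_neq_one)
 have m: "unit j \<in> carrier realmod" if "j \<in> J" for j using that by (auto simp: realmod_def unit_def)
 show ?thesis
  unfolding fin_dim_def
 proof (intro exI[of _ "unit ` J"] conjI ballI)
  fix x assume x: "x \<in> carrier realmod"
  let ?c = "\<lambda>b. \<Sum>j\<in>J. x j * b j"
  have cm: "(\<lambda>j. k * b j) \<in> carrier realmod" if "b \<in> unit ` J" for b k
   using that m by (auto simp: realmod_def)
  have "(\<Oplus>\<^bsub>realmod\<^esub>b\<in>unit ` J. scalar_act (LA n) realmod (?c b) b)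
    = (\<Oplus>\<^bsub>realmod\<^esub>b\<in>unit ` J. (\<lambda>j. ?c b * b j))"
   using cm m by (intro R.L.M.finsum_cong') (auto simp: realmod_scalar)
  also have "\<dots> = (\<lambda>i. \<Sum>b\<in>unit ` J. ?c b * b i)"
   by (rule realmod_finsum) (use finite_J cm in auto)
  also have "\<dots> = x"
  proof
   fix i
   have "(\<Sum>b\<in>unit ` J. ?c b * b i) = (\<Sum>j\<in>J. ?c (unit j) * unit j i)"
    by (simp add: sum.reindex[OF inj])
   also have "\<dots> = (\<Sum>j\<in>J. x j * unit j i)"
    using finite_J by (intro sum.cong) (auto simp: unit_def if_distrib[of "\<lambda>x. _ * x"] cong: if_cong)
   also have "\<dots> = x i"
    using finite_J x by (auto simp: unit_def realmod_def if_distrib[of "\<lambda>x. _ * x"] cong: if_cong)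
   finally show "(\<Sum>b\<in>unit ` J. ?c b * b i) = x i" .
  qed
  finally show "\<exists>c. x = (\<Oplus>\<^bsub>realmod\<^esub>b\<in>unit ` J. scalar_act (LA n) realmod (c b) b)"
   by (intro exI[of _ ?c]) (rule sym)
 qed (use finite_J m in auto)
qed

lemma sl_Tr: "sl w (Tr n realmod u v \<phi>) =
  (if w = v \<and> 1 \<le> u \<and> u \<le> v \<and> v < n then tau u v (sl u \<phi>) else (\<lambda>i. 0))"
proof
 fix i
 have "(\<Sum>x\<in>{1..w}. ee n u v [x..<Suc w] * tau x w (sl x \<phi>) i) =
   (\<Sum>x\<in>{1..w}. if x = u then if w = v \<and> v < n then tau u v (sl u \<phi>) i else 0 else 0)" if "1 \<le> w" "w < n"
  using that by (intro sum.cong) (auto simp: ee_cf)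
 then show "sl w (Tr n realmod u v \<phi>) i = (if w = v \<and> 1 \<le> u \<and> u \<le> v \<and> v < n then tau u v (sl u \<phi>) else (\<lambda>i. 0)) i"
  by (auto simp: Tr_def sl_smult)
qed

definition beta :: "nat => (nat => 'k) => 'b" where
 "beta u \<phi> = emb u (sl u \<phi>)"

lemma beta_T: "[|1 \<le> u; u \<le> v; v < n|] ==> beta v (Tr n realmod u v \<phi>) = T u v (beta u \<phi>)"
 by (simp add: beta_def sl_Tr tau_def emb_co T_emb_mem)

lemma beta_liso:
 assumes u: "1 \<le> u" "u < n"
 shows "liso (Sp n realmod u) (W u) (beta u)"
 unfolding liso_def
proof
 show "lin (Sp n realmod u) (W u) (beta u)"
 proof (rule linI)
  fix a k assume "a \<in> car (Sp n realmod u)"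
  then show "beta u (scl (Sp n realmod u) k a) = scl (W u) k (beta u a)"
   using emb_scl[OF u, of k "sl u a"] by (simp add: beta_def Sp_car realmod_scalar) (simp add: sl_def)
 qed (use u in \<open>simp_all add: beta_def emb_mem sl_add emb_add\<close>)
 have z: "sl w \<phi> = (\<lambda>i. 0)" if "\<phi> \<in> car (Sp n realmod u)" "w \<noteq> u" for w \<phi>
  using sl_Tr[of w u u \<phi>] that by (simp add: Sp_car)
 show "bij_betw (beta u) (car (Sp n realmod u)) (car (W u))"
 proof (rule bij_betw_imageI)
  show "inj_on (beta u) (car (Sp n realmod u))"
  proof (rule inj_onI)
   fix \<phi> \<psi> assume m: "\<phi> \<in> car (Sp n realmod u)" "\<psi> \<in> car (Sp n realmod u)" and "beta u \<phi> = beta u \<psi>"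
   then have "sl u \<phi> = sl u \<psi>"
    using u by (intro emb_inj[of u]) (auto simp: beta_def Sp_car mem_carrier)
   then have "sl w \<phi> = sl w \<psi>" for w using z m by (cases "w = u") auto
   then show "\<phi> = \<psi>" by (rule sl_eqI)
  qed
  show "beta u ` car (Sp n realmod u) = car (W u)"
  proof (intro equalityI subsetI)
   fix w assume w: "w \<in> car (W u)"
   let ?\<phi> = "join (\<lambda>v. if v = u then co u w else (\<lambda>i. 0))"
   have "Tr n realmod u u ?\<phi> = ?\<phi>"
    by (rule sl_eqI) (use u w in \<open>auto simp: sl_Tr tau_id co_zero\<close>)
   moreover have "?\<phi> \<in> carrier realmod" using u w by (auto simp: mem_carrier co_zero)
   ultimately have "?\<phi> \<in> car (Sp n realmod u)" by (simp add: Sp_car)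
   moreover have "beta u ?\<phi> = w" using u w by (simp add: beta_def emb_co)
   ultimately show "w \<in> beta u ` car (Sp n realmod u)" by (intro rev_image_eqI) auto
  qed (use u in \<open>auto simp: beta_def emb_mem\<close>)
 qed
qed

text \<open>Every finite dimensional representation comes from a module in the universe used by \<open>fdmod\<close>.\<close>

lemma realization:
 "\<exists>(M :: 'k amod) \<beta>. left_module (LA n) M \<and> fin_dim (LA n) M \<and>
  (\<forall>u. 1 \<le> u \<and> u < n --> liso (Sp n M u) (W u) (\<beta> u)) \<and>
  (\<forall>u v x. 1 \<le> u \<and> u \<le> v \<and> v < n --> \<beta> v (Tr n M u v x) = T u v (\<beta> u x))"
 using realmod_left_module realmod_fin_dim beta_liso beta_T by blast

end

section \<open>The bimodules defining the functors\<close>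

lemma single_path: "[i] = [i..<Suc i]"
 by (simp add: upt_conv_Cons)

text \<open>At a vertex \<open>u\<close>, this is the end point of the shortest path that starts at \<open>u\<close> and differs from the
 trivial path at \<open>i\<close>, or \<open>n\<close> if there is no such path.\<close>

definition gi :: "nat => nat => nat" where
 "gi i u = (if u = i then Suc i else u)"

lemma gi_ge: "u \<le> gi i u" and gi_mono: "u \<le> v ==> gi i u \<le> gi i v"
 by (auto simp: gi_def)

lemma set_add_iff: "x \<in> set_add R H K \<longleftrightarrow> (\<exists>h\<in>H. \<exists>k\<in>K. x = h \<oplus>\<^bsub>R\<^esub> k)"
 by (auto simp: set_add_def set_mult_def)

locale gbim =
 fixes n i :: nat and kk :: "'k::field itself"
 assumes i: "1 \<le> i" "i < n"
begin

abbreviation A :: "('k, nat list => 'k) module" where "A \<equiv> LA n"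
abbreviation D :: "(nat list => 'k, (nat list => 'k) => 'k) bimodule" where "D \<equiv> dual_A n"
abbreviation F :: "(nat list => 'k, ((nat list => 'k) => 'k) set) bimodule" where "F \<equiv> F_dual_A n i"
abbreviation G :: "(nat list => 'k, ((nat list => 'k) => 'k) set => 'k) bimodule" where "G \<equiv> G_bimodule n i"

text \<open>The two-sided ideal spanned by all paths except the trivial one at \<open>i\<close>.\<close>

definition Ji :: "(nat list => 'k) set" where "Ji = {a \<in> carrier A. a [i] = 0}"

lemma regular_scalar: "x \<in> carrier A ==> scalar_act A (regular_bimodule A) c x = (\<lambda>p. c * x p)"
 by (simp add: scalar_act_def regular_bimodule_def LA_scale_mult LA_one_left)

lemma D_carrier: "\<phi> \<in> carrier D \<longleftrightarrow> \<phi> \<in> extensional (carrier A) \<and>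
  (\<forall>x\<in>carrier A. \<forall>y\<in>carrier A. \<phi> (\<lambda>p. x p + y p) = \<phi> x + \<phi> y) \<and>
  (\<forall>c. \<forall>x\<in>carrier A. \<phi> (\<lambda>p. c * x p) = c * \<phi> x)"
proof -
 have "\<phi> \<in> carrier D \<longleftrightarrow> \<phi> \<in> extensional (carrier A) \<and>
  (\<forall>x\<in>carrier A. \<forall>y\<in>carrier A. \<phi> (x \<oplus>\<^bsub>A\<^esub> y) = \<phi> x + \<phi> y) \<and>
  (\<forall>c. \<forall>x\<in>carrier A. \<phi> (scalar_act A (regular_bimodule A) c x) = c * \<phi> x)"
  by (simp add: dual_A_def dual_bimodule_def) (simp add: regular_bimodule_def)
 then show ?thesis by (simp add: regular_scalar)
qed

lemma D_add: "\<phi> \<oplus>\<^bsub>D\<^esub> \<psi> = (\<lambda>x\<in>carrier A. \<phi> x + \<psi> x)"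
 and D_zero: "\<zero>\<^bsub>D\<^esub> = (\<lambda>x\<in>carrier A. 0)"
 and D_smult: "a \<odot>\<^bsub>D\<^esub> \<phi> = (\<lambda>x\<in>carrier A. \<phi> (x \<otimes>\<^bsub>A\<^esub> a))"
 and D_rsmult: "rsmult D \<phi> a = (\<lambda>x\<in>carrier A. \<phi> (a \<otimes>\<^bsub>A\<^esub> x))"
 by (simp_all add: dual_A_def dual_bimodule_def regular_bimodule_def)

lemma D_ext: "[|\<phi> \<in> carrier D; \<psi> \<in> carrier D; \<And>x. x \<in> carrier A ==> \<phi> x = \<psi> x|] ==> \<phi> = \<psi>"
 by (rule extensionalityI[of _ "carrier A"]) (auto simp: D_carrier)

lemma D_addD: "[|\<phi> \<in> carrier D; x \<in> carrier A; y \<in> carrier A|] ==> \<phi> (\<lambda>p. x p + y p) = \<phi> x + \<phi> y"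
 and D_scaleD: "[|\<phi> \<in> carrier D; x \<in> carrier A|] ==> \<phi> (\<lambda>p. c * x p) = c * \<phi> x"
 by (simp_all add: D_carrier)

lemma D_add_closed: "[|\<phi> \<in> carrier D; \<psi> \<in> carrier D|] ==> \<phi> \<oplus>\<^bsub>D\<^esub> \<psi> \<in> carrier D"
 by (simp add: D_add D_carrier LA_add_closed LA_scale_closed distrib_left)

lemma D_zero_closed: "\<zero>\<^bsub>D\<^esub> \<in> carrier D"
 by (simp add: D_zero D_carrier LA_add_closed LA_scale_closed)

lemma D_scale_closed: "\<phi> \<in> carrier D ==> (\<lambda>x\<in>carrier A. c * \<phi> x) \<in> carrier D"
 by (simp add: D_carrier LA_add_closed LA_scale_closed distrib_left)

definition ng :: "((nat list => 'k) => 'k) => (nat list => 'k) => 'k" where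
 "ng \<phi> = (\<lambda>x\<in>carrier A. -1 * \<phi> x)"

lemma ng_mem: "\<phi> \<in> carrier D ==> ng \<phi> \<in> carrier D"
 unfolding ng_def by (rule D_scale_closed)

lemma D_add_val: "x \<in> carrier A ==> (\<phi> \<oplus>\<^bsub>D\<^esub> \<psi>) x = \<phi> x + \<psi> x"
 and D_zero_val: "x \<in> carrier A ==> \<zero>\<^bsub>D\<^esub> x = 0"
 and ng_val: "x \<in> carrier A ==> ng \<phi> x = - \<phi> x"
 by (simp_all add: D_add D_zero ng_def)

lemma D_smult_closed: "[|a \<in> carrier A; \<phi> \<in> carrier D|] ==> a \<odot>\<^bsub>D\<^esub> \<phi> \<in> carrier D"
 using LA_distr_l[of n _ _ a] unfolding D_smult
 by (simp add: D_carrier LA_add_closed LA_scale_closed LA_mult_closed LA_scale_mult)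

lemma D_rsmult_closed: "[|a \<in> carrier A; \<phi> \<in> carrier D|] ==> rsmult D \<phi> a \<in> carrier D"
 using LA_distr_r[of n a] unfolding D_rsmult
 by (simp add: D_carrier LA_add_closed LA_scale_closed LA_mult_closed LA_mult_scale)

lemma abelian_group_D: "abelian_group D"
proof (rule abelian_groupI)
 fix x y z assume m: "x \<in> carrier D" "y \<in> carrier D" "z \<in> carrier D"
 show "x \<oplus>\<^bsub>D\<^esub> y \<oplus>\<^bsub>D\<^esub> z = x \<oplus>\<^bsub>D\<^esub> (y \<oplus>\<^bsub>D\<^esub> z)"
  by (rule D_ext) (auto simp: m D_add_closed, simp add: D_add)
 show "x \<oplus>\<^bsub>D\<^esub> y = y \<oplus>\<^bsub>D\<^esub> x" by (rule D_ext) (auto simp: m D_add_closed, simp add: D_add)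
 show "\<zero>\<^bsub>D\<^esub> \<oplus>\<^bsub>D\<^esub> x = x"
  by (rule D_ext) (auto simp: m D_add_closed D_zero_closed, simp add: D_add D_zero)
 show "\<exists>y\<in>carrier D. y \<oplus>\<^bsub>D\<^esub> x = \<zero>\<^bsub>D\<^esub>"
 proof
  show n: "ng x \<in> carrier D" using m(1) by (rule ng_mem)
  show "ng x \<oplus>\<^bsub>D\<^esub> x = \<zero>\<^bsub>D\<^esub>"
   by (rule D_ext[OF D_add_closed[OF n m(1)] D_zero_closed]) (simp add: D_add_val D_zero_val ng_val)
 qed
qed (simp_all add: D_add_closed D_zero_closed)

interpretation D: abelian_group D by (rule abelian_group_D)

definition T where "T = trace A (simple_module i) D"

text \<open>The ideal annihilates the simple module, hence every value \<open>\<phi>\<close> of a homomorphism from it, and \<open>\<phi> a\<close>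
 is the value of \<open>a \<phi>\<close> at one. Conversely a functional that vanishes on the ideal is a multiple of
 the coefficient at the trivial path, on which the algebra acts as on the simple module.\<close>

lemma T_eq: "T = {\<phi> \<in> carrier D. \<forall>a\<in>Ji. \<phi> a = 0}"
proof (intro equalityI subsetI)
 fix \<phi> assume "\<phi> \<in> T"
 then obtain H m where H: "finite H" "H \<subseteq> mod_hom A (simple_module i) D" "\<phi> = (\<Oplus>\<^bsub>D\<^esub>h\<in>H. h (m h))"
  unfolding T_def trace_def by blast
 let ?K = "{\<phi> \<in> carrier D. \<forall>a\<in>Ji. \<phi> a = 0}"
 have k: "h x \<in> ?K" if h: "h \<in> mod_hom A (simple_module i) D" for h x
 proof -
  have hD: "h y \<in> carrier D" for y using h by (auto simp: mod_hom_def simple_module_def)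
  have "h x a = 0" if a: "a \<in> Ji" for a
  proof -
   have a': "a \<in> carrier A" "a [i] = 0" using a by (auto simp: Ji_def)
   have "h x a = (a \<odot>\<^bsub>D\<^esub> h x) \<one>\<^bsub>A\<^esub>"
    using a' by (simp add: D_smult LA_one_closed LA_one_left)
   also have "a \<odot>\<^bsub>D\<^esub> h x = h (a [i] * x)"
    using h a' by (auto simp: mod_hom_def simple_module_def)
   also have "h (a [i] * x) = h 0" using a' by simp
   also have "h 0 = (\<lambda>p. 0) \<odot>\<^bsub>D\<^esub> h 0"
   proof -
    have "(\<lambda>p. 0) \<in> carrier A" by (simp add: LA_carrier)
    then show ?thesis using h by (auto simp: mod_hom_def simple_module_def)
   qed
   also have "((\<lambda>p. 0) \<odot>\<^bsub>D\<^esub> h 0) \<one>\<^bsub>A\<^esub> = 0"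
    using D_scaleD[OF hD LA_one_closed, of 0 0] by (simp add: D_smult LA_one_closed)
   finally show ?thesis .
  qed
  then show ?thesis using hD by simp
 qed
 have "(\<Oplus>\<^bsub>D\<^esub>h\<in>H. h (m h)) \<in> ?K"
  using H(1,2)
 proof (induction H rule: finite_induct)
  case empty
  have "\<zero>\<^bsub>D\<^esub> a = 0" if "a \<in> Ji" for a using that by (simp add: D_zero Ji_def)
  then show ?case using D_zero_closed by simp
 next
  case (insert h H)
  have "(\<Oplus>\<^bsub>D\<^esub>h\<in>insert h H. h (m h)) = h (m h) \<oplus>\<^bsub>D\<^esub> (\<Oplus>\<^bsub>D\<^esub>h\<in>H. h (m h))"
   using insert k by (intro D.finsum_insert) auto
  moreover have "(\<Oplus>\<^bsub>D\<^esub>h\<in>H. h (m h)) \<in> ?K" "h (m h) \<in> ?K" using insert k by auto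
  ultimately show ?case by (simp add: D_add_closed) (simp add: D_add Ji_def)
 qed
 then show "\<phi> \<in> ?K" using H(3) by simp
next
 fix \<phi> assume "\<phi> \<in> {\<phi> \<in> carrier D. \<forall>a\<in>Ji. \<phi> a = 0}"
 then have \<phi>: "\<phi> \<in> carrier D" "\<And>a. a \<in> Ji ==> \<phi> a = 0" by auto
 let ?e = "ee n i i :: nat list => 'k"
 have ei: "?e [i] = 1" unfolding single_path using i by (simp add: ee_cf)
 have val: "\<phi> a = a [i] * \<phi> ?e" if a: "a \<in> carrier A" for a
 proof -
  have s: "(\<lambda>p. - a [i] * ?e p) \<in> carrier A" by (rule LA_scale_closed) simp
  have "(\<lambda>p. a p + - a [i] * ?e p) \<in> Ji"
   using LA_add_closed[OF a s] ei by (simp add: Ji_def)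
  then have "0 = \<phi> a + \<phi> (\<lambda>p. - a [i] * ?e p)" using \<phi> D_addD[OF \<phi>(1) a s] by metis
  then show ?thesis using D_scaleD[OF \<phi>(1), of ?e "- a [i]"] by simp
 qed
 define h :: "'k => (nat list => 'k) => 'k" where "h x = (\<lambda>a\<in>carrier A. x * \<phi> a)" for x
 have hm: "h x \<in> carrier D" for x unfolding h_def using \<phi>(1) by (rule D_scale_closed)
 have "h \<in> mod_hom A (simple_module i) D"
 proof -
  have "h (x + y) = h x \<oplus>\<^bsub>D\<^esub> h y" for x y
   by (rule D_ext) (auto simp: hm D_add_closed, simp add: h_def D_add distrib_right)
  moreover have "h (a [i] * x) = a \<odot>\<^bsub>D\<^esub> h x" if a: "a \<in> carrier A" for a x
  proof (rule D_ext)
   fix y assume y: "y \<in> carrier A"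
   have "(y \<otimes>\<^bsub>A\<^esub> a) [i] = y [i] * a [i]" by (simp add: LA_mult)
   then show "h (a [i] * x) y = (a \<odot>\<^bsub>D\<^esub> h x) y"
    using a y val[of y] val[of "y \<otimes>\<^bsub>A\<^esub> a"] by (simp add: h_def D_smult LA_mult_closed)
  qed (use a hm D_smult_closed in auto)
  ultimately show ?thesis using hm by (auto simp: mod_hom_def simple_module_def)
 qed
 moreover have "\<phi> = (\<Oplus>\<^bsub>D\<^esub>h\<in>{h}. h 1)"
 proof -
  have "(\<Oplus>\<^bsub>D\<^esub>h\<in>{h}. h 1) = h 1" using D.finsum_insert[of "{}" h "\<lambda>h. h 1"] hm by simp
  moreover have "h 1 = \<phi>" by (rule D_ext[OF hm \<phi>(1)]) (simp add: h_def)
  ultimately show ?thesis by simp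
 qed
 ultimately show "\<phi> \<in> T"
  unfolding T_def trace_def
  by (intro CollectI exI[of _ "{h}"] exI[of _ "\<lambda>_. 1"]) (auto simp: simple_module_def)
qed

text \<open>The cosets of the trace: a functional matters only through its restriction to the ideal.\<close>

definition cs where "cs \<phi> = {\<psi> \<in> carrier D. \<forall>a\<in>Ji. \<psi> a = \<phi> a}"

lemma coset_eq: "\<phi> \<in> carrier D ==> T +>\<^bsub>D\<^esub> \<phi> = cs \<phi>"
proof (intro equalityI subsetI)
 fix \<psi> assume \<phi>: "\<phi> \<in> carrier D" and "\<psi> \<in> T +>\<^bsub>D\<^esub> \<phi>"
 then obtain t where "t \<in> T" "\<psi> = t \<oplus>\<^bsub>D\<^esub> \<phi>" by (auto simp: a_r_coset_def')
 then show "\<psi> \<in> cs \<phi>" using \<phi> by (auto simp: T_eq cs_def D_add_closed) (auto simp: D_add Ji_def)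
next
 fix \<psi> assume \<phi>: "\<phi> \<in> carrier D" and "\<psi> \<in> cs \<phi>"
 then have \<psi>: "\<psi> \<in> carrier D" "\<And>a. a \<in> Ji ==> \<psi> a = \<phi> a" by (auto simp: cs_def)
 have m: "ng \<phi> \<in> carrier D" using \<phi> by (rule ng_mem)
 have "\<psi> \<oplus>\<^bsub>D\<^esub> ng \<phi> \<in> T"
  using \<psi> m by (simp add: T_eq D_add_closed) (simp add: D_add_val ng_val Ji_def)
 moreover have "\<psi> = (\<psi> \<oplus>\<^bsub>D\<^esub> ng \<phi>) \<oplus>\<^bsub>D\<^esub> \<phi>"
  by (rule D_ext) (auto simp: \<psi> m \<phi> D_add_closed, simp add: D_add_val ng_val)
 ultimately show "\<psi> \<in> T +>\<^bsub>D\<^esub> \<phi>" by (auto simp: a_r_coset_def')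
qed

lemma F_carrier: "carrier F = cs ` carrier D"
proof -
 have "carrier F = (\<lambda>\<phi>. T +>\<^bsub>D\<^esub> \<phi>) ` carrier D"
  by (auto simp: F_dual_A_def quot_bimodule_def A_RCOSETS_def RCOSETS_def a_r_coset_def T_def)
 also have "\<dots> = cs ` carrier D" using coset_eq by (intro image_cong) auto
 finally show ?thesis .
qed

lemma cs_self: "\<phi> \<in> carrier D ==> \<phi> \<in> cs \<phi>"
 by (simp add: cs_def)

lemma cs_eq: "(\<And>a. a \<in> Ji ==> \<phi> a = \<psi> a) ==> cs \<phi> = cs \<psi>"
 by (auto simp: cs_def)

lemma Ji_mult_left: "[|a \<in> carrier A; b \<in> Ji|] ==> a \<otimes>\<^bsub>A\<^esub> b \<in> Ji"
 and Ji_mult_right: "[|a \<in> carrier A; b \<in> Ji|] ==> b \<otimes>\<^bsub>A\<^esub> a \<in> Ji"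
 by (auto simp: Ji_def LA_mult_closed) (auto simp: LA_mult)

lemma Ji_add: "[|a \<in> Ji; b \<in> Ji|] ==> (\<lambda>p. a p + b p) \<in> Ji"
 and Ji_scale: "a \<in> Ji ==> (\<lambda>p. c * a p) \<in> Ji"
 and Ji_carrier: "a \<in> Ji ==> a \<in> carrier A"
 by (auto simp: Ji_def LA_add_closed LA_scale_closed)

lemma F_add: "[|\<phi> \<in> carrier D; \<psi> \<in> carrier D|] ==> cs \<phi> \<oplus>\<^bsub>F\<^esub> cs \<psi> = cs (\<phi> \<oplus>\<^bsub>D\<^esub> \<psi>)"
proof -
 assume \<phi>: "\<phi> \<in> carrier D" and \<psi>: "\<psi> \<in> carrier D"
 have "set_add D (cs \<phi>) (cs \<psi>) = cs (\<phi> \<oplus>\<^bsub>D\<^esub> \<psi>)"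
 proof (intro equalityI subsetI)
  fix x assume "x \<in> set_add D (cs \<phi>) (cs \<psi>)"
  then show "x \<in> cs (\<phi> \<oplus>\<^bsub>D\<^esub> \<psi>)"
   by (auto simp: set_add_iff cs_def D_add_closed) (auto simp: D_add Ji_def)
 next
  fix x assume x: "x \<in> cs (\<phi> \<oplus>\<^bsub>D\<^esub> \<psi>)"
  have m: "ng \<phi> \<in> carrier D" using \<phi> by (rule ng_mem)
  have x': "x \<in> carrier D" using x by (simp add: cs_def)
  have "x \<oplus>\<^bsub>D\<^esub> ng \<phi> \<in> cs \<psi>"
   using x m by (simp add: cs_def D_add_closed) (simp add: D_add_val ng_val Ji_def)
  moreover have "x = \<phi> \<oplus>\<^bsub>D\<^esub> (x \<oplus>\<^bsub>D\<^esub> ng \<phi>)"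
   by (rule D_ext) (auto simp: x' m \<phi> D_add_closed, simp add: D_add_val ng_val)
  ultimately show "x \<in> set_add D (cs \<phi>) (cs \<psi>)" using cs_self[OF \<phi>] unfolding set_add_iff by blast
 qed
 then show ?thesis by (simp add: F_dual_A_def quot_bimodule_def)
qed

lemma F_smult: "[|a \<in> carrier A; \<phi> \<in> carrier D|] ==> a \<odot>\<^bsub>F\<^esub> cs \<phi> = cs (a \<odot>\<^bsub>D\<^esub> \<phi>)"
proof -
 assume a: "a \<in> carrier A" and \<phi>: "\<phi> \<in> carrier D"
 have "T +>\<^bsub>D\<^esub> (a \<odot>\<^bsub>D\<^esub> x) = cs (a \<odot>\<^bsub>D\<^esub> \<phi>)" if x: "x \<in> cs \<phi>" for x
 proof -
  have "x \<in> carrier D" using x by (simp add: cs_def)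
  then have "T +>\<^bsub>D\<^esub> (a \<odot>\<^bsub>D\<^esub> x) = cs (a \<odot>\<^bsub>D\<^esub> x)" using a by (intro coset_eq D_smult_closed)
  also have "\<dots> = cs (a \<odot>\<^bsub>D\<^esub> \<phi>)"
   using x a Ji_mult_right[OF a] by (intro cs_eq) (auto simp: cs_def D_smult)
  finally show ?thesis .
 qed
 then have "(\<Union>x\<in>cs \<phi>. T +>\<^bsub>D\<^esub> (a \<odot>\<^bsub>D\<^esub> x)) = cs (a \<odot>\<^bsub>D\<^esub> \<phi>)" using cs_self[OF \<phi>] by auto
 then show ?thesis by (simp add: F_dual_A_def quot_bimodule_def T_def)
qed

lemma F_rsmult: "[|a \<in> carrier A; \<phi> \<in> carrier D|] ==> rsmult F (cs \<phi>) a = cs (rsmult D \<phi> a)"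
proof -
 assume a: "a \<in> carrier A" and \<phi>: "\<phi> \<in> carrier D"
 have "T +>\<^bsub>D\<^esub> (rsmult D x a) = cs (rsmult D \<phi> a)" if x: "x \<in> cs \<phi>" for x
 proof -
  have "x \<in> carrier D" using x by (simp add: cs_def)
  then have "T +>\<^bsub>D\<^esub> (rsmult D x a) = cs (rsmult D x a)" using a by (intro coset_eq D_rsmult_closed)
  also have "\<dots> = cs (rsmult D \<phi> a)"
   using x a Ji_mult_left[OF a] by (intro cs_eq) (auto simp: cs_def D_rsmult)
  finally show ?thesis .
 qed
 then have "(\<Union>x\<in>cs \<phi>. T +>\<^bsub>D\<^esub> (rsmult D x a)) = cs (rsmult D \<phi> a)" using cs_self[OF \<phi>] by auto
 then show ?thesis by (simp add: F_dual_A_def quot_bimodule_def T_def)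
qed

lemma F_scalar: "\<phi> \<in> carrier D ==> scalar_act A F c (cs \<phi>) = cs (\<lambda>x\<in>carrier A. c * \<phi> x)"
proof -
 assume \<phi>: "\<phi> \<in> carrier D"
 have o: "(\<lambda>p. c * \<one>\<^bsub>A\<^esub> p) \<in> carrier A" by (simp add: LA_scale_closed LA_one_closed)
 have "scalar_act A F c (cs \<phi>) = cs ((\<lambda>p. c * \<one>\<^bsub>A\<^esub> p) \<odot>\<^bsub>D\<^esub> \<phi>)"
  using F_smult[OF o \<phi>] by (simp add: scalar_act_def)
 also have "\<dots> = cs (\<lambda>x\<in>carrier A. c * \<phi> x)"
  using \<phi> by (intro cs_eq)
   (simp add: D_smult Ji_carrier LA_mult_scale LA_one_right D_scaleD)
 finally show ?thesis .
qed

lemma G_carrier: "\<Psi> \<in> carrier G \<longleftrightarrow> \<Psi> \<in> extensional (carrier F) \<and>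
  (\<forall>\<phi>\<in>carrier D. \<forall>\<psi>\<in>carrier D. \<Psi> (cs (\<phi> \<oplus>\<^bsub>D\<^esub> \<psi>)) = \<Psi> (cs \<phi>) + \<Psi> (cs \<psi>)) \<and>
  (\<forall>c. \<forall>\<phi>\<in>carrier D. \<Psi> (cs (\<lambda>x\<in>carrier A. c * \<phi> x)) = c * \<Psi> (cs \<phi>))"
 by (simp add: G_bimodule_def dual_bimodule_def F_carrier F_add F_scalar)

lemma G_add: "\<Psi> \<oplus>\<^bsub>G\<^esub> \<Psi>' = (\<lambda>C\<in>carrier F. \<Psi> C + \<Psi>' C)"
 and G_smult: "a \<odot>\<^bsub>G\<^esub> \<Psi> = (\<lambda>C\<in>carrier F. \<Psi> (rsmult F C a))"
 and G_rsmult: "rsmult G \<Psi> a = (\<lambda>C\<in>carrier F. \<Psi> (a \<odot>\<^bsub>F\<^esub> C))"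
 by (simp_all add: G_bimodule_def dual_bimodule_def)

text \<open>Evaluation identifies the ideal of the elements without constant term at the vertex with the
 dual of the quotient.\<close>

definition ev :: "(nat list => 'k) => ((nat list => 'k) => 'k) set => 'k" where
 "ev a = (\<lambda>C\<in>carrier F. (SOME \<phi>. \<phi> \<in> C) a)"

lemma ev_cs: "[|a \<in> Ji; \<phi> \<in> carrier D|] ==> ev a (cs \<phi>) = \<phi> a"
proof -
 assume a: "a \<in> Ji" and \<phi>: "\<phi> \<in> carrier D"
 have "(SOME \<psi>. \<psi> \<in> cs \<phi>) \<in> cs \<phi>" by (rule someI[of _ \<phi>]) (rule cs_self[OF \<phi>])
 then show ?thesis using a \<phi> by (simp add: ev_def F_carrier cs_def)
qed

lemma ext_F: "[|\<Psi> \<in> extensional (carrier F); \<Psi>' \<in> extensional (carrier F);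
  \<And>\<phi>. \<phi> \<in> carrier D ==> \<Psi> (cs \<phi>) = \<Psi>' (cs \<phi>)|] ==> \<Psi> = \<Psi>'"
 by (rule extensionalityI[of _ "carrier F"]) (auto simp: F_carrier)

lemma ev_ext: "ev a \<in> extensional (carrier F)"
 by (simp add: ev_def)

lemma cs_mem: "\<phi> \<in> carrier D ==> cs \<phi> \<in> carrier F"
 by (simp add: F_carrier)

lemma ev_mem: "a \<in> Ji ==> ev a \<in> carrier G"
 unfolding G_carrier
 by (auto simp: ev_cs D_add_closed D_scale_closed ev_ext) (auto simp: D_add Ji_carrier)

lemma ev_add: "[|a \<in> Ji; b \<in> Ji|] ==> ev (\<lambda>p. a p + b p) = ev a \<oplus>\<^bsub>G\<^esub> ev b"
proof (rule ext_F)
 fix \<phi> assume "a \<in> Ji" "b \<in> Ji" "\<phi> \<in> carrier D"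
 then show "ev (\<lambda>p. a p + b p) (cs \<phi>) = (ev a \<oplus>\<^bsub>G\<^esub> ev b) (cs \<phi>)"
  by (simp add: G_add cs_mem ev_cs Ji_add D_addD Ji_carrier)
qed (simp_all add: ev_ext G_add)

lemma ev_smult: "[|b \<in> carrier A; a \<in> Ji|] ==> ev (b \<otimes>\<^bsub>A\<^esub> a) = b \<odot>\<^bsub>G\<^esub> ev a"
proof (rule ext_F)
 fix \<phi> assume "b \<in> carrier A" "a \<in> Ji" "\<phi> \<in> carrier D"
 then show "ev (b \<otimes>\<^bsub>A\<^esub> a) (cs \<phi>) = (b \<odot>\<^bsub>G\<^esub> ev a) (cs \<phi>)"
  by (simp add: G_smult cs_mem ev_cs Ji_mult_left F_rsmult D_rsmult_closed) (simp add: D_rsmult Ji_carrier)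
qed (simp_all add: ev_ext G_smult)

lemma ev_rsmult: "[|b \<in> carrier A; a \<in> Ji|] ==> ev (a \<otimes>\<^bsub>A\<^esub> b) = rsmult G (ev a) b"
proof (rule ext_F)
 fix \<phi> assume "b \<in> carrier A" "a \<in> Ji" "\<phi> \<in> carrier D"
 then show "ev (a \<otimes>\<^bsub>A\<^esub> b) (cs \<phi>) = rsmult G (ev a) b (cs \<phi>)"
  by (simp add: G_rsmult cs_mem ev_cs Ji_mult_right F_smult D_smult_closed) (simp add: D_smult Ji_carrier)
qed (simp_all add: ev_ext G_rsmult)

text \<open>The coefficient functionals form the basis dual to the paths; a functional is expanded in them,
 which gives the preimage under evaluation.\<close>

definition pf :: "nat list => (nat list => 'k) => 'k" where
 "pf p = (\<lambda>x\<in>carrier A. x p)"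

definition PP :: "nat list set" where
 "PP = {p. \<exists>u v. 1 \<le> u \<and> u \<le> v \<and> v < n \<and> p = [u..<Suc v]}"

lemma finite_PP: "finite PP"
proof (rule finite_subset)
 show "PP \<subseteq> (\<lambda>(u, v). [u..<Suc v]) ` ({..<n} \<times> {..<n})" by (auto simp: PP_def)
qed auto

definition dl :: "nat list => nat list => 'k" where "dl p = (\<lambda>q. if q = p then 1 else 0)"

lemma dl_mem: "p \<in> PP ==> dl p \<in> carrier A"
 by (auto simp: LA_carrier dl_def PP_def)

lemma pf_mem: "pf p \<in> carrier D"
 by (simp add: D_carrier pf_def LA_add_closed LA_scale_closed)

lemma psum_mem: "(\<lambda>x\<in>carrier A. \<Sum>p\<in>Q. c p * x p) \<in> carrier D"
 by (auto simp: D_carrier LA_add_closed LA_scale_closed distrib_left sum.distrib sum_distrib_left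
   mult.left_commute)

lemma D_expand: "\<phi> \<in> carrier D ==> \<phi> = (\<lambda>x\<in>carrier A. \<Sum>p\<in>PP. \<phi> (dl p) * x p)"
proof (rule D_ext[OF _ psum_mem])
 fix x assume \<phi>: "\<phi> \<in> carrier D" and "x \<in> carrier A"
 from this(2) have "\<phi> x = (\<Sum>p\<in>PP. \<phi> (dl p) * x p)"
 proof (induction x rule: LA_induct)
  case zero
  have "(\<lambda>p. 0) \<in> carrier A" by (simp add: LA_carrier)
  then show ?case using D_scaleD[OF \<phi>, of "\<lambda>p. 0" 0] by simp
 next
  case (path u v c)
  then have p: "[u..<Suc v] \<in> PP" and e: "ee n u v = dl [u..<Suc v]" by (auto simp: PP_def ee_def dl_def)
  have "(\<Sum>p\<in>PP. \<phi> (dl p) * (c * dl [u..<Suc v] p)) = (\<Sum>p\<in>PP. if p = [u..<Suc v] then c * \<phi> (dl p) else 0)"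
   by (intro sum.cong) (auto simp: dl_def)
  also have "\<dots> = c * \<phi> (dl [u..<Suc v])" using p finite_PP by simp
  finally show ?case using D_scaleD[OF \<phi> dl_mem[OF p], of c] by (simp add: e)
 next
  case (add a b)
  then show ?case using D_addD[OF \<phi>, of a b] by (simp add: distrib_left sum.distrib)
 qed
 then show "\<phi> x = (\<lambda>x\<in>carrier A. \<Sum>p\<in>PP. \<phi> (dl p) * x p) x" using \<open>x \<in> carrier A\<close> by simp
qed

lemma G_expand:
 assumes \<Psi>: "\<Psi> \<in> carrier G" and "finite Q"
 shows "\<Psi> (cs (\<lambda>x\<in>carrier A. \<Sum>p\<in>Q. c p * x p)) = (\<Sum>p\<in>Q. c p * \<Psi> (cs (pf p)))"
 using assms(2)
proof (induction Q rule: finite_induct)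
 case empty
 have "\<Psi> (cs (\<lambda>x\<in>carrier A. 0 * pf [] x)) = 0 * \<Psi> (cs (pf []))"
  using \<Psi> pf_mem unfolding G_carrier by blast
 moreover have "(\<lambda>x\<in>carrier A. \<Sum>p\<in>{}. c p * x p) = (\<lambda>x\<in>carrier A. 0 * pf [] x)"
  by (rule restrict_ext) simp
 ultimately show ?case by (simp only: mult_zero_left sum.empty)
next
 case (insert p Q)
 let ?s = "\<lambda>x\<in>carrier A. \<Sum>p\<in>Q. c p * x p"
 let ?t = "\<lambda>x\<in>carrier A. c p * pf p x"
 have "(\<lambda>x\<in>carrier A. \<Sum>p\<in>insert p Q. c p * x p) = ?t \<oplus>\<^bsub>D\<^esub> ?s"
  using insert by (auto simp: D_add pf_def fun_eq_iff)
 moreover have "\<Psi> (cs (?t \<oplus>\<^bsub>D\<^esub> ?s)) = \<Psi> (cs ?t) + \<Psi> (cs ?s)"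
  using \<Psi> D_scale_closed[OF pf_mem] psum_mem unfolding G_carrier by blast
 moreover have "\<Psi> (cs ?t) = c p * \<Psi> (cs (pf p))"
  using \<Psi> pf_mem unfolding G_carrier by blast
 ultimately show ?case using insert by simp
qed

definition jinv :: "(((nat list => 'k) => 'k) set => 'k) => nat list => 'k" where
 "jinv \<Psi> = (\<lambda>p. if p \<in> PP \<and> p \<noteq> [i] then \<Psi> (cs (pf p)) else 0)"

lemma jinv_mem: "jinv \<Psi> \<in> Ji"
 by (auto simp: Ji_def jinv_def LA_carrier PP_def)

lemma ev_jinv: "\<Psi> \<in> carrier G ==> ev (jinv \<Psi>) = \<Psi>"
proof (rule ext_F)
 fix \<phi> assume \<Psi>: "\<Psi> \<in> carrier G" and \<phi>: "\<phi> \<in> carrier D"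
 have z: "\<Psi> (cs (pf [i])) = 0"
 proof -
  have "cs (pf [i]) = cs (\<lambda>x\<in>carrier A. 0 * pf [i] x)"
   by (rule cs_eq) (auto simp: pf_def Ji_def)
  then show ?thesis using \<Psi> pf_mem unfolding G_carrier by (metis mult_zero_left)
 qed
 have "ev (jinv \<Psi>) (cs \<phi>) = \<phi> (jinv \<Psi>)" using jinv_mem \<phi> by (rule ev_cs)
 also have "\<dots> = (\<Sum>p\<in>PP. \<phi> (dl p) * jinv \<Psi> p)"
  by (subst D_expand[OF \<phi>]) (simp add: Ji_carrier[OF jinv_mem])
 also have "\<dots> = (\<Sum>p\<in>PP. \<phi> (dl p) * \<Psi> (cs (pf p)))"
  using z by (intro sum.cong) (auto simp: jinv_def)
 also have "\<dots> = \<Psi> (cs (\<lambda>x\<in>carrier A. \<Sum>p\<in>PP. \<phi> (dl p) * x p))"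
  by (rule G_expand[OF \<Psi> finite_PP, symmetric])
 also have "\<dots> = \<Psi> (cs \<phi>)" using D_expand[OF \<phi>] by simp
 finally show "ev (jinv \<Psi>) (cs \<phi>) = \<Psi> (cs \<phi>)" .
qed (auto simp: G_carrier ev_ext)

lemma jinv_ev: "a \<in> Ji ==> jinv (ev a) = a"
proof
 fix p assume a: "a \<in> Ji"
 then have "p \<notin> PP \<or> p = [i] ==> a p = 0" by (auto simp: Ji_def LA_carrier PP_def)
 then show "jinv (ev a) p = a p" using a by (auto simp: jinv_def ev_cs pf_mem) (auto simp: pf_def Ji_carrier)
qed

text \<open>Together with \<open>ev_smult\<close> and \<open>ev_rsmult\<close>: the dual of the quotient is the ideal, as a bimodule.\<close>

lemma G_eq_ev: "carrier G = ev ` Ji"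
 using ev_mem ev_jinv jinv_mem by (auto simp: image_iff) metis

subsection \<open>The functors on modules\<close>

context
 fixes M :: "(nat list => 'k, 'v) module"
 assumes M: "LA_mod n M"
begin

interpretation M: LA_mod n M by (rule M)

abbreviation C :: "(nat list => 'k, (((nat list => 'k) => 'k) set => 'k) => 'v) module"
 where "C \<equiv> G_obj n i M"

text \<open>An element of \<open>G\<^sub>i M\<close> is a homomorphism of left modules from the ideal to \<open>M\<close>.\<close>

lemma C_carrier: "h \<in> carrier C \<longleftrightarrow> h \<in> extensional (carrier G) \<and> (\<forall>a\<in>Ji. h (ev a) \<in> carrier M) \<and>
  (\<forall>a\<in>Ji. \<forall>b\<in>Ji. h (ev (\<lambda>p. a p + b p)) = h (ev a) \<oplus>\<^bsub>M\<^esub> h (ev b)) \<and>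
  (\<forall>b\<in>carrier A. \<forall>a\<in>Ji. h (ev (b \<otimes>\<^bsub>A\<^esub> a)) = b \<odot>\<^bsub>M\<^esub> h (ev a))"
proof -
 have "h \<in> carrier C \<longleftrightarrow> h \<in> carrier G \<rightarrow>\<^sub>E carrier M \<and>
  (\<forall>x\<in>carrier G. \<forall>y\<in>carrier G. h (x \<oplus>\<^bsub>G\<^esub> y) = h x \<oplus>\<^bsub>M\<^esub> h y) \<and>
  (\<forall>b\<in>carrier A. \<forall>x\<in>carrier G. h (b \<odot>\<^bsub>G\<^esub> x) = b \<odot>\<^bsub>M\<^esub> h x)"
  by (simp add: G_obj_def hom_module_def mod_hom_def)
 also have "\<dots> \<longleftrightarrow> h \<in> extensional (carrier G) \<and> (\<forall>a\<in>Ji. h (ev a) \<in> carrier M) \<and>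
  (\<forall>a\<in>Ji. \<forall>b\<in>Ji. h (ev a \<oplus>\<^bsub>G\<^esub> ev b) = h (ev a) \<oplus>\<^bsub>M\<^esub> h (ev b)) \<and>
  (\<forall>b\<in>carrier A. \<forall>a\<in>Ji. h (b \<odot>\<^bsub>G\<^esub> ev a) = b \<odot>\<^bsub>M\<^esub> h (ev a))"
  unfolding G_eq_ev PiE_def Pi_def by blast
 finally show ?thesis by (simp add: ev_add ev_smult)
qed

lemma C_ext: "[|h \<in> carrier C; h' \<in> carrier C; \<And>a. a \<in> Ji ==> h (ev a) = h' (ev a)|] ==> h = h'"
 by (rule extensionalityI[of _ "carrier G"]) (auto simp: C_carrier G_eq_ev)

lemma C_mem: "[|h \<in> carrier C; a \<in> Ji|] ==> h (ev a) \<in> carrier M"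
 and C_addD: "[|h \<in> carrier C; a \<in> Ji; b \<in> Ji|] ==> h (ev (\<lambda>p. a p + b p)) = h (ev a) \<oplus>\<^bsub>M\<^esub> h (ev b)"
 and C_smultD: "[|h \<in> carrier C; b \<in> carrier A; a \<in> Ji|] ==> h (ev (b \<otimes>\<^bsub>A\<^esub> a)) = b \<odot>\<^bsub>M\<^esub> h (ev a)"
 by (simp_all add: C_carrier)

lemma C_add: "a \<in> Ji ==> (h \<oplus>\<^bsub>C\<^esub> h') (ev a) = h (ev a) \<oplus>\<^bsub>M\<^esub> h' (ev a)"
 and C_zero: "a \<in> Ji ==> \<zero>\<^bsub>C\<^esub> (ev a) = \<zero>\<^bsub>M\<^esub>"
 and C_smult: "[|a \<in> Ji; b \<in> carrier A|] ==> (b \<odot>\<^bsub>C\<^esub> h) (ev a) = h (ev (a \<otimes>\<^bsub>A\<^esub> b))"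
 by (simp_all add: G_obj_def hom_module_def ev_mem ev_rsmult)

lemma C_ops_ext: "h \<oplus>\<^bsub>C\<^esub> h' \<in> extensional (carrier G)" "\<zero>\<^bsub>C\<^esub> \<in> extensional (carrier G)"
  "b \<odot>\<^bsub>C\<^esub> h \<in> extensional (carrier G)"
 by (simp_all add: G_obj_def hom_module_def)

lemma C_add_closed: "[|h \<in> carrier C; h' \<in> carrier C|] ==> h \<oplus>\<^bsub>C\<^esub> h' \<in> carrier C"
proof -
 assume h: "h \<in> carrier C" and h': "h' \<in> carrier C"
 have "(h (ev a) \<oplus>\<^bsub>M\<^esub> h (ev b)) \<oplus>\<^bsub>M\<^esub> (h' (ev a) \<oplus>\<^bsub>M\<^esub> h' (ev b)) =
   (h (ev a) \<oplus>\<^bsub>M\<^esub> h' (ev a)) \<oplus>\<^bsub>M\<^esub> (h (ev b) \<oplus>\<^bsub>M\<^esub> h' (ev b))" if "a \<in> Ji" "b \<in> Ji" for a b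
  using M.W.pls_swap[of "h (ev a)" "h (ev b)" "h' (ev a)" "h' (ev b)"] C_mem[OF h] C_mem[OF h'] that
  by simp
 then show ?thesis
  using C_mem[OF h] C_mem[OF h'] C_addD[OF h] C_addD[OF h'] C_smultD[OF h] C_smultD[OF h']
  unfolding C_carrier by (auto simp: C_ops_ext C_add Ji_add Ji_mult_left M.L.smult_r_distr)
qed

lemma C_zero_closed: "\<zero>\<^bsub>C\<^esub> \<in> carrier C"
 unfolding C_carrier by (auto simp: C_ops_ext C_zero Ji_add Ji_mult_left M.smult_zero_right)

lemma C_smult_closed: "[|b \<in> carrier A; h \<in> carrier C|] ==> b \<odot>\<^bsub>C\<^esub> h \<in> carrier C"
proof -
 assume b: "b \<in> carrier A" and h: "h \<in> carrier C"
 have "h (ev ((\<lambda>p. x p + y p) \<otimes>\<^bsub>A\<^esub> b)) = h (ev (x \<otimes>\<^bsub>A\<^esub> b)) \<oplus>\<^bsub>M\<^esub> h (ev (y \<otimes>\<^bsub>A\<^esub> b))"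
  if "x \<in> Ji" "y \<in> Ji" for x y
  using C_addD[OF h Ji_mult_right[OF b that(1)] Ji_mult_right[OF b that(2)]] LA_distr_l[of n x y b] by simp
 moreover have "h (ev (c \<otimes>\<^bsub>A\<^esub> x \<otimes>\<^bsub>A\<^esub> b)) = c \<odot>\<^bsub>M\<^esub> h (ev (x \<otimes>\<^bsub>A\<^esub> b))"
  if "c \<in> carrier A" "x \<in> Ji" for c x
  using C_smultD[OF h that(1) Ji_mult_right[OF b that(2)]] LA_mult_assoc[OF that(1) Ji_carrier[OF that(2)] b] by simp
 ultimately show ?thesis
  using C_mem[OF h] b
  unfolding C_carrier by (auto simp: C_ops_ext C_smult Ji_add Ji_mult_left Ji_mult_right)
qed

lemma C_left_module: "left_module A C"
proof (intro left_module.intro left_module_axioms.intro ring_LA)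
 show "abelian_group C"
 proof (rule abelian_groupI)
  fix x y z assume m: "x \<in> carrier C" "y \<in> carrier C" "z \<in> carrier C"
  show "x \<oplus>\<^bsub>C\<^esub> y \<oplus>\<^bsub>C\<^esub> z = x \<oplus>\<^bsub>C\<^esub> (y \<oplus>\<^bsub>C\<^esub> z)"
   by (rule C_ext) (use m C_mem in \<open>auto simp: C_add_closed C_add M.L.M.a_assoc\<close>)
  show "x \<oplus>\<^bsub>C\<^esub> y = y \<oplus>\<^bsub>C\<^esub> x"
   by (rule C_ext) (use m C_mem in \<open>auto simp: C_add_closed C_add M.L.M.a_comm\<close>)
  show "\<zero>\<^bsub>C\<^esub> \<oplus>\<^bsub>C\<^esub> x = x"
   by (rule C_ext) (use m C_mem in \<open>auto simp: C_add_closed C_zero_closed C_add C_zero\<close>)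
  let ?s = "\<lambda>p. -1 * \<one>\<^bsub>A\<^esub> p"
  have s: "?s \<in> carrier A" by (rule LA_scale_closed[OF LA_one_closed])
  have "?s \<odot>\<^bsub>C\<^esub> x \<oplus>\<^bsub>C\<^esub> x = \<zero>\<^bsub>C\<^esub>"
  proof (rule C_ext)
   fix a assume a: "a \<in> Ji"
   have "(?s \<odot>\<^bsub>C\<^esub> x) (ev a) = x (ev (a \<otimes>\<^bsub>A\<^esub> ?s))" by (rule C_smult[OF a s])
   also have "a \<otimes>\<^bsub>A\<^esub> ?s = ?s \<otimes>\<^bsub>A\<^esub> a"
    using Ji_carrier[OF a] by (simp only: LA_mult_scale LA_scale_mult LA_one_left LA_one_right)
   also have "x (ev (?s \<otimes>\<^bsub>A\<^esub> a)) = scalar_act A M (-1) (x (ev a))"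
    using C_smultD[OF m(1) s a] by (simp add: scalar_act_def)
   finally have "(?s \<odot>\<^bsub>C\<^esub> x) (ev a) = scalar_act A M (-1) (x (ev a))" .
   then show "(?s \<odot>\<^bsub>C\<^esub> x \<oplus>\<^bsub>C\<^esub> x) (ev a) = \<zero>\<^bsub>C\<^esub> (ev a)"
    using M.W.pls_neg'[of "x (ev a)"] C_mem[OF m(1) a] by (simp only: C_add[OF a] C_zero[OF a]) simp
  qed (use C_smult_closed[OF s m(1)] m(1) C_add_closed C_zero_closed in blast)+
  then show "\<exists>y\<in>carrier C. y \<oplus>\<^bsub>C\<^esub> x = \<zero>\<^bsub>C\<^esub>"
   using C_smult_closed[OF s m(1)] by blast
 qed (simp_all add: C_add_closed C_zero_closed)
 fix a b x y assume x: "x \<in> carrier C"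
 show "\<one>\<^bsub>A\<^esub> \<odot>\<^bsub>C\<^esub> x = x"
  by (rule C_ext) (use x in \<open>auto simp: C_smult_closed LA_one_closed C_smult LA_one_right Ji_carrier\<close>)
 assume a: "a \<in> carrier A"
 show "a \<odot>\<^bsub>C\<^esub> x \<in> carrier C" using a x by (rule C_smult_closed)
 {
  assume b: "b \<in> carrier A"
  show "(a \<oplus>\<^bsub>A\<^esub> b) \<odot>\<^bsub>C\<^esub> x = a \<odot>\<^bsub>C\<^esub> x \<oplus>\<^bsub>C\<^esub> b \<odot>\<^bsub>C\<^esub> x"
  proof (rule C_ext)
   fix c assume c: "c \<in> Ji"
   have "x (ev (c \<otimes>\<^bsub>A\<^esub> (a \<oplus>\<^bsub>A\<^esub> b))) = x (ev (c \<otimes>\<^bsub>A\<^esub> a)) \<oplus>\<^bsub>M\<^esub> x (ev (c \<otimes>\<^bsub>A\<^esub> b))"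
    using C_addD[OF x Ji_mult_right[OF a c] Ji_mult_right[OF b c]] LA_distr_r[of n c a b] by simp
   then show "((a \<oplus>\<^bsub>A\<^esub> b) \<odot>\<^bsub>C\<^esub> x) (ev c) = (a \<odot>\<^bsub>C\<^esub> x \<oplus>\<^bsub>C\<^esub> b \<odot>\<^bsub>C\<^esub> x) (ev c)"
    using a b c by (simp add: C_add C_smult LA_add_closed)
  qed (use a b x in \<open>simp_all add: C_smult_closed C_add_closed LA_add_closed\<close>)
  show "(a \<otimes>\<^bsub>A\<^esub> b) \<odot>\<^bsub>C\<^esub> x = a \<odot>\<^bsub>C\<^esub> (b \<odot>\<^bsub>C\<^esub> x)"
   by (rule C_ext) (use a b x in \<open>auto simp: C_smult_closed LA_mult_closed C_smult Ji_mult_right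
    LA_mult_assoc Ji_carrier\<close>)
 }
 assume y: "y \<in> carrier C"
 show "a \<odot>\<^bsub>C\<^esub> (x \<oplus>\<^bsub>C\<^esub> y) = a \<odot>\<^bsub>C\<^esub> x \<oplus>\<^bsub>C\<^esub> a \<odot>\<^bsub>C\<^esub> y"
  by (rule C_ext) (use a x y in \<open>auto simp: C_smult_closed C_add_closed C_smult C_add Ji_mult_right\<close>)
qed

interpretation C: LA_mod n C by (rule LA_mod.intro[OF C_left_module])

text \<open>A homomorphism from the part of the ideal that starts at \<open>u\<close> is determined by its value at the
 shortest path.\<close>

definition theta :: "nat => ((((nat list => 'k) => 'k) set => 'k) => 'v) => 'v" where
 "theta u h = h (ev (ee n u (gi i u)))"

lemma ee_Ji: "(u, v) \<noteq> (i, i) ==> ee n u v \<in> Ji"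
 unfolding Ji_def single_path by (auto simp: ee_cf)

lemma ee_gi_Ji: "ee n u (gi i u) \<in> Ji"
 by (rule ee_Ji) (auto simp: gi_def)

lemma C_Tr: "[|h \<in> carrier C; a \<in> Ji|] ==> Tr n C u v h (ev a) = h (ev (a \<otimes>\<^bsub>A\<^esub> ee n u v))"
 by (simp add: Tr_def C_smult)

lemma theta_Tr:
 assumes h: "h \<in> carrier C" and uv: "u \<le> v"
 shows "theta v (Tr n C u v h) = Tr n M (gi i u) (gi i v) (theta u h)"
proof -
 have "theta v (Tr n C u v h) = h (ev (ee n v (gi i v) \<otimes>\<^bsub>A\<^esub> ee n u v))"
  unfolding theta_def by (rule C_Tr[OF h ee_gi_Ji])
 also have "ee n v (gi i v) \<otimes>\<^bsub>A\<^esub> ee n u v = ee n u (gi i v)" by (rule ee_mult[OF uv gi_ge])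
 also have "\<dots> = ee n (gi i u) (gi i v) \<otimes>\<^bsub>A\<^esub> ee n u (gi i u)"
  by (rule ee_mult[symmetric]) (auto simp: gi_ge gi_mono uv)
 also have "h (ev \<dots>) = Tr n M (gi i u) (gi i v) (theta u h)"
  using C_smultD[OF h ee_carrier ee_gi_Ji] by (simp add: theta_def Tr_def)
 finally show ?thesis .
qed

text \<open>The inverse of \<open>theta\<close>: the left ideal of paths starting at \<open>u\<close>, without the constant path at
 \<open>i\<close>, is free on the path from \<open>u\<close> to \<open>gi i u\<close>.\<close>

definition quo :: "nat => (nat list => 'k) => nat list => 'k" where
 "quo u a = (\<lambda>p. if p \<in> PP \<and> hd p = gi i u then a [u..<Suc (last p)] else 0)"

lemma quo_mem: "quo u a \<in> carrier A"
 by (auto simp: LA_carrier quo_def PP_def)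

lemma quo_cf: "x \<le> y ==> quo u a [x..<Suc y] = (if 1 \<le> x \<and> y < n \<and> x = gi i u then a [u..<Suc y] else 0)"
proof -
 assume xy: "x \<le> y"
 then have p: "[x..<Suc y] \<in> PP \<longleftrightarrow> 1 \<le> x \<and> y < n"
  by (auto simp: PP_def upt_Suc_eq_iff)
 have e: "hd [x..<Suc y] = x" "last [x..<Suc y] = y" using xy by simp_all
 show ?thesis unfolding quo_def by (simp only: p e conj_assoc)
qed

text \<open>Every element of the ideal that starts at \<open>u\<close> is a left multiple of the path from \<open>u\<close> to \<open>gi i u\<close>.
 Of the paths that start at \<open>u\<close>, only the trivial path at \<open>i\<close> fails to factor through that path, and
 its coefficient is zero.\<close>

lemma quo_mult_path:
 assumes a: "a \<in> Ji" and u: "1 \<le> u"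
 shows "quo u a \<otimes>\<^bsub>A\<^esub> ee n u (gi i u) = a \<otimes>\<^bsub>A\<^esub> ee n u u"
proof (rule LA_eqI)
 fix x y assume xy: "1 \<le> x" "x \<le> y" "y < n"
 have "(quo u a \<otimes>\<^bsub>A\<^esub> ee n u (gi i u)) [x..<Suc y] =
   (\<Sum>z\<in>{x..y}. if z = gi i u then if x = u then a [u..<Suc y] else 0 else 0)"
  unfolding LA_mult_cf[OF xy(2)]
  by (rule sum.cong) (use xy gi_ge[of u i] u in \<open>auto simp: ee_cf quo_cf\<close>)
 also have "\<dots> = (if x = u \<and> gi i u \<le> y then a [u..<Suc y] else 0)" using gi_ge[of u i] by auto
 also have "\<dots> = (if x = u then a [u..<Suc y] else 0)"
 proof -
  have "a [u..<Suc y] = 0" if "\<not> gi i u \<le> y" "x = u"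
  proof -
   have "u = i" "y = i" using that xy by (auto simp: gi_def split: if_splits)
   then show ?thesis using a by (simp add: Ji_def single_path)
  qed
  then show ?thesis by auto
 qed
 also have "\<dots> = (\<Sum>z\<in>{x..y}. if z = u then if x = u then a [u..<Suc y] else 0 else 0)"
  using xy by auto
 also have "\<dots> = (a \<otimes>\<^bsub>A\<^esub> ee n u u) [x..<Suc y]"
  unfolding LA_mult_cf[OF xy(2)] by (rule sum.cong) (use xy in \<open>auto simp: ee_cf\<close>)
 finally show "(quo u a \<otimes>\<^bsub>A\<^esub> ee n u (gi i u)) [x..<Suc y] = (a \<otimes>\<^bsub>A\<^esub> ee n u u) [x..<Suc y]" .
qed (use a in \<open>auto simp: LA_mult_closed quo_mem Ji_carrier\<close>)

lemma theta_lin: "lin (Sp n C u) (Sp n M (gi i u)) (theta u)"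
proof (rule linI)
  fix h assume h: "h \<in> car (Sp n C u)"
  then have hC: "h \<in> carrier C" by (rule C.Sp_carrier)
  show "theta u h \<in> car (Sp n M (gi i u))"
   using theta_Tr[OF hC, of u u] C.Tr_id[OF h] C_mem[OF hC ee_gi_Ji] by (simp add: Sp_car theta_def)
  show "theta u (scl (Sp n C u) c h) = scl (Sp n M (gi i u)) c (theta u h)" for c
  proof -
   let ?s = "\<lambda>p. c * \<one>\<^bsub>A\<^esub> p" and ?e = "ee n u (gi i u)"
   have s: "?s \<in> carrier A" by (simp add: LA_scale_closed LA_one_closed)
   have "theta u (scl (Sp n C u) c h) = h (ev (?e \<otimes>\<^bsub>A\<^esub> ?s))"
    using C_smult[OF ee_gi_Ji s] by (simp add: theta_def scalar_act_def)
   also have "?e \<otimes>\<^bsub>A\<^esub> ?s = ?s \<otimes>\<^bsub>A\<^esub> ?e"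
    by (simp only: LA_mult_scale LA_scale_mult LA_one_left[OF ee_carrier] LA_one_right[OF ee_carrier])
   finally show ?thesis using C_smultD[OF hC s ee_gi_Ji] by (simp add: theta_def scalar_act_def)
  qed
qed (simp add: theta_def C_add ee_gi_Ji)

text \<open>Injectivity is the factorization \<open>quo_mult_path\<close>, and the preimage of \<open>m\<close> sends \<open>a\<close> to the product
 of the quotient \<open>quo u a\<close> with \<open>m\<close>. Outside the quiver both components vanish, and if \<open>u\<close> is the
 last vertex and equal to \<open>i\<close>, then the component at \<open>n\<close> is zero, as it should be.\<close>

lemma theta_liso:
 assumes u: "1 \<le> u"
 shows "liso (Sp n C u) (Sp n M (gi i u)) (theta u)"
proof (cases "u < n")
 case True
 note u = u True
 note l = theta_lin[of u]
 have "bij_betw (theta u) (car (Sp n C u)) (car (Sp n M (gi i u)))"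
 proof (rule bij_betw_imageI)
  show "inj_on (theta u) (car (Sp n C u))"
  proof (rule inj_onI)
   fix h h' assume hm: "h \<in> car (Sp n C u)" "h' \<in> car (Sp n C u)" and e: "theta u h = theta u h'"
   have "g (ev a) = quo u a \<odot>\<^bsub>M\<^esub> theta u g" if g: "g \<in> car (Sp n C u)" and a: "a \<in> Ji" for g a
   proof -
    have gC: "g \<in> carrier C" using g by (rule C.Sp_carrier)
    have "g (ev a) = Tr n C u u g (ev a)" using C.Tr_id[OF g] by simp
    also have "\<dots> = g (ev (quo u a \<otimes>\<^bsub>A\<^esub> ee n u (gi i u)))"
     using C_Tr[OF gC a] quo_mult_path[OF a u(1)] by simp
    also have "\<dots> = quo u a \<odot>\<^bsub>M\<^esub> theta u g"
     using C_smultD[OF gC quo_mem ee_gi_Ji] by (simp add: theta_def)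
    finally show ?thesis .
   qed
   then have "h (ev a) = h' (ev a)" if "a \<in> Ji" for a using hm e that by metis
   then show "h = h'" using C.Sp_carrier[OF hm(1)] C.Sp_carrier[OF hm(2)] by (intro C_ext)
  qed
  have "m \<in> theta u ` car (Sp n C u)" if m: "m \<in> car (Sp n M (gi i u))" for m
  proof -
   have mM: "m \<in> carrier M" using m by (rule M.Sp_carrier)
   \<comment> \<open>the homomorphism that sends the path from \<open>u\<close> to \<open>gi i u\<close> to \<open>m\<close>\<close>
   define h where "h = (\<lambda>\<Psi>\<in>carrier G. quo u (jinv \<Psi>) \<odot>\<^bsub>M\<^esub> m)"
   have hev: "h (ev a) = quo u a \<odot>\<^bsub>M\<^esub> m" if "a \<in> Ji" for a
    using that by (simp add: h_def ev_mem jinv_ev)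
   have qa: "quo u (\<lambda>p. a p + b p) = (\<lambda>p. quo u a p + quo u b p)" for a b
    by (auto simp: quo_def)
   have qm: "quo u (b \<otimes>\<^bsub>A\<^esub> a) = b \<otimes>\<^bsub>A\<^esub> quo u a" if b: "b \<in> carrier A" and a: "a \<in> Ji" for a b
   proof (rule LA_eqI[OF quo_mem LA_mult_closed[OF b quo_mem]])
    fix x y assume xy: "1 \<le> x" "x \<le> y" "y < n"
    show "quo u (b \<otimes>\<^bsub>A\<^esub> a) [x..<Suc y] = (b \<otimes>\<^bsub>A\<^esub> quo u a) [x..<Suc y]"
    proof (cases "x = gi i u")
     case True
     have ux: "u \<le> x" using True gi_ge by simp
     have "quo u (b \<otimes>\<^bsub>A\<^esub> a) [x..<Suc y] = (\<Sum>z\<in>{u..y}. b [z..<Suc y] * a [u..<Suc z])"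
      using xy True ux by (simp add: quo_cf LA_mult_cf)
     also have "\<dots> = (\<Sum>z\<in>{x..y}. b [z..<Suc y] * a [u..<Suc z])"
     proof (rule sum.mono_neutral_right)
      show "\<forall>z\<in>{u..y} - {x..y}. b [z..<Suc y] * a [u..<Suc z] = 0"
      proof
       fix z assume "z \<in> {u..y} - {x..y}"
       then have "u = i" "z = i" using True by (auto simp: gi_def split: if_splits)
       then show "b [z..<Suc y] * a [u..<Suc z] = 0" using a by (simp add: Ji_def single_path)
      qed
     qed (use ux in auto)
     also have "\<dots> = (b \<otimes>\<^bsub>A\<^esub> quo u a) [x..<Suc y]"
      using xy True by (auto simp: LA_mult_cf quo_cf intro!: sum.cong)
     finally show ?thesis .
    next
     case False
     then show ?thesis using xy by (simp add: LA_mult_cf quo_cf)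
    qed
   qed
   have hC: "h \<in> carrier C"
    unfolding C_carrier
    using mM by (auto simp: hev Ji_add Ji_mult_left qa qm M.smult_add quo_mem M.L.smult_closed M.L.smult_assoc)
     (simp add: h_def)
   have "Tr n C u u h = h"
   proof (rule C_ext)
    fix a assume a: "a \<in> Ji"
    have "quo u (a \<otimes>\<^bsub>A\<^esub> ee n u u) = quo u a"
    proof (rule LA_eqI[OF quo_mem quo_mem])
     fix x y assume xy: "1 \<le> x" "x \<le> y" "y < n"
     have "(a \<otimes>\<^bsub>A\<^esub> ee n u u) [u..<Suc y] = a [u..<Suc y]" if "u \<le> y"
     proof -
      have "(a \<otimes>\<^bsub>A\<^esub> ee n u u) [u..<Suc y] = (\<Sum>z\<in>{u..y}. if z = u then a [u..<Suc y] else 0)"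
       unfolding LA_mult_cf[OF that] by (rule sum.cong) (use u in \<open>auto simp: ee_cf\<close>)
      then show ?thesis using that by simp
     qed
     then show "quo u (a \<otimes>\<^bsub>A\<^esub> ee n u u) [x..<Suc y] = quo u a [x..<Suc y]"
      using xy gi_ge[of u i] by (auto simp: quo_cf)
    qed
    then show "Tr n C u u h (ev a) = h (ev a)"
     using a hC by (simp add: C_Tr hev Ji_mult_right)
   qed (use hC in auto)
   then have "h \<in> car (Sp n C u)" using hC by (simp add: Sp_car)
   moreover have "theta u h = m"
   proof -
    have "quo u (ee n u (gi i u)) = ee n (gi i u) (gi i u)"
    proof (rule LA_eqI[OF quo_mem ee_carrier])
     fix x y assume xy: "1 \<le> x" "x \<le> y" "y < n"
     then show "quo u (ee n u (gi i u)) [x..<Suc y] = ee n (gi i u) (gi i u) [x..<Suc y]"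
      using u gi_ge[of u i] by (auto simp: quo_cf ee_cf)
    qed
    then show ?thesis using hev[OF ee_gi_Ji] M.Tr_id[OF m] by (simp add: theta_def Tr_def)
   qed
   ultimately show ?thesis by blast
  qed
  then show "theta u ` car (Sp n C u) = car (Sp n M (gi i u))"
   using lin_mem[OF l] by auto
 qed
 then show ?thesis using l by (simp add: liso_def)
next
 case False
 then have "gi i u = u" using i by (simp add: gi_def)
 moreover have "car (Sp n C u) = {zer (Sp n C u)}" "car (Sp n M u) = {zer (Sp n M u)}"
  using False C.Sp_outside M.Sp_outside by auto
 ultimately show ?thesis
  using lin_zer[OF theta_lin C.Sp_vspace M.Sp_vspace, of u] theta_lin[of u]
  by (simp add: liso_def bij_betw_def)
qed

end

lemma theta_G_arr:
 assumes M: "LA_mod n M" and h: "h \<in> carrier (G_obj n i M)"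
 shows "theta u (G_arr n i (M, f, N) h) = f (theta u h)"
 using h by (simp add: theta_def[OF M] G_arr_def arr_map_def compose_def ev_mem ee_gi_Ji[OF M])

lemma G_arr_mem:
 assumes M: "LA_mod n M" and N: "LA_mod n N" and f: "f \<in> mod_hom A M N"
 shows "G_arr n i (M, f, N) \<in> mod_hom A (G_obj n i M) (G_obj n i N)"
proof -
 interpret M: LA_mod n M by fact
 interpret N: LA_mod n N by fact
 interpret LA_mod2 n M N by unfold_locales
 let ?g = "G_arr n i (M, f, N)"
 have v: "?g h (ev a) = f (h (ev a))" if "h \<in> carrier (G_obj n i M)" "a \<in> Ji" for h a
  using that by (simp add: G_arr_def arr_map_def compose_def ev_mem)
 have e: "?g h \<in> extensional (carrier G)" if "h \<in> carrier (G_obj n i M)" for h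
  using that by (simp add: G_arr_def compose_def)
 have m: "?g h \<in> carrier (G_obj n i N)" if h: "h \<in> carrier (G_obj n i M)" for h
  unfolding C_carrier[OF N] using f C_mem[OF M h]
  by (auto simp: e[OF h] v[OF h] Ji_add Ji_mult_left C_addD[OF M h] C_smultD[OF M h] mod_hom_def)
 show ?thesis
  unfolding mod_hom_def
 proof (intro CollectI conjI ballI)
  show "?g \<in> carrier (G_obj n i M) \<rightarrow>\<^sub>E carrier (G_obj n i N)"
   using m by (auto simp: G_arr_def)
  fix h assume h: "h \<in> carrier (G_obj n i M)"
  {
   fix h' assume h': "h' \<in> carrier (G_obj n i M)"
   show "?g (h \<oplus>\<^bsub>G_obj n i M\<^esub> h') = ?g h \<oplus>\<^bsub>G_obj n i N\<^esub> ?g h'"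
   proof (rule C_ext[OF N])
    fix a assume a: "a \<in> Ji"
    show "?g (h \<oplus>\<^bsub>G_obj n i M\<^esub> h') (ev a) = (?g h \<oplus>\<^bsub>G_obj n i N\<^esub> ?g h') (ev a)"
     using f a h h' C_mem[OF M h a] C_mem[OF M h' a]
     by (simp add: v C_add_closed[OF M] C_add[OF M] C_add[OF N] mod_hom_def)
   qed (use h h' m C_add_closed[OF M] C_add_closed[OF N] in auto)
  }
  fix b assume b: "b \<in> carrier A"
  show "?g (b \<odot>\<^bsub>G_obj n i M\<^esub> h) = b \<odot>\<^bsub>G_obj n i N\<^esub> ?g h"
   by (rule C_ext[OF N]) (use b h m in \<open>auto simp: v C_smult_closed[OF M] C_smult_closed[OF N]
    C_smult[OF M] C_smult[OF N] Ji_mult_right\<close>)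
 qed
qed

end

section \<open>A category equivalent to the finite dimensional modules\<close>

lemma Homset_Arr: "f \<in> Homset C x y ==> f \<in> Arr C"
 and Homset_Dom: "f \<in> Homset C x y ==> Dom C f = x"
 and Homset_Cod: "f \<in> Homset C x y ==> Cod C f = y"
 and HomsetI: "f \<in> Arr C ==> f \<in> Homset C (Dom C f) (Cod C f)"
 by (simp_all add: Homset_def)

lemma (in category) iso_cancel:
 assumes "is_iso_arr C e" "e \<in> Homset C x y" "f \<in> Homset C y z" "g \<in> Homset C y z"
  and "f \<bullet>\<^bsub>C\<^esub> e = g \<bullet>\<^bsub>C\<^esub> e"
 shows "f = g"
proof -
 obtain d where d: "d \<in> Homset C y x" "e \<bullet>\<^bsub>C\<^esub> d = Ident C y"
  using assms(1,2) by (auto simp: is_iso_arr_def Homset_def)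
 have "f = (f \<bullet>\<^bsub>C\<^esub> e) \<bullet>\<^bsub>C\<^esub> d" using comp_assoc[OF d(1) assms(2,3)] d(2) comp_ident_right[OF assms(3)] by simp
 also have "\<dots> = (g \<bullet>\<^bsub>C\<^esub> e) \<bullet>\<^bsub>C\<^esub> d" using assms(5) by simp
 also have "\<dots> = g" using comp_assoc[OF d(1) assms(2,4)] d(2) comp_ident_right[OF assms(4)] by simp
 finally show ?thesis .
qed

lemma functor_Obj: "[|is_functor C D F; x \<in> Obj C|] ==> F$x \<in> Obj D"
 and functor_Homset: "[|is_functor C D F; f \<in> Homset C x y|] ==> on_arr F f \<in> Homset D F$x F$y"
 and functor_Ident: "[|is_functor C D F; x \<in> Obj C|] ==> on_arr F (Ident C x) = Ident D F$x"
 and functor_Comp: "[|is_functor C D F; f \<in> Homset C x y; g \<in> Homset C y z|] ==>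
  on_arr F (g \<bullet>\<^bsub>C\<^esub> f) = on_arr F g \<bullet>\<^bsub>D\<^esub> on_arr F f"
 by (auto simp: is_functor_def Homset_def)

lemma comp_functor_simps [simp]:
 "on_obj (F \<circ>\<^sub>F G) x = F$(G$x)" "on_arr (F \<circ>\<^sub>F G) f = on_arr F (on_arr G f)"
 by (simp_all add: comp_functor_def)

lemma id_functor_simps [simp]: "id_functor$x = x" "on_arr id_functor f = f"
 by (simp_all add: id_functor_def)

lemma comp_functor_functor: "[|is_functor C D F; is_functor B C G|] ==> is_functor B D (F \<circ>\<^sub>F G)"
 by (auto simp: is_functor_def Homset_def)

lemma id_functor_functor: "category C ==> is_functor C C id_functor"
 by (auto simp: is_functor_def Homset_def)

lemma comp_functor_assoc: "(F \<circ>\<^sub>F G) \<circ>\<^sub>F H = F \<circ>\<^sub>F (G \<circ>\<^sub>F H)"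
 by (simp add: comp_functor_def comp_assoc)

lemma comp_functor_id [simp]: "F \<circ>\<^sub>F id_functor = F" "id_functor \<circ>\<^sub>F F = F"
 by (simp_all add: comp_functor_def id_functor_def)

text \<open>A functor with a left inverse up to isomorphism is faithful.\<close>

lemma faithful:
 assumes "category C" "is_functor C D F" and iso: "functors_iso C C (G \<circ>\<^sub>F F) id_functor"
  and f: "f \<in> Homset C x y" and g: "g \<in> Homset C x y" and e: "on_arr F f = on_arr F g"
 shows "f = g"
proof -
 interpret category C by fact
 obtain \<eta> where \<eta>: "nat_trans C C (G \<circ>\<^sub>F F) id_functor \<eta>" "\<And>x. x \<in> Obj C ==> is_iso_arr C (\<eta> x)"
  using iso by (auto simp: functors_iso_def)
 have x: "x \<in> Obj C" using f dom_obj by (auto simp: Homset_def)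
 have "f \<bullet>\<^bsub>C\<^esub> \<eta> x = \<eta> y \<bullet>\<^bsub>C\<^esub> on_arr G (on_arr F f)" "g \<bullet>\<^bsub>C\<^esub> \<eta> x = \<eta> y \<bullet>\<^bsub>C\<^esub> on_arr G (on_arr F g)"
  using \<eta>(1) f g by (auto simp: nat_trans_def Homset_def)
 then have "f \<bullet>\<^bsub>C\<^esub> \<eta> x = g \<bullet>\<^bsub>C\<^esub> \<eta> x" using e by simp
 moreover have "\<eta> x \<in> Homset C (G$(F$x)) x" using \<eta>(1) x by (simp add: nat_trans_def)
 ultimately show ?thesis using iso_cancel[OF \<eta>(2)[OF x]] f g by blast
qed

lemma fdmod_Obj: "M \<in> Obj (fdmod (LA n)) \<longleftrightarrow> left_module (LA n) M \<and> fin_dim (LA n) M"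
 by (simp add: fdmod_def)

lemma fdmod_Homset: "f \<in> Homset (fdmod (LA n)) M N \<longleftrightarrow>
  M \<in> Obj (fdmod (LA n)) \<and> N \<in> Obj (fdmod (LA n)) \<and> f = (M, arr_map f, N) \<and> arr_map f \<in> mod_hom (LA n) M N"
 by (cases f) (auto simp: Homset_def fdmod_def arr_map_def)

lemma fdmod_Comp: "g \<in> Homset (fdmod (LA n)) N N' ==> f \<in> Homset (fdmod (LA n)) M N ==>
  g \<bullet>\<^bsub>fdmod (LA n)\<^esub> f = (M, compose (carrier M) (arr_map g) (arr_map f), N')"
 by (cases f, cases g) (auto simp: Homset_def fdmod_def arr_map_def)

lemma fdmod_Ident: "Ident (fdmod (LA n)) M = (M, restrict id (carrier M), M)"
 by (simp add: fdmod_def)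

lemma arr_map_simp [simp]: "arr_map (M, f, N) = f"
 by (simp add: arr_map_def)

lemma mod_hom_compose:
 assumes "LA_mod n M" "f \<in> mod_hom (LA n) M N" "g \<in> mod_hom (LA n) N N'"
 shows "compose (carrier M) g f \<in> mod_hom (LA n) M N'"
proof -
 interpret M: LA_mod n M by fact
 show ?thesis
  using assms(2,3) by (auto simp: mod_hom_def compose_def M.L.smult_closed M.L.M.a_closed PiE_def Pi_def)
qed

lemma mod_hom_id: "LA_mod n M ==> restrict id (carrier M) \<in> mod_hom (LA n) M M"
proof -
 assume "LA_mod n M"
 then interpret M: LA_mod n M .
 show ?thesis by (auto simp: mod_hom_def M.L.smult_closed M.L.M.a_closed)
qed

lemma category_fdmod: "category (fdmod (LA n))"
proof
 fix f x y g z assume f: "f \<in> Homset (fdmod (LA n)) x y" and g: "g \<in> Homset (fdmod (LA n)) y z"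
 then show "g \<bullet>\<^bsub>fdmod (LA n)\<^esub> f \<in> Homset (fdmod (LA n)) x z"
  unfolding fdmod_Comp[OF g f]
  by (auto simp: fdmod_Homset fdmod_Obj intro!: mod_hom_compose LA_mod.intro)
next
 fix f x y assume f: "f \<in> Homset (fdmod (LA n)) x y"
 then have x: "Ident (fdmod (LA n)) x \<in> Homset (fdmod (LA n)) x x"
   "Ident (fdmod (LA n)) y \<in> Homset (fdmod (LA n)) y y"
  by (auto simp: fdmod_Homset fdmod_Ident fdmod_Obj intro!: mod_hom_id LA_mod.intro)
 have m: "arr_map f \<in> carrier x \<rightarrow>\<^sub>E carrier y" and e: "f = (x, arr_map f, y)"
  using f by (auto simp: fdmod_Homset mod_hom_def)
 show "f \<bullet>\<^bsub>fdmod (LA n)\<^esub> Ident (fdmod (LA n)) x = f"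
  using m by (subst (2) e, subst fdmod_Comp[OF f x(1)]) (auto simp: fdmod_Ident compose_def fun_eq_iff PiE_def extensional_def)
 show "Ident (fdmod (LA n)) y \<bullet>\<^bsub>fdmod (LA n)\<^esub> f = f"
  using m by (subst (2) e, subst fdmod_Comp[OF x(2) f]) (auto simp: fdmod_Ident compose_def fun_eq_iff PiE_def extensional_def)
next
 fix f w x g y h z
 assume f: "f \<in> Homset (fdmod (LA n)) w x" and g: "g \<in> Homset (fdmod (LA n)) x y"
  and h: "h \<in> Homset (fdmod (LA n)) y z"
 obtain f' g' h' where e: "f = (w, f', x)" "g = (x, g', y)" "h = (y, h', z)"
  using f g h unfolding fdmod_Homset by metis
 have "f' \<in> carrier w \<rightarrow> carrier x" using f e by (auto simp: fdmod_Homset mod_hom_def)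
 then show "h \<bullet>\<^bsub>fdmod (LA n)\<^esub> g \<bullet>\<^bsub>fdmod (LA n)\<^esub> f = h \<bullet>\<^bsub>fdmod (LA n)\<^esub> (g \<bullet>\<^bsub>fdmod (LA n)\<^esub> f)"
  using compose_assoc[of f' "carrier w" "carrier x" h' g'] by (simp add: e fdmod_def)
qed (auto simp: fdmod_Homset fdmod_Ident fdmod_Obj intro!: mod_hom_id LA_mod.intro, auto simp: fdmod_def)

text \<open>Objects and arrows of the category are studied through the components of the modules that the
 equivalence assigns to them.\<close>

locale X_mod =
 fixes n :: nat and X :: "('o, 'm) category" and E :: "('o, 'm, 'k::field) amod_functor"
 assumes n: "n \<ge> 1" and cat: "category X" and equiv: "is_equivalence X (fdmod (LA n)) E"
begin

sublocale category X by (rule cat)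

abbreviation am :: "'m => (nat => 'k) => nat => 'k" where "am f \<equiv> arr_map (on_arr E f)"
abbreviation V :: "'o => nat => ('k, nat => 'k) vs" where "V x \<equiv> Sp n E$x"
abbreviation tr :: "'o => nat => nat => (nat => 'k) => nat => 'k" where "tr x \<equiv> Tr n E$x"

abbreviation nul (\<open>\<^bold>0_\<close> [1000] 1000) where "nul x \<equiv> \<zero>\<^bsub>E$x\<^esub>"

lemma E_functor: "is_functor X (fdmod (LA n)) E"
 using equiv by (simp add: is_equivalence_def)

lemma dom: "f \<in> Homset X x y ==> x \<in> Obj X" and cod: "f \<in> Homset X x y ==> y \<in> Obj X"
 using dom_obj cod_obj by (auto simp: Homset_def)

lemma LA_mod: "x \<in> Obj X ==> LA_mod n E$x"
 using functor_Obj[OF E_functor] by (simp add: fdmod_Obj LA_mod_def)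

lemma E_fin_dim: "x \<in> Obj X ==> fin_dim (LA n) E$x"
 using functor_Obj[OF E_functor] by (simp add: fdmod_Obj)

lemma LA_mod2: "[|x \<in> Obj X; y \<in> Obj X|] ==> LA_mod2 n E$x E$y"
 by (simp add: LA_mod2_def LA_mod)

lemma E_arr: "f \<in> Homset X x y ==> on_arr E f = (E$x, am f, E$y)"
 and am_mod_hom: "f \<in> Homset X x y ==> am f \<in> mod_hom (LA n) E$x E$y"
 using functor_Homset[OF E_functor] by (auto simp: fdmod_Homset)

lemma am_Comp: "[|f \<in> Homset X x y; g \<in> Homset X y z|] ==>
  am (g \<bullet>\<^bsub>X\<^esub> f) = compose (carrier E$x) (am g) (am f)"
 using functor_Comp[OF E_functor] fdmod_Comp[OF functor_Homset[OF E_functor] functor_Homset[OF E_functor]]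
 by simp

lemma am_Comp': "[|f \<in> Homset X x y; g \<in> Homset X y z; v \<in> carrier E$x|] ==>
  am (g \<bullet>\<^bsub>X\<^esub> f) v = am g (am f v)"
 by (simp add: am_Comp compose_def)

lemma am_Ident: "x \<in> Obj X ==> am (Ident X x) = restrict id (carrier E$x)"
 using functor_Ident[OF E_functor] by (simp add: fdmod_Ident)

lemma E_faithful: "[|f \<in> Homset X x y; g \<in> Homset X x y; am f = am g|] ==> f = g"
proof -
 assume f: "f \<in> Homset X x y" and g: "g \<in> Homset X x y" and e: "am f = am g"
 obtain G where "functors_iso X X (G \<circ>\<^sub>F E) id_functor" using equiv by (auto simp: is_equivalence_def)
 from faithful[OF cat E_functor this f g] show ?thesis using E_arr[OF f] E_arr[OF g] e by simp
qed

text \<open>A quasi-inverse \<open>G\<close> is faithful, and an arrow \<open>h\<close> between images is the image of the arrow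
 that \<open>G h\<close> becomes under the natural isomorphism.\<close>

lemma E_full:
 assumes x: "x \<in> Obj X" and y: "y \<in> Obj X" and h: "h \<in> mod_hom (LA n) E$x E$y"
 shows "\<exists>f\<in>Homset X x y. am f = h"
proof -
 obtain G where G: "is_functor (fdmod (LA n)) X G" "functors_iso X X (G \<circ>\<^sub>F E) id_functor"
   "functors_iso (fdmod (LA n)) (fdmod (LA n)) (E \<circ>\<^sub>F G) id_functor"
  using equiv by (auto simp: is_equivalence_def)
 obtain \<eta> where \<eta>: "nat_trans X X (G \<circ>\<^sub>F E) id_functor \<eta>" "\<And>x. x \<in> Obj X ==> is_iso_arr X (\<eta> x)"
  using G(2) by (auto simp: functors_iso_def)
 let ?h = "(E$x, h, E$y)"
 have hm: "?h \<in> Homset (fdmod (LA n)) E$x E$y"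
  using h functor_Obj[OF E_functor x] functor_Obj[OF E_functor y] by (simp add: fdmod_Homset)
 let ?x = "G$(E$x)" and ?y = "G$(E$y)"
 have \<eta>m: "\<eta> x \<in> Homset X ?x x" "\<eta> y \<in> Homset X ?y y" using \<eta>(1) x y by (auto simp: nat_trans_def)
 obtain d where d: "d \<in> Homset X x ?x" "d \<bullet>\<^bsub>X\<^esub> \<eta> x = Ident X ?x"
  using \<eta>(2)[OF x] \<eta>m(1) by (auto simp: is_iso_arr_def Homset_def)
 have Gh: "on_arr G ?h \<in> Homset X ?x ?y" by (rule functor_Homset[OF G(1) hm])
 define f where "f = (\<eta> y \<bullet>\<^bsub>X\<^esub> on_arr G ?h) \<bullet>\<^bsub>X\<^esub> d"
 have t: "\<eta> y \<bullet>\<^bsub>X\<^esub> on_arr G ?h \<in> Homset X ?x y" by (rule comp[OF Gh \<eta>m(2)])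
 have f: "f \<in> Homset X x y" unfolding f_def by (rule comp[OF d(1) t])
 have GEf: "on_arr G (on_arr E f) \<in> Homset X ?x ?y"
  by (rule functor_Homset[OF G(1) functor_Homset[OF E_functor f]])
 have "\<eta> y \<bullet>\<^bsub>X\<^esub> on_arr G (on_arr E f) = f \<bullet>\<^bsub>X\<^esub> \<eta> x"
  using \<eta>(1) f by (auto simp: nat_trans_def Homset_def)
 also have "\<dots> = \<eta> y \<bullet>\<^bsub>X\<^esub> on_arr G ?h"
  unfolding f_def comp_assoc[OF \<eta>m(1) d(1) t] d(2) by (rule comp_ident_right[OF t])
 finally have eq: "\<eta> y \<bullet>\<^bsub>X\<^esub> on_arr G (on_arr E f) = \<eta> y \<bullet>\<^bsub>X\<^esub> on_arr G ?h" .
 obtain d' where d': "d' \<in> Homset X y ?y" "d' \<bullet>\<^bsub>X\<^esub> \<eta> y = Ident X ?y"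
  using \<eta>(2)[OF y] \<eta>m(2) by (auto simp: is_iso_arr_def Homset_def)
 have "on_arr G (on_arr E f) = (d' \<bullet>\<^bsub>X\<^esub> \<eta> y) \<bullet>\<^bsub>X\<^esub> on_arr G (on_arr E f)"
  unfolding d'(2) by (rule comp_ident_left[OF GEf, symmetric])
 also have "\<dots> = (d' \<bullet>\<^bsub>X\<^esub> \<eta> y) \<bullet>\<^bsub>X\<^esub> on_arr G ?h"
  using comp_assoc[OF GEf \<eta>m(2) d'(1)] comp_assoc[OF Gh \<eta>m(2) d'(1)] eq by simp
 also have "\<dots> = on_arr G ?h" unfolding d'(2) by (rule comp_ident_left[OF Gh])
 finally have "on_arr E f = ?h"
  using faithful[OF category_fdmod G(1) G(3) functor_Homset[OF E_functor f] hm] by simp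
 then show ?thesis using f by (intro bexI[of _ f]) simp_all
qed

text \<open>Up to isomorphism every module is the image of its image under a quasi-inverse.\<close>

lemma E_surj:
 fixes M :: "'k amod"
 assumes M: "left_module (LA n) M" "fin_dim (LA n) M"
 shows "\<exists>x\<in>Obj X. \<exists>h\<in>mod_hom (LA n) E$x M. bij_betw h (carrier E$x) (carrier M)"
proof -
 obtain G where G: "is_functor (fdmod (LA n)) X G"
   "functors_iso (fdmod (LA n)) (fdmod (LA n)) (E \<circ>\<^sub>F G) id_functor"
  using equiv by (auto simp: is_equivalence_def)
 then obtain \<epsilon> where \<epsilon>: "nat_trans (fdmod (LA n)) (fdmod (LA n)) (E \<circ>\<^sub>F G) id_functor \<epsilon>"
   "\<And>M. M \<in> Obj (fdmod (LA n)) ==> is_iso_arr (fdmod (LA n)) (\<epsilon> M)"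
  by (auto simp: functors_iso_def)
 have MO: "M \<in> Obj (fdmod (LA n))" using M by (simp add: fdmod_Obj)
 let ?x = "G$M"
 have x: "?x \<in> Obj X" by (rule functor_Obj[OF G(1) MO])
 have e: "\<epsilon> M \<in> Homset (fdmod (LA n)) (on_obj E ?x) M" using \<epsilon>(1) MO by (simp add: nat_trans_def)
 obtain d where d: "d \<in> Homset (fdmod (LA n)) M (on_obj E ?x)"
   "d \<bullet>\<^bsub>fdmod (LA n)\<^esub> \<epsilon> M = Ident (fdmod (LA n)) (on_obj E ?x)"
   "\<epsilon> M \<bullet>\<^bsub>fdmod (LA n)\<^esub> d = Ident (fdmod (LA n)) M"
  using \<epsilon>(2)[OF MO] e by (auto simp: is_iso_arr_def Homset_def)
 have dm: "arr_map d v \<in> carrier (on_obj E ?x)" if "v \<in> carrier M" for v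
  using d(1) that by (auto simp: fdmod_Homset mod_hom_def)
 have em: "arr_map (\<epsilon> M) v \<in> carrier M" if "v \<in> carrier (on_obj E ?x)" for v
  using e that by (auto simp: fdmod_Homset mod_hom_def)
 have 1: "arr_map d (arr_map (\<epsilon> M) v) = v" if "v \<in> carrier (on_obj E ?x)" for v
 proof -
  have "compose (carrier (on_obj E ?x)) (arr_map d) (arr_map (\<epsilon> M)) = restrict id (carrier (on_obj E ?x))"
   using d(2) by (simp add: fdmod_Comp[OF d(1) e] fdmod_Ident)
  from fun_cong[OF this, of v] show ?thesis using that by (simp add: compose_def)
 qed
 have 2: "arr_map (\<epsilon> M) (arr_map d v) = v" if "v \<in> carrier M" for v
 proof -
  have "compose (carrier M) (arr_map (\<epsilon> M)) (arr_map d) = restrict id (carrier M)"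
   using d(3) by (simp add: fdmod_Comp[OF e d(1)] fdmod_Ident)
  from fun_cong[OF this, of v] show ?thesis using that by (simp add: compose_def)
 qed
 have "bij_betw (arr_map (\<epsilon> M)) (carrier (on_obj E ?x)) (carrier M)"
  by (rule bij_betwI[of _ _ _ "arr_map d"]) (use 1 2 dm em in auto)
 then show ?thesis using x e by (auto simp: fdmod_Homset)
qed

subsection \<open>Objects and arrows by their components\<close>

lemma V_vspace: "x \<in> Obj X ==> vspace (V x u)"
 by (rule LA_mod.Sp_vspace[OF LA_mod])

lemma V_carrier: "[|x \<in> Obj X; z \<in> car (V x u)|] ==> z \<in> carrier E$x"
 by (rule LA_mod.Sp_carrier[OF LA_mod])

lemma V_outside: "[|x \<in> Obj X; \<not> (1 \<le> u \<and> u < n)|] ==> car (V x u) = {zer (V x u)}"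
 using LA_mod.Sp_outside[OF LA_mod] by simp

lemma V_dim: "x \<in> Obj X ==> \<exists>d. vdim (V x u) d"
 using LA_mod.vdim_Sp[OF LA_mod E_fin_dim] by blast

lemma tr_lin: "x \<in> Obj X ==> lin (V x u) (V x v) (tr x u v)"
 by (rule LA_mod.lin_Tr_Sp[OF LA_mod])

lemma tr_id: "[|x \<in> Obj X; z \<in> car (V x u)|] ==> tr x u u z = z"
 by (rule LA_mod.Tr_id[OF LA_mod])

lemma tr_tr: "[|x \<in> Obj X; u \<le> v; v \<le> w; z \<in> car (V x u)|] ==> tr x v w (tr x u v z) = tr x u w z"
 by (rule LA_mod.Tr_Tr[OF LA_mod _ _ V_carrier])

lemma tr_outside: "[|x \<in> Obj X; \<not> (1 \<le> u \<and> u \<le> v \<and> v < n); z \<in> car (V x u)|] ==> tr x u v z = zer (V x v)"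
 using LA_mod.Tr_outside[OF LA_mod _ V_carrier] by simp

lemma am_lin: "f \<in> Homset X x y ==> lin (V x u) (V y u) (am f)"
 using LA_mod2.mod_hom_lin_Sp[OF LA_mod2 am_mod_hom] dom cod by blast

lemma am_tr: "[|f \<in> Homset X x y; z \<in> car (V x u)|] ==> am f (tr x u v z) = tr y u v (am f z)"
 using LA_mod2.mod_hom_Tr[OF LA_mod2 am_mod_hom] dom cod V_carrier by blast

lemma am_comp: "[|f \<in> Homset X x y; g \<in> Homset X y z; v \<in> car (V x u)|] ==>
  am (g \<bullet>\<^bsub>X\<^esub> f) v = am g (am f v)"
 using am_Comp' V_carrier dom by blast

lemma am_id: "[|x \<in> Obj X; v \<in> car (V x u)|] ==> am (Ident X x) v = v"
 using am_Ident V_carrier by simp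

lemma arr_eqI:
 assumes f: "f \<in> Homset X x y" and g: "g \<in> Homset X x y"
  and e: "\<And>u z. [|1 \<le> u; u < n; z \<in> car (V x u)|] ==> am f z = am g z"
 shows "f = g"
proof (rule E_faithful[OF f g])
 have x: "x \<in> Obj X" and y: "y \<in> Obj X" using f dom cod by auto
 show "am f = am g"
 proof (rule LA_mod2.mod_hom_eqI'[OF LA_mod2[OF x y] am_mod_hom[OF f] am_mod_hom[OF g]])
  fix u z assume z: "z \<in> car (V x u)"
  show "am f z = am g z"
  proof (cases "1 \<le> u \<and> u < n")
   case False
   then have "z = zer (V x u)" using z V_outside[OF x] by auto
   then show ?thesis
    using lin_zer[OF am_lin[OF f] V_vspace[OF x] V_vspace[OF y], of u]
     lin_zer[OF am_lin[OF g] V_vspace[OF x] V_vspace[OF y], of u] by simp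
  qed (use e z in auto)
 qed
qed

text \<open>Fullness of the equivalence in terms of components.\<close>

lemma arr_ex:
 assumes x: "x \<in> Obj X" and y: "y \<in> Obj X"
  and l: "\<And>u. [|1 \<le> u; u < n|] ==> lin (V x u) (V y u) (\<phi> u)"
  and T: "\<And>u v z. [|1 \<le> u; u \<le> v; v < n; z \<in> car (V x u)|] ==> \<phi> v (tr x u v z) = tr y u v (\<phi> u z)"
 shows "\<exists>f\<in>Homset X x y. \<forall>u z. 1 \<le> u \<and> u < n \<and> z \<in> car (V x u) --> am f z = \<phi> u z"
proof -
 interpret LA_mod2 n "E$x" "E$y" by (rule LA_mod2[OF x y])
 define \<psi> where "\<psi> u = (if 1 \<le> u \<and> u < n then \<phi> u else (\<lambda>_. zer (V y u)))" for u
 have "\<exists>h\<in>mod_hom (LA n) E$x E$y. \<forall>u. \<forall>z\<in>car (V x u). h z = \<psi> u z"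
 proof (rule assemble)
  fix u
  interpret vspace "V y u" by (rule V_vspace[OF y])
  show "lin (V x u) (V y u) (\<psi> u)"
   using l[of u] pls_zer[OF zer_mem] scl_zer by (auto simp: \<psi>_def lin_def)
 next
  fix u v z assume uv: "u \<le> v" and z: "z \<in> car (V x u)"
  show "\<psi> v (tr x u v z) = tr y u v (\<psi> u z)"
  proof (cases "1 \<le> u \<and> v < n")
   case True
   then show ?thesis using T uv z by (simp add: \<psi>_def)
  next
   case False
   then have n: "\<not> (1 \<le> u \<and> u \<le> v \<and> v < n)" by simp
   have m: "\<psi> u z \<in> car (V y u)"
    using lin_mem[OF l[of u] z] vspace.zer_mem[OF V_vspace[OF y], of u] by (auto simp: \<psi>_def)
   have "\<psi> v (zer (V x v)) = zer (V y v)"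
    using lin_zer[OF l[of v] V_vspace[OF x] V_vspace[OF y]] by (simp add: \<psi>_def)
   then show ?thesis using tr_outside[OF x n z] tr_outside[OF y n m] by simp
  qed
 qed
 then obtain h where h: "h \<in> mod_hom (LA n) E$x E$y"
  "\<And>u z. z \<in> car (V x u) ==> h z = \<psi> u z" by blast
 obtain f where "f \<in> Homset X x y" "am f = h" using E_full[OF x y h(1)] by blast
 then show ?thesis using h(2) by (intro bexI[of _ f]) (auto simp: \<psi>_def)
qed

lemma iso_arr_iff:
 assumes f: "f \<in> Homset X x y"
 shows "is_iso_arr X f \<longleftrightarrow> (\<forall>u. 1 \<le> u \<and> u < n --> bij_betw (am f) (car (V x u)) (car (V y u)))"
proof
 have x: "x \<in> Obj X" and y: "y \<in> Obj X" using f dom cod by auto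
 assume "is_iso_arr X f"
 then obtain g where g: "g \<in> Homset X y x" "g \<bullet>\<^bsub>X\<^esub> f = Ident X x" "f \<bullet>\<^bsub>X\<^esub> g = Ident X y"
  using f by (auto simp: is_iso_arr_def Homset_def)
 show "\<forall>u. 1 \<le> u \<and> u < n --> bij_betw (am f) (car (V x u)) (car (V y u))"
 proof (intro allI impI, rule bij_betwI[of _ _ _ "am g"])
  fix u
  show "am f \<in> car (V x u) \<rightarrow> car (V y u)" "am g \<in> car (V y u) \<rightarrow> car (V x u)"
   using lin_mem[OF am_lin[OF f]] lin_mem[OF am_lin[OF g(1)]] by auto
  fix z
  show "am g (am f z) = z" if "z \<in> car (V x u)" using am_comp[OF f g(1) that] am_id[OF x that] g(2) by simp
  show "am f (am g z) = z" if "z \<in> car (V y u)" using am_comp[OF g(1) f that] am_id[OF y that] g(3) by simp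
 qed
next
 have x: "x \<in> Obj X" and y: "y \<in> Obj X" using f dom cod by auto
 assume b: "\<forall>u. 1 \<le> u \<and> u < n --> bij_betw (am f) (car (V x u)) (car (V y u))"
 then have l: "liso (V x u) (V y u) (am f)" if "1 \<le> u" "u < n" for u
  using am_lin[OF f] that by (simp add: liso_def)
 let ?\<phi> = "\<lambda>u. inv_into (car (V x u)) (am f)"
 note li = liso_inv[OF l V_vspace[OF x]]
 have "\<exists>g\<in>Homset X y x. \<forall>u z. 1 \<le> u \<and> u < n \<and> z \<in> car (V y u) --> am g z = ?\<phi> u z"
 proof (rule arr_ex[OF y x])
  fix u v z assume u: "1 \<le> u" "u \<le> v" "v < n" and z: "z \<in> car (V y u)"
  then have u': "u < n" "1 \<le> v" by auto
  let ?w = "?\<phi> u z"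
  have w: "?w \<in> car (V x u)" by (rule liso_mem[OF li[OF u(1) u'(1)] z])
  have "am f (tr x u v ?w) = tr y u v z"
   using am_tr[OF f w] liso_inv_right[OF l[OF u(1) u'(1)] z] by simp
  then show "?\<phi> v (tr y u v z) = tr x u v (?\<phi> u z)"
   using liso_inv_left[OF l[OF u'(2) u(3)] lin_mem[OF tr_lin[OF x] w, of v]] by simp
 qed (use li liso_lin in blast)
 then obtain g where g: "g \<in> Homset X y x"
   "\<And>u z. [|1 \<le> u; u < n; z \<in> car (V y u)|] ==> am g z = ?\<phi> u z" by blast
 have "g \<bullet>\<^bsub>X\<^esub> f = Ident X x"
 proof (rule arr_eqI[OF comp[OF f g(1)] ident[OF x]])
  fix u z assume u: "1 \<le> u" "u < n" and z: "z \<in> car (V x u)"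
  show "am (g \<bullet>\<^bsub>X\<^esub> f) z = am (Ident X x) z"
   using am_comp[OF f g(1) z] am_id[OF x z] g(2)[OF u lin_mem[OF am_lin[OF f] z]] liso_inv_left[OF l[OF u] z] by simp
 qed
 moreover have "f \<bullet>\<^bsub>X\<^esub> g = Ident X y"
 proof (rule arr_eqI[OF comp[OF g(1) f] ident[OF y]])
  fix u z assume u: "1 \<le> u" "u < n" and z: "z \<in> car (V y u)"
  show "am (f \<bullet>\<^bsub>X\<^esub> g) z = am (Ident X y) z"
   using am_comp[OF g(1) f z] am_id[OF y z] g(2)[OF u z] liso_inv_right[OF l[OF u] z] by simp
 qed
 ultimately show "is_iso_arr X f" using f g(1) by (auto simp: is_iso_arr_def Homset_def)
qed

text \<open>Essential surjectivity of the equivalence in terms of components.\<close>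

lemma object_ex:
 assumes "qrep n W T"
 shows "\<exists>x\<in>Obj X. \<exists>\<beta>. (\<forall>u. 1 \<le> u \<and> u < n --> liso (V x u) (W u) (\<beta> u)) \<and>
  (\<forall>u v z. 1 \<le> u \<and> u \<le> v \<and> v < n \<and> z \<in> car (V x u) --> \<beta> v (tr x u v z) = T u v (\<beta> u z))"
proof -
 interpret qrep n W T by fact
 obtain M :: "'k amod" and \<beta> where M: "left_module (LA n) M" "fin_dim (LA n) M"
   "\<And>u. [|1 \<le> u; u < n|] ==> liso (Sp n M u) (W u) (\<beta> u)"
   "\<And>u v z. [|1 \<le> u; u \<le> v; v < n|] ==> \<beta> v (Tr n M u v z) = T u v (\<beta> u z)"
  using realization by blast
 obtain x h where x: "x \<in> Obj X" and h: "h \<in> mod_hom (LA n) E$x M"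
   "bij_betw h (carrier E$x) (carrier M)" using E_surj[OF M(1,2)] by blast
 interpret LA_mod2 n "E$x" M
  using LA_mod[OF x] M(1) by (simp add: LA_mod2_def LA_mod_def)
 have l: "liso (V x u) (Sp n M u) h" for u
  using mod_hom_lin_Sp[OF h(1)] mod_hom_bij_iff[OF h(1)] h(2) by (simp add: liso_def)
 show ?thesis
 proof (rule bexI[OF _ x], rule exI[of _ "\<lambda>u z. \<beta> u (h z)"], intro conjI allI impI)
  fix u assume "1 \<le> u \<and> u < n"
  then show "liso (V x u) (W u) (\<lambda>z. \<beta> u (h z))" using liso_comp[OF l M(3)] by blast
 next
  fix u v z assume "1 \<le> u \<and> u \<le> v \<and> v < n \<and> z \<in> car (V x u)"
  then show "\<beta> v (h (tr x u v z)) = T u v (\<beta> u (h z))"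
   using mod_hom_Tr[OF h(1) V_carrier[OF x], of z u u v] M(4)[of u v "h z"] by auto
 qed
qed

end

section \<open>Finite products of subspaces\<close>

text \<open>A product of finitely many subspaces of one space, as functions that vanish from the number of
 factors on.\<close>

definition prodvs :: "('k::field, 'b) vs => (nat => 'b set) => nat => ('k, nat => 'b) vs" where
 "prodvs S Ws r = \<lparr>car = {\<phi>. (\<forall>k<r. \<phi> k \<in> Ws k) \<and> (\<forall>k\<ge>r. \<phi> k = zer S)},
   pls = (\<lambda>\<phi> \<psi> k. pls S (\<phi> k) (\<psi> k)), zer = (\<lambda>k. zer S), scl = (\<lambda>c \<phi> k. scl S c (\<phi> k))\<rparr>"

lemma prodvs_simps [simp]:
 "pls (prodvs S Ws r) = (\<lambda>\<phi> \<psi> k. pls S (\<phi> k) (\<psi> k))" "zer (prodvs S Ws r) = (\<lambda>k. zer S)"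
 "scl (prodvs S Ws r) = (\<lambda>c \<phi> k. scl S c (\<phi> k))"
 by (simp_all add: prodvs_def)

lemma prodvs_car: "\<phi> \<in> car (prodvs S Ws r) \<longleftrightarrow> (\<forall>k<r. \<phi> k \<in> Ws k) \<and> (\<forall>k\<ge>r. \<phi> k = zer S)"
 by (simp add: prodvs_def)

lemma prodvs_vspace:
 assumes S: "vspace S" and W: "\<And>k. k < r ==> Ws k \<subseteq> car S" "\<And>k. k < r ==> vspace (S\<lparr>car := Ws k\<rparr>)"
 shows "vspace (prodvs S Ws r)"
proof -
 interpret S: vspace S by fact
 have m: "\<phi> k \<in> car S" if "\<phi> \<in> car (prodvs S Ws r)" for \<phi> k
  using that W(1)[of k] S.zer_mem by (cases "k < r") (auto simp: prodvs_car)
 show ?thesis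
 proof
  show "zer (prodvs S Ws r) \<in> car (prodvs S Ws r)"
   using vspace.zer_mem[OF W(2)] by (simp add: prodvs_car)
  fix a b w c d assume a: "a \<in> car (prodvs S Ws r)"
  note am = m[OF a]
  show "scl (prodvs S Ws r) c a \<in> car (prodvs S Ws r)"
   using vspace.scl_mem[OF W(2)] a by (simp add: prodvs_car)
  show "pls (prodvs S Ws r) a (zer (prodvs S Ws r)) = a" "scl (prodvs S Ws r) 0 a = zer (prodvs S Ws r)"
   "scl (prodvs S Ws r) 1 a = a" using am by simp_all
  show "scl (prodvs S Ws r) (c + d) a = pls (prodvs S Ws r) (scl (prodvs S Ws r) c a) (scl (prodvs S Ws r) d a)"
   "scl (prodvs S Ws r) c (scl (prodvs S Ws r) d a) = scl (prodvs S Ws r) (c * d) a"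
   using am by (simp_all add: S.scl_add S.scl_scl)
  assume b: "b \<in> car (prodvs S Ws r)"
  note bm = m[OF b]
  show "pls (prodvs S Ws r) a b \<in> car (prodvs S Ws r)"
   using vspace.pls_mem[OF W(2)] a b by (simp add: prodvs_car)
  show "pls (prodvs S Ws r) a b = pls (prodvs S Ws r) b a"
   using am bm by (simp add: S.pls_comm[of "a k" "b k" for k])
  show "scl (prodvs S Ws r) c (pls (prodvs S Ws r) a b) =
    pls (prodvs S Ws r) (scl (prodvs S Ws r) c a) (scl (prodvs S Ws r) c b)"
   using am bm by (simp add: S.scl_pls)
  assume "w \<in> car (prodvs S Ws r)"
  from m[OF this]
  show "pls (prodvs S Ws r) (pls (prodvs S Ws r) a b) w = pls (prodvs S Ws r) a (pls (prodvs S Ws r) b w)"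
   using am bm by (simp add: S.pls_assoc)
 qed
qed

lemma vdim_prodvs:
 assumes S: "vspace S"
 shows "[|\<And>k. k < r ==> Ws k \<subseteq> car S; \<And>k. k < r ==> vspace (S\<lparr>car := Ws k\<rparr>);
  \<And>k. k < r ==> vdim (S\<lparr>car := Ws k\<rparr>) (d k)|] ==> vdim (prodvs S Ws r) (\<Sum>k<r. d k)"
proof (induction r)
 case 0
 have "vspace (prodvs S Ws 0)" by (rule prodvs_vspace[OF S]) auto
 then show ?case by (auto simp: vdim_0_iff prodvs_car)
next
 case (Suc r)
 interpret S: vspace S by fact
 have v: "vspace (prodvs S Ws r)" "vspace (prodvs S Ws (Suc r))"
  by (rule prodvs_vspace[OF S]; use Suc.prems in \<open>simp add: less_SucI\<close>)+
 interpret W: vspace "S\<lparr>car := Ws r\<rparr>" using Suc.prems by simp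
 have z: "zer S \<in> Ws r" using W.zer_mem by simp
 have "vdim (prodvs S Ws (Suc r)) ((\<Sum>k<r. d k) + d r)"
 proof (rule vdim_exact[OF v W.vspace_axioms, of "\<lambda>\<phi>. \<phi>" "\<lambda>\<phi>. \<phi> r"])
  show "lin (prodvs S Ws r) (prodvs S Ws (Suc r)) (\<lambda>\<phi>. \<phi>)"
   using z by (auto simp: lin_def prodvs_car less_Suc_eq)
  show "lin (prodvs S Ws (Suc r)) (S\<lparr>car := Ws r\<rparr>) (\<lambda>\<phi>. \<phi> r)"
   by (auto simp: lin_def prodvs_car)
  have "b \<in> car (prodvs S Ws r) \<longleftrightarrow> b \<in> car (prodvs S Ws (Suc r)) \<and> b r = zer S" for b
  proof
   assume b: "b \<in> car (prodvs S Ws (Suc r)) \<and> b r = zer S"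
   then have "b k = zer S" if "k \<ge> r" for k using that by (cases "k = r") (auto simp: prodvs_car)
   then show "b \<in> car (prodvs S Ws r)" using b by (auto simp: prodvs_car)
  qed (use z in \<open>auto simp: prodvs_car less_Suc_eq\<close>)
  then show "(\<lambda>\<phi>. \<phi>) ` car (prodvs S Ws r) = {b \<in> car (prodvs S Ws (Suc r)). b r = zer (S\<lparr>car := Ws r\<rparr>)}"
   by auto
  show "(\<lambda>\<phi>. \<phi> r) ` car (prodvs S Ws (Suc r)) = car (S\<lparr>car := Ws r\<rparr>)"
  proof
   show "car (S\<lparr>car := Ws r\<rparr>) \<subseteq> (\<lambda>\<phi>. \<phi> r) ` car (prodvs S Ws (Suc r))"
   proof
    fix w assume w: "w \<in> car (S\<lparr>car := Ws r\<rparr>)"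
    have z': "zer S \<in> Ws k" if "k < Suc r" for k using vspace.zer_mem[OF Suc.prems(2)[OF that]] by simp
    have "(\<lambda>k. if k = r then w else zer S) \<in> car (prodvs S Ws (Suc r))"
     using w z' by (auto simp: prodvs_car)
    then show "w \<in> (\<lambda>\<phi>. \<phi> r) ` car (prodvs S Ws (Suc r))" by (rule rev_image_eqI) simp
   qed
  qed (auto simp: prodvs_car)
 qed (use Suc in \<open>auto simp: inj_on_def\<close>)
 then show ?case by simp
qed

section \<open>Natural transformations by components\<close>

context X_mod begin

text \<open>Natural transformations of endofunctors in terms of components. Since arrows are determined by their
 components, no information is lost (\<open>nat_trans_cnat\<close>, \<open>cnat_nat_trans\<close>).\<close>

definition cnat where
 "cnat F H \<zeta> \<longleftrightarrow> is_functor X X F \<and> is_functor X X H \<and>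
  (\<forall>x\<in>Obj X. \<forall>u. 1 \<le> u \<and> u < n -->
   lin (V F$x u) (V H$x u) (\<zeta> x u) \<and>
   (\<forall>v z. u \<le> v \<and> v < n \<and> z \<in> car (V F$x u) -->
    \<zeta> x v (tr F$x u v z) = tr H$x u v (\<zeta> x u z)) \<and>
   (\<forall>y. \<forall>f\<in>Homset X x y. \<forall>z\<in>car (V F$x u).
    \<zeta> y u (am (on_arr F f) z) = am (on_arr H f) (\<zeta> x u z)))"

lemma cnat_functor: "cnat F H \<zeta> ==> is_functor X X F" "cnat F H \<zeta> ==> is_functor X X H"
 unfolding cnat_def by blast+

lemma cnat_lin: "[|cnat F H \<zeta>; x \<in> Obj X; 1 \<le> u; u < n|] ==> lin (V F$x u) (V H$x u) (\<zeta> x u)"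
 unfolding cnat_def by blast

lemma cnat_tr: "[|cnat F H \<zeta>; x \<in> Obj X; 1 \<le> u; u \<le> v; v < n; z \<in> car (V F$x u)|] ==>
  \<zeta> x v (tr F$x u v z) = tr H$x u v (\<zeta> x u z)"
 unfolding cnat_def using le_less_trans by blast

lemma cnat_nat: "[|cnat F H \<zeta>; f \<in> Homset X x y; 1 \<le> u; u < n; z \<in> car (V F$x u)|] ==>
  \<zeta> y u (am (on_arr F f) z) = am (on_arr H f) (\<zeta> x u z)"
 unfolding cnat_def using dom by blast

lemma nat_trans_cnat: "nat_trans X X F H \<eta> ==> cnat F H (\<lambda>x u. am (\<eta> x))"
 unfolding cnat_def
proof (intro conjI ballI allI impI)
 assume \<eta>: "nat_trans X X F H \<eta>"
 then show F: "is_functor X X F" and H: "is_functor X X H" by (simp_all add: nat_trans_def)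
 have m: "\<eta> x \<in> Homset X F$x H$x" if "x \<in> Obj X" for x
  using \<eta> that by (simp add: nat_trans_def)
 fix x u assume x: "x \<in> Obj X" and u: "1 \<le> u \<and> u < n"
 show "lin (V F$x u) (V H$x u) (am (\<eta> x))" by (rule am_lin[OF m[OF x]])
 show "am (\<eta> x) (tr F$x u v z) = tr H$x u v (am (\<eta> x) z)"
  if "u \<le> v \<and> v < n \<and> z \<in> car (V F$x u)" for v z
  using am_tr[OF m[OF x]] that by blast
 fix y f z assume f: "f \<in> Homset X x y" and z: "z \<in> car (V F$x u)"
 have "\<eta> y \<bullet>\<^bsub>X\<^esub> on_arr F f = on_arr H f \<bullet>\<^bsub>X\<^esub> \<eta> x" using \<eta> f by (auto simp: nat_trans_def Homset_def)
 then show "am (\<eta> y) (am (on_arr F f) z) = am (on_arr H f) (am (\<eta> x) z)"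
  using am_comp[OF functor_Homset[OF F f] m[OF cod[OF f]] z] am_comp[OF m[OF x] functor_Homset[OF H f] z] by simp
qed

lemma cnat_nat_trans:
 assumes \<zeta>: "cnat F H \<zeta>"
 shows "\<exists>\<eta>. nat_trans X X F H \<eta> \<and>
  (\<forall>x\<in>Obj X. \<forall>u z. 1 \<le> u \<and> u < n \<and> z \<in> car (V F$x u) --> am (\<eta> x) z = \<zeta> x u z)"
proof -
 note F = cnat_functor(1)[OF \<zeta>] and H = cnat_functor(2)[OF \<zeta>]
 have "\<forall>x\<in>Obj X. \<exists>f. f \<in> Homset X F$x H$x \<and>
   (\<forall>u z. 1 \<le> u \<and> u < n \<and> z \<in> car (V F$x u) --> am f z = \<zeta> x u z)"
 proof
  fix x assume x: "x \<in> Obj X"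
  show "\<exists>f. f \<in> Homset X F$x H$x \<and>
   (\<forall>u z. 1 \<le> u \<and> u < n \<and> z \<in> car (V F$x u) --> am f z = \<zeta> x u z)"
   using arr_ex[OF functor_Obj[OF F x] functor_Obj[OF H x] cnat_lin[OF \<zeta> x] cnat_tr[OF \<zeta> x]] by blast
 qed
 from bchoice[OF this] obtain \<eta> where m: "\<And>x. x \<in> Obj X ==> \<eta> x \<in> Homset X F$x H$x"
  and v: "\<And>x u z. [|x \<in> Obj X; 1 \<le> u; u < n; z \<in> car (V F$x u)|] ==> am (\<eta> x) z = \<zeta> x u z"
  by blast
 have N: "\<eta> y \<bullet>\<^bsub>X\<^esub> on_arr F f = on_arr H f \<bullet>\<^bsub>X\<^esub> \<eta> x" if f: "f \<in> Homset X x y" for f x y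
 proof -
  have x: "x \<in> Obj X" and y: "y \<in> Obj X" using f dom cod by auto
  note Ff = functor_Homset[OF F f] and Hf = functor_Homset[OF H f]
  show ?thesis
  proof (rule arr_eqI[OF comp[OF Ff m[OF y]] comp[OF m[OF x] Hf]])
   fix u z assume u: "1 \<le> u" "u < n" and z: "z \<in> car (V F$x u)"
   show "am (\<eta> y \<bullet>\<^bsub>X\<^esub> on_arr F f) z = am (on_arr H f \<bullet>\<^bsub>X\<^esub> \<eta> x) z"
    using am_comp[OF Ff m[OF y] z] am_comp[OF m[OF x] Hf z] v[OF x u z]
     v[OF y u lin_mem[OF am_lin[OF Ff] z]] cnat_nat[OF \<zeta> f u z] by simp
  qed
 qed
 have "nat_trans X X F H \<eta>" using F H m N[OF HomsetI] by (auto simp: nat_trans_def)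
 then show ?thesis using v by blast
qed

lemma functors_iso_iff: "functors_iso X X F H \<longleftrightarrow> (\<exists>\<zeta>. cnat F H \<zeta> \<and>
  (\<forall>x\<in>Obj X. \<forall>u. 1 \<le> u \<and> u < n --> bij_betw (\<zeta> x u) (car (V F$x u)) (car (V H$x u))))"
proof
 assume "functors_iso X X F H"
 then obtain \<eta> where \<eta>: "nat_trans X X F H \<eta>" "\<And>x. x \<in> Obj X ==> is_iso_arr X (\<eta> x)"
  by (auto simp: functors_iso_def)
 have "\<eta> x \<in> Homset X F$x H$x" if "x \<in> Obj X" for x
  using \<eta>(1) that by (simp add: nat_trans_def)
 then show "\<exists>\<zeta>. cnat F H \<zeta> \<and>
  (\<forall>x\<in>Obj X. \<forall>u. 1 \<le> u \<and> u < n --> bij_betw (\<zeta> x u) (car (V F$x u)) (car (V H$x u)))"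
  using nat_trans_cnat[OF \<eta>(1)] \<eta>(2) iso_arr_iff by blast
next
 assume "\<exists>\<zeta>. cnat F H \<zeta> \<and>
  (\<forall>x\<in>Obj X. \<forall>u. 1 \<le> u \<and> u < n --> bij_betw (\<zeta> x u) (car (V F$x u)) (car (V H$x u)))"
 then obtain \<zeta> where \<zeta>: "cnat F H \<zeta>"
  and b: "\<And>x u. [|x \<in> Obj X; 1 \<le> u; u < n|] ==> bij_betw (\<zeta> x u) (car (V F$x u)) (car (V H$x u))"
  by blast
 obtain \<eta> where \<eta>: "nat_trans X X F H \<eta>"
  "\<And>x u z. [|x \<in> Obj X; 1 \<le> u; u < n; z \<in> car (V F$x u)|] ==> am (\<eta> x) z = \<zeta> x u z"
  using cnat_nat_trans[OF \<zeta>] by blast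
 have "is_iso_arr X (\<eta> x)" if x: "x \<in> Obj X" for x
 proof -
  have "\<eta> x \<in> Homset X F$x H$x" using \<eta>(1) x by (simp add: nat_trans_def)
  moreover have "bij_betw (am (\<eta> x)) (car (V F$x u)) (car (V H$x u))"
   if u: "1 \<le> u" "u < n" for u
   using b[OF x u] \<eta>(2)[OF x u] by (simp cong: bij_betw_cong)
  ultimately show ?thesis using iso_arr_iff by blast
 qed
 then show "functors_iso X X F H" using \<eta>(1) by (auto simp: functors_iso_def)
qed

text \<open>A biproduct of endofunctors in terms of components.\<close>

definition cds where
 "cds H F G i j p q \<longleftrightarrow> cnat F H i \<and> cnat G H j \<and> cnat H F p \<and> cnat H G q \<and>
  (\<forall>x\<in>Obj X. \<forall>u. 1 \<le> u \<and> u < n -->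
   (\<forall>z\<in>car (V F$x u). p x u (i x u z) = z) \<and>
   (\<forall>z\<in>car (V G$x u). q x u (j x u z) = z) \<and>
   (\<forall>z\<in>car (V H$x u). pls (V H$x u) (i x u (p x u z)) (j x u (q x u z)) = z))"

lemma direct_sum_iff: "direct_sum X E H F G \<longleftrightarrow> (\<exists>i j p q. cds H F G i j p q)"
proof
 assume "direct_sum X E H F G"
 then obtain i j p q where nt: "nat_trans X X F H i" "nat_trans X X G H j" "nat_trans X X H F p" "nat_trans X X H G q"
  and pi: "\<And>x. x \<in> Obj X ==> p x \<bullet>\<^bsub>X\<^esub> i x = Ident X F$x"
  and qj: "\<And>x. x \<in> Obj X ==> q x \<bullet>\<^bsub>X\<^esub> j x = Ident X G$x"
  and s: "\<And>x v. [|x \<in> Obj X; v \<in> carrier (E$(H$x))|] ==>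
   am (i x \<bullet>\<^bsub>X\<^esub> p x) v \<oplus>\<^bsub>E$(H$x)\<^esub> am (j x \<bullet>\<^bsub>X\<^esub> q x) v = v"
  unfolding direct_sum_def Let_def by blast
 have m: "i x \<in> Homset X F$x H$x" "j x \<in> Homset X G$x H$x"
  "p x \<in> Homset X H$x F$x" "q x \<in> Homset X H$x G$x" if "x \<in> Obj X" for x
  using nt that by (simp_all add: nat_trans_def)
 have "cds H F G (\<lambda>x u. am (i x)) (\<lambda>x u. am (j x)) (\<lambda>x u. am (p x)) (\<lambda>x u. am (q x))"
  unfolding cds_def
 proof (intro conjI ballI allI impI nt[THEN nat_trans_cnat])
  fix x u z assume x: "x \<in> Obj X"
  show "am (p x) (am (i x) z) = z" if z: "z \<in> car (V F$x u)"
   using am_comp[OF m(1)[OF x] m(3)[OF x] z] pi[OF x] am_id[OF dom[OF m(1)[OF x]] z] by simp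
  show "am (q x) (am (j x) z) = z" if z: "z \<in> car (V G$x u)"
   using am_comp[OF m(2)[OF x] m(4)[OF x] z] qj[OF x] am_id[OF dom[OF m(2)[OF x]] z] by simp
  show "pls (V H$x u) (am (i x) (am (p x) z)) (am (j x) (am (q x) z)) = z"
   if z: "z \<in> car (V H$x u)"
   using s[OF x V_carrier[OF cod[OF m(1)[OF x]] z]] am_comp[OF m(3)[OF x] m(1)[OF x] z]
    am_comp[OF m(4)[OF x] m(2)[OF x] z] by simp
 qed
 then show "\<exists>i j p q. cds H F G i j p q" by blast
next
 assume "\<exists>i j p q. cds H F G i j p q"
 then obtain i j p q where c: "cnat F H i" "cnat G H j" "cnat H F p" "cnat H G q"
  and pi: "\<And>x u z. [|x \<in> Obj X; 1 \<le> u; u < n; z \<in> car (V F$x u)|] ==> p x u (i x u z) = z"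
  and qj: "\<And>x u z. [|x \<in> Obj X; 1 \<le> u; u < n; z \<in> car (V G$x u)|] ==> q x u (j x u z) = z"
  and s: "\<And>x u z. [|x \<in> Obj X; 1 \<le> u; u < n; z \<in> car (V H$x u)|] ==>
   pls (V H$x u) (i x u (p x u z)) (j x u (q x u z)) = z"
  unfolding cds_def by blast
 obtain i' where i': "nat_trans X X F H i'"
  "\<And>x u z. [|x \<in> Obj X; 1 \<le> u; u < n; z \<in> car (V F$x u)|] ==> am (i' x) z = i x u z"
  using cnat_nat_trans[OF c(1)] by blast
 obtain j' where j': "nat_trans X X G H j'"
  "\<And>x u z. [|x \<in> Obj X; 1 \<le> u; u < n; z \<in> car (V G$x u)|] ==> am (j' x) z = j x u z"
  using cnat_nat_trans[OF c(2)] by blast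
 obtain p' where p': "nat_trans X X H F p'"
  "\<And>x u z. [|x \<in> Obj X; 1 \<le> u; u < n; z \<in> car (V H$x u)|] ==> am (p' x) z = p x u z"
  using cnat_nat_trans[OF c(3)] by blast
 obtain q' where q': "nat_trans X X H G q'"
  "\<And>x u z. [|x \<in> Obj X; 1 \<le> u; u < n; z \<in> car (V H$x u)|] ==> am (q' x) z = q x u z"
  using cnat_nat_trans[OF c(4)] by blast
 have m: "i' x \<in> Homset X F$x H$x" "j' x \<in> Homset X G$x H$x"
  "p' x \<in> Homset X H$x F$x" "q' x \<in> Homset X H$x G$x" if "x \<in> Obj X" for x
  using i'(1) j'(1) p'(1) q'(1) that by (simp_all add: nat_trans_def)
 have "p' x \<bullet>\<^bsub>X\<^esub> i' x = Ident X F$x \<and> q' x \<bullet>\<^bsub>X\<^esub> j' x = Ident X G$x \<and>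
   (\<forall>v\<in>carrier (E$(H$x)). am (i' x \<bullet>\<^bsub>X\<^esub> p' x) v \<oplus>\<^bsub>E$(H$x)\<^esub> am (j' x \<bullet>\<^bsub>X\<^esub> q' x) v = v)"
  if x: "x \<in> Obj X" for x
 proof (intro conjI ballI)
  note mx = m[OF x]
  note iF = ident[OF dom[OF mx(1)]] and iG = ident[OF dom[OF mx(2)]]
  show "p' x \<bullet>\<^bsub>X\<^esub> i' x = Ident X F$x"
  proof (rule arr_eqI[OF comp[OF mx(1,3)] iF])
   fix u z assume u: "1 \<le> u" "u < n" and z: "z \<in> car (V F$x u)"
   show "am (p' x \<bullet>\<^bsub>X\<^esub> i' x) z = am (Ident X F$x) z"
    using am_comp[OF mx(1,3) z] am_id[OF dom[OF mx(1)] z] i'(2)[OF x u z]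
     p'(2)[OF x u lin_mem[OF cnat_lin[OF c(1) x u] z]] pi[OF x u z] by simp
  qed
  show "q' x \<bullet>\<^bsub>X\<^esub> j' x = Ident X G$x"
  proof (rule arr_eqI[OF comp[OF mx(2,4)] iG])
   fix u z assume u: "1 \<le> u" "u < n" and z: "z \<in> car (V G$x u)"
   show "am (q' x \<bullet>\<^bsub>X\<^esub> j' x) z = am (Ident X G$x) z"
    using am_comp[OF mx(2,4) z] am_id[OF dom[OF mx(2)] z] j'(2)[OF x u z]
     q'(2)[OF x u lin_mem[OF cnat_lin[OF c(2) x u] z]] qj[OF x u z] by simp
  qed
  let ?M = "E$(H$x)"
  have Hx: "H$x \<in> Obj X" by (rule cod[OF mx(1)])
  interpret M: LA_mod n ?M by (rule LA_mod[OF Hx])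
  note ip = comp[OF mx(3,1)] and jq = comp[OF mx(4,2)]
  have cm: "am (i' x \<bullet>\<^bsub>X\<^esub> p' x) v \<in> carrier ?M" "am (j' x \<bullet>\<^bsub>X\<^esub> q' x) v \<in> carrier ?M" if "v \<in> carrier ?M" for v
   using LA_mod2.mod_hom_mem[OF LA_mod2[OF Hx Hx] am_mod_hom[OF ip] that]
    LA_mod2.mod_hom_mem[OF LA_mod2[OF Hx Hx] am_mod_hom[OF jq] that] .
  fix v assume v: "v \<in> carrier ?M"
  show "am (i' x \<bullet>\<^bsub>X\<^esub> p' x) v \<oplus>\<^bsub>?M\<^esub> am (j' x \<bullet>\<^bsub>X\<^esub> q' x) v = v"
  proof (rule M.eq_if_components_eq)
   fix u
   let ?z = "tr H$x u u v"
   have z: "?z \<in> car (V H$x u)" by (rule M.Tr_Sp[OF v])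
   have "tr H$x u u (am (i' x \<bullet>\<^bsub>X\<^esub> p' x) v \<oplus>\<^bsub>?M\<^esub> am (j' x \<bullet>\<^bsub>X\<^esub> q' x) v) =
     am (i' x \<bullet>\<^bsub>X\<^esub> p' x) ?z \<oplus>\<^bsub>?M\<^esub> am (j' x \<bullet>\<^bsub>X\<^esub> q' x) ?z"
    using M.Tr_pls[OF cm(1)[OF v] cm(2)[OF v]] LA_mod2.mod_hom_Tr[OF LA_mod2[OF Hx Hx] am_mod_hom[OF ip] v]
     LA_mod2.mod_hom_Tr[OF LA_mod2[OF Hx Hx] am_mod_hom[OF jq] v] by simp
   also have "\<dots> = am (i' x) (am (p' x) ?z) \<oplus>\<^bsub>?M\<^esub> am (j' x) (am (q' x) ?z)"
    using am_comp[OF mx(3,1) z] am_comp[OF mx(4,2) z] by simp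
   also have "\<dots> = ?z"
   proof (cases "1 \<le> u \<and> u < n")
    case True
    then have u: "1 \<le> u" "u < n" by auto
    show ?thesis using s[OF x u z] p'(2)[OF x u z] q'(2)[OF x u z]
      i'(2)[OF x u lin_mem[OF cnat_lin[OF c(3) x u] z]] j'(2)[OF x u lin_mem[OF cnat_lin[OF c(4) x u] z]] by simp
   next
    case False
    have Hv: "w = \<zero>\<^bsub>?M\<^esub>" if "w \<in> car (V H$x u)" for w using V_outside[OF Hx False] that by auto
    have "am (i' x) (am (p' x) ?z) = \<zero>\<^bsub>?M\<^esub>" "am (j' x) (am (q' x) ?z) = \<zero>\<^bsub>?M\<^esub>"
     by (rule Hv[OF lin_mem[OF am_lin[OF mx(1)] lin_mem[OF am_lin[OF mx(3)] z]]],
       rule Hv[OF lin_mem[OF am_lin[OF mx(2)] lin_mem[OF am_lin[OF mx(4)] z]]])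
    then show ?thesis using Hv[OF z] by simp
   qed
   finally show "tr H$x u u (am (i' x \<bullet>\<^bsub>X\<^esub> p' x) v \<oplus>\<^bsub>?M\<^esub> am (j' x \<bullet>\<^bsub>X\<^esub> q' x) v) = ?z" .
  qed (use v cm in auto)
 qed
 then show "direct_sum X E H F G"
  unfolding direct_sum_def Let_def using i'(1) j'(1) p'(1) q'(1) by blast
qed

lemma cdsD:
 assumes "cds H F G i j p q"
 shows "cnat F H i" "cnat G H j" "cnat H F p" "cnat H G q"
  and "[|x \<in> Obj X; 1 \<le> u; u < n; z \<in> car (V F$x u)|] ==> p x u (i x u z) = z"
  and "[|x \<in> Obj X; 1 \<le> u; u < n; z \<in> car (V G$x u)|] ==> q x u (j x u z) = z"
  and "[|x \<in> Obj X; 1 \<le> u; u < n; z \<in> car (V H$x u)|] ==>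
   pls (V H$x u) (i x u (p x u z)) (j x u (q x u z)) = z"
 using assms unfolding cds_def by blast+

lemma cds_swap: "cds H F G i j p q ==> cds H G F j i q p"
 unfolding cds_def
proof (intro conjI ballI allI impI)
 assume c: "cnat F H i \<and> cnat G H j \<and> cnat H F p \<and> cnat H G q \<and> (\<forall>x\<in>Obj X. \<forall>u. 1 \<le> u \<and> u < n -->
   (\<forall>z\<in>car (V F$x u). p x u (i x u z) = z) \<and>
   (\<forall>z\<in>car (V G$x u). q x u (j x u z) = z) \<and>
   (\<forall>z\<in>car (V H$x u). pls (V H$x u) (i x u (p x u z)) (j x u (q x u z)) = z))"
 then have c': "cds H F G i j p q" unfolding cds_def .
 note d = cdsD[OF c']
 fix x u z assume x: "x \<in> Obj X" and u: "1 \<le> u \<and> u < n" and z: "z \<in> car (V H$x u)"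
 then have u: "1 \<le> u" "u < n" by auto
 have "pls (V H$x u) (i x u (p x u z)) (j x u (q x u z)) =
   pls (V H$x u) (j x u (q x u z)) (i x u (p x u z))"
  using vspace.pls_comm[OF V_vspace[OF functor_Obj[OF cnat_functor(2)[OF d(1)] x]]
    lin_mem[OF cnat_lin[OF d(1) x u] lin_mem[OF cnat_lin[OF d(3) x u] z]]
    lin_mem[OF cnat_lin[OF d(2) x u] lin_mem[OF cnat_lin[OF d(4) x u] z]]] .
 then show "pls (V H$x u) (j x u (q x u z)) (i x u (p x u z)) = z"
  using d(7)[OF x u z] by simp
qed blast+

lemma cds_cross:
 assumes c: "cds H F G i j p q" and x: "x \<in> Obj X" and u: "1 \<le> u" "u < n"
  and z: "z \<in> car (V G$x u)"
 shows "p x u (j x u z) = zer (V F$x u)"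
proof -
 note d = cdsD[OF c]
 note l = cnat_lin[OF d(1) x u] cnat_lin[OF d(2) x u] cnat_lin[OF d(3) x u]
 let ?w = "j x u z"
 have w: "?w \<in> car (V H$x u)" by (rule lin_mem[OF l(2) z])
 note pw = lin_mem[OF l(3) w]
 have "pls (V H$x u) (i x u (p x u ?w)) ?w = ?w" using d(7)[OF x u w] d(6)[OF x u z] by simp
 then have "p x u ?w = p x u (pls (V H$x u) (i x u (p x u ?w)) ?w)" by simp
 also have "\<dots> = pls (V F$x u) (p x u (i x u (p x u ?w))) (p x u ?w)"
  by (rule lin_pls[OF l(3) lin_mem[OF l(1) pw] w])
 also have "p x u (i x u (p x u ?w)) = p x u ?w" by (rule d(5)[OF x u pw])
 finally show ?thesis
  using vspace.idempotent_zer[OF V_vspace[OF functor_Obj[OF cnat_functor(1)[OF d(1)] x]] pw] by simp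
qed

text \<open>Functors can be prescribed by their components.\<close>

lemma functor_ex:
 assumes W: "\<And>x. x \<in> Obj X ==> qrep n (W x) (T x)"
  and l: "\<And>f x y u. [|f \<in> Homset X x y; 1 \<le> u; u < n|] ==> lin (W x u) (W y u) (\<Phi> y f u)"
  and T: "\<And>f x y u v w. [|f \<in> Homset X x y; 1 \<le> u; u \<le> v; v < n; w \<in> car (W x u)|] ==>
   \<Phi> y f v (T x u v w) = T y u v (\<Phi> y f u w)"
  and Id: "\<And>x u w. [|x \<in> Obj X; 1 \<le> u; u < n; w \<in> car (W x u)|] ==> \<Phi> x (Ident X x) u w = w"
  and Comp: "\<And>f g x y z u w. [|f \<in> Homset X x y; g \<in> Homset X y z; 1 \<le> u; u < n; w \<in> car (W x u)|] ==>
   \<Phi> z (g \<bullet>\<^bsub>X\<^esub> f) u w = \<Phi> z g u (\<Phi> y f u w)"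
 shows "\<exists>H \<beta>. is_functor X X H \<and>
  (\<forall>x\<in>Obj X. \<forall>u. 1 \<le> u \<and> u < n --> liso (V H$x u) (W x u) (\<beta> x u) \<and>
   (\<forall>v z. u \<le> v \<and> v < n \<and> z \<in> car (V H$x u) --> \<beta> x v (tr H$x u v z) = T x u v (\<beta> x u z)) \<and>
   (\<forall>y. \<forall>f\<in>Homset X x y. \<forall>z\<in>car (V H$x u). \<beta> y u (am (on_arr H f) z) = \<Phi> y f u (\<beta> x u z)))"
proof -
 have "\<forall>x\<in>Obj X. \<exists>y\<beta>. fst y\<beta> \<in> Obj X \<and> (\<forall>u. 1 \<le> u \<and> u < n --> liso (V (fst y\<beta>) u) (W x u) (snd y\<beta> u)) \<and>
  (\<forall>u v z. 1 \<le> u \<and> u \<le> v \<and> v < n \<and> z \<in> car (V (fst y\<beta>) u) -->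
   snd y\<beta> v (tr (fst y\<beta>) u v z) = T x u v (snd y\<beta> u z))"
 proof
  fix x assume "x \<in> Obj X"
  from object_ex[OF W[OF this]] obtain y \<beta> where y: "y \<in> Obj X"
   "\<forall>u. 1 \<le> u \<and> u < n --> liso (V y u) (W x u) (\<beta> u)"
   "\<forall>u v z. 1 \<le> u \<and> u \<le> v \<and> v < n \<and> z \<in> car (V y u) --> \<beta> v (tr y u v z) = T x u v (\<beta> u z)" by blast
  show "\<exists>y\<beta>. fst y\<beta> \<in> Obj X \<and> (\<forall>u. 1 \<le> u \<and> u < n --> liso (V (fst y\<beta>) u) (W x u) (snd y\<beta> u)) \<and>
   (\<forall>u v z. 1 \<le> u \<and> u \<le> v \<and> v < n \<and> z \<in> car (V (fst y\<beta>) u) -->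
    snd y\<beta> v (tr (fst y\<beta>) u v z) = T x u v (snd y\<beta> u z))"
   by (rule exI[of _ "(y, \<beta>)"]) (simp only: fst_conv snd_conv y, use y in blast)
 qed
 from bchoice[OF this] obtain Y where Y: "\<forall>x\<in>Obj X. fst (Y x) \<in> Obj X \<and>
  (\<forall>u. 1 \<le> u \<and> u < n --> liso (V (fst (Y x)) u) (W x u) (snd (Y x) u)) \<and>
  (\<forall>u v z. 1 \<le> u \<and> u \<le> v \<and> v < n \<and> z \<in> car (V (fst (Y x)) u) -->
   snd (Y x) v (tr (fst (Y x)) u v z) = T x u v (snd (Y x) u z))" by blast
 define y where "y x = fst (Y x)" for x
 define \<beta> where "\<beta> x = snd (Y x)" for x
 have yO: "y x \<in> Obj X" if "x \<in> Obj X" for x using Y that by (auto simp: y_def)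
 have bl: "liso (V (y x) u) (W x u) (\<beta> x u)" if "x \<in> Obj X" "1 \<le> u" "u < n" for x u
  using Y that by (auto simp: y_def \<beta>_def)
 have bT: "\<beta> x v (tr (y x) u v z) = T x u v (\<beta> x u z)"
  if "x \<in> Obj X" "1 \<le> u" "u \<le> v" "v < n" "z \<in> car (V (y x) u)" for x u v z
  using Y that by (auto simp: y_def \<beta>_def)
 have "\<forall>f\<in>Arr X. \<exists>h. h \<in> Homset X (y (Dom X f)) (y (Cod X f)) \<and> (\<forall>u z. 1 \<le> u \<and> u < n \<and> z \<in> car (V (y (Dom X f)) u) -->
   \<beta> (Cod X f) u (am h z) = \<Phi> (Cod X f) f u (\<beta> (Dom X f) u z))"
 proof
  fix f assume "f \<in> Arr X"
  then have f: "f \<in> Homset X (Dom X f) (Cod X f)" by (rule HomsetI)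
  let ?a = "Dom X f" and ?b = "Cod X f"
  note a = dom[OF f] and b = cod[OF f]
  let ?\<psi> = "\<lambda>u z. inv_into (car (V (y ?b) u)) (\<beta> ?b u) (\<Phi> ?b f u (\<beta> ?a u z))"
  have m: "\<Phi> ?b f u (\<beta> ?a u z) \<in> car (W ?b u)" if "1 \<le> u" "u < n" "z \<in> car (V (y ?a) u)" for u z
   using lin_mem[OF l[OF f that(1,2)] liso_mem[OF bl[OF a that(1,2)] that(3)]] .
  have "\<exists>h\<in>Homset X (y ?a) (y ?b). \<forall>u z. 1 \<le> u \<and> u < n \<and> z \<in> car (V (y ?a) u) --> am h z = ?\<psi> u z"
  proof (rule arr_ex[OF yO[OF a] yO[OF b]])
   fix u assume u: "1 \<le> u" "u < n"
   show "lin (V (y ?a) u) (V (y ?b) u) (?\<psi> u)"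
    by (rule lin_comp[OF lin_comp[OF liso_lin[OF bl[OF a u]] l[OF f u]]
      liso_lin[OF liso_inv[OF bl[OF b u] V_vspace[OF yO[OF b]]]]])
  next
   fix u v z assume u: "1 \<le> u" "u \<le> v" "v < n" and z: "z \<in> car (V (y ?a) u)"
   then have u': "u < n" "1 \<le> v" by auto
   note li = liso_inv[OF bl[OF b u(1) u'(1)] V_vspace[OF yO[OF b]]]
   have p: "?\<psi> u z \<in> car (V (y ?b) u)" by (rule liso_mem[OF li m[OF u(1) u'(1) z]])
   have "\<beta> ?b v (tr (y ?b) u v (?\<psi> u z)) = T ?b u v (\<Phi> ?b f u (\<beta> ?a u z))"
    using bT[OF b u p] liso_inv_right[OF bl[OF b u(1) u'(1)] m[OF u(1) u'(1) z]] by simp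
   also have "\<dots> = \<Phi> ?b f v (\<beta> ?a v (tr (y ?a) u v z))"
    using T[OF f u liso_mem[OF bl[OF a u(1) u'(1)] z]] bT[OF a u z] by simp
   finally show "?\<psi> v (tr (y ?a) u v z) = tr (y ?b) u v (?\<psi> u z)"
    using liso_inv_left[OF bl[OF b u'(2) u(3)] lin_mem[OF tr_lin[OF yO[OF b]] p, of v]] by simp
  qed
  then obtain h where h: "h \<in> Homset X (y ?a) (y ?b)"
   "\<forall>u z. 1 \<le> u \<and> u < n \<and> z \<in> car (V (y ?a) u) --> am h z = ?\<psi> u z" by blast
  then show "\<exists>h. h \<in> Homset X (y ?a) (y ?b) \<and> (\<forall>u z. 1 \<le> u \<and> u < n \<and> z \<in> car (V (y ?a) u) -->
   \<beta> ?b u (am h z) = \<Phi> ?b f u (\<beta> ?a u z))"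
   using liso_inv_right[OF bl[OF b] m] by (intro exI[of _ h]) auto
 qed
 from bchoice[OF this] obtain h where h: "\<And>f x x'. f \<in> Homset X x x' ==> h f \<in> Homset X (y x) (y x')"
  and hv: "\<And>f x x' u z. [|f \<in> Homset X x x'; 1 \<le> u; u < n; z \<in> car (V (y x) u)|] ==>
   \<beta> x' u (am (h f) z) = \<Phi> x' f u (\<beta> x u z)" unfolding Homset_def by auto
 let ?H = "\<lparr>on_obj = y, on_arr = h\<rparr>"
 have "is_functor X X ?H"
  unfolding is_functor_def
 proof (intro conjI ballI impI)
  fix f assume "f \<in> Arr X"
  then show "on_arr ?H f \<in> Homset X (on_obj ?H (Dom X f)) (on_obj ?H (Cod X f))" using h[OF HomsetI] by simp
 next
  fix x assume x: "x \<in> Obj X"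
  show "on_arr ?H (Ident X x) = Ident X (on_obj ?H x)"
   unfolding cfunctor.simps
  proof (rule arr_eqI[OF h[OF ident[OF x]] ident[OF yO[OF x]]])
   fix u z assume u: "1 \<le> u" "u < n" and z: "z \<in> car (V (y x) u)"
   have "\<beta> x u (am (h (Ident X x)) z) = \<beta> x u z"
    using hv[OF ident[OF x] u z] Id[OF x u liso_mem[OF bl[OF x u] z]] by simp
   then have "am (h (Ident X x)) z = z"
    using liso_eq_iff[OF bl[OF x u] lin_mem[OF am_lin[OF h[OF ident[OF x]]] z] z] by simp
   then show "am (h (Ident X x)) z = am (Ident X (y x)) z" using am_id[OF yO[OF x] z] by simp
  qed
 next
  fix f g assume "f \<in> Arr X" "g \<in> Arr X" and e: "Dom X g = Cod X f"
  then have f: "f \<in> Homset X (Dom X f) (Cod X f)" and g: "g \<in> Homset X (Cod X f) (Cod X g)"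
   using HomsetI by force+
  note hf = h[OF f] and hg = h[OF g]
  show "on_arr ?H (g \<bullet>\<^bsub>X\<^esub> f) = on_arr ?H g \<bullet>\<^bsub>X\<^esub> on_arr ?H f"
   unfolding cfunctor.simps
  proof (rule arr_eqI[OF h[OF comp[OF f g]] comp[OF hf hg]])
   fix u z assume u: "1 \<le> u" "u < n" and z: "z \<in> car (V (y (Dom X f)) u)"
   have w: "am (h f) z \<in> car (V (y (Cod X f)) u)" by (rule lin_mem[OF am_lin[OF hf] z])
   have "\<beta> (Cod X g) u (am (h (g \<bullet>\<^bsub>X\<^esub> f)) z) = \<beta> (Cod X g) u (am (h g) (am (h f) z))"
    using hv[OF comp[OF f g] u z] hv[OF g u w] hv[OF f u z]
     Comp[OF f g u liso_mem[OF bl[OF dom[OF f] u] z]] by simp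
   then have "am (h (g \<bullet>\<^bsub>X\<^esub> f)) z = am (h g) (am (h f) z)"
    using liso_eq_iff[OF bl[OF cod[OF g] u] lin_mem[OF am_lin[OF h[OF comp[OF f g]]] z] lin_mem[OF am_lin[OF hg] w]]
    by simp
   then show "am (h (g \<bullet>\<^bsub>X\<^esub> f)) z = am (h g \<bullet>\<^bsub>X\<^esub> h f) z" using am_comp[OF hf hg z] by simp
  qed
 qed (simp add: yO)
 then show ?thesis using bl bT hv by (intro exI[of _ ?H] exI[of _ \<beta>]) auto
qed

section \<open>Functors given by reindexing the components\<close>

text \<open>The maps along which components can be reindexed. The index \<open>n\<close> is included because the end point of
 the quiver may be moved there; it is fixed by each of these maps.\<close>

definition good :: "(nat => nat) => bool" where
 "good g \<longleftrightarrow> (\<forall>u. 1 \<le> u \<and> u \<le> n --> u \<le> g u \<and> g u \<le> n) \<and>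
  (\<forall>u v. 1 \<le> u \<and> u \<le> v \<and> v \<le> n --> g u \<le> g v)"

lemma goodD: "[|good g; 1 \<le> u; u \<le> n|] ==> u \<le> g u" "[|good g; 1 \<le> u; u \<le> n|] ==> g u \<le> n"
 "[|good g; 1 \<le> u; u \<le> v; v \<le> n|] ==> g u \<le> g v"
 by (simp_all add: good_def)

lemma good_n: "good g ==> g n = n"
 using goodD(1,2)[of g n] n by simp

lemma good_comp:
 assumes "good g" "good h"
 shows "good (g \<circ> h)"
 unfolding good_def
proof (intro conjI allI impI)
 fix u assume u: "1 \<le> u \<and> u \<le> n"
 have h: "u \<le> h u" "h u \<le> n" using goodD[OF assms(2)] u by auto
 then have "1 \<le> h u" using u by simp
 then show "u \<le> (g \<circ> h) u" "(g \<circ> h) u \<le> n" using goodD(1,2)[OF assms(1), of "h u"] h by auto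
next
 fix u v assume u: "1 \<le> u \<and> u \<le> v \<and> v \<le> n"
 have "u \<le> h u" "h u \<le> h v" "h v \<le> n" using goodD[OF assms(2)] u by auto
 then show "(g \<circ> h) u \<le> (g \<circ> h) v" using goodD(3)[OF assms(1), of "h u" "h v"] u by auto
qed

text \<open>The components, transition maps and arrow maps of the direct sum of the functors that reindex along
 the members of a list.\<close>

definition PV :: "'o => (nat => nat) list => nat => ('k, nat => nat => 'k) vs" where
 "PV x gs u = prodvs (Wh n E$x) (\<lambda>k. car (V x ((gs ! k) u))) (length gs)"

definition PT :: "'o => (nat => nat) list => nat => nat => (nat => nat => 'k) => nat => nat => 'k" where
 "PT x gs u v \<phi> = (\<lambda>k. if k < length gs then tr x ((gs ! k) u) ((gs ! k) v) (\<phi> k) else \<^bold>0x)"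

definition PA :: "'o => (nat => nat) list => 'm => (nat => nat => 'k) => nat => nat => 'k" where
 "PA y gs f \<phi> = (\<lambda>k. if k < length gs then am f (\<phi> k) else \<^bold>0y)"

lemma PV_simps [simp]:
 "pls (PV x gs u) = (\<lambda>\<phi> \<psi> k. \<phi> k \<oplus>\<^bsub>E$x\<^esub> \<psi> k)" "zer (PV x gs u) = (\<lambda>k. \<^bold>0x)"
 "scl (PV x gs u) = (\<lambda>c \<phi> k. scalar_act (LA n) E$x c (\<phi> k))"
 by (simp_all add: PV_def)

lemma PV_car: "\<phi> \<in> car (PV x gs u) \<longleftrightarrow>
  (\<forall>k<length gs. \<phi> k \<in> car (V x ((gs ! k) u))) \<and> (\<forall>k\<ge>length gs. \<phi> k = \<^bold>0x)"
 by (simp add: PV_def prodvs_car)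

lemma V_eq_Wh: "(Wh n E$x)\<lparr>car := car (V x u)\<rparr> = V x u"
 by (simp add: Sp_def)

lemma Wh_vspace: "x \<in> Obj X ==> vspace (Wh n E$x)"
proof -
 assume "x \<in> Obj X"
 then interpret LA_mod n "E$x" by (rule LA_mod)
 show ?thesis by (rule W.vspace_axioms)
qed

lemma PV_vspace: "x \<in> Obj X ==> vspace (PV x gs u)"
 unfolding PV_def
 by (rule prodvs_vspace[OF Wh_vspace]) (auto simp: V_eq_Wh V_vspace V_carrier)

lemma PV_dim: "x \<in> Obj X ==> \<exists>d. vdim (PV x gs u) d"
proof -
 assume x: "x \<in> Obj X"
 have "\<forall>k. \<exists>d. vdim (V x ((gs ! k) u)) d" using V_dim[OF x] by blast
 then obtain d where "\<And>k. vdim (V x ((gs ! k) u)) (d k)" by metis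
 then have "vdim (PV x gs u) (\<Sum>k<length gs. d k)"
  unfolding PV_def by (intro vdim_prodvs[OF Wh_vspace[OF x]]) (auto simp: V_eq_Wh V_vspace V_carrier x)
 then show ?thesis by blast
qed

lemma zero_V: "x \<in> Obj X ==> \<^bold>0x \<in> car (V x u)"
 using vspace.zer_mem[OF V_vspace] by simp

lemma zero_add [simp]: "x \<in> Obj X ==> \<^bold>0x \<oplus>\<^bsub>E$x\<^esub> \<^bold>0x = \<^bold>0x"
 and zero_scl [simp]: "x \<in> Obj X ==> scalar_act (LA n) E$x c \<^bold>0x = \<^bold>0x"
 using vspace.pls_zer[OF Wh_vspace vspace.zer_mem[OF Wh_vspace]] vspace.scl_zer[OF Wh_vspace] by simp_all

lemma tr_zero: "x \<in> Obj X ==> tr x u v \<^bold>0x = \<^bold>0x"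
 using lin_zer[OF tr_lin V_vspace V_vspace, of x u v] by simp

lemma am_zero: "f \<in> Homset X x y ==> am f \<^bold>0x = \<^bold>0y"
 using lin_zer[OF am_lin[of f x y 0] V_vspace V_vspace] dom cod by simp

lemma PT_lin: "x \<in> Obj X ==> lin (PV x gs u) (PV x gs v) (PT x gs u v)"
proof (rule linI)
 fix a b c assume x: "x \<in> Obj X" and a: "a \<in> car (PV x gs u)"
 note l = tr_lin[OF x]
 show "PT x gs u v a \<in> car (PV x gs v)" using a lin_mem[OF l] by (simp add: PV_car PT_def)
 show "PT x gs u v (scl (PV x gs u) c a) = scl (PV x gs v) c (PT x gs u v a)"
  by (rule ext) (use a x lin_scl[OF l] in \<open>simp add: PV_car PT_def\<close>)
 assume "b \<in> car (PV x gs u)"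
 then show "PT x gs u v (pls (PV x gs u) a b) = pls (PV x gs v) (PT x gs u v a) (PT x gs u v b)"
  by (intro ext[where f = "PT x gs u v (pls (PV x gs u) a b)"]) (use a x lin_pls[OF l] in \<open>simp add: PV_car PT_def\<close>)
qed

lemma PA_lin: "f \<in> Homset X x y ==> lin (PV x gs u) (PV y gs u) (PA y gs f)"
proof (rule linI)
 fix a b c assume f: "f \<in> Homset X x y" and a: "a \<in> car (PV x gs u)"
 note l = am_lin[OF f] and y = cod[OF f]
 show "PA y gs f a \<in> car (PV y gs u)" using a lin_mem[OF l] by (simp add: PV_car PA_def)
 have s: "am f (scalar_act (LA n) E$x c (a k)) = scalar_act (LA n) E$y c (am f (a k))"
  if "k < length gs" for k
  using lin_scl[OF am_lin[OF f, of "(gs ! k) u"], of "a k" c] a that by (simp add: PV_car)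
 show "PA y gs f (scl (PV x gs u) c a) = scl (PV y gs u) c (PA y gs f a)"
  by (rule ext) (simp add: PA_def s y)
 assume b: "b \<in> car (PV x gs u)"
 have "am f (a k \<oplus>\<^bsub>E$x\<^esub> b k) = am f (a k) \<oplus>\<^bsub>E$y\<^esub> am f (b k)" if "k < length gs" for k
  using lin_pls[OF am_lin[OF f, of "(gs ! k) u"], of "a k" "b k"] a b that by (simp add: PV_car)
 then show "PA y gs f (pls (PV x gs u) a b) = pls (PV y gs u) (PA y gs f a) (PA y gs f b)"
  by (intro ext[where f = "PA y gs f (pls (PV x gs u) a b)"]) (simp add: PA_def y)
qed

definition decomp_by where
 "decomp_by gs H \<beta> \<longleftrightarrow> is_functor X X H \<and> (\<forall>x\<in>Obj X. \<forall>u. 1 \<le> u \<and> u \<le> n -->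
   liso (V H$x u) (PV x gs u) (\<beta> x u) \<and>
   (\<forall>v z. u \<le> v \<and> v \<le> n \<and> z \<in> car (V H$x u) -->
    \<beta> x v (tr H$x u v z) = PT x gs u v (\<beta> x u z)) \<and>
   (\<forall>y. \<forall>f\<in>Homset X x y. \<forall>z\<in>car (V H$x u).
    \<beta> y u (am (on_arr H f) z) = PA y gs f (\<beta> x u z)))"

text \<open>The functor \<open>H\<close> is isomorphic to the direct sum of the reindexing functors along the members of the
 list.\<close>

definition decomp where
 "decomp gs H \<longleftrightarrow> (\<forall>g\<in>set gs. good g) \<and> (\<exists>\<beta>. decomp_by gs H \<beta>)"

lemma decomp_by_functor: "decomp_by gs H \<beta> ==> is_functor X X H"
 unfolding decomp_by_def by blast

lemma decomp_functor: "decomp gs H ==> is_functor X X H"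
 unfolding decomp_def using decomp_by_functor by blast

lemma db_liso: "[|decomp_by gs H \<beta>; x \<in> Obj X; 1 \<le> u; u \<le> n|] ==> liso (V H$x u) (PV x gs u) (\<beta> x u)"
 unfolding decomp_by_def by blast

lemma db_tr: "[|decomp_by gs H \<beta>; x \<in> Obj X; 1 \<le> u; u \<le> v; v \<le> n; z \<in> car (V H$x u)|] ==>
  \<beta> x v (tr H$x u v z) = PT x gs u v (\<beta> x u z)"
 unfolding decomp_by_def using le_trans by blast

lemma db_nat: "[|decomp_by gs H \<beta>; f \<in> Homset X x y; 1 \<le> u; u \<le> n; z \<in> car (V H$x u)|] ==>
  \<beta> y u (am (on_arr H f) z) = PA y gs f (\<beta> x u z)"
 unfolding decomp_by_def using dom by blast

lemma db_mem: "[|decomp_by gs H \<beta>; x \<in> Obj X; 1 \<le> u; u \<le> n; z \<in> car (V H$x u); k < length gs|] ==>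
  \<beta> x u z k \<in> car (V x ((gs ! k) u))"
 and db_zero: "[|decomp_by gs H \<beta>; x \<in> Obj X; 1 \<le> u; u \<le> n; z \<in> car (V H$x u); k \<ge> length gs|] ==>
  \<beta> x u z k = \<^bold>0x"
 using liso_mem[OF db_liso] by (simp_all add: PV_car)

abbreviation binv where "binv H \<beta> x u \<equiv> inv_into (car (V H$x u)) (\<beta> x u)"

text \<open>At the vertex \<open>n\<close>, which is not in the quiver, all components vanish.\<close>

lemma decompI:
 assumes H: "is_functor X X H" and gs: "\<forall>g\<in>set gs. good g"
  and l: "\<And>x u. [|x \<in> Obj X; 1 \<le> u; u < n|] ==> liso (V H$x u) (PV x gs u) (\<beta> x u)"
  and T: "\<And>x u v z. [|x \<in> Obj X; 1 \<le> u; u \<le> v; v < n; z \<in> car (V H$x u)|] ==>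
   \<beta> x v (tr H$x u v z) = PT x gs u v (\<beta> x u z)"
  and N: "\<And>f x y u z. [|f \<in> Homset X x y; 1 \<le> u; u < n; z \<in> car (V H$x u)|] ==>
   \<beta> y u (am (on_arr H f) z) = PA y gs f (\<beta> x u z)"
 shows "decomp gs H"
proof -
 \<comment> \<open>at \<open>n\<close> both sides are zero\<close>
 define \<gamma> where "\<gamma> x u = (if u < n then \<beta> x u else (\<lambda>_ _. \<^bold>0x))" for x u
 have Vn: "car (V x n) = {\<^bold>0x}" if "x \<in> Obj X" for x using V_outside[OF that, of n] by simp
 have gn: "(gs ! k) n = n" if "k < length gs" for k using gs that good_n by simp
 have PVn: "car (PV x gs n) = {\<lambda>k. \<^bold>0x}" if x: "x \<in> Obj X" for x
 proof -
  have "\<phi> k = \<^bold>0x" if "\<phi> \<in> car (PV x gs n)" for \<phi> k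
   using that gn Vn[OF x] by (cases "k < length gs") (auto simp: PV_car)
  moreover have "(\<lambda>k. \<^bold>0x) \<in> car (PV x gs n)" using x zero_V by (simp add: PV_car)
  ultimately show ?thesis by blast
 qed
 have "decomp_by gs H \<gamma>"
  unfolding decomp_by_def
 proof (intro conjI ballI allI impI H)
  fix x u assume x: "x \<in> Obj X" and u: "1 \<le> u \<and> u \<le> n"
  have Hx: "H$x \<in> Obj X" by (rule functor_Obj[OF H x])
  show "liso (V H$x u) (PV x gs u) (\<gamma> x u)"
  proof (cases "u < n")
   case False
   then have "u = n" using u by simp
   then show ?thesis using Vn[OF Hx] PVn[OF x] x by (auto simp: \<gamma>_def liso_def lin_def bij_betw_def)
  qed (use l x u in \<open>simp add: \<gamma>_def\<close>)
  show "\<gamma> x v (tr H$x u v z) = PT x gs u v (\<gamma> x u z)"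
   if v: "u \<le> v \<and> v \<le> n \<and> z \<in> car (V H$x u)" for v z
  proof (cases "v < n")
   case True
   then show ?thesis using T x u v by (simp add: \<gamma>_def)
  next
   case False
   then have vn: "v = n" using v by simp
   have "tr x ((gs ! k) u) n (\<gamma> x u z k) = \<^bold>0x" if k: "k < length gs" for k
   proof (cases "u < n")
    case True
    then have "\<gamma> x u z k \<in> car (V x ((gs ! k) u))"
     using liso_mem[OF l[OF x], of u z] u v k by (simp add: \<gamma>_def PV_car)
    then show ?thesis using tr_outside[OF x, of "(gs ! k) u" n] by simp
   next
    case False
    then show ?thesis using tr_zero[OF x] by (simp add: \<gamma>_def)
   qed
   then have "PT x gs u n (\<gamma> x u z) = (\<lambda>k. \<^bold>0x)"
    by (intro ext[where f = "PT x gs u n (\<gamma> x u z)"]) (simp add: PT_def gn)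
   then show ?thesis by (simp add: vn) (simp add: \<gamma>_def)
  qed
  fix y f z assume f: "f \<in> Homset X x y" and z: "z \<in> car (V H$x u)"
  show "\<gamma> y u (am (on_arr H f) z) = PA y gs f (\<gamma> x u z)"
   using N[OF f _ _ z] u am_zero[OF f] by (auto simp: \<gamma>_def PA_def fun_eq_iff)
 qed
 then show ?thesis using gs by (auto simp: decomp_def)
qed

lemma decomp_singleI:
 assumes H: "is_functor X X H" and g: "good g"
  and l: "\<And>x u. [|x \<in> Obj X; 1 \<le> u; u < n|] ==> liso (V H$x u) (V x (g u)) (\<theta> x u)"
  and T: "\<And>x u v z. [|x \<in> Obj X; 1 \<le> u; u \<le> v; v < n; z \<in> car (V H$x u)|] ==>
   \<theta> x v (tr H$x u v z) = tr x (g u) (g v) (\<theta> x u z)"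
  and N: "\<And>f x y u z. [|f \<in> Homset X x y; 1 \<le> u; u < n; z \<in> car (V H$x u)|] ==>
   \<theta> y u (am (on_arr H f) z) = am f (\<theta> x u z)"
 shows "decomp [g] H"
proof (rule decompI[where \<beta> = "\<lambda>x u z k. if k = 0 then \<theta> x u z else \<^bold>0x", OF H])
 fix x u assume x: "x \<in> Obj X" and u: "1 \<le> u" "u < n"
 note m = lin_mem[OF liso_lin[OF l[OF x u]]]
 show "liso (V H$x u) (PV x [g] u) (\<lambda>z k. if k = 0 then \<theta> x u z else \<^bold>0x)"
  unfolding liso_def
 proof
  show "lin (V H$x u) (PV x [g] u) (\<lambda>z k. if k = 0 then \<theta> x u z else \<^bold>0x)"
   using liso_lin[OF l[OF x u]] x by (auto simp: lin_def PV_car)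
  show "bij_betw (\<lambda>z k. if k = 0 then \<theta> x u z else \<^bold>0x) (car (V H$x u)) (car (PV x [g] u))"
  proof (rule bij_betwI[of _ _ _ "\<lambda>\<phi>. inv_into (car (V H$x u)) (\<theta> x u) (\<phi> 0)"])
   show "(\<lambda>z k. if k = 0 then \<theta> x u z else \<^bold>0x) \<in> car (V H$x u) \<rightarrow> car (PV x [g] u)"
    using m by (auto simp: PV_car)
   show "(\<lambda>\<phi>. inv_into (car (V H$x u)) (\<theta> x u) (\<phi> 0)) \<in> car (PV x [g] u) \<rightarrow> car (V H$x u)"
    using liso_mem[OF liso_inv[OF l[OF x u] V_vspace[OF functor_Obj[OF H x]]]] by (auto simp: PV_car)
  qed (use liso_inv_left[OF l[OF x u]] liso_inv_right[OF l[OF x u]] in \<open>auto simp: PV_car fun_eq_iff\<close>)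
 qed
qed (use g T N in \<open>auto simp: PT_def PA_def fun_eq_iff\<close>)

subsection \<open>Maps between products\<close>

text \<open>Rearrangement of the factors of a product along a partial map of indices: the new factor \<open>k\<close> is the
 old factor \<open>\<sigma> k\<close>, or zero. The isomorphisms, injections and projections between direct sums of
 reindexing functors that are needed below have this form.\<close>

definition RI :: "(nat => nat option) => 'o => (nat => nat => 'k) => nat => nat => 'k" where
 "RI \<sigma> x \<phi> = (\<lambda>k. case \<sigma> k of None => \<^bold>0x | Some l => \<phi> l)"

text \<open>Factors are moved only to positions with the same reindexing map.\<close>

definition compat :: "(nat => nat) list => (nat => nat) list => (nat => nat option) => bool" where
 "compat gs hs \<sigma> \<longleftrightarrow> (\<forall>k l. \<sigma> k = Some l --> k < length hs \<and> l < length gs \<and> hs ! k = gs ! l)"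

lemma RI_lin:
 assumes c: "compat gs hs \<sigma>" and x: "x \<in> Obj X"
 shows "lin (PV x gs u) (PV x hs u) (RI \<sigma> x)"
proof (rule linI)
 fix a assume a: "a \<in> car (PV x gs u)"
 have "RI \<sigma> x a k \<in> car (V x ((hs ! k) u))" if "k < length hs" for k
 proof (cases "\<sigma> k")
  case (Some l)
  then have "l < length gs" "hs ! k = gs ! l" using c by (auto simp: compat_def)
  then show ?thesis using a Some by (simp add: PV_car RI_def)
 qed (simp add: RI_def zero_V x)
 moreover have "RI \<sigma> x a k = \<^bold>0x" if k: "k \<ge> length hs" for k
 proof (cases "\<sigma> k")
  case (Some l)
  then have "k < length hs" using c unfolding compat_def by blast
  then show ?thesis using k by simp
 qed (simp add: RI_def)
 ultimately show "RI \<sigma> x a \<in> car (PV x hs u)" by (simp add: PV_car)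
qed (auto simp: RI_def x split: option.splits)

lemma RI_PT: "[|compat gs hs \<sigma>; x \<in> Obj X|] ==> RI \<sigma> x (PT x gs u v \<phi>) = PT x hs u v (RI \<sigma> x \<phi>)"
 using tr_zero by (auto simp: RI_def PT_def compat_def fun_eq_iff split: option.splits)

lemma RI_PA: "[|compat gs hs \<sigma>; f \<in> Homset X x y|] ==> RI \<sigma> y (PA y gs f \<phi>) = PA y hs f (RI \<sigma> x \<phi>)"
 using am_zero by (auto simp: RI_def PA_def compat_def fun_eq_iff split: option.splits)

lemma cnat_RI:
 assumes F: "decomp_by gs F \<beta>" and H: "decomp_by hs H \<gamma>" and c: "compat gs hs \<sigma>"
 shows "cnat F H (\<lambda>x u z. binv H \<gamma> x u (RI \<sigma> x (\<beta> x u z)))"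
 unfolding cnat_def
proof (intro conjI ballI allI impI)
 show FF: "is_functor X X F" and HF: "is_functor X X H"
  using F H by (simp_all add: decomp_by_functor)
 fix x u assume x: "x \<in> Obj X" and "1 \<le> u \<and> u < n"
 then have u: "1 \<le> u" "u \<le> n" "u < n" by auto
 have Hx: "H$x \<in> Obj X" by (rule functor_Obj[OF HF x])
 note lF = db_liso[OF F x] and lH = db_liso[OF H x]
 show l: "lin (V F$x u) (V H$x u) (\<lambda>z. binv H \<gamma> x u (RI \<sigma> x (\<beta> x u z)))"
  by (rule lin_comp[OF lin_comp[OF liso_lin[OF lF[OF u(1,2)]] RI_lin[OF c x]] liso_lin[OF liso_inv[OF lH[OF u(1,2)] V_vspace[OF Hx]]]])
 have g: "\<gamma> x w (binv H \<gamma> x w (RI \<sigma> x (\<beta> x w z))) = RI \<sigma> x (\<beta> x w z)"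
  if "1 \<le> w" "w \<le> n" "z \<in> car (V F$x w)" for w z
  by (rule liso_inv_right[OF lH[OF that(1,2)] lin_mem[OF RI_lin[OF c x] liso_mem[OF lF[OF that(1,2)] that(3)]]])
 show "binv H \<gamma> x v (RI \<sigma> x (\<beta> x v (tr F$x u v z))) = tr H$x u v (binv H \<gamma> x u (RI \<sigma> x (\<beta> x u z)))"
  if v: "u \<le> v \<and> v < n \<and> z \<in> car (V F$x u)" for v z
 proof -
  let ?w = "binv H \<gamma> x u (RI \<sigma> x (\<beta> x u z))"
  have v': "u \<le> v" "v \<le> n" "1 \<le> v" and z: "z \<in> car (V F$x u)" using v u by auto
  have w: "?w \<in> car (V H$x u)" by (rule lin_mem[OF l z])
  have "\<gamma> x v (tr H$x u v ?w) = PT x hs u v (RI \<sigma> x (\<beta> x u z))"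
   using db_tr[OF H x u(1) v'(1,2) w] g[OF u(1,2) z] by simp
  also have "\<dots> = RI \<sigma> x (\<beta> x v (tr F$x u v z))"
   using RI_PT[OF c x] db_tr[OF F x u(1) v'(1,2) z] by simp
  finally show ?thesis
   using liso_inv_left[OF lH[OF v'(3,2)] lin_mem[OF tr_lin[OF Hx] w, of v]] by simp
 qed
 fix y f z assume f: "f \<in> Homset X x y" and z: "z \<in> car (V F$x u)"
 let ?w = "binv H \<gamma> x u (RI \<sigma> x (\<beta> x u z))"
 have w: "?w \<in> car (V H$x u)" by (rule lin_mem[OF l z])
 have "\<gamma> y u (am (on_arr H f) ?w) = PA y hs f (RI \<sigma> x (\<beta> x u z))"
  using db_nat[OF H f u(1,2) w] g[OF u(1,2) z] by simp
 also have "\<dots> = RI \<sigma> y (\<beta> y u (am (on_arr F f) z))"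
  using RI_PA[OF c f] db_nat[OF F f u(1,2) z] by simp
 finally show "binv H \<gamma> y u (RI \<sigma> y (\<beta> y u (am (on_arr F f) z))) = am (on_arr H f) ?w"
  using liso_inv_left[OF db_liso[OF H cod[OF f] u(1,2)] lin_mem[OF am_lin[OF functor_Homset[OF HF f]] w]] by simp
qed

lemma binv_RI:
 assumes F: "decomp_by gs F \<beta>" and H: "decomp_by hs H \<gamma>" and c: "compat gs hs \<sigma>"
  and x: "x \<in> Obj X" and u: "1 \<le> u" "u < n" and z: "z \<in> car (V F$x u)"
 shows "\<gamma> x u (binv H \<gamma> x u (RI \<sigma> x (\<beta> x u z))) = RI \<sigma> x (\<beta> x u z)"
 using u lin_mem[OF RI_lin[OF c x] liso_mem[OF db_liso[OF F x] z]]
 by (intro liso_inv_right[OF db_liso[OF H x]]) auto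

lemma RI_RI:
 assumes "\<phi> \<in> car (PV x gs u)" and "\<And>k. k < length gs ==> \<exists>l. \<sigma> k = Some l \<and> \<tau> l = Some k"
  and "\<And>k. k \<ge> length gs ==> \<sigma> k = None"
 shows "RI \<sigma> x (RI \<tau> x \<phi>) = \<phi>"
proof
 fix k
 show "RI \<sigma> x (RI \<tau> x \<phi>) k = \<phi> k"
 proof (cases "k < length gs")
  case True
  then show ?thesis using assms(2)[OF True] by (auto simp: RI_def)
 next
  case False
  then show ?thesis using assms(1,3) by (simp add: RI_def PV_car)
 qed
qed

lemma db_RI_RI:
 assumes F: "decomp_by gs F \<beta>" and H: "decomp_by hs H \<gamma>" and c: "compat gs hs \<tau>" "compat hs gs \<sigma>"
  and s: "\<And>k. k < length gs ==> \<exists>l. \<sigma> k = Some l \<and> \<tau> l = Some k"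
  and x: "x \<in> Obj X" and u: "1 \<le> u" "u < n" and z: "z \<in> car (V F$x u)"
 shows "binv F \<beta> x u (RI \<sigma> x (\<gamma> x u (binv H \<gamma> x u (RI \<tau> x (\<beta> x u z))))) = z"
proof -
 have u': "u \<le> n" using u by simp
 have "\<sigma> k = None" if k: "k \<ge> length gs" for k
 proof (rule ccontr)
  assume "\<sigma> k \<noteq> None"
  then have "k < length gs" using c(2) unfolding compat_def by blast
  then show False using k by simp
 qed
 then have "RI \<sigma> x (RI \<tau> x (\<beta> x u z)) = \<beta> x u z"
  using RI_RI[OF liso_mem[OF db_liso[OF F x u(1) u'] z] s] by blast
 then show ?thesis using binv_RI[OF F H c(1) x u z] liso_inv_left[OF db_liso[OF F x u(1) u'] z] by simp
qed

text \<open>The isomorphism is the identity rearrangement of the factors.\<close>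

lemma decomp_unique:
 assumes "decomp gs F" "decomp gs H"
 shows "functors_iso X X F H"
proof -
 obtain \<beta> \<gamma> where F: "decomp_by gs F \<beta>" and H: "decomp_by gs H \<gamma>" using assms by (auto simp: decomp_def)
 let ?\<sigma> = "\<lambda>k. if k < length gs then Some k else None"
 have c: "compat gs gs ?\<sigma>" by (auto simp: compat_def split: if_splits)
 let ?\<zeta> = "\<lambda>x u z. binv H \<gamma> x u (RI ?\<sigma> x (\<beta> x u z))" and ?\<xi> = "\<lambda>x u z. binv F \<beta> x u (RI ?\<sigma> x (\<gamma> x u z))"
 note a = cnat_RI[OF F H c] and b = cnat_RI[OF H F c]
 have "bij_betw (?\<zeta> x u) (car (V F$x u)) (car (V H$x u))" if x: "x \<in> Obj X" and u: "1 \<le> u" "u < n" for x u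
  by (rule bij_betwI[of _ _ _ "?\<xi> x u"])
   (use lin_mem[OF cnat_lin[OF a x u]] lin_mem[OF cnat_lin[OF b x u]] db_RI_RI[OF F H c c _ x u] db_RI_RI[OF H F c c _ x u] in auto)
 then show ?thesis using a functors_iso_iff by blast
qed

text \<open>The rearrangements are the inclusions of the first and the last factors and the corresponding
 projections.\<close>

lemma decomp_split:
 assumes "decomp (fs @ ks) H" "decomp fs F" "decomp ks K"
 shows "direct_sum X E H F K"
proof -
 obtain \<beta> \<phi> \<kappa> where H: "decomp_by (fs @ ks) H \<beta>" and F: "decomp_by fs F \<phi>" and K: "decomp_by ks K \<kappa>"
  using assms by (auto simp: decomp_def)
 let ?l = "\<lambda>k. if k < length fs then Some k else None"
 let ?j = "\<lambda>k. if length fs \<le> k \<and> k < length fs + length ks then Some (k - length fs) else None"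
 let ?q = "\<lambda>k. if k < length ks then Some (k + length fs) else None"
 have c: "compat fs (fs @ ks) ?l" "compat (fs @ ks) fs ?l" "compat ks (fs @ ks) ?j" "compat (fs @ ks) ks ?q"
  by (auto simp: compat_def nth_append split: if_splits)
 let ?i = "\<lambda>x u z. binv H \<beta> x u (RI ?l x (\<phi> x u z))" and ?p = "\<lambda>x u z. binv F \<phi> x u (RI ?l x (\<beta> x u z))"
 let ?jj = "\<lambda>x u z. binv H \<beta> x u (RI ?j x (\<kappa> x u z))" and ?qq = "\<lambda>x u z. binv K \<kappa> x u (RI ?q x (\<beta> x u z))"
 note cn = cnat_RI[OF F H c(1)] cnat_RI[OF K H c(3)] cnat_RI[OF H F c(2)] cnat_RI[OF H K c(4)]
 have "cds H F K ?i ?jj ?p ?qq"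
  unfolding cds_def
 proof (intro conjI ballI allI impI cn)
  fix x u z assume x: "x \<in> Obj X" and "1 \<le> u \<and> u < n"
  then have u: "1 \<le> u" "u < n" "u \<le> n" by auto
  show "?p x u (?i x u z) = z" if z: "z \<in> car (V F$x u)"
   by (rule db_RI_RI[OF F H c(1,2) _ x u(1,2) z]) auto
  show "?qq x u (?jj x u z) = z" if z: "z \<in> car (V K$x u)"
   by (rule db_RI_RI[OF K H c(3,4) _ x u(1,2) z]) auto
  assume z: "z \<in> car (V H$x u)"
  have p: "?p x u z \<in> car (V F$x u)" and q: "?qq x u z \<in> car (V K$x u)"
   using lin_mem[OF cnat_lin[OF cn(3) x u(1,2)] z] lin_mem[OF cnat_lin[OF cn(4) x u(1,2)] z] .
  note ip = lin_mem[OF cnat_lin[OF cn(1) x u(1,2)] p] and jq = lin_mem[OF cnat_lin[OF cn(2) x u(1,2)] q]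
  note lH = db_liso[OF H x u(1,3)]
  have "\<beta> x u (pls (V H$x u) (?i x u (?p x u z)) (?jj x u (?qq x u z))) =
    (\<lambda>k. RI ?l x (RI ?l x (\<beta> x u z)) k \<oplus>\<^bsub>E$x\<^esub> RI ?j x (RI ?q x (\<beta> x u z)) k)"
   using lin_pls[OF liso_lin[OF lH] ip jq] binv_RI[OF F H c(1) x u(1,2) p] binv_RI[OF K H c(3) x u(1,2) q]
    binv_RI[OF H F c(2) x u(1,2) z] binv_RI[OF H K c(4) x u(1,2) z] by simp
  also have "\<dots> = \<beta> x u z"
  proof
   fix k
   have m: "\<beta> x u z k \<in> carrier E$x"
    using db_mem[OF H x u(1,3) z, of k] db_zero[OF H x u(1,3) z, of k] V_carrier[OF x] zero_V[OF x]
    by (cases "k < length (fs @ ks)") auto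
   interpret W: vspace "Wh n E$x" by (rule Wh_vspace[OF x])
   show "RI ?l x (RI ?l x (\<beta> x u z)) k \<oplus>\<^bsub>E$x\<^esub> RI ?j x (RI ?q x (\<beta> x u z)) k = \<beta> x u z k"
    using m W.pls_zer[of "\<beta> x u z k"] W.zer_pls[of "\<beta> x u z k"] db_zero[OF H x u(1,3) z, of k] x
    by (auto simp: RI_def)
  qed
  finally show "pls (V H$x u) (?i x u (?p x u z)) (?jj x u (?qq x u z)) = z"
   using liso_eq_iff[OF lH vspace.pls_mem[OF V_vspace[OF functor_Obj[OF decomp_by_functor[OF H] x]] ip jq] z] by blast
 qed
 then show ?thesis unfolding direct_sum_iff by blast
qed

lemma decomp_iso_transfer:
 assumes "decomp gs F" "functors_iso X X F H"
 shows "decomp gs H"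
proof -
 obtain \<beta> where F: "decomp_by gs F \<beta>" and gs: "\<forall>g\<in>set gs. good g" using assms(1) by (auto simp: decomp_def)
 obtain \<zeta> where \<zeta>: "cnat F H \<zeta>"
  and b: "\<And>x u. [|x \<in> Obj X; 1 \<le> u; u < n|] ==> bij_betw (\<zeta> x u) (car (V F$x u)) (car (V H$x u))"
  using assms(2) functors_iso_iff by blast
 note FF = cnat_functor(1)[OF \<zeta>] and HF = cnat_functor(2)[OF \<zeta>]
 have l: "liso (V F$x u) (V H$x u) (\<zeta> x u)" if "x \<in> Obj X" "1 \<le> u" "u < n" for x u
  using cnat_lin[OF \<zeta> that] b[OF that] by (simp add: liso_def)
 have VF: "vspace (V F$x u)" if "x \<in> Obj X" for x u by (rule V_vspace[OF functor_Obj[OF FF that]])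
 let ?i = "\<lambda>x u. inv_into (car (V F$x u)) (\<zeta> x u)"
 have im: "?i x u z \<in> car (V F$x u)" if "x \<in> Obj X" "1 \<le> u" "u < n" "z \<in> car (V H$x u)" for x u z
  by (rule liso_mem[OF liso_inv[OF l[OF that(1-3)] VF[OF that(1)]] that(4)])
 show ?thesis
 proof (rule decompI[where \<beta> = "\<lambda>x u z. \<beta> x u (?i x u z)", OF HF gs])
  fix x u assume x: "x \<in> Obj X" and u: "1 \<le> u" "u < n"
  show "liso (V H$x u) (PV x gs u) (\<lambda>z. \<beta> x u (?i x u z))"
   using u by (intro liso_comp[OF liso_inv[OF l[OF x u] VF[OF x]] db_liso[OF F x]]) auto
 next
  fix x u v z assume x: "x \<in> Obj X" and u: "1 \<le> u" "u \<le> v" "v < n" and z: "z \<in> car (V H$x u)"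
  then have u': "u < n" "1 \<le> v" "v \<le> n" by auto
  note w = im[OF x u(1) u'(1) z]
  have "\<zeta> x v (tr F$x u v (?i x u z)) = tr H$x u v z"
   using cnat_tr[OF \<zeta> x u w] liso_inv_right[OF l[OF x u(1) u'(1)] z] by simp
  then have "?i x v (tr H$x u v z) = tr F$x u v (?i x u z)"
   using liso_inv_left[OF l[OF x u'(2) u(3)] lin_mem[OF tr_lin[OF functor_Obj[OF FF x]] w, of v]] by simp
  then show "\<beta> x v (?i x v (tr H$x u v z)) = PT x gs u v (\<beta> x u (?i x u z))"
   using db_tr[OF F x u(1,2) u'(3) w] by simp
 next
  fix f x y u z assume f: "f \<in> Homset X x y" and u: "1 \<le> u" "u < n" and z: "z \<in> car (V H$x u)"
  then have u': "u \<le> n" by auto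
  note w = im[OF dom[OF f] u z]
  have "\<zeta> y u (am (on_arr F f) (?i x u z)) = am (on_arr H f) z"
   using cnat_nat[OF \<zeta> f u w] liso_inv_right[OF l[OF dom[OF f] u] z] by simp
  then have "?i y u (am (on_arr H f) z) = am (on_arr F f) (?i x u z)"
   using liso_inv_left[OF l[OF cod[OF f] u] lin_mem[OF am_lin[OF functor_Homset[OF FF f]] w]] by simp
  then show "\<beta> y u (?i y u (am (on_arr H f) z)) = PA y gs f (\<beta> x u (?i x u z))"
   using db_nat[OF F f u(1) u' w] by simp
 qed
qed

text \<open>The prescribed components form a representation at each object; realize these and invoke
 \<open>functor_ex\<close>.\<close>

lemma decomp_ex:
 assumes gs: "\<forall>g\<in>set gs. good g"
 shows "\<exists>H. decomp gs H"
proof -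
 have q: "qrep n (PV x gs) (PT x gs)" if x: "x \<in> Obj X" for x
 proof (rule qrep.intro)
  fix u v w \<phi> assume u: "1 \<le> u" and \<phi>: "\<phi> \<in> car (PV x gs u)"
  {
   assume "u < n"
   then show "PT x gs u u \<phi> = \<phi>" using \<phi> tr_id[OF x] by (auto simp: PT_def PV_car fun_eq_iff)
  }
  assume uv: "u \<le> v" "v \<le> w" "w < n"
  have "tr x ((gs ! k) v) ((gs ! k) w) (tr x ((gs ! k) u) ((gs ! k) v) (\<phi> k)) = tr x ((gs ! k) u) ((gs ! k) w) (\<phi> k)"
   if k: "k < length gs" for k
  proof -
   have g: "good (gs ! k)" using gs k by simp
   show ?thesis
    using goodD(3)[OF g u uv(1)] goodD(3)[OF g _ uv(2)] u uv \<phi> k by (intro tr_tr[OF x]) (auto simp: PV_car)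
  qed
  then show "PT x gs v w (PT x gs u v \<phi>) = PT x gs u w \<phi>" by (auto simp: PT_def fun_eq_iff)
 qed (rule PV_vspace[OF x] PT_lin[OF x] PV_dim[OF x])+
 have PTA: "PA y gs f (PT x gs u v w) = PT y gs u v (PA y gs f w)"
  if f: "f \<in> Homset X x y" and w: "w \<in> car (PV x gs u)" for f x y u v w
  using am_tr[OF f] w by (auto simp: PA_def PT_def PV_car fun_eq_iff)
 have PAI: "PA x gs (Ident X x) w = w" if x: "x \<in> Obj X" and w: "w \<in> car (PV x gs u)" for x u w
  using am_id[OF x] w by (auto simp: PA_def PV_car fun_eq_iff)
 have PAC: "PA z gs (g \<bullet>\<^bsub>X\<^esub> f) w = PA z gs g (PA y gs f w)"
  if f: "f \<in> Homset X x y" and g: "g \<in> Homset X y z" and w: "w \<in> car (PV x gs u)" for f g x y z u w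
  using am_comp[OF f g] w by (auto simp: PA_def PV_car fun_eq_iff)
 have "\<exists>H \<beta>. is_functor X X H \<and> (\<forall>x\<in>Obj X. \<forall>u. 1 \<le> u \<and> u < n -->
   liso (V H$x u) (PV x gs u) (\<beta> x u) \<and>
   (\<forall>v z. u \<le> v \<and> v < n \<and> z \<in> car (V H$x u) --> \<beta> x v (tr H$x u v z) = PT x gs u v (\<beta> x u z)) \<and>
   (\<forall>y. \<forall>f\<in>Homset X x y. \<forall>z\<in>car (V H$x u). \<beta> y u (am (on_arr H f) z) = PA y gs f (\<beta> x u z)))"
 proof (rule functor_ex[where W = "\<lambda>x u. PV x gs u" and T = "\<lambda>x. PT x gs" and \<Phi> = "\<lambda>y f u. PA y gs f"])
  fix x assume "x \<in> Obj X"
  then show "qrep n (PV x gs) (PT x gs)" by (rule q)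
 qed (rule PA_lin PTA PAI PAC, assumption+)+
 then obtain H \<beta> where H: "is_functor X X H" and b: "\<forall>x\<in>Obj X. \<forall>u. 1 \<le> u \<and> u < n -->
   liso (V H$x u) (PV x gs u) (\<beta> x u) \<and>
   (\<forall>v z. u \<le> v \<and> v < n \<and> z \<in> car (V H$x u) --> \<beta> x v (tr H$x u v z) = PT x gs u v (\<beta> x u z)) \<and>
   (\<forall>y. \<forall>f\<in>Homset X x y. \<forall>z\<in>car (V H$x u). \<beta> y u (am (on_arr H f) z) = PA y gs f (\<beta> x u z))"
  by (elim exE conjE)
 note b = b[rule_format]
 have "decomp gs H"
 proof (rule decompI[where \<beta> = \<beta>, OF H gs])
  fix x u assume "x \<in> Obj X" "1 \<le> u" "u < n"
  then show "liso (V H$x u) (PV x gs u) (\<beta> x u)" using b by simp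
 next
  fix x u v z assume "x \<in> Obj X" "1 \<le> u" "u \<le> v" "v < n" "z \<in> car (V H$x u)"
  then show "\<beta> x v (tr H$x u v z) = PT x gs u v (\<beta> x u z)" using b[of x u] by simp
 next
  fix f x y u z assume f: "f \<in> Homset X x y" and "1 \<le> u" "u < n" "z \<in> car (V H$x u)"
  then show "\<beta> y u (am (on_arr H f) z) = PA y gs f (\<beta> x u z)" using b[OF dom[OF f], of u] by simp
 qed
 then show ?thesis by blast
qed

lemma decomp_append:
 assumes "direct_sum X E H F K" "decomp fs F" "decomp ks K"
 shows "decomp (fs @ ks) H"
proof -
 obtain i j p q where c: "cds H F K i j p q" using assms(1) direct_sum_iff by blast
 obtain \<phi> \<kappa> where F: "decomp_by fs F \<phi>" and K: "decomp_by ks K \<kappa>" and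
  gs: "\<forall>g\<in>set (fs @ ks). good g" using assms by (auto simp: decomp_def)
 note d = cdsD[OF c]
 note HF = cnat_functor(2)[OF d(1)]
 let ?m = "length fs"
 define \<beta> where "\<beta> x u z = (\<lambda>k. if k < ?m then \<phi> x u (p x u z) k else \<kappa> x u (q x u z) (k - ?m))" for x u z
 show ?thesis
 proof (rule decompI[where \<beta> = \<beta>, OF HF gs])
  fix x u assume x: "x \<in> Obj X" and u: "1 \<le> u" "u < n"
  then have u': "u \<le> n" by simp
  note lF = db_liso[OF F x u(1) u'] and lK = db_liso[OF K x u(1) u']
  note li = cnat_lin[OF d(1) x u] and lj = cnat_lin[OF d(2) x u] and lp = cnat_lin[OF d(3) x u] and lq = cnat_lin[OF d(4) x u]
  have vH: "vspace (V H$x u)" by (rule V_vspace[OF functor_Obj[OF HF x]])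
  have vF: "vspace (V F$x u)" by (rule V_vspace[OF functor_Obj[OF decomp_by_functor[OF F] x]])
  have vK: "vspace (V K$x u)" by (rule V_vspace[OF functor_Obj[OF decomp_by_functor[OF K] x]])
  have L1: "lin (V H$x u) (PV x fs u) (\<lambda>z. \<phi> x u (p x u z))" by (rule lin_comp[OF lp liso_lin[OF lF]])
  have L2: "lin (V H$x u) (PV x ks u) (\<lambda>z. \<kappa> x u (q x u z))" by (rule lin_comp[OF lq liso_lin[OF lK]])
  have L: "lin (V H$x u) (PV x (fs @ ks) u) (\<beta> x u)"
   using L1 L2 by (auto simp: lin_def PV_car nth_append \<beta>_def fun_eq_iff)
  have "bij_betw (\<beta> x u) (car (V H$x u)) (car (PV x (fs @ ks) u))"
  proof (rule bij_betw_imageI)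
   show "inj_on (\<beta> x u) (car (V H$x u))"
   proof (rule inj_onI)
    fix z w assume z: "z \<in> car (V H$x u)" and w: "w \<in> car (V H$x u)" and e: "\<beta> x u z = \<beta> x u w"
    have "\<phi> x u (p x u z) k = \<phi> x u (p x u w) k" for k
     using fun_cong[OF e, of k] db_zero[OF F x u(1) u' lin_mem[OF lp z]] db_zero[OF F x u(1) u' lin_mem[OF lp w]]
     by (cases "k < ?m") (auto simp: \<beta>_def)
    then have "p x u z = p x u w" using liso_eq_iff[OF lF lin_mem[OF lp z] lin_mem[OF lp w]] by blast
    moreover have "\<kappa> x u (q x u z) k = \<kappa> x u (q x u w) k" for k
     using fun_cong[OF e, of "k + ?m"] by (auto simp: \<beta>_def)
    then have "q x u z = q x u w" using liso_eq_iff[OF lK lin_mem[OF lq z] lin_mem[OF lq w]] by blast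
    ultimately show "z = w" using d(7)[OF x u z] d(7)[OF x u w] by simp
   qed
   have "\<psi> \<in> \<beta> x u ` car (V H$x u)" if \<psi>: "\<psi> \<in> car (PV x (fs @ ks) u)" for \<psi>
   proof -
    let ?a = "\<lambda>k. if k < ?m then \<psi> k else \<^bold>0x" and ?b = "\<lambda>k. \<psi> (k + ?m)"
    have ab: "?a \<in> car (PV x fs u)" "?b \<in> car (PV x ks u)"
    proof -
     have "\<psi> k \<in> car (V x ((fs ! k) u))" if "k < ?m" for k
      using \<psi>[unfolded PV_car, THEN conjunct1, rule_format, of k] that by (simp add: nth_append)
     moreover have "\<psi> (k + ?m) \<in> car (V x ((ks ! k) u))" if "k < length ks" for k
      using \<psi>[unfolded PV_car, THEN conjunct1, rule_format, of "k + ?m"] that by (simp add: nth_append)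
     ultimately show "?a \<in> car (PV x fs u)" "?b \<in> car (PV x ks u)"
      using \<psi> by (auto simp: PV_car)
    qed
    let ?a' = "binv F \<phi> x u ?a" and ?b' = "binv K \<kappa> x u ?b"
    have a': "?a' \<in> car (V F$x u)" "\<phi> x u ?a' = ?a"
     using liso_mem[OF liso_inv[OF lF vF] ab(1)] liso_inv_right[OF lF ab(1)] .
    have b': "?b' \<in> car (V K$x u)" "\<kappa> x u ?b' = ?b"
     using liso_mem[OF liso_inv[OF lK vK] ab(2)] liso_inv_right[OF lK ab(2)] .
    let ?z = "pls (V H$x u) (i x u ?a') (j x u ?b')"
    have z: "?z \<in> car (V H$x u)"
     by (rule vspace.pls_mem[OF vH lin_mem[OF li a'(1)] lin_mem[OF lj b'(1)]])
    have pz: "p x u ?z = ?a'"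
     using lin_pls[OF lp lin_mem[OF li a'(1)] lin_mem[OF lj b'(1)]] d(5)[OF x u a'(1)] cds_cross[OF c x u b'(1)]
      vspace.pls_zer[OF vF a'(1)] by simp
    have qz: "q x u ?z = ?b'"
     using lin_pls[OF lq lin_mem[OF li a'(1)] lin_mem[OF lj b'(1)]] d(6)[OF x u b'(1)] cds_cross[OF cds_swap[OF c] x u a'(1)]
      vspace.zer_pls[OF vK b'(1)] by simp
    have "\<beta> x u ?z = \<psi>"
    proof
     fix k
     show "\<beta> x u ?z k = \<psi> k" unfolding \<beta>_def pz qz a'(2) b'(2) by simp
    qed
    then show ?thesis by (intro image_eqI[OF _ z]) (rule sym)
   qed
   then show "\<beta> x u ` car (V H$x u) = car (PV x (fs @ ks) u)" using lin_mem[OF L] by blast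
  qed
  then show "liso (V H$x u) (PV x (fs @ ks) u) (\<beta> x u)" using L by (simp add: liso_def)
 next
  fix x u v z assume x: "x \<in> Obj X" and u: "1 \<le> u" "u \<le> v" "v < n" and z: "z \<in> car (V H$x u)"
  then have u': "u < n" "v \<le> n" by auto
  show "\<beta> x v (tr H$x u v z) = PT x (fs @ ks) u v (\<beta> x u z)"
   using cnat_tr[OF d(3) x u z] cnat_tr[OF d(4) x u z] db_tr[OF F x u(1,2) u'(2) lin_mem[OF cnat_lin[OF d(3) x u(1) u'(1)] z]]
    db_tr[OF K x u(1,2) u'(2) lin_mem[OF cnat_lin[OF d(4) x u(1) u'(1)] z]]
   by (intro ext[where f = "\<beta> x v (tr H$x u v z)"]) (auto simp: \<beta>_def PT_def nth_append)
 next
  fix f x y u z assume f: "f \<in> Homset X x y" and u: "1 \<le> u" "u < n" and z: "z \<in> car (V H$x u)"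
  then have u': "u \<le> n" by auto
  show "\<beta> y u (am (on_arr H f) z) = PA y (fs @ ks) f (\<beta> x u z)"
   using cnat_nat[OF d(3) f u z] cnat_nat[OF d(4) f u z] db_nat[OF F f u(1) u' lin_mem[OF cnat_lin[OF d(3) dom[OF f] u] z]]
    db_nat[OF K f u(1) u' lin_mem[OF cnat_lin[OF d(4) dom[OF f] u] z]]
   by (intro ext[where f = "\<beta> y u (am (on_arr H f) z)"]) (auto simp: \<beta>_def PA_def)
 qed
qed

lemma decomp_Nil_iff: "decomp [] H \<longleftrightarrow> zero_functor X E H"
proof
 assume d: "decomp [] H"
 then obtain \<beta> where H: "decomp_by [] H \<beta>" by (auto simp: decomp_def)
 note HF = decomp_by_functor[OF H]
 have "carrier (E$(H$x)) = {\<^bold>0(H$x)}" if x: "x \<in> Obj X" for x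
 proof -
  have Hx: "H$x \<in> Obj X" by (rule functor_Obj[OF HF x])
  have "car (V H$x u) = {\<^bold>0(H$x)}" for u
  proof (cases "1 \<le> u \<and> u < n")
   case True
   then have l: "liso (V H$x u) (PV x [] u) (\<beta> x u)" using db_liso[OF H x] by simp
   have "z = \<^bold>0(H$x)" if z: "z \<in> car (V H$x u)" for z
    using liso_zer_iff[OF l V_vspace[OF Hx] PV_vspace[OF x] z] liso_mem[OF l z] by (simp add: PV_car fun_eq_iff)
   then show ?thesis using zero_V[OF Hx] by auto
  next
   case False
   then show ?thesis using V_outside[OF Hx] by simp
  qed
  then show ?thesis using LA_mod.trivial_iff[OF LA_mod[OF Hx]] by simp
 qed
 then show "zero_functor X E H" using HF by (simp add: zero_functor_def)
next
 assume z: "zero_functor X E H"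
 then have HF: "is_functor X X H" by (simp add: zero_functor_def)
 have V0: "car (V H$x u) = {\<^bold>0(H$x)}" if x: "x \<in> Obj X" for x u
  using z x LA_mod.trivial_iff[OF LA_mod[OF functor_Obj[OF HF x]]] by (simp add: zero_functor_def)
 show "decomp [] H"
 proof (rule decompI[where \<beta> = "\<lambda>x u z k. \<^bold>0x", OF HF])
  fix x u assume x: "x \<in> Obj X"
  show "liso (V H$x u) (PV x [] u) (\<lambda>z k. \<^bold>0x)"
   using V0[OF x, of u] x by (auto simp: liso_def lin_def bij_betw_def PV_car image_iff)
 qed (auto simp: PT_def PA_def)
qed

lemma decomp_id: "decomp [\<lambda>u. u] id_functor"
 by (rule decomp_singleI[where \<theta> = "\<lambda>x u z. z"])
  (use id_functor_functor[OF cat] in \<open>auto simp: good_def liso_id\<close>)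

section \<open>Composition of reindexing functors\<close>

definition comp_list :: "(nat => nat) list => (nat => nat) list => (nat => nat) list" where
 "comp_list fs gs = map (\<lambda>i. gs ! (i mod length gs) \<circ> fs ! (i div length gs)) [0..<length fs * length gs]"

lemma comp_list_index:
 assumes "i < length fs * length gs"
 shows "i div length gs < length fs" "i mod length gs < length gs"
  "comp_list fs gs ! i = gs ! (i mod length gs) \<circ> fs ! (i div length gs)"
 using assms less_mult_imp_div_less[OF assms] by (cases "length gs = 0"; simp add: comp_list_def)+

lemma block_index: "l < m ==> (k * m + l) div m = (k::nat)" "l < m ==> (k * m + l) mod m = (l::nat)"
 by (subst div_mult_self3) auto

lemma comp_list_good: "[|\<forall>g\<in>set fs. good g; \<forall>g\<in>set gs. good g|] ==> \<forall>g\<in>set (comp_list fs gs). good g"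
proof
 fix h assume a: "\<forall>g\<in>set fs. good g" "\<forall>g\<in>set gs. good g" and "h \<in> set (comp_list fs gs)"
 then obtain i where i: "i < length fs * length gs" "h = gs ! (i mod length gs) \<circ> fs ! (i div length gs)"
  by (auto simp: comp_list_def)
 then show "good h" using a comp_list_index[OF i(1)] by (auto intro!: good_comp)
qed

text \<open>Reindexing twice: the component of \<open>F (G x)\<close> at \<open>u\<close> is a sum of components of \<open>G x\<close> at \<open>f u\<close>,
 each of which is a sum of components of \<open>x\<close> at \<open>g (f u)\<close>. The factors are numbered by division
 with remainder.\<close>

lemma decomp_comp:
 assumes "decomp fs F" "decomp gs G"
 shows "decomp (comp_list fs gs) (F \<circ>\<^sub>F G)"
proof -
 obtain \<phi> \<gamma> where F: "decomp_by fs F \<phi>" and G: "decomp_by gs G \<gamma>"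
  and gd: "\<forall>g\<in>set fs. good g" "\<forall>g\<in>set gs. good g" using assms by (auto simp: decomp_def)
 note FF = decomp_by_functor[OF F] and GF = decomp_by_functor[OF G]
 let ?m = "length gs" and ?r = "length fs" and ?L = "comp_list fs gs"
 have len: "length ?L = ?r * ?m" by (simp add: comp_list_def)
 have fk: "1 \<le> (fs ! k) u" "(fs ! k) u \<le> n" if "k < ?r" "1 \<le> u" "u \<le> n" for k u
  using goodD[of "fs ! k" u] gd that by force+
 have fmono: "(fs ! k) u \<le> (fs ! k) v" if "k < ?r" "1 \<le> u" "u \<le> v" "v \<le> n" for k u v
  using goodD(3)[of "fs ! k" u v] gd that by simp
 define \<beta> where "\<beta> x u z = (\<lambda>i. if i < ?r * ?m
   then \<gamma> x ((fs ! (i div ?m)) u) (\<phi> G$x u z (i div ?m)) (i mod ?m) else \<^bold>0x)" for x u z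
 show ?thesis
 proof (rule decompI[where \<beta> = \<beta>])
  show "is_functor X X (F \<circ>\<^sub>F G)" by (rule comp_functor_functor[OF FF GF])
  show "\<forall>g\<in>set ?L. good g" by (rule comp_list_good[OF gd])
 next
  fix x u assume x: "x \<in> Obj X" and u: "1 \<le> u" "u < n"
  then have u': "u \<le> n" by simp
  have Gx: "G$x \<in> Obj X" by (rule functor_Obj[OF GF x])
  have FGx: "F$(G$x) \<in> Obj X" by (rule functor_Obj[OF FF Gx])
  note lF = db_liso[OF F Gx u(1) u']
  have lG: "liso (V G$x ((fs ! k) u)) (PV x gs ((fs ! k) u)) (\<gamma> x ((fs ! k) u))" if "k < ?r" for k
   using db_liso[OF G x] fk[OF that u(1) u'] by simp
  let ?V = "V (F$(G$x)) u"
  have lin: "lin ?V (PV x ?L u) (\<beta> x u)"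
  proof (rule linI)
   fix a assume a: "a \<in> car ?V"
   have m: "\<phi> G$x u a k \<in> car (V G$x ((fs ! k) u))" if "k < ?r" for k
    by (rule db_mem[OF F Gx u(1) u' a that])
   have "\<beta> x u a i \<in> car (V x ((?L ! i) u))" if "i < ?r * ?m" for i
    using liso_mem[OF lG m, OF comp_list_index(1)[OF that] comp_list_index(1)[OF that]] comp_list_index[OF that] that by (simp add: \<beta>_def PV_car)
   then show "\<beta> x u a \<in> car (PV x ?L u)" by (simp add: PV_car len) (simp add: \<beta>_def)
   have "\<gamma> x ((fs ! k) u) (\<phi> G$x u (scl ?V c a) k) =
     (\<lambda>l. scalar_act (LA n) E$x c (\<gamma> x ((fs ! k) u) (\<phi> G$x u a k) l))" if "k < ?r" for k c
    using lin_scl[OF liso_lin[OF lF] a, of c] lin_scl[OF liso_lin[OF lG[OF that]] m[OF that], of c] by simp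
   then show "\<beta> x u (scl ?V c a) = scl (PV x ?L u) c (\<beta> x u a)" for c
    using x comp_list_index(1) by (intro ext[where f = "\<beta> x u (scl ?V c a)"]) (simp add: \<beta>_def)
   fix b assume b: "b \<in> car ?V"
   have m': "\<phi> G$x u b k \<in> car (V G$x ((fs ! k) u))" if "k < ?r" for k
    by (rule db_mem[OF F Gx u(1) u' b that])
   have "\<gamma> x ((fs ! k) u) (\<phi> G$x u (pls ?V a b) k) = (\<lambda>l. \<gamma> x ((fs ! k) u) (\<phi> G$x u a k) l
     \<oplus>\<^bsub>E$x\<^esub> \<gamma> x ((fs ! k) u) (\<phi> G$x u b k) l)" if "k < ?r" for k
    using lin_pls[OF liso_lin[OF lF] a b] lin_pls[OF liso_lin[OF lG[OF that]] m[OF that] m'[OF that]] by simp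
   then show "\<beta> x u (pls ?V a b) = pls (PV x ?L u) (\<beta> x u a) (\<beta> x u b)"
    using x comp_list_index(1) by (intro ext[where f = "\<beta> x u (pls ?V a b)"]) (simp add: \<beta>_def)
  qed
  have "bij_betw (\<beta> x u) (car ?V) (car (PV x ?L u))"
  proof (rule bij_betw_imageI)
   show "inj_on (\<beta> x u) (car ?V)"
   proof (rule inj_onI)
    fix a b assume a: "a \<in> car ?V" and b: "b \<in> car ?V" and e: "\<beta> x u a = \<beta> x u b"
    have "\<phi> G$x u a k = \<phi> G$x u b k" for k
    proof (cases "k < ?r")
     case True
     note ma = db_mem[OF F Gx u(1) u' a True] and mb = db_mem[OF F Gx u(1) u' b True]
     have "\<gamma> x ((fs ! k) u) (\<phi> G$x u a k) l = \<gamma> x ((fs ! k) u) (\<phi> G$x u b k) l" for l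
     proof (cases "l < ?m")
      case l: True
      have "k * ?m + l < ?r * ?m"
       using True l by (metis add_less_cancel_left less_le_trans mult_Suc mult_le_mono1 Suc_leI add.commute)
      then show ?thesis using fun_cong[OF e, of "k * ?m + l"] l by (simp add: \<beta>_def block_index)
     next
      case False
      then show ?thesis using liso_mem[OF lG[OF True] ma] liso_mem[OF lG[OF True] mb] by (simp add: PV_car)
     qed
     then show ?thesis using liso_eq_iff[OF lG[OF True] ma mb] by blast
    next
     case False
     then show ?thesis using db_zero[OF F Gx u(1) u' a] db_zero[OF F Gx u(1) u' b] by simp
    qed
    then show "a = b" using liso_eq_iff[OF lF a b] by blast
   qed
   have "\<psi> \<in> \<beta> x u ` car ?V" if \<psi>: "\<psi> \<in> car (PV x ?L u)" for \<psi>
   proof -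
    let ?c = "\<lambda>k l. if l < ?m then \<psi> (k * ?m + l) else \<^bold>0x"
    have c: "?c k \<in> car (PV x gs ((fs ! k) u))" if k: "k < ?r" for k
    proof -
     have "\<psi> (k * ?m + l) \<in> car (V x ((gs ! l) ((fs ! k) u)))" if l: "l < ?m" for l
     proof -
      have i: "k * ?m + l < ?r * ?m"
       using k l by (metis add_less_cancel_left less_le_trans mult_Suc mult_le_mono1 Suc_leI add.commute)
      then have "\<psi> (k * ?m + l) \<in> car (V x ((?L ! (k * ?m + l)) u))" using \<psi> by (simp add: PV_car len)
      then show ?thesis using comp_list_index(3)[OF i] l by (simp add: block_index)
     qed
     then show ?thesis by (simp add: PV_car)
    qed
    define a where "a k = (if k < ?r then inv_into (car (V G$x ((fs ! k) u))) (\<gamma> x ((fs ! k) u)) (?c k)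
     else \<^bold>0(G$x))" for k
    have am: "a k \<in> car (V G$x ((fs ! k) u))" "\<gamma> x ((fs ! k) u) (a k) = ?c k" if k: "k < ?r" for k
     using liso_mem[OF liso_inv[OF lG[OF k] V_vspace[OF Gx]] c[OF k]] liso_inv_right[OF lG[OF k] c[OF k]] k
     by (simp_all add: a_def)
    have a: "a \<in> car (PV G$x fs u)" using am(1) by (simp add: PV_car) (simp add: a_def)
    let ?z = "inv_into (car ?V) (\<phi> G$x u) a"
    have z: "?z \<in> car ?V" "\<phi> G$x u ?z = a"
     using liso_mem[OF liso_inv[OF lF V_vspace[OF FGx]] a] liso_inv_right[OF lF a] .
    have "\<beta> x u ?z i = \<psi> i" for i
    proof (cases "i < ?r * ?m")
     case True
     then show ?thesis using am(2)[OF comp_list_index(1)[OF True]] comp_list_index(2)[OF True]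
      by (simp add: \<beta>_def z(2))
    next
     case False
     then show ?thesis using \<psi> by (simp add: \<beta>_def PV_car len)
    qed
    then show ?thesis by (intro image_eqI[OF _ z(1)]) auto
   qed
   then show "\<beta> x u ` car ?V = car (PV x ?L u)" using lin_mem[OF lin] by blast
  qed
  then show "liso (V (on_obj (F \<circ>\<^sub>F G) x) u) (PV x ?L u) (\<beta> x u)" using lin by (simp add: liso_def)
 next
  fix x u v z assume x: "x \<in> Obj X" and u: "1 \<le> u" "u \<le> v" "v < n" and z: "z \<in> car (V (on_obj (F \<circ>\<^sub>F G) x) u)"
  then have u': "u \<le> n" "v \<le> n" and z: "z \<in> car (V (F$(G$x)) u)" by auto
  have Gx: "G$x \<in> Obj X" by (rule functor_Obj[OF GF x])
  have "\<gamma> x ((fs ! k) v) (\<phi> G$x v (tr (F$(G$x)) u v z) k) =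
    PT x gs ((fs ! k) u) ((fs ! k) v) (\<gamma> x ((fs ! k) u) (\<phi> G$x u z k))" if k: "k < ?r" for k
   using db_tr[OF F Gx u(1,2) u'(2) z] k fk[OF k u(1) u'(1)] fk[OF k _ u'(2)] u
    db_tr[OF G x _ fmono[OF k u(1,2) u'(2)] _ db_mem[OF F Gx u(1) u'(1) z k]] by (simp add: PT_def)
  then show "\<beta> x v (tr (on_obj (F \<circ>\<^sub>F G) x) u v z) = PT x ?L u v (\<beta> x u z)"
   using comp_list_index by (intro ext[where f = "\<beta> x v (tr (on_obj (F \<circ>\<^sub>F G) x) u v z)"]) (simp add: \<beta>_def PT_def len)
 next
  fix f x y u z assume f: "f \<in> Homset X x y" and u: "1 \<le> u" "u < n" and z: "z \<in> car (V (on_obj (F \<circ>\<^sub>F G) x) u)"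
  then have u': "u \<le> n" and z: "z \<in> car (V (F$(G$x)) u)" by auto
  note x = dom[OF f] and Gf = functor_Homset[OF GF f]
  have "\<gamma> y ((fs ! k) u) (\<phi> G$y u (am (on_arr F (on_arr G f)) z) k) =
    PA y gs f (\<gamma> x ((fs ! k) u) (\<phi> G$x u z k))" if k: "k < ?r" for k
   using db_nat[OF F Gf u(1) u' z] k fk[OF k u(1) u'] db_nat[OF G f _ _ db_mem[OF F functor_Obj[OF GF x] u(1) u' z k]]
   by (simp add: PA_def)
  then show "\<beta> y u (am (on_arr (F \<circ>\<^sub>F G) f) z) = PA y ?L f (\<beta> x u z)"
   using comp_list_index by (intro ext[where f = "\<beta> y u (am (on_arr (F \<circ>\<^sub>F G) f) z)"]) (simp add: \<beta>_def PA_def len)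
 qed
qed

subsection \<open>The functors attached to the vertices\<close>

lemma gi_good: "1 \<le> i ==> i < n ==> good (gi i)"
 by (auto simp: good_def gi_def)

text \<open>The functors \<open>G\<^sub>i\<close> reindex along \<open>gi i\<close>, by the isomorphisms \<open>theta\<close>.\<close>

lemma acts_as_G_decomp:
 assumes i: "1 \<le> i" "i < n" and H: "acts_as_G n X E i H"
 shows "decomp [gi i] H"
proof -
 interpret B: gbim n i "TYPE('k)" by unfold_locales (use i in auto)
 have HF: "is_functor X X H" using H by (simp add: acts_as_G_def)
 obtain \<eta> where \<eta>: "\<And>x. x \<in> Obj X ==> \<eta> x \<in> mod_iso (LA n) (E$(H$x)) (G_obj n i E$x)"
  and N: "\<And>f v. [|f \<in> Arr X; v \<in> carrier (on_obj E (H$(Dom X f)))|] ==>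
   \<eta> (Cod X f) (am (on_arr H f) v) = G_arr n i (on_arr E f) (\<eta> (Dom X f) v)"
  using H unfolding acts_as_G_def by blast
 have m2: "LA_mod2 n (E$(H$x)) (G_obj n i E$x)" if x: "x \<in> Obj X" for x
  using LA_mod[OF functor_Obj[OF HF x]] B.C_left_module[OF LA_mod[OF x]] by (simp add: LA_mod2_def LA_mod_def)
 have hom: "\<eta> x \<in> mod_hom (LA n) (E$(H$x)) (G_obj n i E$x)"
  and bij: "bij_betw (\<eta> x) (carrier (E$(H$x))) (carrier (G_obj n i E$x))" if x: "x \<in> Obj X" for x
  using \<eta>[OF x] by (simp_all add: mod_iso_def)
 have l: "liso (V H$x u) (Sp n (G_obj n i E$x) u) (\<eta> x)" if x: "x \<in> Obj X" for x u
  using LA_mod2.mod_hom_lin_Sp[OF m2[OF x] hom[OF x]] LA_mod2.mod_hom_bij_iff[OF m2[OF x] hom[OF x]] bij[OF x]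
  by (simp add: liso_def)
 have Gm: "\<eta> x z \<in> carrier (G_obj n i E$x)" if "x \<in> Obj X" "z \<in> carrier (E$(H$x))" for x z
  by (rule LA_mod2.mod_hom_mem[OF m2[OF that(1)] hom[OF that(1)] that(2)])
 show ?thesis
 proof (rule decomp_singleI[where \<theta> = "\<lambda>x u z. B.theta u (\<eta> x z)", OF HF gi_good[OF i]])
  fix x u assume x: "x \<in> Obj X" and u: "1 \<le> u" "u < n"
  show "liso (V H$x u) (V x (gi i u)) (\<lambda>z. B.theta u (\<eta> x z))"
   by (rule liso_comp[OF l[OF x] B.theta_liso[OF LA_mod[OF x] u(1)]])
 next
  fix x u v z assume x: "x \<in> Obj X" and u: "1 \<le> u" "u \<le> v" "v < n" and z: "z \<in> car (V H$x u)"
  have zc: "z \<in> carrier (E$(H$x))" by (rule V_carrier[OF functor_Obj[OF HF x] z])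
  show "B.theta v (\<eta> x (tr H$x u v z)) = tr x (gi i u) (gi i v) (B.theta u (\<eta> x z))"
   using LA_mod2.mod_hom_Tr[OF m2[OF x] hom[OF x] zc, of u v] B.theta_Tr[OF LA_mod[OF x] Gm[OF x zc] u(2)] by simp
 next
  fix f x y u z assume f: "f \<in> Homset X x y" and z: "z \<in> car (V H$x u)"
  have zc: "z \<in> carrier (E$(H$x))" by (rule V_carrier[OF functor_Obj[OF HF dom[OF f]] z])
  have "\<eta> y (am (on_arr H f) z) = G_arr n i (E$x, am f, E$y) (\<eta> x z)"
   using N[of f z] zc E_arr[OF f] Homset_Arr[OF f] Homset_Dom[OF f] Homset_Cod[OF f] by simp
  then show "B.theta u (\<eta> y (am (on_arr H f) z)) = am f (B.theta u (\<eta> x z))"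
   using B.theta_G_arr[OF LA_mod[OF dom[OF f]] Gm[OF dom[OF f] zc]] by simp
 qed
qed

text \<open>Conversely, a functor that reindexes along \<open>gi i\<close> acts as \<open>G\<^sub>i\<close>: the inverses of the maps \<open>theta\<close>
 assemble to isomorphisms of modules.\<close>

lemma acts_as_G_ex:
 assumes i: "1 \<le> i" "i < n"
 shows "\<exists>H. acts_as_G n X E i H"
proof -
 interpret B: gbim n i "TYPE('k)" by unfold_locales (use i in auto)
 have "\<forall>g\<in>set [gi i]. good g" using gi_good[OF i] by simp
 from decomp_ex[OF this] obtain H \<beta> where H: "decomp_by [gi i] H \<beta>" by (auto simp: decomp_def)
 note HF = decomp_by_functor[OF H]
 have m2: "LA_mod2 n (E$(H$x)) (G_obj n i E$x)" if x: "x \<in> Obj X" for x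
  using LA_mod[OF functor_Obj[OF HF x]] B.C_left_module[OF LA_mod[OF x]] by (simp add: LA_mod2_def LA_mod_def)
 let ?th = "\<lambda>x u. inv_into (car (Sp n (G_obj n i E$x) u)) (B.theta u)"
 have "\<exists>h. h \<in> mod_iso (LA n) (E$(H$x)) (G_obj n i E$x) \<and>
  (\<forall>u z. 1 \<le> u \<and> u < n \<and> z \<in> car (V H$x u) --> B.theta u (h z) = \<beta> x u z 0)" if x: "x \<in> Obj X" for x
 proof -
  let ?C = "G_obj n i E$x"
  interpret LA_mod2 n "E$(H$x)" ?C by (rule m2[OF x])
  have Hx: "H$x \<in> Obj X" by (rule functor_Obj[OF HF x])
  note th = B.theta_liso[OF LA_mod[OF x]]
  define \<psi> where "\<psi> u z = (if 1 \<le> u \<and> u < n then ?th x u (\<beta> x u z 0) else zer (Wh n ?C))" for u z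
  have b0: "liso (V H$x u) (V x (gi i u)) (\<lambda>z. \<beta> x u z 0)" if u: "1 \<le> u" "u < n" for u
  proof -
   have l: "liso (V H$x u) (PV x [gi i] u) (\<beta> x u)" using db_liso[OF H x] u by simp
   have "liso (PV x [gi i] u) (V x (gi i u)) (\<lambda>\<phi>. \<phi> 0)"
    unfolding liso_def
   proof
    show "lin (PV x [gi i] u) (V x (gi i u)) (\<lambda>\<phi>. \<phi> 0)" by (auto simp: lin_def PV_car)
    show "bij_betw (\<lambda>\<phi>. \<phi> 0) (car (PV x [gi i] u)) (car (V x (gi i u)))"
     by (rule bij_betwI[of _ _ _ "\<lambda>z k. if k = 0 then z else \<^bold>0x"]) (auto simp: PV_car)
   qed
   from liso_comp[OF l this] show ?thesis .
  qed
  have l: "liso (V H$x u) (Sp n ?C u) (\<psi> u)" for u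
  proof (cases "1 \<le> u \<and> u < n")
   case True
   then have u: "1 \<le> u" "u < n" by auto
   have "\<psi> u = (\<lambda>z. ?th x u (\<beta> x u z 0))" by (rule ext) (use u in \<open>simp add: \<psi>_def\<close>)
   then show ?thesis using liso_comp[OF b0[OF u] liso_inv[OF th[OF u(1)] N.Sp_vspace]] by simp
  next
   case False
   then have "car (V H$x u) = {zer (V H$x u)}" "car (Sp n ?C u) = {\<zero>\<^bsub>?C\<^esub>}"
    using V_outside[OF Hx] N.Sp_outside by auto
   moreover have "\<zero>\<^bsub>?C\<^esub> \<oplus>\<^bsub>?C\<^esub> \<zero>\<^bsub>?C\<^esub> = \<zero>\<^bsub>?C\<^esub>" "scalar_act (LA n) ?C c \<zero>\<^bsub>?C\<^esub> = \<zero>\<^bsub>?C\<^esub>" for c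
    using N.W.pls_zer[OF N.W.zer_mem] N.W.scl_zer by simp_all
   moreover have "\<psi> u = (\<lambda>_. \<zero>\<^bsub>?C\<^esub>)" using False by (auto simp: \<psi>_def)
   ultimately show ?thesis using zero_add[OF Hx] zero_scl[OF Hx] by (simp add: liso_def lin_def bij_betw_def)
  qed
  have thp: "B.theta u (\<psi> u z) = \<beta> x u z 0" if "1 \<le> u" "u < n" "z \<in> car (V H$x u)" for u z
   using liso_inv_right[OF th liso_mem[OF b0 that(3)]] that by (simp add: \<psi>_def)
  have T: "\<psi> v (tr H$x u v z) = Tr n ?C u v (\<psi> u z)" if uv: "u \<le> v" and z: "z \<in> car (V H$x u)" for u v z
  proof (cases "1 \<le> u \<and> v < n")
   case True
   then have u: "1 \<le> u" "u < n" "1 \<le> v" "v < n" using uv by auto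
   note m = liso_mem[OF l z]
   have t: "tr H$x u v z \<in> car (V H$x v)" by (rule lin_mem[OF tr_lin[OF Hx] z])
   have "B.theta v (Tr n ?C u v (\<psi> u z)) = tr x (gi i u) (gi i v) (\<beta> x u z 0)"
    using B.theta_Tr[OF LA_mod[OF x] N.Sp_carrier[OF m] uv] thp[OF u(1,2) z] by simp
   also have "\<dots> = B.theta v (\<psi> v (tr H$x u v z))"
    using thp[OF u(3,4) t] db_tr[OF H x u(1) uv _ z] u by (simp add: PT_def)
   finally show ?thesis
    using liso_eq_iff[OF th[OF u(3)] lin_mem[OF N.lin_Tr_Sp m] liso_mem[OF l t]] by simp
  next
   case False
   then have nu: "\<not> (1 \<le> u \<and> u \<le> v \<and> v < n)" by simp
   have "\<psi> v (zer (V H$x v)) = \<zero>\<^bsub>?C\<^esub>" using lin_zer[OF liso_lin[OF l] V_vspace[OF Hx] N.Sp_vspace] by simp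
   then show ?thesis using tr_outside[OF Hx nu z] N.Tr_outside[OF nu N.Sp_carrier[OF liso_mem[OF l z]]] by simp
  qed
  obtain h where h: "h \<in> mod_hom (LA n) (E$(H$x)) ?C" "\<And>u z. z \<in> car (V H$x u) ==> h z = \<psi> u z"
   using assemble[OF liso_lin[OF l] T] by blast
  have "bij_betw h (car (V H$x u)) (car (Sp n ?C u))" for u
   using liso_bij[OF l] h(2) by (simp cong: bij_betw_cong)
  then have "h \<in> mod_iso (LA n) (E$(H$x)) ?C" using h(1) mod_hom_bij_iff by (simp add: mod_iso_def)
  then show ?thesis
  proof (intro exI[of _ h] conjI allI impI)
   fix u z assume "1 \<le> u \<and> u < n \<and> z \<in> car (V H$x u)"
   then show "B.theta u (h z) = \<beta> x u z 0" using h(2)[of z u] thp[of u z] by simp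
  qed
 qed
 then have "\<forall>x\<in>Obj X. \<exists>h. h \<in> mod_iso (LA n) (E$(H$x)) (G_obj n i E$x) \<and>
  (\<forall>u z. 1 \<le> u \<and> u < n \<and> z \<in> car (V H$x u) --> B.theta u (h z) = \<beta> x u z 0)" by blast
 from bchoice[OF this] obtain \<eta> where \<eta>: "\<And>x. x \<in> Obj X ==> \<eta> x \<in> mod_iso (LA n) (E$(H$x)) (G_obj n i E$x)"
  and th: "\<And>x u z. [|x \<in> Obj X; 1 \<le> u; u < n; z \<in> car (V H$x u)|] ==> B.theta u (\<eta> x z) = \<beta> x u z 0" by blast
 have N: "\<eta> y (am (on_arr H f) v) = G_arr n i (on_arr E f) (\<eta> x v)"
  if f: "f \<in> Homset X x y" and v: "v \<in> carrier (E$(H$x))" for f x y v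
 proof -
  note x = dom[OF f] and y = cod[OF f] and Hf = functor_Homset[OF HF f]
  let ?Hx = "E$(H$x)" and ?Cy = "G_obj n i E$y" and ?Cx = "G_obj n i E$x"
  interpret LA_mod2 n ?Hx ?Cy
   using m2[OF x] m2[OF y] by (simp add: LA_mod2_def)
  have hx: "\<eta> x \<in> mod_hom (LA n) ?Hx ?Cx" and hy: "\<eta> y \<in> mod_hom (LA n) (E$(H$y)) ?Cy"
   using \<eta>[OF x] \<eta>[OF y] by (simp_all add: mod_iso_def)
  have Gf: "G_arr n i (on_arr E f) \<in> mod_hom (LA n) ?Cx ?Cy"
   using B.G_arr_mem[OF LA_mod[OF x] LA_mod[OF y] am_mod_hom[OF f]] E_arr[OF f] by simp
  have "compose (carrier ?Hx) (\<eta> y) (am (on_arr H f)) v = compose (carrier ?Hx) (G_arr n i (on_arr E f)) (\<eta> x) v"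
  proof (rule mod_hom_eqI[OF mod_hom_compose[OF M.LA_mod_axioms am_mod_hom[OF Hf] hy] mod_hom_compose[OF M.LA_mod_axioms hx Gf] _ v])
   fix u z assume z: "z \<in> car (V H$x u)"
   have zc: "z \<in> carrier ?Hx" by (rule M.Sp_carrier[OF z])
   note az = lin_mem[OF am_lin[OF Hf] z]
   have ez: "\<eta> x z \<in> car (Sp n ?Cx u)" using lin_mem[OF LA_mod2.mod_hom_lin_Sp[OF m2[OF x] hx] z] .
   have ea: "\<eta> y (am (on_arr H f) z) \<in> car (Sp n ?Cy u)" using lin_mem[OF LA_mod2.mod_hom_lin_Sp[OF m2[OF y] hy] az] .
   have eg: "G_arr n i (on_arr E f) (\<eta> x z) \<in> car (Sp n ?Cy u)"
    using lin_mem[OF LA_mod2.mod_hom_lin_Sp[OF _ Gf] ez] m2[OF x] m2[OF y] by (simp add: LA_mod2_def)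
   have "\<eta> y (am (on_arr H f) z) = G_arr n i (on_arr E f) (\<eta> x z)"
   proof (cases "1 \<le> u \<and> u < n")
    case True
    then have u: "1 \<le> u" "u < n" by auto
    have "B.theta u (G_arr n i (on_arr E f) (\<eta> x z)) = am f (\<beta> x u z 0)"
     by (subst E_arr[OF f])
      (use B.theta_G_arr[OF LA_mod[OF x], of "\<eta> x z"] LA_mod2.mod_hom_mem[OF m2[OF x] hx zc] th[OF x u z] in simp)
    also have "\<dots> = B.theta u (\<eta> y (am (on_arr H f) z))"
     using th[OF y u az] db_nat[OF H f u(1) _ z] u by (simp add: PA_def)
    finally show ?thesis using liso_eq_iff[OF B.theta_liso[OF LA_mod[OF y] u(1)] ea eg] by simp
   next
    case False
    then show ?thesis using ea eg N.Sp_outside by simp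
   qed
   then show "compose (carrier ?Hx) (\<eta> y) (am (on_arr H f)) z = compose (carrier ?Hx) (G_arr n i (on_arr E f)) (\<eta> x) z"
    using zc by (simp add: compose_def)
  qed
  then show ?thesis using v by (simp add: compose_def)
 qed
 have "acts_as_G n X E i H"
  unfolding acts_as_G_def
  by (intro conjI exI[of _ \<eta>] ballI HF) (rule \<eta> N[OF HomsetI]; assumption)+
 then show ?thesis by blast
qed

end

section \<open>Interval modules, summands and multiplicities\<close>

text \<open>One-dimensional or zero, depending on a truth value.\<close>

definition line :: "bool => ('k::field, 'k) vs" where
 "line b = \<lparr>car = (if b then UNIV else {0}), pls = (+), zer = 0, scl = (*)\<rparr>"

lemma line_simps [simp]: "car (line b) = (if b then UNIV else {0})" "pls (line b) = (+)" "zer (line b) = 0"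
 "scl (line b) = (*)"
 by (simp_all add: line_def)

lemma line_vspace: "vspace (line b)"
 by unfold_locales (auto simp: algebra_simps)

lemma line_dim: "vdim (line b :: ('k::field, 'k) vs) (if b then 1 else 0)"
proof (cases b)
 case True
 have "\<exists>c. v = lc (line b) (\<lambda>_. 1) 1 c" for v :: 'k by (rule exI[of _ "\<lambda>_. v"]) simp
 then have "basis (line b :: ('k, 'k) vs) (\<lambda>_. 1) 1"
  using True by (auto simp: basis_def)
 then show ?thesis using True by (auto simp: vdim_def)
qed (simp add: vdim_0_iff line_vspace)

context X_mod begin

text \<open>A module with support \<open>{a..b}\<close>: one-dimensional components, identified with the
 field by \<open>\<beta>\<close>, and bijective transition maps within the support.\<close>

definition interval :: "nat => nat => 'o => (nat => (nat => 'k) => 'k) => bool" where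
 "interval a b P \<beta> \<longleftrightarrow> P \<in> Obj X \<and>
  (\<forall>u. 1 \<le> u \<and> u < n --> liso (V P u) (line (a \<le> u \<and> u \<le> b)) (\<beta> u)) \<and>
  (\<forall>u v z. 1 \<le> u \<and> u \<le> v \<and> v < n \<and> z \<in> car (V P u) -->
   \<beta> v (tr P u v z) = (if a \<le> u \<and> v \<le> b then \<beta> u z else 0))"

lemma interval_ex: "\<exists>P \<beta>. interval a b P \<beta>"
proof -
 have "qrep n (\<lambda>u. line (a \<le> u \<and> u \<le> b)) (\<lambda>u v z. if a \<le> u \<and> v \<le> b then z else (0::'k))"
 proof (rule qrep.intro)
  fix u v w assume uv: "1 \<le> u" "u \<le> v" "v < n"
  show "lin (line (a \<le> u \<and> u \<le> b)) (line (a \<le> v \<and> v \<le> b)) (\<lambda>z. if a \<le> u \<and> v \<le> b then z else (0::'k))"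
   using uv by (auto simp: lin_def)
 qed (use line_dim in \<open>auto simp: line_vspace split: if_splits\<close>)
 from object_ex[OF this] obtain P \<beta> where "interval a b P \<beta>" unfolding interval_def by blast
 then show ?thesis by blast
qed

lemma intervalD:
 assumes "interval a b P \<beta>"
 shows "P \<in> Obj X" "[|1 \<le> u; u < n|] ==> liso (V P u) (line (a \<le> u \<and> u \<le> b)) (\<beta> u)"
  "[|1 \<le> u; u \<le> v; v < n; z \<in> car (V P u)|] ==> \<beta> v (tr P u v z) = (if a \<le> u \<and> v \<le> b then \<beta> u z else 0)"
 using assms by (simp_all add: interval_def)

definition gen where "gen P \<beta> u = inv_into (car (V P u)) (\<beta> u) (1::'k)"

lemma gen:
 assumes I: "interval a b P \<beta>" and u: "1 \<le> u" "u < n" "a \<le> u" "u \<le> b"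
 shows "gen P \<beta> u \<in> car (V P u)" "\<beta> u (gen P \<beta> u) = 1"
proof -
 note l = intervalD(2)[OF I u(1,2)]
 have "(1::'k) \<in> car (line (a \<le> u \<and> u \<le> b))" using u by simp
 then show "gen P \<beta> u \<in> car (V P u)" "\<beta> u (gen P \<beta> u) = 1"
  using liso_mem[OF liso_inv[OF l V_vspace[OF intervalD(1)[OF I]]]] liso_inv_right[OF l] by (simp_all add: gen_def)
qed

lemma gen_span:
 assumes I: "interval a b P \<beta>" and u: "1 \<le> u" "u < n" "a \<le> u" "u \<le> b" and z: "z \<in> car (V P u)"
 shows "z = scl (V P u) (\<beta> u z) (gen P \<beta> u)"
proof -
 note l = intervalD(2)[OF I u(1,2)]
 interpret vspace "V P u" by (rule V_vspace[OF intervalD(1)[OF I]])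
 have "\<beta> u (scl (V P u) (\<beta> u z) (gen P \<beta> u)) = \<beta> u z"
  using lin_scl[OF liso_lin[OF l] gen(1)[OF I u]] gen(2)[OF I u] by simp
 then show ?thesis using liso_eq_iff[OF l _ z] scl_mem[OF gen(1)[OF I u]] by metis
qed

lemma gen_tr:
 assumes I: "interval a b P \<beta>" and u: "1 \<le> u" "u \<le> v" "v < n" "a \<le> u" "v \<le> b"
 shows "tr P u v (gen P \<beta> u) = gen P \<beta> v"
proof -
 have u': "u < n" "u \<le> b" "1 \<le> v" "a \<le> v" using u by auto
 note gu = gen[OF I u(1) u'(1) u(4) u'(2)] and gv = gen[OF I u'(3) u(3) u'(4) u(5)]
 have "\<beta> v (tr P u v (gen P \<beta> u)) = \<beta> v (gen P \<beta> v)"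
  using intervalD(3)[OF I u(1-3) gu(1)] gu(2) gv(2) u by simp
 then show ?thesis
  using liso_eq_iff[OF intervalD(2)[OF I u'(3) u(3)] lin_mem[OF tr_lin[OF intervalD(1)[OF I]] gu(1)] gv(1)] by simp
qed

lemma gen_nonzero:
 assumes I: "interval a b P \<beta>" and u: "1 \<le> u" "u < n" "a \<le> u" "u \<le> b"
 shows "gen P \<beta> u \<noteq> \<^bold>0P"
 using gen(2)[OF I u] lin_zer[OF liso_lin[OF intervalD(2)[OF I u(1,2)]] V_vspace[OF intervalD(1)[OF I]] line_vspace] by force

text \<open>An interval module whose support extends to the last vertex is the projective module generated at
 \<open>a\<close>.\<close>

lemma yoneda:
 assumes I: "interval a (n - 1) P \<beta>" and a: "1 \<le> a" "a < n" and x: "x \<in> Obj X" and w: "w \<in> car (V x a)"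
 shows "\<exists>f\<in>Homset X P x. am f (gen P \<beta> a) = w"
proof -
 note P = intervalD(1)[OF I]
 let ?\<phi> = "\<lambda>u z. scl (V x u) (\<beta> u z) (tr x a u w)"
 have t: "tr x a u w \<in> car (V x u)" for u by (rule lin_mem[OF tr_lin[OF x] w])
 have "\<exists>f\<in>Homset X P x. \<forall>u z. 1 \<le> u \<and> u < n \<and> z \<in> car (V P u) --> am f z = ?\<phi> u z"
 proof (rule arr_ex[OF P x])
  fix u assume u: "1 \<le> u" "u < n"
  note l = liso_lin[OF intervalD(2)[OF I u]]
  interpret vspace "V x u" by (rule V_vspace[OF x])
  show "lin (V P u) (V x u) (?\<phi> u)"
  proof (rule linI)
   fix y z c assume y: "y \<in> car (V P u)"
   show "?\<phi> u y \<in> car (V x u)" by (rule scl_mem[OF t])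
   show "?\<phi> u (scl (V P u) c y) = scl (V x u) c (?\<phi> u y)"
    unfolding lin_scl[OF l y] by (simp only: line_simps scl_scl[OF t])
   assume z: "z \<in> car (V P u)"
   show "?\<phi> u (pls (V P u) y z) = pls (V x u) (?\<phi> u y) (?\<phi> u z)"
    unfolding lin_pls[OF l y z] by (simp only: line_simps scl_add[OF t])
  qed
 next
  fix u v z assume u: "1 \<le> u" "u \<le> v" "v < n" and z: "z \<in> car (V P u)"
  have un: "u < n" using u by simp
  interpret U: vspace "V x u" by (rule V_vspace[OF x])
  interpret V: vspace "V x v" by (rule V_vspace[OF x])
  have b: "\<beta> v (tr P u v z) = \<beta> u z \<and> (a \<le> u \<or> \<beta> u z = 0)"
   using intervalD(3)[OF I u z] liso_mem[OF intervalD(2)[OF I u(1) un] z] u by (auto split: if_splits)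
  have s: "tr x u v (?\<phi> u z) = scl (V x v) (\<beta> u z) (tr x u v (tr x a u w))" by (rule lin_scl[OF tr_lin[OF x] t])
  show "?\<phi> v (tr P u v z) = tr x u v (?\<phi> u z)"
  proof (cases "a \<le> u")
   case True
   then show ?thesis using b s tr_tr[OF x True u(2) w] by simp
  next
   case False
   then have "\<beta> u z = 0" "\<beta> v (tr P u v z) = 0" using b by auto
   then show ?thesis using s V.scl_0[OF t] V.scl_0[OF lin_mem[OF tr_lin[OF x] t]] by simp
  qed
 qed
 then obtain f where f: "f \<in> Homset X P x" "\<And>u z. [|1 \<le> u; u < n; z \<in> car (V P u)|] ==> am f z = ?\<phi> u z" by blast
 have "am f (gen P \<beta> a) = w"
  using f(2)[OF a gen(1)[OF I a]] gen(2)[OF I a] tr_id[OF x w] vspace.scl_1[OF V_vspace[OF x] w] a by simp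
 then show ?thesis using f(1) by blast
qed

text \<open>By Yoneda's lemma the natural endomorphisms of a functor given by reindexing are scalars.\<close>

lemma natural_scalar:
 assumes H: "decomp_by [g] H \<beta>" and g: "good g" and \<pi>: "cnat H H \<pi>"
 shows "\<exists>c. \<forall>x\<in>Obj X. \<forall>u z. 1 \<le> u \<and> u < n \<and> z \<in> car (V H$x u) --> \<pi> x u z = scl (V H$x u) c z"
proof -
 note HF = decomp_by_functor[OF H]
 have b0: "\<beta> x u z 0 \<in> car (V x (g u))" if "x \<in> Obj X" "1 \<le> u" "u < n" "z \<in> car (V H$x u)" for x u z
  using db_mem[OF H that(1,2) _ that(4), of 0] that(3) by simp
 have beq: "z = w" if "x \<in> Obj X" "1 \<le> u" "u < n" "z \<in> car (V H$x u)" "w \<in> car (V H$x u)"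
  "\<beta> x u z 0 = \<beta> x u w 0" for x u z w
 proof -
  have "\<beta> x u z k = \<beta> x u w k" for k
   using that db_zero[OF H that(1,2) _ that(4), of k] db_zero[OF H that(1,2) _ that(5), of k] by (cases k) auto
  then show ?thesis using liso_eq_iff[OF db_liso[OF H that(1,2)] that(4,5)] that(3) by (simp add: fun_eq_iff)
 qed
 have Hv: "vspace (V H$x u)" if "x \<in> Obj X" for x u by (rule V_vspace[OF functor_Obj[OF HF that]])
 show ?thesis
 proof (cases "1 < n \<and> g 1 < n")
  case False
  have "z = zer (V H$x u)" if x: "x \<in> Obj X" and u: "1 \<le> u" "u < n" and z: "z \<in> car (V H$x u)" for x u z
  proof -
   have gu: "\<not> g u < n" using False goodD(3)[OF g _ u(1)] u by auto
   have "\<beta> x u z 0 \<in> car (V x (g u))" "\<beta> x u (zer (V H$x u)) 0 \<in> car (V x (g u))"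
    using b0[OF x u z] b0[OF x u vspace.zer_mem[OF Hv[OF x]]] .
   then have "\<beta> x u z 0 = \<beta> x u (zer (V H$x u)) 0" using V_outside[OF x, of "g u"] gu by simp
   then show ?thesis by (rule beq[OF x u z vspace.zer_mem[OF Hv[OF x]]])
  qed
  then have "\<pi> x u z = scl (V H$x u) 0 z" if "x \<in> Obj X" "1 \<le> u" "u < n" "z \<in> car (V H$x u)" for x u z
   using that lin_mem[OF cnat_lin[OF \<pi>] that(4)] vspace.scl_0[OF Hv that(4)] by metis
  then show ?thesis by blast
 next
  case True
  have "\<exists>Q. interval a (n - 1) (fst Q) (snd Q)" for a
   using interval_ex[of a "n - 1"] by auto
  then obtain Q where Q: "\<And>a. interval a (n - 1) (fst (Q a)) (snd (Q a))" by metis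
  define P where "P a = fst (Q a)" for a
  define \<gamma> where "\<gamma> a = snd (Q a)" for a
  have I: "interval a (n - 1) (P a) (\<gamma> a)" for a using Q by (simp add: P_def \<gamma>_def)
  note PO = intervalD(1)[OF I]
  \<comment> \<open>the generators, on which the scalar can be read off\<close>
  define e where "e a = gen (P a) (\<gamma> a) a" for a
  \<comment> \<open>the element of the value at \<open>P (g u)\<close> that corresponds to the generator\<close>
  define z0 where "z0 u = inv_into (car (V (H$(P (g u))) u)) (\<beta> (P (g u)) u) (\<lambda>k. if k = 0 then e (g u) else \<^bold>0(P (g u)))" for u
  have gu: "1 \<le> g u" if "1 \<le> u" "u < n" for u using goodD(1)[OF g, of u] that by simp
  have em: "e (g u) \<in> car (V (P (g u)) (g u))" if "1 \<le> u" "u < n" "g u < n" for u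
   unfolding e_def by (rule gen(1)[OF I gu[OF that(1,2)] that(3)]) (use that in auto)
  have z0: "z0 u \<in> car (V (H$(P (g u))) u)" "\<beta> (P (g u)) u (z0 u) 0 = e (g u)" if u: "1 \<le> u" "u < n" "g u < n" for u
  proof -
   have l: "liso (V (H$(P (g u))) u) (PV (P (g u)) [g] u) (\<beta> (P (g u)) u)"
    using db_liso[OF H PO u(1)] u by simp
   have m: "(\<lambda>k. if k = 0 then e (g u) else \<^bold>0(P (g u))) \<in> car (PV (P (g u)) [g] u)"
    using em[OF u] by (simp add: PV_car)
   show "z0 u \<in> car (V (H$(P (g u))) u)" "\<beta> (P (g u)) u (z0 u) 0 = e (g u)"
    using liso_mem[OF liso_inv[OF l Hv[OF PO]] m] liso_inv_right[OF l m] by (simp_all add: z0_def)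
  qed
  have "\<exists>c. \<forall>x\<in>Obj X. \<forall>z\<in>car (V H$x u). \<pi> x u z = scl (V H$x u) c z" if u: "1 \<le> u" "u < n" "g u < n" for u
  proof -
   let ?P = "P (g u)" and ?b = "\<beta> (P (g u)) u (\<pi> (P (g u)) u (z0 u)) 0"
   note pz = lin_mem[OF cnat_lin[OF \<pi> PO u(1,2)] z0(1)[OF u]]
   define c where "c = \<gamma> (g u) (g u) ?b"
   have "?b = scl (V ?P (g u)) c (e (g u))"
    unfolding c_def e_def using gu[OF u(1,2)] u by (intro gen_span[OF I] b0[OF PO u(1,2) pz]) auto
   also have "\<dots> = \<beta> ?P u (scl (V (on_obj H ?P) u) c (z0 u)) 0"
    using lin_scl[OF liso_lin[OF db_liso[OF H PO u(1)]] z0(1)[OF u], of c] z0(2)[OF u] u by simp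
   finally have pc: "\<pi> ?P u (z0 u) = scl (V (on_obj H ?P) u) c (z0 u)"
    by (intro beq[OF PO u(1,2) pz] vspace.scl_mem[OF Hv[OF PO]] z0[OF u])
   have "\<pi> x u z = scl (V H$x u) c z" if x: "x \<in> Obj X" and z: "z \<in> car (V H$x u)" for x z
   proof -
    obtain f where f: "f \<in> Homset X ?P x" "am f (e (g u)) = \<beta> x u z 0"
     using yoneda[OF I gu[OF u(1,2)] u(3) x b0[OF x u(1,2) z]] unfolding e_def by blast
    note Hf = functor_Homset[OF HF f(1)]
    have "am (on_arr H f) (z0 u) = z"
    proof (rule beq[OF x u(1,2) lin_mem[OF am_lin[OF Hf] z0(1)[OF u]] z])
     show "\<beta> x u (am (on_arr H f) (z0 u)) 0 = \<beta> x u z 0"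
      using db_nat[OF H f(1) u(1) _ z0(1)[OF u]] z0(2)[OF u] f(2) u by (simp add: PA_def)
    qed
    then show ?thesis
     using cnat_nat[OF \<pi> f(1) u(1,2) z0(1)[OF u]] pc lin_scl[OF am_lin[OF Hf] z0(1)[OF u], of c] by simp
   qed
   then show ?thesis by blast
  qed
  then obtain c where c: "\<And>u x z. [|1 \<le> u; u < n; g u < n; x \<in> Obj X; z \<in> car (V H$x u)|] ==>
    \<pi> x u z = scl (V H$x u) (c u) z" by metis
  have cc: "c v = c 1" if v: "1 \<le> v" "v < n" "g v < n" for v
  proof -
   let ?P = "P (g 1)" and ?t = "tr (H$(P (g 1))) 1 v (z0 1)"
   have o: "1 \<le> (1::nat)" "1 < n" "g 1 < n" using True by auto
   have HP: "on_obj H ?P \<in> Obj X" by (rule functor_Obj[OF HF PO])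
   have t: "?t \<in> car (V (on_obj H ?P) v)" by (rule lin_mem[OF tr_lin[OF HP] z0(1)[OF o]])
   have "scl (V (on_obj H ?P) v) (c v) ?t = \<pi> ?P v ?t" using c[OF v PO t] by simp
   also have "\<dots> = tr (on_obj H ?P) 1 v (scl (V (on_obj H ?P) 1) (c 1) (z0 1))"
    using cnat_tr[OF \<pi> PO o(1) v(1,2) z0(1)[OF o]] c[OF o PO z0(1)[OF o]] by simp
   also have "\<dots> = scl (V (on_obj H ?P) v) (c 1) ?t" by (rule lin_scl[OF tr_lin[OF HP] z0(1)[OF o]])
   finally have e1: "scl (V (on_obj H ?P) v) (c v) ?t = scl (V (on_obj H ?P) v) (c 1) ?t" .
   have "\<beta> ?P v ?t 0 = tr ?P (g 1) (g v) (e (g 1))"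
    using db_tr[OF H PO o(1) v(1) _ z0(1)[OF o]] z0(2)[OF o] v by (simp add: PT_def)
   also have "\<dots> = gen ?P (\<gamma> (g 1)) (g v)"
    unfolding e_def using gu[OF o(1,2)] goodD(3)[OF g o(1) v(1)] v by (intro gen_tr[OF I]) auto
   finally have "\<beta> ?P v ?t 0 = gen ?P (\<gamma> (g 1)) (g v)" .
   moreover have "gen ?P (\<gamma> (g 1)) (g v) \<noteq> \<zero>\<^bsub>on_obj E ?P\<^esub>"
    using gu[OF v(1,2)] goodD(3)[OF g o(1) v(1)] v by (intro gen_nonzero[OF I]) auto
   ultimately have nz: "\<beta> ?P v ?t 0 \<noteq> \<zero>\<^bsub>on_obj E ?P\<^esub>" by simp
   interpret S: vspace "V (on_obj H ?P) v" by (rule Hv[OF PO])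
   have "?t \<noteq> zer (V (on_obj H ?P) v)"
   proof
    assume "?t = zer (V (on_obj H ?P) v)"
    then show False
     using nz lin_zer[OF liso_lin[OF db_liso[OF H PO v(1)]] Hv[OF PO] PV_vspace[OF PO]] v by simp
   qed
   moreover have "scl (V (on_obj H ?P) v) (c v + -1 * c 1) ?t = zer (V (on_obj H ?P) v)"
    using e1 S.pls_neg[OF S.scl_mem[OF t]] unfolding S.scl_add[OF t] S.scl_scl[OF t, symmetric] by simp
   ultimately have "c v + -1 * c 1 = 0" using S.scl_eq_zer[OF t] by blast
   then show ?thesis by simp
  qed
  have "\<pi> x u z = scl (V H$x u) (c 1) z" if x: "x \<in> Obj X" and u: "1 \<le> u" "u < n" and z: "z \<in> car (V H$x u)" for x u z
  proof (cases "g u < n")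
   case True
   then show ?thesis using c[OF u True x z] cc[OF u True] by simp
  next
   case False
   have "\<beta> x u w 0 = \<^bold>0x" if w: "w \<in> car (V H$x u)" for w
    using b0[OF x u w] V_outside[OF x, of "g u"] False by simp
   then show ?thesis
    using beq[OF x u lin_mem[OF cnat_lin[OF \<pi> x u] z] vspace.scl_mem[OF Hv[OF x] z]]
     lin_mem[OF cnat_lin[OF \<pi> x u] z] vspace.scl_mem[OF Hv[OF x] z] by metis
  qed
  then show ?thesis by blast
 qed
qed

lemma iso_complement:
 assumes c: "cds C F K i j p q" and z: "\<And>x u z. [|x \<in> Obj X; 1 \<le> u; u < n; z \<in> car (V C$x u)|] ==>
  i x u (p x u z) = zer (V C$x u)"
 shows "zero_functor X E F" "functors_iso X X C K"
proof -
 note d = cdsD[OF c]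
 note FF = cnat_functor(1)[OF d(1)] and CF = cnat_functor(2)[OF d(1)]
 have F0: "w = zer (V F$x u)" if x: "x \<in> Obj X" and u: "1 \<le> u" "u < n" and w: "w \<in> car (V F$x u)" for x u w
 proof -
  note vs = V_vspace[OF functor_Obj[OF FF x]] V_vspace[OF functor_Obj[OF CF x]]
  have "i x u w = zer (V C$x u)"
   using z[OF x u lin_mem[OF cnat_lin[OF d(1) x u] w]] d(5)[OF x u w] by simp
  then have "w = p x u (zer (V C$x u))" using d(5)[OF x u w] by simp
  then show ?thesis using lin_zer[OF cnat_lin[OF d(3) x u] vs(2,1)] by simp
 qed
 have "decomp [] F"
 proof (rule decompI[where \<beta> = "\<lambda>x u z k. \<^bold>0x", OF FF])
  fix x u assume x: "x \<in> Obj X" and u: "1 \<le> u" "u < n"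
  have "car (V F$x u) = {\<^bold>0(F$x)}" using F0[OF x u] zero_V[OF functor_Obj[OF FF x]] by auto
  then show "liso (V F$x u) (PV x [] u) (\<lambda>z k. \<^bold>0x)"
   using x by (auto simp: liso_def lin_def bij_betw_def PV_car image_iff)
 qed (auto simp: PT_def PA_def)
 then show "zero_functor X E F" by (simp add: decomp_Nil_iff)
 have "bij_betw (q x u) (car (V C$x u)) (car (V K$x u))" if x: "x \<in> Obj X" and u: "1 \<le> u" "u < n" for x u
 proof (rule bij_betwI[of _ _ _ "j x u"])
  show "q x u \<in> car (V C$x u) \<rightarrow> car (V K$x u)" "j x u \<in> car (V K$x u) \<rightarrow> car (V C$x u)"
   using lin_mem[OF cnat_lin[OF d(4) x u]] lin_mem[OF cnat_lin[OF d(2) x u]] by auto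
  fix w assume w: "w \<in> car (V C$x u)"
  show "j x u (q x u w) = w"
   using d(7)[OF x u w] z[OF x u w] lin_mem[OF cnat_lin[OF d(2) x u] lin_mem[OF cnat_lin[OF d(4) x u] w]]
    vspace.zer_pls[OF V_vspace[OF functor_Obj[OF CF x]]] by metis
 qed (use d(6)[OF x u] in auto)
 then show "functors_iso X X C K" using d(4) functors_iso_iff by blast
qed

text \<open>The projection to a summand is an idempotent natural endomorphism, hence a scalar equal to zero or
 one; so one of the two summands vanishes.\<close>

lemma summand_trivial:
 assumes "decomp [g] C" "direct_sum X E C F K"
 shows "decomp [] F \<and> decomp [g] K \<or> decomp [g] F \<and> decomp [] K"
proof -
 obtain \<beta> where C: "decomp_by [g] C \<beta>" and g: "good g" using assms(1) by (auto simp: decomp_def)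
 obtain i j p q where c: "cds C F K i j p q" using assms(2) direct_sum_iff by blast
 note d = cdsD[OF c]
 note CF = decomp_by_functor[OF C]
 have "cnat C C (\<lambda>x u z. i x u (p x u z))"
  unfolding cnat_def
 proof (intro conjI ballI allI impI CF)
  fix x u assume x: "x \<in> Obj X" and "1 \<le> u \<and> u < n"
  then have u: "1 \<le> u" "u < n" by auto
  show "lin (V C$x u) (V C$x u) (\<lambda>z. i x u (p x u z))"
   by (rule lin_comp[OF cnat_lin[OF d(3) x u] cnat_lin[OF d(1) x u]])
  show "i x v (p x v (tr C$x u v z)) = tr C$x u v (i x u (p x u z))"
   if v: "u \<le> v \<and> v < n \<and> z \<in> car (V C$x u)" for v z
   using cnat_tr[OF d(3) x u(1), of v z] cnat_tr[OF d(1) x u(1) _ _ lin_mem[OF cnat_lin[OF d(3) x u]], of v z] v by simp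
  fix y f z assume f: "f \<in> Homset X x y" and z: "z \<in> car (V C$x u)"
  show "i y u (p y u (am (on_arr C f) z)) = am (on_arr C f) (i x u (p x u z))"
   using cnat_nat[OF d(3) f u z] cnat_nat[OF d(1) f u lin_mem[OF cnat_lin[OF d(3) x u] z]] by simp
 qed
 from natural_scalar[OF C g this] obtain c where s: "\<And>x u z. [|x \<in> Obj X; 1 \<le> u; u < n; z \<in> car (V C$x u)|] ==>
  i x u (p x u z) = scl (V C$x u) c z" by blast
 have Cv: "vspace (V C$x u)" if "x \<in> Obj X" for x u by (rule V_vspace[OF functor_Obj[OF CF that]])
 have m: "p x u z \<in> car (V F$x u)" "i x u (p x u z) \<in> car (V C$x u)" "j x u (q x u z) \<in> car (V C$x u)"
  if "x \<in> Obj X" "1 \<le> u" "u < n" "z \<in> car (V C$x u)" for x u z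
  using lin_mem[OF cnat_lin[OF d(3) that(1-3)] that(4)] lin_mem[OF cnat_lin[OF d(1) that(1-3)]]
   lin_mem[OF cnat_lin[OF d(2) that(1-3)] lin_mem[OF cnat_lin[OF d(4) that(1-3)] that(4)]] by auto
 \<comment> \<open>the scalar is idempotent, unless the functor is zero\<close>
 have "scl (V C$x u) (c * (c - 1)) z = zer (V C$x u)"
  if x: "x \<in> Obj X" and u: "1 \<le> u" "u < n" and z: "z \<in> car (V C$x u)" for x u z
 proof -
  interpret S: vspace "V C$x u" by (rule Cv[OF x])
  have "scl (V C$x u) c (scl (V C$x u) c z) = i x u (p x u (i x u (p x u z)))"
   using s[OF x u z] s[OF x u m(2)[OF x u z]] by simp
  also have "\<dots> = scl (V C$x u) c z" using d(5)[OF x u m(1)[OF x u z]] s[OF x u z] by simp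
  finally have "scl (V C$x u) (c * c) z = scl (V C$x u) c z" by (simp only: S.scl_scl[OF z])
  then have "pls (V C$x u) (scl (V C$x u) (c * c) z) (scl (V C$x u) (-1 * c) z) = zer (V C$x u)"
   using S.pls_neg[OF S.scl_mem[OF z], of c] by (simp only: S.scl_scl[OF z])
  moreover have "c * (c - 1) = c * c + -1 * c" by (simp add: algebra_simps)
  ultimately show ?thesis by (simp only: S.scl_add[OF z])
 qed
 then have z0: "c * (c - 1) = 0 \<or> z = zer (V C$x u)"
  if "x \<in> Obj X" "1 \<le> u" "u < n" "z \<in> car (V C$x u)" for x u z
  using that vspace.scl_eq_zer[OF Cv] by blast
 have ?thesis if h: "\<And>x u z. [|x \<in> Obj X; 1 \<le> u; u < n; z \<in> car (V C$x u)|] ==> i x u (p x u z) = zer (V C$x u)"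
  using iso_complement[OF c h] assms(1) decomp_iso_transfer decomp_Nil_iff by blast
 moreover have ?thesis if h: "\<And>x u z. [|x \<in> Obj X; 1 \<le> u; u < n; z \<in> car (V C$x u)|] ==> j x u (q x u z) = zer (V C$x u)"
  using iso_complement[OF cds_swap[OF c] h] assms(1) decomp_iso_transfer decomp_Nil_iff by blast
 moreover have "(\<forall>x u z. x \<in> Obj X \<and> 1 \<le> u \<and> u < n \<and> z \<in> car (V C$x u) --> i x u (p x u z) = zer (V C$x u)) \<or>
   (\<forall>x u z. x \<in> Obj X \<and> 1 \<le> u \<and> u < n \<and> z \<in> car (V C$x u) --> j x u (q x u z) = zer (V C$x u))"
 proof (cases "c = 1")
  case True
  have "j x u (q x u z) = zer (V C$x u)" if x: "x \<in> Obj X" and u: "1 \<le> u" "u < n" and z: "z \<in> car (V C$x u)" for x u z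
  proof -
   interpret S: vspace "V C$x u" by (rule Cv[OF x])
   have "pls (V C$x u) z (j x u (q x u z)) = pls (V C$x u) z (zer (V C$x u))"
    using d(7)[OF x u z] s[OF x u z] S.scl_1[OF z] True S.pls_zer[OF z] by simp
   from S.pls_cancel[OF z m(3)[OF x u z] S.zer_mem this] show ?thesis .
  qed
  then show ?thesis by blast
 next
  case False
  have "i x u (p x u z) = zer (V C$x u)" if x: "x \<in> Obj X" and u: "1 \<le> u" "u < n" and z: "z \<in> car (V C$x u)" for x u z
  proof -
   interpret S: vspace "V C$x u" by (rule Cv[OF x])
   have "c = 0 \<or> z = zer (V C$x u)" using z0[OF x u z] False by auto
   then show ?thesis using s[OF x u z] S.scl_0[OF z] S.scl_zer by auto
  qed
  then show ?thesis by blast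
 qed
 ultimately show ?thesis by blast
qed

subsection \<open>Counting summands\<close>

text \<open>Truncation of the full interval module to an initial segment.\<close>

lemma interval_proj:
 assumes J: "interval 1 (n - 1) J \<beta>" and P: "interval 1 b P \<gamma>"
 shows "\<exists>f\<in>Homset X J P. \<forall>u z. 1 \<le> u \<and> u < n \<and> z \<in> car (V J u) --> \<gamma> u (am f z) = (if u \<le> b then \<beta> u z else 0)"
proof -
 note JO = intervalD(1)[OF J] and PO = intervalD(1)[OF P]
 let ?h = "\<lambda>u z. if u \<le> b then \<beta> u z else 0"
 let ?\<phi> = "\<lambda>u z. inv_into (car (V P u)) (\<gamma> u) (?h u z)"
 have h: "lin (V J u) (line (1 \<le> u \<and> u \<le> b)) (?h u)" if u: "1 \<le> u" "u < n" for u
  using lin_pls[OF liso_lin[OF intervalD(2)[OF J u]]] lin_scl[OF liso_lin[OF intervalD(2)[OF J u]]] u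
  by (auto simp: lin_def)
 have l: "liso (V P u) (line (1 \<le> u \<and> u \<le> b)) (\<gamma> u)" if "1 \<le> u" "u < n" for u by (rule intervalD(2)[OF P that])
 note li = liso_inv[OF l V_vspace[OF PO]]
 have \<gamma>\<phi>: "\<gamma> u (?\<phi> u z) = ?h u z" if "1 \<le> u" "u < n" "z \<in> car (V J u)" for u z
  by (rule liso_inv_right[OF l[OF that(1,2)] lin_mem[OF h[OF that(1,2)] that(3)]])
 have "\<exists>f\<in>Homset X J P. \<forall>u z. 1 \<le> u \<and> u < n \<and> z \<in> car (V J u) --> am f z = ?\<phi> u z" (is "\<exists>f\<in>_. ?R f")
 proof (rule arr_ex[OF JO PO])
  fix u assume u: "1 \<le> u" "u < n"
  show "lin (V J u) (V P u) (?\<phi> u)" by (rule lin_comp[OF h[OF u] liso_lin[OF li[OF u]]])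
 next
  fix u v z assume u: "1 \<le> u" "u \<le> v" "v < n" and z: "z \<in> car (V J u)"
  then have u': "u < n" "1 \<le> v" by auto
  have m: "?\<phi> u z \<in> car (V P u)" by (rule liso_mem[OF li[OF u(1) u'(1)] lin_mem[OF h[OF u(1) u'(1)] z]])
  have t: "tr J u v z \<in> car (V J v)" by (rule lin_mem[OF tr_lin[OF JO] z])
  have "\<gamma> v (tr P u v (?\<phi> u z)) = (if v \<le> b then ?h u z else 0)"
   using intervalD(3)[OF P u m] u unfolding \<gamma>\<phi>[OF u(1) u'(1) z] by auto
  also have "\<dots> = \<gamma> v (?\<phi> v (tr J u v z))" using \<gamma>\<phi>[OF u'(2) u(3) t] intervalD(3)[OF J u z] u by auto
  finally show "?\<phi> v (tr J u v z) = tr P u v (?\<phi> u z)"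
   using liso_eq_iff[OF l[OF u'(2) u(3)] lin_mem[OF tr_lin[OF PO] m] liso_mem[OF li[OF u'(2) u(3)] lin_mem[OF h[OF u'(2) u(3)] t]]] by simp
 qed
 then obtain f where f: "f \<in> Homset X J P" "?R f" by (rule bexE)
 show ?thesis
 proof (rule bexI[OF _ f(1)], intro allI impI, elim conjE)
  fix u z assume u: "1 \<le> u" "u < n" "z \<in> car (V J u)"
  have "am f z = ?\<phi> u z" using f(2) u by simp
  then show "\<gamma> u (am f z) = ?h u z" by (simp only: \<gamma>\<phi>[OF u])
 qed
qed

text \<open>The quotients of the interval module of full support detect the multiplicities: the
 subspace below is one-dimensional on a functor given by reindexing along \<open>g\<close> if \<open>g\<close> is large enough
 compared with \<open>f\<close>, and vanishes otherwise.\<close>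

definition NN where
 "NN J \<pi> H f = {z \<in> car (V H$J 1). \<forall>w. 2 \<le> w \<and> w \<le> n -->
   am (on_arr H (\<pi> (w - 1))) (tr H$J 1 (f w) z) = \<zero>\<^bsub>on_obj E (on_obj H (Cod X (\<pi> (w - 1))))\<^esub>}"

text \<open>A summand that reindexes along \<open>g\<close> contributes the component of \<open>J\<close> at \<open>g 1\<close>, which is a line iff
 \<open>g 1 < n\<close>. Its transition to \<open>g (f w)\<close> is annihilated by the truncation at \<open>w - 1\<close> iff
 \<open>g (f w) \<ge> w\<close>.\<close>

lemma NN_dim:
 assumes n1: "1 < n" and J: "interval 1 (n - 1) J \<gamma>" and \<pi>: "\<And>v. \<pi> v \<in> Homset X J (P v)"
  and \<pi>0: "\<And>v u z. [|1 \<le> u; u < n; z \<in> car (V J u)|] ==> am (\<pi> v) z = \<^bold>0(P v) \<longleftrightarrow> z = \<^bold>0J \<or> v < u"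
  and H: "decomp gs H" and f: "\<And>w. [|2 \<le> w; w \<le> n|] ==> 1 \<le> f w \<and> f w \<le> n"
 shows "vspace (V H$J 1\<lparr>car := NN J \<pi> H f\<rparr>)"
  and "vdim (V H$J 1\<lparr>car := NN J \<pi> H f\<rparr>)
  (card {k. k < length gs \<and> (gs ! k) 1 < n \<and> (\<forall>w. 2 \<le> w \<and> w \<le> n --> w \<le> (gs ! k) (f w))})"
proof -
 obtain \<beta> where b: "decomp_by gs H \<beta>" and gs: "\<forall>g\<in>set gs. good g" using H by (auto simp: decomp_def)
 note HF = decomp_by_functor[OF b] and JO = intervalD(1)[OF J]
 let ?r = "length gs"
 define cond where "cond k \<longleftrightarrow> (gs ! k) 1 < n \<and> (\<forall>w. 2 \<le> w \<and> w \<le> n --> w \<le> (gs ! k) (f w))" for k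
 define Ws where "Ws k = {y \<in> car (V J ((gs ! k) 1)). \<forall>w. 2 \<le> w \<and> w \<le> n -->
   am (\<pi> (w - 1)) (tr J ((gs ! k) 1) ((gs ! k) (f w)) y) = \<^bold>0(P (w - 1))}" for k
 have zJ: "\<^bold>0J \<in> car (V J u)" for u by (rule zero_V[OF JO])
 have WsV: "Ws k = (if cond k then car (V J ((gs ! k) 1)) else {\<^bold>0J})" if k: "k < ?r" for k
 proof -
  let ?g = "gs ! k"
  have g: "good ?g" using gs k by simp
  have g1: "1 \<le> ?g 1" using goodD(1)[OF g, of 1] n1 by simp
  have z: "\<^bold>0J \<in> Ws k" using zJ tr_zero[OF JO] am_zero[OF \<pi>] by (simp add: Ws_def)
  have mem: "am (\<pi> (w - 1)) (tr J (?g 1) (?g (f w)) y) = \<^bold>0(P (w - 1)) \<longleftrightarrow>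
    y = \<^bold>0J \<or> w \<le> ?g (f w)"
   if w: "2 \<le> w" "w \<le> n" and y: "y \<in> car (V J (?g 1))" and gn: "?g 1 < n" for w y
  proof -
   have gg: "?g 1 \<le> ?g (f w)" "1 \<le> ?g (f w)" using goodD(3)[OF g, of 1 "f w"] f[OF w] g1 by auto
   have t: "tr J (?g 1) (?g (f w)) y \<in> car (V J (?g (f w)))" by (rule lin_mem[OF tr_lin[OF JO] y])
   show ?thesis
   proof (cases "?g (f w) < n")
    case True
    have "tr J (?g 1) (?g (f w)) y = \<^bold>0J \<longleftrightarrow> \<gamma> (?g (f w)) (tr J (?g 1) (?g (f w)) y) = 0"
     using liso_zer_iff[OF intervalD(2)[OF J gg(2) True] V_vspace[OF JO] line_vspace t] by simp
    also have "\<dots> \<longleftrightarrow> \<gamma> (?g 1) y = 0" using intervalD(3)[OF J g1 gg(1) True y] g1 True by simp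
    also have "\<dots> \<longleftrightarrow> y = \<^bold>0J"
     using liso_zer_iff[OF intervalD(2)[OF J g1 gn] V_vspace[OF JO] line_vspace y] by simp
    finally show ?thesis using \<pi>0[OF gg(2) True t, of "w - 1"] w by auto
   next
    case False
    then show ?thesis using t V_outside[OF JO, of "?g (f w)"] am_zero[OF \<pi>] w by simp
   qed
  qed
  show ?thesis
  proof (cases "?g 1 < n")
   case True
   have "Ws k = {y \<in> car (V J (?g 1)). y = \<^bold>0J \<or> (\<forall>w. 2 \<le> w \<and> w \<le> n --> w \<le> ?g (f w))}"
    unfolding Ws_def using mem[OF _ _ _ True] by auto
   then show ?thesis using True zJ by (auto simp: cond_def)
  next
   case False
   then have "car (V J (?g 1)) = {\<^bold>0J}" using V_outside[OF JO] by simp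
   then show ?thesis using z False by (auto simp: cond_def Ws_def)
  qed
 qed
 interpret W: vspace "Wh n E$J" by (rule Wh_vspace[OF JO])
 have z0: "vspace (Wh n E$J\<lparr>car := {\<^bold>0J}\<rparr>)"
  by (rule W.subspace) (use JO V_carrier[OF JO zJ] in auto)
 have Wv: "vspace (Wh n E$J\<lparr>car := Ws k\<rparr>)" "Ws k \<subseteq> car (Wh n E$J)" if "k < ?r" for k
  using WsV[OF that] z0 V_carrier[OF JO] V_vspace[OF JO] V_carrier[OF JO zJ] by (auto simp: V_eq_Wh)
 have Wd: "vdim (Wh n E$J\<lparr>car := Ws k\<rparr>) (if cond k then 1 else 0)" if k: "k < ?r" for k
 proof (cases "cond k")
  case True
  have u: "1 \<le> (gs ! k) 1" "(gs ! k) 1 < n" using True goodD(1)[of "gs ! k" 1] gs k n1 by (auto simp: cond_def)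
  note l = intervalD(2)[OF J u]
  have t: "(1 \<le> (gs ! k) 1 \<and> (gs ! k) 1 \<le> n - 1) = True" using u by auto
  have "vdim (line (1 \<le> (gs ! k) 1 \<and> (gs ! k) 1 \<le> n - 1) :: ('k, 'k) vs) 1" unfolding t using line_dim[of True] by simp
  then have "vdim (V J ((gs ! k) 1)) 1"
   by (rule vdim_liso[OF liso_inv[OF l V_vspace[OF JO]] line_vspace V_vspace[OF JO]])
  then show ?thesis using True WsV[OF k] by (simp add: V_eq_Wh)
 qed (use WsV[OF k] vdim_0_iff[OF z0] in auto)
 let ?Q = "prodvs (Wh n E$J) Ws ?r" and ?N = "V H$J 1\<lparr>car := NN J \<pi> H f\<rparr>"
 have Qd: "vdim ?Q (\<Sum>k<?r. if cond k then 1 else 0)" by (rule vdim_prodvs[OF W.vspace_axioms Wv(2,1) Wd])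
 have Qv: "vspace ?Q" by (rule prodvs_vspace[OF W.vspace_axioms Wv(2,1)])
 have HJ: "H$J \<in> Obj X" by (rule functor_Obj[OF HF JO])
 interpret S: vspace "V H$J 1" by (rule V_vspace[OF HJ])
 note n1' = order_refl[of "1::nat"] less_imp_le[OF n1]
 note l = db_liso[OF b JO n1']
 have QPV: "car ?Q \<subseteq> car (PV J gs 1)" by (auto simp: prodvs_car PV_car Ws_def)
 have mem: "z \<in> NN J \<pi> H f \<longleftrightarrow> \<beta> J 1 z \<in> car ?Q" if z: "z \<in> car (V H$J 1)" for z
 proof -
  have "am (on_arr H (\<pi> (w - 1))) (tr H$J 1 (f w) z) = \<zero>\<^bsub>on_obj E (H$(P (w - 1)))\<^esub> \<longleftrightarrow>
   (\<forall>k<?r. am (\<pi> (w - 1)) (tr J ((gs ! k) 1) ((gs ! k) (f w)) (\<beta> J 1 z k)) = \<^bold>0(P (w - 1)))"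
   if w: "2 \<le> w" "w \<le> n" for w
  proof -
   note fw = conjunct1[OF f[OF w]] conjunct2[OF f[OF w]]
   note p = \<pi>[of "w - 1"]
   have t: "tr H$J 1 (f w) z \<in> car (V H$J (f w))" by (rule lin_mem[OF tr_lin[OF HJ] z])
   have a: "am (on_arr H (\<pi> (w - 1))) (tr H$J 1 (f w) z) \<in> car (V (H$(P (w - 1))) (f w))"
    by (rule lin_mem[OF am_lin[OF functor_Homset[OF HF p]] t])
   have "\<beta> (P (w - 1)) (f w) (am (on_arr H (\<pi> (w - 1))) (tr H$J 1 (f w) z)) =
     PA (P (w - 1)) gs (\<pi> (w - 1)) (PT J gs 1 (f w) (\<beta> J 1 z))"
    using db_nat[OF b p fw t] db_tr[OF b JO n1'(1) fw z] by simp
   then show ?thesis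
    using liso_zer_iff[OF db_liso[OF b cod[OF p] fw] V_vspace[OF functor_Obj[OF HF cod[OF p]]] PV_vspace[OF cod[OF p]] a]
    by (auto simp: PA_def PT_def fun_eq_iff[where f = "PA _ _ _ _"] dest: fun_cong split: if_splits)
  qed
  then show ?thesis
   using z liso_mem[OF l z] Homset_Cod[OF \<pi>] by (auto simp: NN_def prodvs_car Ws_def PV_car)
 qed
 have Nsub: "NN J \<pi> H f \<subseteq> car (V H$J 1)" by (auto simp: NN_def)
 have Nv: "vspace ?N"
 proof (rule S.subspace[OF Nsub])
  show "zer (V H$J 1) \<in> NN J \<pi> H f"
   using mem[OF S.zer_mem] lin_zer[OF liso_lin[OF l] S.vspace_axioms PV_vspace[OF JO]] vspace.zer_mem[OF Qv] by simp
  fix x y c assume x: "x \<in> NN J \<pi> H f"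
  then have xm: "x \<in> car (V H$J 1)" "\<beta> J 1 x \<in> car ?Q" using Nsub mem by auto
  show "scl (V H$J 1) c x \<in> NN J \<pi> H f"
   using mem[OF S.scl_mem[OF xm(1)]] vspace.scl_mem[OF Qv xm(2)] lin_scl[OF liso_lin[OF l] xm(1)] by simp
  assume "y \<in> NN J \<pi> H f"
  then have ym: "y \<in> car (V H$J 1)" "\<beta> J 1 y \<in> car ?Q" using Nsub mem by auto
  show "pls (V H$J 1) x y \<in> NN J \<pi> H f"
   using mem[OF S.pls_mem[OF xm(1) ym(1)]] vspace.pls_mem[OF Qv xm(2) ym(2)] lin_pls[OF liso_lin[OF l] xm(1) ym(1)] by simp
 qed
 have "liso ?N ?Q (\<beta> J 1)"
  unfolding liso_def
 proof
  show "lin ?N ?Q (\<beta> J 1)"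
   using lin_pls[OF liso_lin[OF l]] lin_scl[OF liso_lin[OF l]] mem Nsub by (auto simp: lin_def subset_iff)
  show "bij_betw (\<beta> J 1) (car ?N) (car ?Q)"
  proof (rule bij_betw_imageI)
   show "inj_on (\<beta> J 1) (car ?N)" using liso_bij[OF l] Nsub by (auto simp: bij_betw_def intro: inj_on_subset)
   have "y \<in> \<beta> J 1 ` NN J \<pi> H f" if y: "y \<in> car ?Q" for y
   proof -
    have "y \<in> \<beta> J 1 ` car (V H$J 1)" using y QPV liso_bij[OF l] by (auto simp: bij_betw_def)
    then show ?thesis using mem y by auto
   qed
   then show "\<beta> J 1 ` car ?N = car ?Q" using mem Nsub by auto
  qed
 qed
 from vdim_liso[OF liso_inv[OF this Nv] Qv Nv Qd]
 have "vdim ?N (\<Sum>k<?r. if cond k then 1 else 0)" .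
 moreover have "(\<Sum>k<?r. if cond k then 1 else 0) = card {k. k < ?r \<and> cond k}"
  by (simp add: sum.If_cases Int_def lessThan_def)
 ultimately show "vdim ?N (card {k. k < length gs \<and> (gs ! k) 1 < n \<and> (\<forall>w. 2 \<le> w \<and> w \<le> n --> w \<le> (gs ! k) (f w))})"
  by (simp add: cond_def)
 show "vspace ?N" by (rule Nv)
qed

lemma decomp_counts:
 assumes "decomp gs H" "decomp hs H" and n1: "1 < n" and f: "\<And>w. [|2 \<le> w; w \<le> n|] ==> 1 \<le> f w \<and> f w \<le> n"
 shows "card {k. k < length gs \<and> (gs ! k) 1 < n \<and> (\<forall>w. 2 \<le> w \<and> w \<le> n --> w \<le> (gs ! k) (f w))} =
  card {k. k < length hs \<and> (hs ! k) 1 < n \<and> (\<forall>w. 2 \<le> w \<and> w \<le> n --> w \<le> (hs ! k) (f w))}"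
proof -
 obtain J \<gamma> where J: "interval 1 (n - 1) J \<gamma>" using interval_ex by blast
 have "\<exists>\<pi> P. \<pi> \<in> Homset X J P \<and> (\<forall>u z. 1 \<le> u \<and> u < n \<and> z \<in> car (V J u) -->
   (am \<pi> z = \<^bold>0P \<longleftrightarrow> z = \<^bold>0J \<or> v < u))" for v
 proof -
  obtain P \<delta> where P: "interval 1 v P \<delta>" using interval_ex by blast
  obtain \<pi> where \<pi>: "\<pi> \<in> Homset X J P"
   "\<And>u z. [|1 \<le> u; u < n; z \<in> car (V J u)|] ==> \<delta> u (am \<pi> z) = (if u \<le> v then \<gamma> u z else 0)"
   using interval_proj[OF J P] by blast
  have "am \<pi> z = \<^bold>0P \<longleftrightarrow> z = \<^bold>0J \<or> v < u" if u: "1 \<le> u" "u < n" and z: "z \<in> car (V J u)" for u z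
   using liso_zer_iff[OF intervalD(2)[OF P u] V_vspace[OF intervalD(1)[OF P]] line_vspace lin_mem[OF am_lin[OF \<pi>(1)] z]]
    liso_zer_iff[OF intervalD(2)[OF J u] V_vspace[OF intervalD(1)[OF J]] line_vspace z] \<pi>(2)[OF u z]
   by (auto split: if_splits)
  then show ?thesis using \<pi>(1) by blast
 qed
 then obtain \<pi> P where \<pi>: "\<And>v. \<pi> v \<in> Homset X J (P v)"
  "\<And>v u z. [|1 \<le> u; u < n; z \<in> car (V J u)|] ==> am (\<pi> v) z = \<^bold>0(P v) \<longleftrightarrow> z = \<^bold>0J \<or> v < u"
  by metis
 show ?thesis
  by (rule vspace.vdim_unique[OF NN_dim(1)[OF n1 J \<pi> assms(1) f] NN_dim(2)[OF n1 J \<pi> assms(1) f]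
   NN_dim(2)[OF n1 J \<pi> assms(2) f]])
qed

section \<open>The Catalan monoid and its action by reindexing\<close>

abbreviation "\<C> \<equiv> catalan_monoid n"

lemma catalan_iff: "f \<in> carrier \<C> \<longleftrightarrow> f \<in> extensional {1..n} \<and> (\<forall>w. 1 \<le> w \<and> w \<le> n --> 1 \<le> f w \<and> f w \<le> w) \<and>
  (\<forall>v w. 1 \<le> v \<and> v \<le> w \<and> w \<le> n --> f v \<le> f w)"
 by (auto simp: catalan_monoid_def PiE_iff mono_on_def intro: order_trans)

lemma catalanD:
 assumes "f \<in> carrier \<C>"
 shows "f \<in> extensional {1..n}" "[|1 \<le> w; w \<le> n|] ==> 1 \<le> f w" "[|1 \<le> w; w \<le> n|] ==> f w \<le> w"
  "[|1 \<le> w; w \<le> n|] ==> f w \<le> n" "[|1 \<le> v; v \<le> w; w \<le> n|] ==> f v \<le> f w"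
 using assms unfolding catalan_iff by (auto intro: order_trans)

lemma catalan_eqI:
 assumes "f \<in> carrier \<C>" "h \<in> carrier \<C>" "\<And>w. [|1 \<le> w; w \<le> n|] ==> f w = h w"
 shows "f = h"
 using assms by (intro extensionalityI[OF catalanD(1)[OF assms(1)] catalanD(1)[OF assms(2)]]) auto

lemma catalan_mult: "f \<otimes>\<^bsub>\<C>\<^esub> h = compose {1..n} f h"
 and catalan_one: "\<one>\<^bsub>\<C>\<^esub> = restrict id {1..n}"
 by (simp_all add: catalan_monoid_def)

lemma catalan_mult_closed: "[|f \<in> carrier \<C>; h \<in> carrier \<C>|] ==> f \<otimes>\<^bsub>\<C>\<^esub> h \<in> carrier \<C>"
 unfolding catalan_mult catalan_iff[of "compose {1..n} f h"]
proof (intro conjI allI impI; (elim conjE)?)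
 fix v w assume f: "f \<in> carrier \<C>" and h: "h \<in> carrier \<C>" and w: "1 \<le> v" "v \<le> w" "w \<le> n"
 show "compose {1..n} f h v \<le> compose {1..n} f h w"
  using catalanD(5)[OF f catalanD(2)[OF h] catalanD(5)[OF h w] catalanD(4)[OF h]] w by (simp add: compose_def)
next
 fix w assume f: "f \<in> carrier \<C>" and h: "h \<in> carrier \<C>" and w: "1 \<le> w" "w \<le> n"
 note b = catalanD(2)[OF h w] catalanD(4)[OF h w]
 show "1 \<le> compose {1..n} f h w" "compose {1..n} f h w \<le> w"
  using catalanD(2,3)[OF f b] catalanD(3)[OF h w] w by (auto simp: compose_def)
qed (simp add: compose_def)

lemma catalan_is_monoid: "monoid \<C>"
proof
 show "x \<otimes>\<^bsub>\<C>\<^esub> y \<in> carrier \<C>" if "x \<in> carrier \<C>" "y \<in> carrier \<C>" for x y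
  using that by (rule catalan_mult_closed)
 show o: "\<one>\<^bsub>\<C>\<^esub> \<in> carrier \<C>" by (auto simp: catalan_iff catalan_one)
 show "x \<otimes>\<^bsub>\<C>\<^esub> y \<otimes>\<^bsub>\<C>\<^esub> z = x \<otimes>\<^bsub>\<C>\<^esub> (y \<otimes>\<^bsub>\<C>\<^esub> z)"
  if "x \<in> carrier \<C>" "y \<in> carrier \<C>" "z \<in> carrier \<C>" for x y z
  using that catalanD(2,4)[of z] by (auto simp: catalan_mult compose_def fun_eq_iff)
 show "\<one>\<^bsub>\<C>\<^esub> \<otimes>\<^bsub>\<C>\<^esub> x = x" if "x \<in> carrier \<C>" for x
  by (rule catalan_eqI[OF catalan_mult_closed[OF o that] that])
   (use catalanD(2,4)[OF that] in \<open>auto simp: catalan_mult catalan_one compose_def\<close>)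
 show "x \<otimes>\<^bsub>\<C>\<^esub> \<one>\<^bsub>\<C>\<^esub> = x" if "x \<in> carrier \<C>" for x
  by (rule catalan_eqI[OF catalan_mult_closed[OF that o] that]) (auto simp: catalan_mult catalan_one compose_def)
qed

lemma catalan_zero_mem: "catalan_zero n \<in> carrier \<C>"
 by (auto simp: catalan_iff catalan_zero_def)

lemma catalan_zero_mult:
 assumes "f \<in> carrier \<C>"
 shows "f \<otimes>\<^bsub>\<C>\<^esub> catalan_zero n = catalan_zero n" "catalan_zero n \<otimes>\<^bsub>\<C>\<^esub> f = catalan_zero n"
proof -
 have "f 1 = 1" using catalanD(2,3)[OF assms, of 1] n by simp
 then show "f \<otimes>\<^bsub>\<C>\<^esub> catalan_zero n = catalan_zero n" "catalan_zero n \<otimes>\<^bsub>\<C>\<^esub> f = catalan_zero n"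
  using catalanD(2,4)[OF assms] by (auto simp: catalan_mult catalan_zero_def compose_def fun_eq_iff)
qed

lemma alpha_mem: "[|1 \<le> i; i < n|] ==> alpha n i \<in> carrier \<C>"
 by (auto simp: catalan_iff alpha_def)

lemma finite_catalan: "finite (carrier \<C>)"
 by (rule finite_subset[of _ "{1..n} \<rightarrow>\<^sub>E {1..n}"]) (auto simp: catalan_monoid_def intro: finite_PiE)

text \<open>The upper adjoint of \<open>f\<close> for the order on \<open>{1..n}\<close>. Off this interval it is the identity, so that
 the equations for composites, the identity and the generators hold as equations of functions.\<close>

definition gal :: "(nat => nat) => nat => nat" where
 "gal f u = (if 1 \<le> u \<and> u \<le> n then Max {w. 1 \<le> w \<and> w \<le> n \<and> f w \<le> u} else u)"

lemma gal_bounds: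
 assumes f: "f \<in> carrier \<C>" and u: "1 \<le> u" "u \<le> n"
 shows "u \<le> gal f u" "gal f u \<le> n" "f (gal f u) \<le> u"
proof -
 let ?S = "{w. 1 \<le> w \<and> w \<le> n \<and> f w \<le> u}"
 have fin: "finite ?S" by (rule finite_subset[of _ "{..n}"]) auto
 have us: "u \<in> ?S" using catalanD(3)[OF f u] u by simp
 have "Max ?S \<in> ?S" using fin us by (intro Max_in) auto
 then show "u \<le> gal f u" "gal f u \<le> n" "f (gal f u) \<le> u" using Max_ge[OF fin us] u by (auto simp: gal_def)
qed

lemma gal_iff:
 assumes f: "f \<in> carrier \<C>" and u: "1 \<le> u" "u \<le> n" and w: "1 \<le> w" "w \<le> n"
 shows "f w \<le> u \<longleftrightarrow> w \<le> gal f u"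
proof
 have fin: "finite {w. 1 \<le> w \<and> w \<le> n \<and> f w \<le> u}" by (rule finite_subset[of _ "{..n}"]) auto
 show "w \<le> gal f u" if "f w \<le> u" using Max_ge[OF fin, of w] that u w by (simp add: gal_def)
 show "f w \<le> u" if "w \<le> gal f u"
  using catalanD(5)[OF f w(1) that gal_bounds(2)[OF f u]] gal_bounds(3)[OF f u] by simp
qed

lemma gal_eqI:
 assumes f: "f \<in> carrier \<C>" and u: "1 \<le> u" "u \<le> n" and z: "1 \<le> z" "z \<le> n"
  and h: "\<And>w. [|1 \<le> w; w \<le> n|] ==> f w \<le> u \<longleftrightarrow> w \<le> z"
 shows "gal f u = z"
proof (rule antisym)
 have "1 \<le> gal f u" using gal_bounds(1)[OF f u] u by simp
 then show "gal f u \<le> z" using h gal_bounds[OF f u] by blast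
 show "z \<le> gal f u" using h[OF z] gal_iff[OF f u z] by simp
qed

lemma gal_good: "f \<in> carrier \<C> ==> good (gal f)"
 unfolding good_def
proof (intro conjI allI impI; elim conjE)
 fix u assume f: "f \<in> carrier \<C>" and u: "1 \<le> u" "u \<le> n"
 show "u \<le> gal f u" "gal f u \<le> n" by (rule gal_bounds[OF f u])+
next
 fix u v assume f: "f \<in> carrier \<C>" and u: "1 \<le> u" "u \<le> v" "v \<le> n"
 have u': "u \<le> n" "1 \<le> v" using u by auto
 note b = gal_bounds[OF f u(1) u'(1)]
 have "1 \<le> gal f u" using b u by simp
 then show "gal f u \<le> gal f v" using gal_iff[OF f u'(2) u(3), of "gal f u"] b u by simp
qed

lemma gal_comp:
 assumes f: "f \<in> carrier \<C>" and h: "h \<in> carrier \<C>"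
 shows "gal (f \<otimes>\<^bsub>\<C>\<^esub> h) = gal h \<circ> gal f"
proof
 fix u
 show "gal (f \<otimes>\<^bsub>\<C>\<^esub> h) u = (gal h \<circ> gal f) u"
 proof (cases "1 \<le> u \<and> u \<le> n")
  case True
  then have u: "1 \<le> u" "u \<le> n" by auto
  note b = gal_bounds[OF f u]
  have g: "1 \<le> gal f u" using b u by simp
  note b' = gal_bounds[OF h g b(2)]
  show ?thesis
   unfolding o_def
  proof (rule gal_eqI[OF catalan_mult_closed[OF f h] u])
   show "1 \<le> gal h (gal f u)" "gal h (gal f u) \<le> n" using b' g by auto
   fix w assume w: "1 \<le> w" "w \<le> n"
   show "(f \<otimes>\<^bsub>\<C>\<^esub> h) w \<le> u \<longleftrightarrow> w \<le> gal h (gal f u)"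
    using gal_iff[OF h g b(2) w] gal_iff[OF f u catalanD(2)[OF h w] catalanD(4)[OF h w]] w
    by (simp add: catalan_mult compose_def)
  qed
 next
  case False
  then show ?thesis by (auto simp: gal_def)
 qed
qed

lemma gal_one: "gal \<one>\<^bsub>\<C>\<^esub> = (\<lambda>u. u)"
proof
 fix u
 have "gal \<one>\<^bsub>\<C>\<^esub> u = u" if u: "1 \<le> u" "u \<le> n"
  by (rule gal_eqI[OF monoid.one_closed[OF catalan_is_monoid] u u]) (simp add: catalan_one)
 then show "gal \<one>\<^bsub>\<C>\<^esub> u = u" by (auto simp: gal_def)
qed

lemma gal_alpha:
 assumes i: "1 \<le> i" "i < n"
 shows "gal (alpha n i) = gi i"
proof
 fix u
 have "gal (alpha n i) u = gi i u" if u: "1 \<le> u" "u \<le> n"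
  by (rule gal_eqI[OF alpha_mem[OF i] u]) (use u i in \<open>auto simp: alpha_def gi_def\<close>)
 then show "gal (alpha n i) u = gi i u" using i by (auto simp: gal_def gi_def)
qed

lemma gal_zero_iff:
 assumes f: "f \<in> carrier \<C>"
 shows "gal f 1 < n \<longleftrightarrow> f \<noteq> catalan_zero n"
proof -
 have "gal f 1 < n \<longleftrightarrow> \<not> f n \<le> 1" using gal_iff[OF f order_refl n n order_refl] by auto
 also have "\<dots> \<longleftrightarrow> f \<noteq> catalan_zero n"
 proof
  assume "\<not> f n \<le> 1" then show "f \<noteq> catalan_zero n" using n by (auto simp: catalan_zero_def)
 next
  assume a: "f \<noteq> catalan_zero n"
  show "\<not> f n \<le> 1"
  proof
   assume "f n \<le> 1"
   then have "f w = 1" if "1 \<le> w" "w \<le> n" for w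
    using catalanD(2)[OF f that] catalanD(5)[OF f that order_refl] by simp
   then have "f = catalan_zero n" by (intro catalan_eqI[OF f catalan_zero_mem]) (auto simp: catalan_zero_def)
   then show False using a by simp
  qed
 qed
 finally show ?thesis .
qed

text \<open>Generation by the \<open>\<alpha>\<^sub>i\<close>: if \<open>j\<close> is the largest point moved by \<open>f\<close>, then \<open>f\<close> factors through the map
 \<open>\<alpha>\<^sub>i\<close> with \<open>i = f j\<close>, and the other factor moves points by one step less in total.\<close>

lemma catalan_factor:
 assumes f: "f \<in> carrier \<C>" and ne: "f \<noteq> \<one>\<^bsub>\<C>\<^esub>"
 obtains i h where "1 \<le> i" "i < n" "h \<in> carrier \<C>" "f = alpha n i \<otimes>\<^bsub>\<C>\<^esub> h"
  "(\<Sum>j=1..n. j - h j) < (\<Sum>j=1..n. j - f j)"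
proof -
 let ?S = "{j. 1 \<le> j \<and> j \<le> n \<and> f j < j}"
 have fin: "finite ?S" by (rule finite_subset[of _ "{..n}"]) auto
 have "?S \<noteq> {}"
 proof
  assume "?S = {}"
  then have "f = \<one>\<^bsub>\<C>\<^esub>" using catalanD(3)[OF f]
   by (intro catalan_eqI[OF f monoid.one_closed[OF catalan_is_monoid]]) (force simp: catalan_one)
  then show False using ne by simp
 qed
 define j where "j = Max ?S"
 have j: "1 \<le> j" "j \<le> n" "f j < j" using Max_in[OF fin \<open>?S \<noteq> {}\<close>] by (auto simp: j_def)
 have top: "f w = w" if "j < w" "w \<le> n" for w
 proof (rule ccontr)
  assume "f w \<noteq> w"
  then have "w \<in> ?S" using that catalanD(3)[OF f, of w] j by auto
  then show False using Max_ge[OF fin \<open>w \<in> ?S\<close>] that unfolding j_def by linarith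
 qed
 let ?i = "f j" and ?h = "f(j := Suc (f j))"
 have i: "1 \<le> ?i" "?i < n" using catalanD(2)[OF f j(1,2)] j by auto
 have mono: "?h v \<le> ?h w" if vw: "1 \<le> v" "v \<le> w" "w \<le> n" for v w
 proof (cases "w = j")
  case True
  then show ?thesis using catalanD(5)[OF f vw] by (auto intro: le_SucI)
 next
  case False
  then show ?thesis using catalanD(5)[OF f vw] vw top[of w] j by (cases "v = j") auto
 qed
 have h: "?h \<in> carrier \<C>"
  unfolding catalan_iff
 proof (intro conjI allI impI; (elim conjE)?)
  show "?h \<in> extensional {1..n}" using catalanD(1)[OF f] j by (auto simp: extensional_def)
 qed (use catalanD(2,3)[OF f] j mono in auto)
 have fac: "f = alpha n ?i \<otimes>\<^bsub>\<C>\<^esub> ?h"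
 proof (rule catalan_eqI[OF f catalan_mult_closed[OF alpha_mem[OF i] h]])
  fix w assume w: "1 \<le> w" "w \<le> n"
  have "f w \<noteq> Suc ?i" if "w \<noteq> j"
  proof (cases "w < j")
   case True
   then show ?thesis using catalanD(5)[OF f w(1) _ j(2)] by fastforce
  next
   case False
   then show ?thesis using top[of w] w that j by simp
  qed
  then show "f w = (alpha n ?i \<otimes>\<^bsub>\<C>\<^esub> ?h) w"
   using w i j catalanD(2,4)[OF f w] by (auto simp: catalan_mult compose_def alpha_def)
 qed
 have "(\<Sum>w=1..n. w - ?h w) < (\<Sum>w=1..n. w - f w)"
  by (rule sum_strict_mono_ex1) (use j in auto)
 then show ?thesis using that[OF i h fac] by blast
qed

section \<open>Classification of the 1-morphisms\<close>

text \<open>All components are taken at the index \<open>n\<close>, where they are zero.\<close>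

lemma zero_single:
 assumes g: "good g" and g1: "g 1 = n"
 shows "decomp [g] H \<longleftrightarrow> decomp [] H"
proof -
 have 1: "decomp [] H" if d: "decomp [g] H" for H
 proof -
  obtain \<beta> where H: "decomp_by [g] H \<beta>" using d by (auto simp: decomp_def)
  note HF = decomp_by_functor[OF H]
  have gn: "g u = n" if "1 \<le> u" "u \<le> n" for u
   using goodD(3)[OF g order_refl that] goodD(2)[OF g that] g1 by simp
  have "car (PV x [g] u) = car (PV x [] u)" if x: "x \<in> Obj X" and u: "1 \<le> u" "u < n" for x u
  proof (rule Set.set_eqI)
   fix \<phi>
   have "\<phi> \<in> car (PV x [g] u) \<longleftrightarrow> \<phi> 0 = \<^bold>0x \<and> (\<forall>k\<ge>1. \<phi> k = \<^bold>0x)"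
    using V_outside[OF x, of n] gn[of u] u by (auto simp: PV_car)
   also have "\<dots> \<longleftrightarrow> \<phi> \<in> car (PV x [] u)"
    unfolding PV_car by (auto simp: Suc_le_eq) (metis neq0_conv)
   finally show "\<phi> \<in> car (PV x [g] u) \<longleftrightarrow> \<phi> \<in> car (PV x [] u)" .
  qed
  then have e: "PV x [g] u = PV x [] u" if "x \<in> Obj X" "1 \<le> u" "u < n" for x u
   using that by (simp add: vs.equality)
  have z: "\<beta> x u z = (\<lambda>k. \<^bold>0x)" if "x \<in> Obj X" "1 \<le> u" "u < n" "z \<in> car (V H$x u)" for x u z
   using liso_mem[OF db_liso[OF H that(1,2)] that(4)] e[OF that(1-3)] that by (auto simp: PV_car fun_eq_iff)
  show ?thesis
  proof (rule decompI[OF HF, where \<beta> = \<beta>])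
   show "liso (V H$x u) (PV x [] u) (\<beta> x u)" if "x \<in> Obj X" "1 \<le> u" "u < n" for x u
    using db_liso[OF H that(1,2)] e[OF that] that by simp
   show "\<beta> x v (tr H$x u v z) = PT x [] u v (\<beta> x u z)"
    if "x \<in> Obj X" "1 \<le> u" "u \<le> v" "v < n" "z \<in> car (V H$x u)" for x u v z
    using z[OF that(1) _ that(4) lin_mem[OF tr_lin[OF functor_Obj[OF HF that(1)]] that(5)]] that by (simp add: PT_def)
   show "\<beta> y u (am (on_arr H f) z) = PA y [] f (\<beta> x u z)"
    if "f \<in> Homset X x y" "1 \<le> u" "u < n" "z \<in> car (V H$x u)" for f x y u z
    using z[OF cod[OF that(1)] that(2,3) lin_mem[OF am_lin[OF functor_Homset[OF HF that(1)]] that(4)]] by (simp add: PA_def)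
  qed simp
 qed
 have "decomp [g] H" if d: "decomp [] H"
 proof -
  obtain K where K: "decomp [g] K" using decomp_ex[of "[g]"] g by auto
  show ?thesis by (rule decomp_iso_transfer[OF K decomp_unique[OF 1[OF K] d]])
 qed
 then show ?thesis using 1 by blast
qed

text \<open>The functors that correspond to an element of the monoid.\<close>

abbreviation T where "T f H \<equiv> decomp [gal f] H"

lemma T_zero: "T (catalan_zero n) H \<longleftrightarrow> zero_functor X E H"
 using zero_single[OF gal_good[OF catalan_zero_mem]] gal_zero_iff[OF catalan_zero_mem]
  gal_bounds(2)[OF catalan_zero_mem order_refl n] by (simp add: decomp_Nil_iff)

lemma T_ex: "f \<in> carrier \<C> ==> \<exists>H. T f H"
 using decomp_ex[of "[gal f]"] gal_good by simp

lemma comp_list_map: "[|set fs \<subseteq> carrier \<C>; set hs \<subseteq> carrier \<C>|] ==> comp_list (map gal fs) (map gal hs) =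
  map gal (map (\<lambda>i. fs ! (i div length hs) \<otimes>\<^bsub>\<C>\<^esub> hs ! (i mod length hs)) [0..<length fs * length hs])"
proof (rule nth_equalityI)
 fix i assume s: "set fs \<subseteq> carrier \<C>" "set hs \<subseteq> carrier \<C>"
  and "i < length (comp_list (map gal fs) (map gal hs))"
 then have i: "i < length (map gal fs) * length (map gal hs)" by (simp add: comp_list_def)
 note c = comp_list_index[OF i]
 have "fs ! (i div length hs) \<in> carrier \<C>" "hs ! (i mod length hs) \<in> carrier \<C>" using s c(1,2) by auto
 then show "comp_list (map gal fs) (map gal hs) ! i = map gal
   (map (\<lambda>i. fs ! (i div length hs) \<otimes>\<^bsub>\<C>\<^esub> hs ! (i mod length hs)) [0..<length fs * length hs]) ! i"
  using c i gal_comp by simp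
qed (simp add: comp_list_def)

lemma T_comp:
 assumes "f \<in> carrier \<C>" "h \<in> carrier \<C>" "T f F" "T h G"
 shows "T (f \<otimes>\<^bsub>\<C>\<^esub> h) (F \<circ>\<^sub>F G)"
 using decomp_comp[OF assms(3,4)] comp_list_map[of "[f]" "[h]"] assms(1,2) by (simp add: upt_Suc)

lemma T_one: "T \<one>\<^bsub>\<C>\<^esub> id_functor"
 using decomp_id by (simp add: gal_one)

lemma T_alpha: "[|1 \<le> i; i < n; acts_as_G n X E i H|] ==> T (alpha n i) H"
 using acts_as_G_decomp by (simp add: gal_alpha)

lemma G_compositions_T: "C \<in> G_compositions n X E ==> \<exists>f\<in>carrier \<C>. T f C"
proof (induction rule: G_compositions.induct)
 case empty
 show ?case using T_one monoid.one_closed[OF catalan_is_monoid] by (rule bexI)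
next
 case (step i H C)
 then have i: "1 \<le> i" "i < n" by auto
 obtain f where f: "f \<in> carrier \<C>" "T f C" using step.IH by (rule bexE)
 show ?case
  using T_comp[OF alpha_mem[OF i] f(1) T_alpha[OF i step.hyps(2)] f(2)] catalan_mult_closed[OF alpha_mem[OF i] f(1)]
  by (rule bexI)
qed

text \<open>Write the element as a product of generators, by induction on the total displacement.\<close>

lemma T_G_composition: "f \<in> carrier \<C> ==> \<exists>C\<in>G_compositions n X E. T f C"
proof (induction "\<Sum>j=1..n. j - f j" arbitrary: f rule: less_induct)
 case less
 show ?case
 proof (cases "f = \<one>\<^bsub>\<C>\<^esub>")
  case True
  then show ?thesis using T_one G_compositions.empty by blast
 next
  case False
  obtain i h where i: "1 \<le> i" "i < n" and h: "h \<in> carrier \<C>" "f = alpha n i \<otimes>\<^bsub>\<C>\<^esub> h"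
   "(\<Sum>j=1..n. j - h j) < (\<Sum>j=1..n. j - f j)" using catalan_factor[OF less.prems False] by metis
  obtain C where C: "C \<in> G_compositions n X E" "T h C" using less.hyps[OF h(3,1)] by (rule bexE)
  obtain H where H: "acts_as_G n X E i H" using acts_as_G_ex[OF i] by (rule exE)
  have "T f (H \<circ>\<^sub>F C)" using T_comp[OF alpha_mem[OF i] h(1) T_alpha[OF i H] C(2)] h(2) by simp
  moreover have "H \<circ>\<^sub>F C \<in> G_compositions n X E" using G_compositions.step[OF _ H C(1)] i by simp
  ultimately show ?thesis by (rule bexI)
 qed
qed

abbreviation "OM \<equiv> one_morphisms n X E"

text \<open>A summand of a composition of the \<open>G\<^sub>i\<close> is trivial or the whole composition.\<close>

lemma one_morphism_list:
 "[|direct_sum_list X E Fs H; \<forall>F\<in>set Fs. \<exists>C\<in>G_compositions n X E. \<exists>K. direct_sum X E C F K|] ==>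
  \<exists>fs. set fs \<subseteq> carrier \<C> \<and> decomp (map gal fs) H"
proof (induction Fs arbitrary: H)
 case Nil
 then show ?case by (intro exI[of _ "[]"]) (simp add: decomp_Nil_iff)
next
 case (Cons F Fs)
 obtain K where K: "direct_sum X E H F K" "direct_sum_list X E Fs K" using Cons.prems(1) by auto
 obtain fs where fs: "set fs \<subseteq> carrier \<C>" "decomp (map gal fs) K" using Cons.IH[OF K(2)] Cons.prems(2) by auto
 obtain C K' where C: "C \<in> G_compositions n X E" "direct_sum X E C F K'" using Cons.prems(2) by auto
 obtain f where f: "f \<in> carrier \<C>" "T f C" using G_compositions_T[OF C(1)] by (rule bexE)
 have "decomp [] F \<or> decomp [gal f] F" using summand_trivial[OF f(2) C(2)] by auto
 then show ?case
 proof
  assume "decomp [] F"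
  then show ?thesis using decomp_append[OF K(1) _ fs(2), of "[]"] fs(1) by auto
 next
  assume "decomp [gal f] F"
  then have "decomp (map gal (f # fs)) H" using decomp_append[OF K(1) _ fs(2), of "[gal f]"] by simp
  then show ?thesis using fs(1) f(1) by (intro exI[of _ "f # fs"]) simp
 qed
qed

lemma list_one_morphism:
 "[|set fs \<subseteq> carrier \<C>; decomp (map gal fs) H|] ==>
  \<exists>Fs. direct_sum_list X E Fs H \<and> (\<forall>F\<in>set Fs. \<exists>C\<in>G_compositions n X E. \<exists>K. direct_sum X E C F K)"
proof (induction fs arbitrary: H)
 case Nil
 then show ?case by (intro exI[of _ "[]"]) (simp add: decomp_Nil_iff)
next
 case (Cons f fs)
 then have f: "f \<in> carrier \<C>" and fs: "set fs \<subseteq> carrier \<C>" by auto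
 obtain F where F: "F \<in> G_compositions n X E" "T f F" using T_G_composition[OF f] by (rule bexE)
 have "\<forall>g\<in>set (map gal fs). good g" using fs gal_good by auto
 from decomp_ex[OF this] obtain K where K: "decomp (map gal fs) K" by (rule exE)
 obtain Z where Z: "decomp [] Z" using decomp_ex[of "[]"] by auto
 have 1: "direct_sum X E H F K" using decomp_split[OF _ F(2) K] Cons.prems(2) by simp
 have 2: "direct_sum X E F F Z" using decomp_split[OF _ F(2) Z] F(2) by simp
 obtain Fs where Fs: "direct_sum_list X E Fs K" "\<forall>F\<in>set Fs. \<exists>C\<in>G_compositions n X E. \<exists>K. direct_sum X E C F K"
  using Cons.IH[OF fs K] by blast
 show ?case
 proof (intro exI[of _ "F # Fs"] conjI)
  show "direct_sum_list X E (F # Fs) H" using 1 Fs(1) by auto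
  show "\<forall>F\<in>set (F # Fs). \<exists>C\<in>G_compositions n X E. \<exists>K. direct_sum X E C F K" using 2 F(1) Fs(2) by auto
 qed
qed

lemma one_morphisms_iff: "H \<in> OM \<longleftrightarrow> (\<exists>fs. set fs \<subseteq> carrier \<C> \<and> decomp (map gal fs) H)"
proof
 assume "H \<in> OM"
 then show "\<exists>fs. set fs \<subseteq> carrier \<C> \<and> decomp (map gal fs) H" using one_morphism_list by (auto simp: one_morphisms_def)
next
 assume "\<exists>fs. set fs \<subseteq> carrier \<C> \<and> decomp (map gal fs) H"
 then obtain fs where fs: "set fs \<subseteq> carrier \<C>" "decomp (map gal fs) H" by blast
 show "H \<in> OM" using list_one_morphism[OF fs] decomp_functor[OF fs(2)] by (simp add: one_morphisms_def)
qed

lemma T_OM: "[|f \<in> carrier \<C>; T f H|] ==> H \<in> OM"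
 using one_morphisms_iff[THEN iffD2, OF exI[of _ "[f]"]] by simp

text \<open>Of the summands of an indecomposable 1-morphism all but at most one are zero. The zero functor, which has
 no other summands, belongs to the zero of the monoid.\<close>

lemma indecomposable_iff: "indecomposable n X E H \<longleftrightarrow> (\<exists>f\<in>carrier \<C>. T f H)"
proof
 assume "\<exists>f\<in>carrier \<C>. T f H"
 then obtain f where f: "f \<in> carrier \<C>" "T f H" by (rule bexE)
 show "indecomposable n X E H"
  using T_OM[OF f] summand_trivial[OF f(2)] by (auto simp: indecomposable_def decomp_Nil_iff)
next
 assume H: "indecomposable n X E H"
 then have "H \<in> OM" by (simp add: indecomposable_def)
 then obtain fs where fs: "set fs \<subseteq> carrier \<C>" "decomp (map gal fs) H" unfolding one_morphisms_iff by blast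
 then show "\<exists>f\<in>carrier \<C>. T f H"
 proof (induction fs)
  case Nil
  then show ?case using T_zero catalan_zero_mem decomp_Nil_iff by auto
 next
  case (Cons f fs)
  then have f: "f \<in> carrier \<C>" and s: "set fs \<subseteq> carrier \<C>" by auto
  obtain F where F: "T f F" using T_ex[OF f] by (rule exE)
  have "\<forall>g\<in>set (map gal fs). good g" using s gal_good by auto
  from decomp_ex[OF this] obtain K where K: "decomp (map gal fs) K" by (rule exE)
  have D: "direct_sum X E H F K" using decomp_split[OF _ F K] Cons.prems(2) by simp
  have "F \<in> OM" "K \<in> OM" using T_OM[OF f F] one_morphisms_iff s K by auto
  then have "zero_functor X E F \<or> zero_functor X E K" using H D by (auto simp: indecomposable_def)
  then show ?case
  proof
   assume "zero_functor X E F"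
   then show ?thesis using decomp_append[OF D _ K, of "[]"] Cons.IH[OF s] by (simp add: decomp_Nil_iff)
  next
   assume "zero_functor X E K"
   then show ?thesis using decomp_append[OF D F, of "[]"] f by (auto simp: decomp_Nil_iff)
  qed
 qed
qed

section \<open>Uniqueness of the multiplicities\<close>

text \<open>The numbers that the interval modules detect, in terms of the monoid: by adjointness
 \<open>w \<le> gal h (f w)\<close> means \<open>h w \<le> f w\<close>.\<close>

definition below where "below f fs = length (filter (\<lambda>h. h \<noteq> catalan_zero n \<and> (\<forall>w. 2 \<le> w \<and> w \<le> n --> h w \<le> f w)) fs)"

lemma below_eq:
 assumes fs: "set fs \<subseteq> carrier \<C>" and hs: "set hs \<subseteq> carrier \<C>"
  and H: "decomp (map gal fs) H" "decomp (map gal hs) H" and f: "f \<in> carrier \<C>"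
 shows "below f fs = below f hs"
proof (cases "1 < n")
 case True
 have b: "below f ks = card {k. k < length (map gal ks) \<and> (map gal ks ! k) 1 < n \<and>
   (\<forall>w. 2 \<le> w \<and> w \<le> n --> w \<le> (map gal ks ! k) (f w))}"
  if ks: "set ks \<subseteq> carrier \<C>" for ks
 proof -
  have e: "(map gal ks ! k) 1 < n \<and> (\<forall>w. 2 \<le> w \<and> w \<le> n --> w \<le> (map gal ks ! k) (f w)) \<longleftrightarrow>
    ks ! k \<noteq> catalan_zero n \<and> (\<forall>w. 2 \<le> w \<and> w \<le> n --> (ks ! k) w \<le> f w)" if k: "k < length ks" for k
  proof -
   have m: "ks ! k \<in> carrier \<C>" using ks k by auto
   have "w \<le> gal (ks ! k) (f w) \<longleftrightarrow> (ks ! k) w \<le> f w" if "2 \<le> w" "w \<le> n" for w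
    using gal_iff[OF m catalanD(2)[OF f] catalanD(4)[OF f], of w w] that by simp
   then show ?thesis using gal_zero_iff[OF m] k by auto
  qed
  show ?thesis unfolding below_def length_filter_conv_card length_map
   by (rule arg_cong[where f = card], rule Collect_cong, rule conj_cong[OF refl]) (rule e[symmetric])
 qed
 have f': "1 \<le> f w \<and> f w \<le> n" if "2 \<le> w" "w \<le> n" for w using catalanD(2,4)[OF f, of w] that by simp
 show ?thesis unfolding b[OF fs] b[OF hs] by (rule decomp_counts[OF H True f'])
next
 case False
 have "h = catalan_zero n" if h: "h \<in> carrier \<C>" for h
 proof (rule catalan_eqI[OF h catalan_zero_mem])
  fix w assume w: "1 \<le> w" "w \<le> n"
  then have "w = 1" using False by simp
  then show "h w = catalan_zero n w" using catalanD(2,3)[OF h w] w by (simp add: catalan_zero_def)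
 qed
 then show ?thesis using fs hs by (auto simp: below_def filter_empty_conv subset_iff)
qed

lemma count_list_sum:
 assumes "finite S"
 shows "length (filter (\<lambda>h. h \<in> S) fs) = (\<Sum>h\<in>S. count_list fs h)"
proof (induction fs)
 case (Cons f fs)
 have "(\<Sum>h\<in>S. count_list (f # fs) h) = (\<Sum>h\<in>S. count_list fs h + (if h = f then 1 else 0))"
  by (rule sum.cong) auto
 also have "\<dots> = (\<Sum>h\<in>S. count_list fs h) + (if f \<in> S then 1 else 0)" using assms by (simp add: sum.distrib)
 finally show ?case using Cons by simp
qed simp

text \<open>The count of all nonzero elements below \<open>f\<close> is the sum of the multiplicities of these elements, all of which
 except that of \<open>f\<close> are known by induction.\<close>

lemma multiplicity_unique:
 assumes fs: "set fs \<subseteq> carrier \<C>" and hs: "set hs \<subseteq> carrier \<C>"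
  and H: "decomp (map gal fs) H" "decomp (map gal hs) H"
 shows "[|f \<in> carrier \<C>; f \<noteq> catalan_zero n|] ==> count_list fs f = count_list hs f"
proof (induction "\<Sum>w=1..n. f w" arbitrary: f rule: less_induct)
 case less
 let ?S = "{h \<in> carrier \<C>. h \<noteq> catalan_zero n \<and> (\<forall>w. 2 \<le> w \<and> w \<le> n --> h w \<le> f w)}"
 have fin: "finite ?S" using finite_catalan by simp
 have fS: "f \<in> ?S" using less.prems by simp
 have b: "below f ks = count_list ks f + (\<Sum>h\<in>?S - {f}. count_list ks h)" if "set ks \<subseteq> carrier \<C>" for ks
 proof -
  have "below f ks = length (filter (\<lambda>h. h \<in> ?S) ks)"
   unfolding below_def using that by (intro arg_cong[where f = length] filter_cong) auto
  then show ?thesis using count_list_sum[OF fin] sum.remove[OF fin fS] by simp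
 qed
 have "(\<Sum>h\<in>?S - {f}. count_list fs h) = (\<Sum>h\<in>?S - {f}. count_list hs h)"
 proof (rule sum.cong[OF refl])
  fix h assume h: "h \<in> ?S - {f}"
  have le: "h w \<le> f w" if w: "w \<in> {1..n}" for w
  proof (cases "w = 1")
   case True
   then show ?thesis using catalanD(3)[of h 1] catalanD(2)[OF less.prems(1), of 1] h w by auto
  qed (use h w in auto)
  moreover have "\<exists>w\<in>{1..n}. h w < f w"
  proof (rule ccontr)
   assume "\<not> ?thesis"
   then have "h = f" using h le less.prems(1) by (intro catalan_eqI) (force simp: not_less)+
   then show False using h by simp
  qed
  ultimately have "(\<Sum>w=1..n. h w) < (\<Sum>w=1..n. f w)" by (intro sum_strict_mono_ex1) auto
  then show "count_list fs h = count_list hs h" using less.hyps h by blast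
 qed
 then show ?case using b[OF fs] b[OF hs] below_eq[OF fs hs H less.prems(1)] by simp
qed

lemma T_unique:
 assumes f: "f \<in> carrier \<C>" "T f H" and h: "h \<in> carrier \<C>" "T h H"
 shows "f = h"
proof (rule ccontr)
 assume ne: "f \<noteq> h"
 have c: "count_list [f] k = count_list [h] k" if "k \<in> carrier \<C>" "k \<noteq> catalan_zero n" for k
  by (rule multiplicity_unique[where H = H, OF _ _ _ _ that]) (use f h in auto)
 show False using c[OF f(1)] c[OF h(1)] ne by (auto split: if_splits)
qed

section \<open>The monoid of indecomposable 1-morphisms\<close>

abbreviation cls where "cls f \<equiv> {H. T f H}"

lemma iso_class_T:
 assumes f: "f \<in> carrier \<C>" and F: "T f F"
 shows "iso_class n X E F = cls f"
 unfolding iso_class_def using decomp_iso_transfer[OF F] decomp_unique[OF F] T_OM[OF f] by blast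

lemma indec_monoid_carrier: "carrier (indec_monoid n X E) = cls ` carrier \<C>"
proof -
 have "iso_class n X E ` {F. indecomposable n X E F} = cls ` carrier \<C>"
 proof (intro equalityI subsetI)
  fix U assume "U \<in> iso_class n X E ` {F. indecomposable n X E F}"
  then show "U \<in> cls ` carrier \<C>" using iso_class_T by (auto simp: indecomposable_iff)
 next
  fix U assume "U \<in> cls ` carrier \<C>"
  then obtain f where f: "f \<in> carrier \<C>" "U = cls f" by blast
  obtain F where F: "T f F" using T_ex[OF f(1)] by (rule exE)
  show "U \<in> iso_class n X E ` {F. indecomposable n X E F}"
   using iso_class_T[OF f(1) F] f F by (auto simp: indecomposable_iff)
 qed
 then show ?thesis by (simp add: indec_monoid_def)
qed

lemma indec_monoid_one: "\<one>\<^bsub>indec_monoid n X E\<^esub> = cls \<one>\<^bsub>\<C>\<^esub>"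
 using iso_class_T[OF monoid.one_closed[OF catalan_is_monoid] T_one] by (simp add: indec_monoid_def)

text \<open>All composites of representatives are isomorphic, so their classes coincide.\<close>

lemma indec_monoid_mult:
 assumes "f \<in> carrier \<C>" "h \<in> carrier \<C>"
 shows "cls f \<otimes>\<^bsub>indec_monoid n X E\<^esub> cls h = cls (f \<otimes>\<^bsub>\<C>\<^esub> h)"
proof -
 have "(\<Union>F\<in>cls f. \<Union>G\<in>cls h. iso_class n X E (F \<circ>\<^sub>F G)) = (\<Union>F\<in>cls f. \<Union>G\<in>cls h. cls (f \<otimes>\<^bsub>\<C>\<^esub> h))"
  using iso_class_T[OF catalan_mult_closed[OF assms] T_comp[OF assms]] by simp
 also have "\<dots> = cls (f \<otimes>\<^bsub>\<C>\<^esub> h)" using T_ex[OF assms(1)] T_ex[OF assms(2)] by auto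
 finally show ?thesis by (simp add: indec_monoid_def)
qed

lemma indec_monoid_iso: "cls \<in> iso \<C> (indec_monoid n X E)"
proof (rule isoI)
 show "cls \<in> hom \<C> (indec_monoid n X E)"
  using indec_monoid_mult indec_monoid_carrier by (auto intro!: homI)
 have "inj_on cls (carrier \<C>)"
 proof (rule inj_onI)
  fix f h assume f: "f \<in> carrier \<C>" and h: "h \<in> carrier \<C>" and e: "cls f = cls h"
  obtain F where "T f F" using T_ex[OF f] by (rule exE)
  then show "f = h" using T_unique[OF f _ h] e by blast
 qed
 then show "bij_betw cls (carrier \<C>) (carrier (indec_monoid n X E))"
  by (simp add: bij_betw_def indec_monoid_carrier)
qed

lemma indec_monoid_monoid: "monoid (indec_monoid n X E)"
proof -
 have "monoid (indec_monoid n X E \<lparr>carrier := cls ` carrier \<C>, one := cls \<one>\<^bsub>\<C>\<^esub>\<rparr>)"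
  using monoid.hom_imp_img_monoid[OF catalan_is_monoid] indec_monoid_iso by (auto simp: iso_def)
 then show ?thesis by (simp flip: indec_monoid_carrier indec_monoid_one)
qed

end

section \<open>Integral monoid rings\<close>

lemma frag_extend_fun_diff: "frag_extend (\<lambda>x. f x - g x) c = frag_extend f c - frag_extend g c"
 and frag_extend_fun_add: "frag_extend (\<lambda>x. f x + g x) c = frag_extend f c + frag_extend g c"
 and frag_extend_fun_0: "frag_extend (\<lambda>x. 0) c = 0"
 using subset_UNIV by (induction c rule: frag_induction; simp add: frag_extend_diff)+

lemma frag_mult_simps [simp]:
 "frag_mult m 0 b = 0" "frag_mult m a 0 = 0"
 "frag_mult m (a - a') b = frag_mult m a b - frag_mult m a' b"
 "frag_mult m a (b - b') = frag_mult m a b - frag_mult m a b'"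
 "frag_mult m (a + a') b = frag_mult m a b + frag_mult m a' b"
 "frag_mult m a (b + b') = frag_mult m a b + frag_mult m a b'"
 "frag_mult m (frag_of x) (frag_of y) = frag_of (m x y)"
 by (simp_all add: frag_mult_def frag_extend_diff frag_extend_add frag_extend_fun_diff frag_extend_fun_add frag_extend_fun_0)

lemma frag_mult_keys:
 assumes "supp a \<subseteq> S" "supp b \<subseteq> S'" "\<And>x y. [|x \<in> S; y \<in> S'|] ==> m x y \<in> U"
 shows "supp (frag_mult m a b) \<subseteq> U"
proof -
 have "supp (frag_extend (\<lambda>y. frag_of (m x y)) b) \<subseteq> U" if "x \<in> S" for x
  using keys_frag_extend[of "\<lambda>y. frag_of (m x y)" b] assms(2,3) that by (fastforce simp: keys_frag_of)
 then show ?thesis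
  using keys_frag_extend[of "\<lambda>x. frag_extend (\<lambda>y. frag_of (m x y)) b" a] assms(1) unfolding frag_mult_def by fastforce
qed

lemma int_monoid_ring_sel [simp]:
 "carrier (int_monoid_ring M) = {c. supp c \<subseteq> carrier M}"
 "monoid.mult (int_monoid_ring M) = frag_mult (monoid.mult M)" "monoid.one (int_monoid_ring M) = frag_of \<one>\<^bsub>M\<^esub>"
 "ring.zero (int_monoid_ring M) = 0" "ring.add (int_monoid_ring M) = (+)"
 by (simp_all add: int_monoid_ring_def)

lemma add_keys: "[|supp a \<subseteq> S; supp b \<subseteq> S|] ==> supp (a + b) \<subseteq> S"
 and diff_keys: "[|supp a \<subseteq> S; supp b \<subseteq> S|] ==> supp (a - b) \<subseteq> S"
 for a b :: "'a \<Rightarrow>\<^sub>0 int"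
 using keys_add[of a b] keys_diff[of a b] by blast+

lemma int_monoid_ring_ring:
 assumes "monoid M"
 shows "ring (int_monoid_ring M)"
proof (rule ringI)
 interpret monoid M by fact
 show "abelian_group (int_monoid_ring M)"
 proof (rule abelian_groupI; unfold int_monoid_ring_sel mem_Collect_eq)
  show "\<exists>y\<in>{c. supp c \<subseteq> carrier M}. y + x = 0" if "supp x \<subseteq> carrier M" for x :: "'a \<Rightarrow>\<^sub>0 int"
   using that by (intro bexI[of _ "- x"]) auto
 qed (auto simp: add.assoc add.commute dest: add_keys)
 show "Group.monoid (int_monoid_ring M)"
 proof (rule monoidI; unfold int_monoid_ring_sel mem_Collect_eq)
  fix x y z :: "'a \<Rightarrow>\<^sub>0 int"
  assume x: "supp x \<subseteq> carrier M"
  show "frag_mult (\<otimes>\<^bsub>M\<^esub>) (frag_of \<one>\<^bsub>M\<^esub>) x = x" using x by (induction x rule: frag_induction) auto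
  show "frag_mult (\<otimes>\<^bsub>M\<^esub>) x (frag_of \<one>\<^bsub>M\<^esub>) = x" using x by (induction x rule: frag_induction) auto
  assume y: "supp y \<subseteq> carrier M"
  show "supp (frag_mult (\<otimes>\<^bsub>M\<^esub>) x y) \<subseteq> carrier M" by (rule frag_mult_keys[OF x y]) simp
  assume z: "supp z \<subseteq> carrier M"
  show "frag_mult (\<otimes>\<^bsub>M\<^esub>) (frag_mult (\<otimes>\<^bsub>M\<^esub>) x y) z = frag_mult (\<otimes>\<^bsub>M\<^esub>) x (frag_mult (\<otimes>\<^bsub>M\<^esub>) y z)"
   using x
  proof (induction x rule: frag_induction)
   case (one a)
   show ?case using y
   proof (induction y rule: frag_induction)
    case (one b)
    show ?case using z by (induction z rule: frag_induction) (use \<open>a \<in> carrier M\<close> one in \<open>auto simp: m_assoc\<close>)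
   qed auto
  qed auto
 qed (simp add: keys_frag_of)
qed auto

lemma int_monoid_ring_minus:
 assumes "monoid M" "supp a \<subseteq> carrier M" "supp b \<subseteq> carrier M"
 shows "a \<ominus>\<^bsub>int_monoid_ring M\<^esub> b = a - b"
proof -
 interpret ring "int_monoid_ring M" by (rule int_monoid_ring_ring[OF assms(1)])
 have "\<ominus>\<^bsub>int_monoid_ring M\<^esub> b = - b" using assms(3) by (intro minus_equality) simp_all
 then show ?thesis by (simp add: a_minus_def)
qed

text \<open>Multiples of a zero element of a monoid absorb products.\<close>

lemma zero_ideal:
 assumes M: "monoid M" and z: "z \<in> carrier M" "\<And>x. x \<in> carrier M ==> x \<otimes>\<^bsub>M\<^esub> z = z" "\<And>x. x \<in> carrier M ==> z \<otimes>\<^bsub>M\<^esub> x = z"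
 shows "ideal {c. supp c \<subseteq> {z}} (int_monoid_ring M)"
proof (rule idealI[OF int_monoid_ring_ring[OF M]])
 interpret ring "int_monoid_ring M" by (rule int_monoid_ring_ring[OF M])
 show "subgroup {c. supp c \<subseteq> {z}} (add_monoid (int_monoid_ring M))"
 proof (rule add.subgroupI; (unfold int_monoid_ring_sel)?)
  show "{c. supp c \<subseteq> {z}} \<subseteq> {c. supp c \<subseteq> carrier M}" using z(1) by auto
  show "{c::'a \<Rightarrow>\<^sub>0 int. supp c \<subseteq> {z}} \<noteq> {}" by (auto intro: exI[of _ 0])
  show "\<ominus>\<^bsub>int_monoid_ring M\<^esub> a \<in> {c. supp c \<subseteq> {z}}" if a: "a \<in> {c. supp c \<subseteq> {z}}" for a
  proof -
   have "\<ominus>\<^bsub>int_monoid_ring M\<^esub> a = - a" using a z(1) by (intro minus_equality) auto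
   then show ?thesis using a by simp
  qed
  show "a + b \<in> {c. supp c \<subseteq> {z}}"
   if "a \<in> {c. supp c \<subseteq> {z}}" "b \<in> {c. supp c \<subseteq> {z}}" for a b :: "'a \<Rightarrow>\<^sub>0 int"
   using that add_keys[of a "{z}" b] by auto
 qed
qed (use z frag_mult_keys[of _ "{z}" _ "carrier M" "(\<otimes>\<^bsub>M\<^esub>)" "{z}"] frag_mult_keys[of _ "carrier M" _ "{z}" "(\<otimes>\<^bsub>M\<^esub>)" "{z}"] in auto)

text \<open>A property that holds at zero and is preserved by differences passes from a generating set to the
 subgroup.\<close>

lemma generate_free_Abelian_group_induct:
 assumes "c \<in> generate (free_Abelian_group S) Z" and Z: "\<And>z. z \<in> Z ==> supp z \<subseteq> S \<and> P z"
  and "P 0" and d: "\<And>a b. [|P a; P b|] ==> P (a - b)"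
 shows "P c"
proof -
 have neg: "P (- z)" if "P z" for z using d[OF \<open>P 0\<close> that] by simp
 show ?thesis using assms(1)
 proof (induction rule: generate.induct)
  case (eng a b)
  then show ?case using d[OF eng.IH(1) neg[OF eng.IH(2)]] by simp
 qed (use Z neg \<open>P 0\<close> in auto)
qed

text \<open>Formal sums record lists with multiplicities and forget the order.\<close>

definition list_frag :: "'a list => 'a \<Rightarrow>\<^sub>0 int" where
 "list_frag xs = (\<Sum>x\<leftarrow>xs. frag_of x)"

lemma list_frag_simps [simp]: "list_frag [] = 0" "list_frag (x # xs) = frag_of x + list_frag xs"
 "list_frag (xs @ ys) = list_frag xs + list_frag ys"
 by (simp_all add: list_frag_def)

lemma list_frag_lookup: "Poly_Mapping.lookup (list_frag xs) x = int (count_list xs x)"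
 by (induction xs) (auto simp: lookup_add lookup_single when_def)

lemma list_frag_keys: "supp (list_frag xs) = set xs"
 by (auto simp: set_eq_iff in_keys_iff list_frag_lookup count_list_0_iff)

context X_mod begin

section \<open>The Grothendieck ring\<close>

lemma list_frag_mult:
 "list_frag (map (\<lambda>i. m (xs ! (i div length ys)) (ys ! (i mod length ys))) [0..<length xs * length ys]) =
  frag_mult m (list_frag xs) (list_frag ys)"
proof (induction xs rule: rev_induct)
 case (snoc x xs)
 let ?l = "length ys"
 have 1: "frag_mult m (frag_of x) (list_frag zs) = list_frag (map (m x) zs)" for zs
  by (induction zs) simp_all
 have e1: "[0..<length (xs @ [x]) * ?l] = [0..<length xs * ?l] @ map (\<lambda>j. length xs * ?l + j) [0..<?l]"
  using upt_add_eq_append[of 0 "length xs * ?l" ?l] map_add_upt[of "length xs * ?l" ?l] by (simp add: add.commute)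
 have e2: "map (\<lambda>i. m ((xs @ [x]) ! (i div ?l)) (ys ! (i mod ?l))) [0..<length xs * ?l] =
   map (\<lambda>i. m (xs ! (i div ?l)) (ys ! (i mod ?l))) [0..<length xs * ?l]"
  by (auto simp: nth_append less_mult_imp_div_less)
 have e3: "map (\<lambda>j. m ((xs @ [x]) ! ((length xs * ?l + j) div ?l)) (ys ! ((length xs * ?l + j) mod ?l))) [0..<?l] = map (m x) ys"
  by (rule nth_equalityI) (auto simp: block_index)
 show ?case unfolding e1 map_append map_map o_def e2 e3 list_frag_simps snoc.IH by (simp add: 1)
qed simp

abbreviation "ZC \<equiv> int_monoid_ring \<C>"
abbreviation "ZM \<equiv> int_monoid_ring (one_morphism_monoid n X E)"
abbreviation "J \<equiv> {c :: (nat => nat) \<Rightarrow>\<^sub>0 int. supp c \<subseteq> {catalan_zero n}}"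
abbreviation "SR \<equiv> split_relations n X E"

lemma one_morphism_monoid_sel [simp]: "carrier (one_morphism_monoid n X E) = OM"
 "monoid.mult (one_morphism_monoid n X E) = (\<circ>\<^sub>F)" "monoid.one (one_morphism_monoid n X E) = id_functor"
 by (simp_all add: one_morphism_monoid_def)

lemma OM_comp_list:
 assumes fs: "set fs \<subseteq> carrier \<C>" "decomp (map gal fs) F" and hs: "set hs \<subseteq> carrier \<C>" "decomp (map gal hs) G"
 defines "ks \<equiv> map (\<lambda>i. fs ! (i div length hs) \<otimes>\<^bsub>\<C>\<^esub> hs ! (i mod length hs)) [0..<length fs * length hs]"
 shows "set ks \<subseteq> carrier \<C>" "decomp (map gal ks) (F \<circ>\<^sub>F G)"
proof -
 show "decomp (map gal ks) (F \<circ>\<^sub>F G)" using decomp_comp[OF fs(2) hs(2)] comp_list_map[OF fs(1) hs(1)] by (simp add: ks_def)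
 show "set ks \<subseteq> carrier \<C>"
 proof
  fix k assume "k \<in> set ks"
  then obtain i where i: "i < length fs * length hs" "k = fs ! (i div length hs) \<otimes>\<^bsub>\<C>\<^esub> hs ! (i mod length hs)"
   by (auto simp: ks_def)
  have "fs ! (i div length hs) \<in> carrier \<C>" "hs ! (i mod length hs) \<in> carrier \<C>"
   using comp_list_index(1,2)[OF i(1)] fs hs by auto
  then show "k \<in> carrier \<C>" using i(2) catalan_mult_closed by simp
 qed
qed

lemma one_morphism_monoid: "monoid (one_morphism_monoid n X E)"
proof (rule monoidI; unfold one_morphism_monoid_sel)
 show "F \<circ>\<^sub>F G \<in> OM" if F: "F \<in> OM" and G: "G \<in> OM" for F G
 proof -
  obtain fs where f: "set fs \<subseteq> carrier \<C>" "decomp (map gal fs) F" using F unfolding one_morphisms_iff by blast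
  obtain hs where h: "set hs \<subseteq> carrier \<C>" "decomp (map gal hs) G" using G unfolding one_morphisms_iff by blast
  show ?thesis unfolding one_morphisms_iff by (rule exI, rule conjI[OF OM_comp_list[OF f h]])
 qed
 show "id_functor \<in> OM" by (rule T_OM[OF monoid.one_closed[OF catalan_is_monoid] T_one])
qed (simp_all add: comp_functor_assoc)

lemma J_ideal: "ideal J ZC"
 by (rule zero_ideal[OF catalan_is_monoid catalan_zero_mem catalan_zero_mult])

lemma J_coset: "[|supp a \<subseteq> carrier \<C>; supp b \<subseteq> carrier \<C>|] ==>
  J +>\<^bsub>ZC\<^esub> a = J +>\<^bsub>ZC\<^esub> b \<longleftrightarrow> a - b \<in> J"
 using ring.quotient_eq_iff_same_a_r_cos[OF int_monoid_ring_ring[OF catalan_is_monoid] J_ideal, of a b]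
 by (simp add: int_monoid_ring_minus[OF catalan_is_monoid])

definition summands where
 "summands H = (SOME fs. set fs \<subseteq> carrier \<C> \<and> decomp (map gal fs) H)"

lemma summands:
 assumes "H \<in> OM"
 shows "set (summands H) \<subseteq> carrier \<C>" "decomp (map gal (summands H)) H"
 using someI_ex[of "\<lambda>fs. set fs \<subseteq> carrier \<C> \<and> decomp (map gal fs) H"] assms
 unfolding summands_def one_morphisms_iff by auto

text \<open>On the level of formal sums, a 1-morphism is sent to the sum of its summands. Multiplicities of the
 zero of the monoid are arbitrary, hence the map is of interest only modulo \<open>J\<close>.\<close>

definition mult_map where "mult_map = frag_extend (\<lambda>H. list_frag (summands H))"

lemma mult_map_simps [simp]: "mult_map 0 = 0" "mult_map (frag_of H) = list_frag (summands H)"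
 "mult_map (a - b) = mult_map a - mult_map b" "mult_map (a + b) = mult_map a + mult_map b"
 by (simp_all add: mult_map_def frag_extend_diff frag_extend_add)

lemma mult_map_keys: "supp c \<subseteq> OM ==> supp (mult_map c) \<subseteq> carrier \<C>"
 unfolding mult_map_def using keys_frag_extend[of "\<lambda>H. list_frag (summands H)" c] summands(1)
 by (fastforce simp: list_frag_keys)

lemma J_diff: "[|a \<in> J; b \<in> J|] ==> a - b \<in> J"
 using diff_keys by blast

lemma mult_map_J:
 assumes fs: "set fs \<subseteq> carrier \<C>" "decomp (map gal fs) H"
 shows "mult_map (frag_of H) - list_frag fs \<in> J"
proof -
 have H: "H \<in> OM" using fs one_morphisms_iff by blast
 note s = summands[OF H]
 have "f = catalan_zero n" if "f \<in> supp (mult_map (frag_of H) - list_frag fs)" for f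
 proof (rule ccontr)
  assume ne: "f \<noteq> catalan_zero n"
  have f: "f \<in> carrier \<C>"
   using that diff_keys[of "list_frag (summands H)" "carrier \<C>" "list_frag fs"] fs(1) s(1) by (auto simp: list_frag_keys)
  have "count_list (summands H) f = count_list fs f" by (rule multiplicity_unique[OF s(1) fs(1) s(2) fs(2) f ne])
  then show False using that by (simp add: in_keys_iff lookup_minus list_frag_lookup)
 qed
 then show ?thesis by blast
qed

text \<open>The summands of a composite are the products of the summands of its factors.\<close>

lemma mult_map_mult:
 assumes "supp a \<subseteq> OM" "supp b \<subseteq> OM"
 shows "mult_map (frag_mult (\<circ>\<^sub>F) a b) - frag_mult (monoid.mult \<C>) (mult_map a) (mult_map b) \<in> J"
 using assms(1)
proof (induction a rule: frag_induction)
 case zero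
 then show ?case by simp
next
 case (one F)
 show ?case using assms(2)
 proof (induction b rule: frag_induction)
  case zero
  then show ?case by simp
 next
  case (one G)
  note f = summands[OF \<open>F \<in> OM\<close>] and g = summands[OF \<open>G \<in> OM\<close>]
  show ?case
   using mult_map_J[OF OM_comp_list[OF f g]] list_frag_mult[of "monoid.mult \<C>" "summands F" "summands G"] by simp
 next
  case (diff a b)
  then show ?case using J_diff[OF diff] by (simp add: algebra_simps)
 qed
next
 case (diff a b)
 then show ?case using J_diff[OF diff] by (simp add: algebra_simps)
qed

definition rep where "rep f = (SOME F. T f F)"

lemma rep: "f \<in> carrier \<C> ==> T f (rep f)"
 unfolding rep_def using someI_ex[OF T_ex] by simp

lemma rep_OM: "f \<in> carrier \<C> ==> rep f \<in> OM"
 using T_OM rep by simp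

text \<open>A section of \<open>mult_map\<close> modulo \<open>J\<close>, which is also inverse to it modulo the split relations.\<close>

definition rep_map where "rep_map = frag_extend (\<lambda>f. frag_of (rep f))"

lemma rep_map_simps [simp]: "rep_map 0 = 0" "rep_map (frag_of f) = frag_of (rep f)"
 "rep_map (a - b) = rep_map a - rep_map b" "rep_map (a + b) = rep_map a + rep_map b"
 by (simp_all add: rep_map_def frag_extend_diff frag_extend_add)

lemma rep_map_keys: "supp c \<subseteq> carrier \<C> ==> supp (rep_map c) \<subseteq> OM"
 unfolding rep_map_def using keys_frag_extend[of "\<lambda>f. frag_of (rep f)" c] rep_OM by (fastforce simp: keys_frag_of)

lemma mult_rep_map: "supp c \<subseteq> carrier \<C> ==> mult_map (rep_map c) - c \<in> J"
proof (induction c rule: frag_induction)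
 case (one f)
 then show ?case using mult_map_J[of "[f]" "rep f"] rep by simp
next
 case (diff a b)
 then show ?case using J_diff[OF diff] by (simp add: algebra_simps)
qed simp

lemma frag_of_diff_keys: "[|H \<in> S; F \<in> S; G \<in> S|] ==> supp (frag_of H - frag_of F - frag_of G) \<subseteq> S"
 by (intro diff_keys) (simp_all add: keys_frag_of)

lemma SR_subgroup: "subgroup SR (free_Abelian_group OM)"
 unfolding split_relations_def
proof (rule group.generate_is_subgroup[OF group_free_Abelian_group], rule subsetI)
 fix c assume "c \<in> {frag_of H - frag_of F - frag_of G | H F G. H \<in> OM \<and> F \<in> OM \<and> G \<in> OM \<and> direct_sum X E H F G}"
 then obtain H F G where "c = frag_of H - frag_of F - frag_of G" "H \<in> OM" "F \<in> OM" "G \<in> OM" by blast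
 then show "c \<in> carrier (free_Abelian_group OM)" using frag_of_diff_keys[of H OM F G] by simp
qed

lemma SR_keys: "c \<in> SR ==> supp c \<subseteq> OM"
 using subgroup.mem_carrier[OF SR_subgroup] by simp

lemma SR_diff: "[|a \<in> SR; b \<in> SR|] ==> a - b \<in> SR"
 using subgroup.m_closed[OF SR_subgroup _ subgroup.m_inv_closed[OF SR_subgroup]] SR_keys[of b] by force

lemma SR_0: "0 \<in> SR"
 using generate.one[of "free_Abelian_group OM"] by (simp add: split_relations_def)

lemma SR_incl: "[|H \<in> OM; F \<in> OM; G \<in> OM; direct_sum X E H F G|] ==> frag_of H - frag_of F - frag_of G \<in> SR"
 unfolding split_relations_def by (rule generate.incl) blast

lemma SR_mult_map: "c \<in> SR ==> mult_map c \<in> J"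
 unfolding split_relations_def
proof (erule generate_free_Abelian_group_induct)
 fix z assume "z \<in> {frag_of H - frag_of F - frag_of G | H F G. H \<in> OM \<and> F \<in> OM \<and> G \<in> OM \<and> direct_sum X E H F G}"
 then obtain H F G where z: "z = frag_of H - frag_of F - frag_of G" and F: "F \<in> OM" and G: "G \<in> OM" and H: "H \<in> OM"
  and d: "direct_sum X E H F G" by blast
 have "mult_map (frag_of H) - list_frag (summands F @ summands G) \<in> J"
  using summands[OF F] summands[OF G] decomp_append[OF d] by (intro mult_map_J) auto
 then show "supp z \<subseteq> OM \<and> mult_map z \<in> J" using frag_of_diff_keys[OF H F G] by (simp add: z algebra_simps)
next
 fix a b assume "mult_map a \<in> J" "mult_map b \<in> J"
 then show "mult_map (a - b) \<in> J" using J_diff by simp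
qed simp

text \<open>A zero functor is the direct sum of two copies of itself.\<close>

lemma SR_zero: "zero_functor X E H ==> frag_of H \<in> SR"
proof -
 assume "zero_functor X E H"
 then have d: "decomp [] H" by (simp add: decomp_Nil_iff)
 have H: "H \<in> OM" using d one_morphisms_iff[of H] by (metis empty_subsetI list.map(1) list.set(1))
 have "frag_of H - frag_of H - frag_of H \<in> SR" using decomp_split[OF _ d d] d by (intro SR_incl[OF H H H]) simp
 from SR_diff[OF SR_0 this] show ?thesis by simp
qed

lemma SR_rep:
 "[|set fs \<subseteq> carrier \<C>; decomp (map gal fs) H|] ==> frag_of H - rep_map (list_frag fs) \<in> SR"
proof (induction fs arbitrary: H)
 case Nil
 then show ?case using SR_zero by (simp add: decomp_Nil_iff)
next
 case (Cons f fs)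
 then have f: "f \<in> carrier \<C>" and fs: "set fs \<subseteq> carrier \<C>" by auto
 have "\<forall>g\<in>set (map gal fs). good g" using fs gal_good by auto
 from decomp_ex[OF this] obtain K where K: "decomp (map gal fs) K" by (rule exE)
 have "direct_sum X E H (rep f) K" using decomp_split[OF _ rep[OF f] K] Cons.prems(2) by simp
 moreover have "H \<in> OM" "K \<in> OM" using one_morphisms_iff Cons.prems fs K by blast+
 ultimately have "frag_of H - frag_of (rep f) - frag_of K \<in> SR" by (intro SR_incl rep_OM[OF f])
 from SR_diff[OF this SR_diff[OF SR_0 Cons.IH[OF fs K]]] show ?case by (simp add: algebra_simps)
qed

lemma SR_rep_map: "supp c \<subseteq> OM ==> c - rep_map (mult_map c) \<in> SR"
proof (induction c rule: frag_induction)
 case (one H)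
 show ?case using SR_rep[OF summands[OF one]] by simp
next
 case (diff a b)
 then show ?case using SR_diff[OF diff] by (simp add: algebra_simps)
qed (simp add: SR_0)

lemma rep_map_J: "c \<in> J ==> rep_map c \<in> SR"
proof -
 assume "c \<in> J"
 then have "supp c \<subseteq> {catalan_zero n}" by simp
 then show ?thesis
 proof (induction c rule: frag_induction)
  case (one f)
  then show ?case using SR_zero[of "rep f"] rep[OF catalan_zero_mem] T_zero by simp
 qed (simp_all add: SR_0 SR_diff)
qed

lemma SR_iff: "supp c \<subseteq> OM ==> c \<in> SR \<longleftrightarrow> mult_map c \<in> J"
proof
 assume c: "supp c \<subseteq> OM" and "mult_map c \<in> J"
 from SR_diff[OF SR_rep_map[OF c] SR_diff[OF SR_0 rep_map_J[OF this(2)]]] show "c \<in> SR" by simp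
qed (rule SR_mult_map)

lemma Gr_ring_iso: "Gr_ring n X E \<simeq> ZC Quot J"
proof -
 interpret ideal J ZC by (rule J_ideal)
 let ?h = "\<lambda>c. J +>\<^bsub>ZC\<^esub> mult_map c"
 note q = ring_hom_memE[OF rcos_ring_hom]
 have z: "J +>\<^bsub>ZC\<^esub> a = J \<longleftrightarrow> a \<in> J" if "supp a \<subseteq> carrier \<C>" for a
  using J_coset[OF that, of 0] ring_hom_zero[OF rcos_ring_hom ring_axioms quotient_is_ring] by (simp add: FactRing_def)
 have "?h \<in> ring_hom ZM (ZC Quot J)"
 proof (rule ring_hom_memI; unfold int_monoid_ring_sel one_morphism_monoid_sel mem_Collect_eq)
  fix a b :: "('o, 'm) endofunctor \<Rightarrow>\<^sub>0 int" assume a: "supp a \<subseteq> OM"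
  note ma = mult_map_keys[OF a]
  show "?h a \<in> carrier (ZC Quot J)" using q(1) ma by simp
  assume b: "supp b \<subseteq> OM"
  note mb = mult_map_keys[OF b]
  show "?h (a + b) = ?h a \<oplus>\<^bsub>ZC Quot J\<^esub> ?h b" using q(3)[of "mult_map a" "mult_map b"] ma mb by simp
  have k: "supp (frag_mult (\<circ>\<^sub>F) a b) \<subseteq> OM"
   using frag_mult_keys[OF a b, of "(\<circ>\<^sub>F)" OM] monoid.m_closed[OF one_morphism_monoid] by simp
  have k': "supp (frag_mult (monoid.mult \<C>) (mult_map a) (mult_map b)) \<subseteq> carrier \<C>"
   using frag_mult_keys[OF ma mb] catalan_mult_closed by blast
  have "?h (frag_mult (\<circ>\<^sub>F) a b) = J +>\<^bsub>ZC\<^esub> frag_mult (monoid.mult \<C>) (mult_map a) (mult_map b)"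
   using J_coset[OF mult_map_keys[OF k] k'] mult_map_mult[OF a b] by simp
  then show "?h (frag_mult (\<circ>\<^sub>F) a b) = ?h a \<otimes>\<^bsub>ZC Quot J\<^esub> ?h b" using q(2)[of "mult_map a" "mult_map b"] ma mb by simp
 next
  have o: "\<one>\<^bsub>\<C>\<^esub> \<in> carrier \<C>" by (rule monoid.one_closed[OF catalan_is_monoid])
  have k: "supp (frag_of \<one>\<^bsub>\<C>\<^esub>) \<subseteq> carrier \<C>" using o by (simp add: keys_frag_of)
  have k': "supp (frag_of (id_functor :: ('o, 'm) endofunctor)) \<subseteq> OM"
   using monoid.one_closed[OF one_morphism_monoid] by (simp add: keys_frag_of)
  have "?h (frag_of id_functor) = J +>\<^bsub>ZC\<^esub> frag_of \<one>\<^bsub>\<C>\<^esub>"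
   using J_coset[OF mult_map_keys[OF k'] k] mult_map_J[of "[\<one>\<^bsub>\<C>\<^esub>]" id_functor] T_one o by simp
  then show "?h (frag_of id_functor) = \<one>\<^bsub>ZC Quot J\<^esub>" using q(4) by simp
 qed
 then interpret h: ring_hom_ring ZM "ZC Quot J" ?h
  by (rule ring_hom_ringI2[OF int_monoid_ring_ring[OF one_morphism_monoid] quotient_is_ring])
 have "a_kernel ZM (ZC Quot J) ?h = SR"
 proof -
  have "a_kernel ZM (ZC Quot J) ?h = {c. supp c \<subseteq> OM \<and> ?h c = J}"
   unfolding a_kernel_def' int_monoid_ring_sel one_morphism_monoid_sel mem_Collect_eq by (simp only: FactRing_def ring.simps)
  also have "\<dots> = {c. supp c \<subseteq> OM \<and> c \<in> SR}" by (intro Collect_cong conj_cong refl) (simp only: z[OF mult_map_keys] SR_iff)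
  also have "\<dots> = SR" using SR_keys by blast
  finally show ?thesis .
 qed
 moreover have "?h ` carrier ZM = carrier (ZC Quot J)"
 proof
  show "?h ` carrier ZM \<subseteq> carrier (ZC Quot J)" using h.hom_closed by blast
  show "carrier (ZC Quot J) \<subseteq> ?h ` carrier ZM"
  proof
   fix U assume "U \<in> carrier (ZC Quot J)"
   then obtain c where c: "supp c \<subseteq> carrier \<C>" "U = J +>\<^bsub>ZC\<^esub> c"
    by (auto simp: FactRing_def A_RCOSETS_def' )
   have "U = ?h (rep_map c)" using J_coset[OF mult_map_keys[OF rep_map_keys[OF c(1)]] c(1)] mult_rep_map[OF c(1)] c(2) by simp
   then show "U \<in> ?h ` carrier ZM" using rep_map_keys[OF c(1)] by simp
  qed
 qed
 ultimately show ?thesis using h.FactRing_iso by (simp add: Gr_ring_def)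
qed

end

section \<open>Dimension vectors and short exact sequences\<close>

text \<open>The kernel of the last coordinate function of a basis.\<close>

lemma hyperplane:
 assumes "vspace S" and "vdim S (Suc d)"
 shows "\<exists>p. lin S (line True) p \<and> (\<forall>r. \<exists>v\<in>car S. p v = r) \<and> vdim (S\<lparr>car := {v \<in> car S. p v = 0}\<rparr>) d"
proof -
 interpret vspace S by fact
 obtain b where b: "\<forall>i<Suc d. b i \<in> car S" "\<And>v. v \<in> car S ==> \<exists>c. v = lc S b (Suc d) c"
  and ind: "\<And>c. lc S b (Suc d) c = zer S ==> \<forall>i<Suc d. c i = 0" using assms(2) by (auto simp: vdim_def basis_def)
 define co where "co v = (SOME c. v = lc S b (Suc d) c)" for v
 have co: "lc S b (Suc d) (co v) = v" if "v \<in> car S" for v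
  using someI_ex[OF b(2)[OF that]] by (simp add: co_def)
 have p: "co (lc S b (Suc d) c) d = c d" for c
 proof -
  let ?v = "lc S b (Suc d) c"
  have v: "?v \<in> car S" by (rule lc_mem[OF b(1)])
  have "lc S b (Suc d) (\<lambda>i. c i + -1 * co ?v i) = zer S"
   unfolding lc_add[OF b(1)] lc_scl[OF b(1)] co[OF v] by (rule pls_neg[OF v])
  from ind[OF this, rule_format, OF lessI] show ?thesis by (simp del: lc.simps)
 qed
 let ?p = "\<lambda>v. co v d"
 have "lin S (line True) ?p"
 proof (rule linI)
  fix a a' c assume a: "a \<in> car S"
  show "?p (scl S c a) = scl (line True) c (?p a)"
   using p[of "\<lambda>i. c * co a i"] unfolding lc_scl[OF b(1)] co[OF a] by simp
  assume a': "a' \<in> car S"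
  show "?p (pls S a a') = pls (line True) (?p a) (?p a')"
   using p[of "\<lambda>i. co a i + co a' i"] unfolding lc_add[OF b(1)] co[OF a] co[OF a'] by simp
 qed simp
 moreover have "\<exists>v\<in>car S. ?p v = r" for r
  using p[of "\<lambda>_. r"] by (intro bexI[OF _ lc_mem[OF b(1)]])
 moreover have "basis (S\<lparr>car := {v \<in> car S. ?p v = 0}\<rparr>) b d"
  unfolding basis_def lc_car_update
 proof (intro conjI allI impI ballI)
  fix i assume i: "i < d"
  then show "b i \<in> car (S\<lparr>car := {v \<in> car S. ?p v = 0}\<rparr>)"
   using p[of "\<lambda>k. if k = i then 1 else 0"] lc_single[OF b(1), of i] b(1) by simp
 next
  fix v assume "v \<in> car (S\<lparr>car := {v \<in> car S. ?p v = 0}\<rparr>)"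
  then have v: "v \<in> car S" "co v d = 0" by auto
  have "lc S b (Suc d) (co v) = lc S b d (co v)" using b(1) v(2) scl_0[of "b d"] by simp
  then show "\<exists>c. v = lc S b d c" unfolding co[OF v(1)] by blast
 next
  fix c i assume z: "lc S b d c = zer (S\<lparr>car := {v \<in> car S. ?p v = 0}\<rparr>)" and i: "i < d"
  have "lc S b d (c(d := 0)) = lc S b d c" by (rule lc_cong) auto
  then have "lc S b (Suc d) (c(d := 0)) = zer S" using b(1) z scl_0[of "b d"] by simp
  from ind[OF this, rule_format, of i] i show "c i = 0" by simp
 qed
 ultimately show ?thesis unfolding vdim_def by blast
qed

context X_mod begin

definition dm :: "'o => nat => nat" where "dm x u = (THE d. vdim (V x u) d)"

lemma dm_eq: "[|x \<in> Obj X; vdim (V x u) d|] ==> dm x u = d"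
 unfolding dm_def using vspace.vdim_unique[OF V_vspace] by blast

lemma dm: "x \<in> Obj X ==> vdim (V x u) (dm x u)"
 using V_dim dm_eq by metis

lemma dm_0_iff: "x \<in> Obj X ==> dm x u = 0 \<longleftrightarrow> car (V x u) = {\<^bold>0x}"
 using dm[of x u] dm_eq[of x u 0] vdim_0_iff[OF V_vspace, of x u] by auto

lemma dm_outside: "[|x \<in> Obj X; \<not> (1 \<le> u \<and> u < n)|] ==> dm x u = 0"
 using V_outside dm_0_iff by simp

lemma dm_interval: "[|interval a b P \<gamma>; 1 \<le> u; u < n|] ==> dm P u = (if a \<le> u \<and> u \<le> b then 1 else 0)"
 using dm_eq[OF intervalD(1) vdim_liso[OF liso_inv[OF intervalD(2) V_vspace[OF intervalD(1)]] line_vspace V_vspace[OF intervalD(1)] line_dim]]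
 by blast

lemma dm_decomp:
 assumes H: "decomp gs H" and x: "x \<in> Obj X" and u: "1 \<le> u" "u < n"
 shows "dm H$x u = (\<Sum>g\<leftarrow>gs. dm x (g u))"
proof -
 obtain \<beta> where b: "decomp_by gs H \<beta>" using H by (auto simp: decomp_def)
 have Hx: "H$x \<in> Obj X" by (rule functor_Obj[OF decomp_functor[OF H] x])
 have "vdim (PV x gs u) (\<Sum>k<length gs. dm x ((gs ! k) u))"
  unfolding PV_def by (intro vdim_prodvs[OF Wh_vspace[OF x]]) (auto simp: V_eq_Wh V_vspace V_carrier x dm)
 then have "vdim (V H$x u) (\<Sum>k<length gs. dm x ((gs ! k) u))"
  using vdim_liso[OF liso_inv[OF db_liso[OF b x u(1)] V_vspace[OF Hx]] PV_vspace[OF x] V_vspace[OF Hx]] u by simp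
 then show ?thesis using dm_eq[OF Hx] by (simp add: sum_list_sum_nth atLeast0LessThan)
qed

lemma short_exact_dm:
 assumes s: "short_exact X E f g"
 shows "dm (Cod X f) u = dm (Dom X f) u + dm (Cod X g) u"
proof -
 let ?a = "Dom X f" and ?b = "Cod X f" and ?c = "Cod X g"
 have f: "f \<in> Homset X ?a ?b" and g: "g \<in> Homset X ?b ?c"
  and inj: "inj_on (am f) (carrier (on_obj E ?a))"
  and im: "am f ` carrier (on_obj E ?a) = {b \<in> carrier (on_obj E ?b). am g b = \<zero>\<^bsub>on_obj E ?c\<^esub>}"
  and surj: "am g ` carrier (on_obj E ?b) = carrier (on_obj E ?c)"
  using s by (auto simp: short_exact_def Let_def Homset_def)
 note a = dom[OF f] and b = cod[OF f] and c = cod[OF g]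
 interpret F: LA_mod2 n "on_obj E ?a" "on_obj E ?b" by (rule LA_mod2[OF a b])
 interpret G: LA_mod2 n "on_obj E ?b" "on_obj E ?c" by (rule LA_mod2[OF b c])
 note fl = am_lin[OF f, of u] and gl = am_lin[OF g, of u] and fm = am_mod_hom[OF f] and gm = am_mod_hom[OF g]
 have "vdim (V ?b u) (dm ?a u + dm ?c u)"
 proof (rule vdim_exact[OF V_vspace[OF a] V_vspace[OF b] V_vspace[OF c] fl gl _ _ _ dm[OF a] dm[OF c]])
  show "inj_on (am f) (car (V ?a u))" using inj by (rule inj_on_subset) (use V_carrier[OF a] in auto)
  show "am f ` car (V ?a u) = {z \<in> car (V ?b u). am g z = zer (V ?c u)}"
  proof (intro equalityI subsetI)
   fix z assume "z \<in> am f ` car (V ?a u)"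
   then show "z \<in> {z \<in> car (V ?b u). am g z = zer (V ?c u)}"
    using im V_carrier[OF a] lin_mem[OF fl] by auto
  next
   fix z assume z: "z \<in> {z \<in> car (V ?b u). am g z = zer (V ?c u)}"
   then have "z \<in> am f ` carrier (on_obj E ?a)" unfolding im using V_carrier[OF b, of z u] by simp
   then obtain y where y: "y \<in> carrier (on_obj E ?a)" "z = am f y" by blast
   have "z = am f (tr ?a u u y)" using F.mod_hom_Tr[OF fm y(1)] tr_id[OF b, of z u] z y(2) by simp
   then show "z \<in> am f ` car (V ?a u)" using F.M.Tr_Sp[OF y(1)] by blast
  qed
  show "am g ` car (V ?b u) = car (V ?c u)"
  proof (intro equalityI subsetI)
   fix z assume "z \<in> am g ` car (V ?b u)"
   then show "z \<in> car (V ?c u)" using lin_mem[OF gl] by auto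
  next
   fix z assume z: "z \<in> car (V ?c u)"
   then have "z \<in> am g ` carrier (on_obj E ?b)" unfolding surj using V_carrier[OF c, of z u] by simp
   then obtain y where y: "y \<in> carrier (on_obj E ?b)" "z = am g y" by blast
   have "z = am g (tr ?b u u y)" using G.mod_hom_Tr[OF gm y(1)] tr_id[OF c z] y(2) by simp
   then show "z \<in> am g ` car (V ?b u)" using F.N.Tr_Sp[OF y(1)] by blast
  qed
 qed
 then show ?thesis by (rule dm_eq[OF b])
qed

lemma short_exactI:
 assumes f: "f \<in> Homset X a b" and g: "g \<in> Homset X b c"
  and inj: "\<And>u. [|1 \<le> u; u < n|] ==> inj_on (am f) (car (V a u))"
  and im: "\<And>u. [|1 \<le> u; u < n|] ==> am f ` car (V a u) = {z \<in> car (V b u). am g z = \<^bold>0c}"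
  and surj: "\<And>u. [|1 \<le> u; u < n|] ==> am g ` car (V b u) = car (V c u)"
 shows "short_exact X E f g"
proof -
 note a = dom[OF f] and b = cod[OF f] and c = cod[OF g]
 interpret F: LA_mod2 n "E$a" "E$b" by (rule LA_mod2[OF a b])
 interpret G: LA_mod2 n "E$b" "E$c" by (rule LA_mod2[OF b c])
 note fm = am_mod_hom[OF f] and gm = am_mod_hom[OF g]
 note z = am_zero[OF f] am_zero[OF g]
 have im: "am f ` car (V a u) = {z \<in> car (V b u). am g z = \<^bold>0c}" for u
  using im[of u] z V_outside[OF a, of u] V_outside[OF b, of u] by (cases "1 \<le> u \<and> u < n") auto
 have surj: "am g ` car (V b u) = car (V c u)" for u
  using surj[of u] z V_outside[OF b, of u] V_outside[OF c, of u] by (cases "1 \<le> u \<and> u < n") auto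
 have inj: "inj_on (am f) (car (V a u))" for u
  using inj[of u] V_outside[OF a, of u] by (cases "1 \<le> u \<and> u < n") auto
 have "inj_on (am f) (car (Wh n E$a))"
 proof (rule lin_inj[OF F.mod_hom_lin[OF fm] Wh_vspace[OF a] Wh_vspace[OF b]])
  fix x assume "x \<in> car (Wh n E$a)" and fx: "am f x = zer (Wh n E$b)"
  then have x: "x \<in> carrier E$a" by simp
  have "tr a u u x = \<^bold>0a" for u
  proof -
   have "am f (tr a u u x) = am f \<^bold>0a" using F.mod_hom_Tr[OF fm x, of u u] fx z(1) by simp
   from inj_onD[OF inj this F.M.Tr_Sp[OF x] zero_V[OF a]] show ?thesis .
  qed
  then show "x = zer (Wh n E$a)" using F.M.eq_if_components_eq[OF x, of "\<^bold>0a"] by simp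
 qed
 moreover have "am f ` carrier E$a = {y \<in> carrier E$b. am g y = \<^bold>0c}"
 proof (intro equalityI subsetI)
  fix y assume "y \<in> am f ` carrier E$a"
  then obtain x where x: "x \<in> carrier E$a" "y = am f x" by auto
  have y: "y \<in> carrier E$b" using F.mod_hom_mem[OF fm x(1)] x(2) by simp
  have "am g (tr b u u y) = \<^bold>0c" for u
  proof -
   have "tr b u u y \<in> am f ` car (V a u)"
    using F.mod_hom_Tr[OF fm x(1), of u u] F.M.Tr_Sp[OF x(1), of u u] x(2) by (intro image_eqI) simp_all
   then show ?thesis unfolding im by simp
  qed
  then show "y \<in> {y \<in> carrier E$b. am g y = \<^bold>0c}" using G.mod_hom_ker[OF gm y] y by simp
 next
  fix y assume "y \<in> {y \<in> carrier E$b. am g y = \<^bold>0c}"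
  then have y: "y \<in> carrier E$b" "am g y = \<^bold>0c" by auto
  show "y \<in> am f ` carrier E$a"
   by (rule F.mod_hom_image[OF fm y(1)]) (use im G.mod_hom_Tr[OF gm y(1)] F.N.Tr_Sp[OF y(1)] y(2) in auto)
 qed
 moreover have "am g ` carrier E$b = carrier E$c"
  using G.mod_hom_mem[OF gm] G.mod_hom_image[OF gm] surj G.N.Tr_Sp by auto
 ultimately show ?thesis using f g by (simp add: short_exact_def Let_def Homset_def)
qed

text \<open>No nonzero transition map ends at the first vertex of the support, so a functional on this component
 extends by zero to a homomorphism onto the simple module.\<close>

lemma simple_quotient:
 assumes x: "x \<in> Obj X" and u: "1 \<le> u" "u < n" and d: "dm x u \<noteq> 0" and low: "\<And>v. v < u ==> dm x v = 0"
  and P: "interval u u P \<gamma>"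
 shows "\<exists>f g. short_exact X E f g \<and> Cod X f = x \<and> Cod X g = P"
proof -
 note PO = intervalD(1)[OF P]
 obtain d where "vdim (V x u) (Suc d)" using dm[OF x, of u] d by (cases "dm x u") auto
 from hyperplane[OF V_vspace[OF x] this] obtain p where p: "lin (V x u) (line True) p"
  and ps: "\<And>r. \<exists>v\<in>car (V x u). p v = r" and pk: "vdim (V x u\<lparr>car := {v \<in> car (V x u). p v = 0}\<rparr>) d" by blast
 define W where "W v = (if v = u then V x u\<lparr>car := {v \<in> car (V x u). p v = 0}\<rparr> else V x v)" for v
 have W: "car (W v) = {z \<in> car (V x v). v = u --> p z = 0}" "pls (W v) = ring.add E$x"
  "zer (W v) = \<^bold>0x" "scl (W v) = scalar_act (LA n) E$x" for v
  by (auto simp: W_def)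
 have p0: "p \<^bold>0x = 0" using lin_zer[OF p V_vspace[OF x] line_vspace] by simp
 have triv: "z = \<^bold>0x" if "v < u" "z \<in> car (V x v)" for v z
  using low[OF that(1)] dm_0_iff[OF x] that(2) by auto
 have Wt: "tr x v w z \<in> car (W w)" if "v \<le> w" "z \<in> car (W v)" for v w z
 proof -
  have z: "z \<in> car (V x v)" using that(2) by (simp add: W)
  have "p (tr x v w z) = 0" if "w = u"
   using triv[of v z] tr_zero[OF x] p0 tr_id[OF x z] z \<open>v \<le> w\<close> \<open>z \<in> car (W v)\<close> that by (cases "v = u") (auto simp: W)
  then show ?thesis using lin_mem[OF tr_lin[OF x] z] by (simp add: W)
 qed
 have "qrep n W (tr x)"
 proof (rule qrep.intro)
  fix v w assume v: "1 \<le> v" "v \<le> w" "w < n"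
  show "lin (W v) (W w) (tr x v w)"
   using Wt[OF v(2)] lin_pls[OF tr_lin[OF x]] lin_scl[OF tr_lin[OF x]] by (auto simp: lin_def W)
 next
  fix v assume v: "1 \<le> v" "v < n"
  show "vspace (W v)"
  proof (cases "v = u")
   case True
   have "vspace (V x u\<lparr>car := {v \<in> car (V x u). p v = 0}\<rparr>)"
    by (rule vspace.subspace[OF V_vspace[OF x]])
     (use p0 zero_V[OF x] vspace.pls_mem[OF V_vspace[OF x], of _ u] vspace.scl_mem[OF V_vspace[OF x], of _ u] lin_pls[OF p] lin_scl[OF p] in auto)
   then show ?thesis using True by (simp add: W_def)
  qed (simp add: W_def V_vspace[OF x])
  show "\<exists>d. vdim (W v) d" using pk V_dim[OF x] by (auto simp: W_def)
 qed (use tr_id[OF x] tr_tr[OF x] in \<open>auto simp: W\<close>)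
 from object_ex[OF this] obtain K \<beta> where K: "K \<in> Obj X"
  and \<beta>: "\<And>v. [|1 \<le> v; v < n|] ==> liso (V K v) (W v) (\<beta> v)"
  and \<beta>t: "\<And>v w z. [|1 \<le> v; v \<le> w; w < n; z \<in> car (V K v)|] ==> \<beta> w (tr K v w z) = tr x v w (\<beta> v z)" by blast
 have "\<exists>f\<in>Homset X K x. \<forall>v z. 1 \<le> v \<and> v < n \<and> z \<in> car (V K v) --> am f z = \<beta> v z"
  by (rule arr_ex[OF K x _ \<beta>t]) (use \<beta> in \<open>auto simp: liso_def lin_def W\<close>)
 then obtain f where f: "f \<in> Homset X K x" "\<And>v z. [|1 \<le> v; v < n; z \<in> car (V K v)|] ==> am f z = \<beta> v z" by blast
 let ?h = "\<lambda>v z. if v = u then p z else 0"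
 let ?\<phi> = "\<lambda>v z. inv_into (car (V P v)) (\<gamma> v) (?h v z)"
 have h: "lin (V x v) (line (u \<le> v \<and> v \<le> u)) (?h v)" for v
  using lin_pls[OF p] lin_scl[OF p] by (auto simp: lin_def)
 note l = intervalD(2)[OF P]
 note li = liso_inv[OF l V_vspace[OF PO]]
 have \<gamma>\<phi>: "\<gamma> v (?\<phi> v z) = ?h v z" if "1 \<le> v" "v < n" "z \<in> car (V x v)" for v z
  by (rule liso_inv_right[OF l[OF that(1,2)] lin_mem[OF h that(3)]])
 have "\<exists>g\<in>Homset X x P. \<forall>v z. 1 \<le> v \<and> v < n \<and> z \<in> car (V x v) --> am g z = ?\<phi> v z" (is "\<exists>g\<in>_. ?R g")
 proof (rule arr_ex[OF x PO])
  fix v assume v: "1 \<le> v" "v < n"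
  show "lin (V x v) (V P v) (?\<phi> v)" by (rule lin_comp[OF h liso_lin[OF li[OF v]]])
 next
  fix v w z assume v: "1 \<le> v" "v \<le> w" "w < n" and z: "z \<in> car (V x v)"
  then have v': "v < n" "1 \<le> w" by auto
  have m: "?\<phi> v z \<in> car (V P v)" by (rule liso_mem[OF li[OF v(1) v'(1)] lin_mem[OF h z]])
  have t: "tr x v w z \<in> car (V x w)" by (rule lin_mem[OF tr_lin[OF x] z])
  have "?h w (tr x v w z) = (if u \<le> v \<and> w \<le> u then ?h v z else 0)"
  proof -
   consider "v < u" | "v = u" "w = u" | "u < w" using v by linarith
   then show ?thesis using triv[of v z] z tr_zero[OF x] p0 tr_id[OF x z] by cases auto
  qed
  then have "\<gamma> w (tr P v w (?\<phi> v z)) = \<gamma> w (?\<phi> w (tr x v w z))"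
   using intervalD(3)[OF P v m] unfolding \<gamma>\<phi>[OF v(1) v'(1) z] \<gamma>\<phi>[OF v'(2) v(3) t] by (simp only:)
  then show "?\<phi> w (tr x v w z) = tr P v w (?\<phi> v z)"
   using liso_eq_iff[OF l[OF v'(2) v(3)] lin_mem[OF tr_lin[OF PO] m] liso_mem[OF li[OF v'(2) v(3)] lin_mem[OF h t]]] by simp
 qed
 then obtain g where g: "g \<in> Homset X x P" "?R g" by (rule bexE)
 have gz: "\<gamma> v (am g z) = ?h v z" if "1 \<le> v" "v < n" "z \<in> car (V x v)" for v z
  using \<gamma>\<phi>[OF that] g(2) that by simp
 have "short_exact X E f g"
 proof (rule short_exactI[OF f(1) g(1)])
  fix v assume v: "1 \<le> v" "v < n"
  have fi: "am f ` car (V K v) = car (W v)"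
   using f(2)[OF v] liso_bij[OF \<beta>[OF v]] by (auto simp: bij_betw_def image_iff cong: image_cong)
  show "inj_on (am f) (car (V K v))"
   using f(2)[OF v] liso_bij[OF \<beta>[OF v]] by (auto simp: bij_betw_def cong: inj_on_cong)
  have "am g z = \<^bold>0P \<longleftrightarrow> (v = u --> p z = 0)" if z: "z \<in> car (V x v)" for z
   using liso_zer_iff[OF l[OF v] V_vspace[OF PO] line_vspace lin_mem[OF am_lin[OF g(1)] z]] gz[OF v z] by (simp split: if_splits)
  then show "am f ` car (V K v) = {z \<in> car (V x v). am g z = \<^bold>0P}" unfolding fi W by auto
  show "am g ` car (V x v) = car (V P v)"
  proof (intro equalityI subsetI)
   fix z assume "z \<in> am g ` car (V x v)"
   then show "z \<in> car (V P v)" using lin_mem[OF am_lin[OF g(1)]] by auto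
  next
   fix z assume z: "z \<in> car (V P v)"
   have "\<exists>y\<in>car (V x v). ?h v y = \<gamma> v z"
    using ps[of "\<gamma> v z"] liso_mem[OF l[OF v] z] zero_V[OF x, of v] by (cases "v = u") (auto split: if_splits)
   then obtain y where y: "y \<in> car (V x v)" "\<gamma> v (am g y) = \<gamma> v z" using gz[OF v] by auto
   then have "am g y = z" using liso_eq_iff[OF l[OF v] lin_mem[OF am_lin[OF g(1)] y(1)] z] by simp
   then show "z \<in> am g ` car (V x v)" using y(1) by blast
  qed
 qed
 then show ?thesis using f(1) g(1) by (auto simp: Homset_def)
qed

section \<open>The Grothendieck group\<close>

abbreviation "FX \<equiv> free_Abelian_group (Obj X)"
abbreviation "FN \<equiv> free_Abelian_group {1..n-1}"
abbreviation "ER \<equiv> exact_relations X E"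

text \<open>The basis vectors of the natural representation. With \<open>e\<^sub>0 = 0\<close>, shifts of the index need no case
 distinction.\<close>

definition en :: "nat => nat \<Rightarrow>\<^sub>0 int" where "en j = (if j = 0 then 0 else frag_of j)"

text \<open>The coordinates in which dimension vectors appear: if \<open>c\<close> is the class of a module, this is its
 dimension at \<open>u\<close>.\<close>

definition tail :: "nat => (nat \<Rightarrow>\<^sub>0 int) => int" where
 "tail u c = (\<Sum>j=u..n-1. Poly_Mapping.lookup c j)"

lemma tail_simps [simp]: "tail u 0 = 0" "tail u (a + b) = tail u a + tail u b" "tail u (a - b) = tail u a - tail u b"
 "tail u (frag_cmul k a) = k * tail u a"
 by (simp_all add: tail_def lookup_add lookup_minus sum.distrib sum_subtractf sum_distrib_left)

lemma tail_sum: "tail u (\<Sum>i\<in>I. f i) = (\<Sum>i\<in>I. tail u (f i))"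
 by (induction I rule: infinite_finite_induct) simp_all

lemma tail_en: "[|1 \<le> u; j < n|] ==> tail u (en j) = (if u \<le> j then 1 else 0)"
 by (auto simp: tail_def en_def lookup_single when_def)

lemma en_keys: "j < n ==> supp (en j) \<subseteq> {1..n-1}"
 by (auto simp: en_def keys_frag_of)

lemma tail_eqI:
 assumes "supp a \<subseteq> {1..n-1}" "supp b \<subseteq> {1..n-1}"
  and t: "\<And>u. [|1 \<le> u; u < n|] ==> tail u a = tail u b"
 shows "a = b"
proof (rule poly_mapping_eqI)
 fix j
 show "Poly_Mapping.lookup a j = Poly_Mapping.lookup b j"
 proof (cases "1 \<le> j \<and> j < n")
  case True
  then have "j \<le> n - 1" by linarith
  then have l: "Poly_Mapping.lookup c j = tail j c - tail (Suc j) c" for c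
   using sum.atLeast_Suc_atMost[of j "n - 1" "Poly_Mapping.lookup c"] by (simp add: tail_def)
  have "tail (Suc j) a = tail (Suc j) b"
   using t[of "Suc j"] by (cases "Suc j < n") (simp_all add: tail_def)
  then show ?thesis unfolding l using t[of j] True by simp
 next
  case False
  then have "j \<notin> {1..n-1}" by auto
  then have "j \<notin> supp a" "j \<notin> supp b" using assms by blast+
  then show ?thesis by (simp add: in_keys_iff)
 qed
qed

text \<open>The class of a module, in terms of the classes \<open>e\<^sub>w - e\<^sub>w\<^sub>-\<^sub>1\<close> of the simple modules.\<close>

definition cl :: "'o => nat \<Rightarrow>\<^sub>0 int" where
 "cl x = (\<Sum>w=1..n-1. frag_cmul (int (dm x w)) (en w - en (w - 1)))"

lemma sum_keys: "(\<And>i. i \<in> I ==> supp (f i) \<subseteq> S) ==> supp (\<Sum>i\<in>I. f i :: 'a \<Rightarrow>\<^sub>0 int) \<subseteq> S"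
proof (induction I rule: infinite_finite_induct)
 case (insert i I)
 then show ?case using add_keys[of "f i" S "sum f I"] by simp
qed simp_all

lemma cl_keys: "supp (cl x) \<subseteq> {1..n-1}"
 unfolding cl_def
proof (rule sum_keys)
 fix w assume "w \<in> {1..n-1}"
 then have "supp (en w - en (w - 1)) \<subseteq> {1..n-1}" by (intro diff_keys en_keys) auto
 then show "supp (frag_cmul (int (dm x w)) (en w - en (w - 1))) \<subseteq> {1..n-1}" using keys_cmul by blast
qed

lemma tail_cl:
 assumes x: "x \<in> Obj X" and u: "1 \<le> u"
 shows "tail u (cl x) = int (dm x u)"
proof -
 have "tail u (cl x) = (\<Sum>w=1..n-1. if w = u then int (dm x u) else 0)"
  unfolding cl_def tail_sum
 proof (rule sum.cong[OF refl])
  fix w assume "w \<in> {1..n-1}"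
  then have w: "1 \<le> w" "w < n" "w - 1 < n" by auto
  have "u \<le> w \<longleftrightarrow> w = u \<or> u \<le> w - 1" using w(1) by linarith
  moreover have "\<not> u \<le> u - 1" using u by linarith
  ultimately show "tail u (frag_cmul (int (dm x w)) (en w - en (w - 1))) = (if w = u then int (dm x u) else 0)"
   using tail_en[OF u w(2)] tail_en[OF u w(3)] by simp
 qed
 also have "\<dots> = int (dm x u)" using u dm_outside[OF x, of u] by (auto simp: sum.delta)
 finally show ?thesis .
qed

lemma cl_add:
 assumes "\<And>u. [|1 \<le> u; u < n|] ==> dm x u = dm y u + dm z u"
 shows "cl x = cl y + cl z"
 unfolding cl_def sum.distrib[symmetric]
proof (rule sum.cong[OF refl])
 fix w assume "w \<in> {1..n-1}"
 then have "dm x w = dm y w + dm z w" using assms[of w] by auto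
 then show "frag_cmul (int (dm x w)) (en w - en (w - 1)) =
   frag_cmul (int (dm y w)) (en w - en (w - 1)) + frag_cmul (int (dm z w)) (en w - en (w - 1))"
  by (simp add: frag_cmul_distrib)
qed

abbreviation "Cl \<equiv> frag_extend cl"

lemma Cl_keys: "supp (Cl c) \<subseteq> {1..n-1}"
 using keys_frag_extend[of cl c] cl_keys by blast

lemma ER_gen_keys: "short_exact X E f g ==>
  supp (frag_of (Cod X f) - frag_of (Dom X f) - frag_of (Cod X g)) \<subseteq> Obj X"
 by (intro frag_of_diff_keys) (auto simp: short_exact_def dom_obj cod_obj)

lemma ER_subgroup: "subgroup ER FX"
 unfolding exact_relations_def
 by (rule group.generate_is_subgroup[OF group_free_Abelian_group]) (use ER_gen_keys in auto)

lemma ER_keys: "c \<in> ER ==> supp c \<subseteq> Obj X"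
 using subgroup.mem_carrier[OF ER_subgroup] by simp

lemma ER_diff: "[|a \<in> ER; b \<in> ER|] ==> a - b \<in> ER"
 using subgroup.m_closed[OF ER_subgroup _ subgroup.m_inv_closed[OF ER_subgroup]] ER_keys[of b] by force

lemma ER_0: "0 \<in> ER"
 using subgroup.one_closed[OF ER_subgroup] by simp

lemma ER_incl: "short_exact X E f g ==> frag_of (Cod X f) - frag_of (Dom X f) - frag_of (Cod X g) \<in> ER"
 unfolding exact_relations_def by (rule generate.incl) blast

lemma ER_Cl: "c \<in> ER ==> Cl c = 0"
 unfolding exact_relations_def
proof (erule generate_free_Abelian_group_induct)
 fix z assume "z \<in> {frag_of (Cod X f) - frag_of (Dom X f) - frag_of (Cod X g) | f g. short_exact X E f g}"
 then obtain f g where z: "z = frag_of (Cod X f) - frag_of (Dom X f) - frag_of (Cod X g)" and s: "short_exact X E f g" by blast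
 show "supp z \<subseteq> Obj X \<and> Cl z = 0"
  using ER_gen_keys[OF s] cl_add[OF short_exact_dm[OF s]] by (simp add: z frag_extend_diff)
qed (simp_all add: frag_extend_diff)

definition simple where "simple w = (SOME P. \<exists>\<gamma>. interval w w P \<gamma>)"

lemma simple: "\<exists>\<gamma>. interval w w (simple w) \<gamma>"
 unfolding simple_def using interval_ex by (rule someI_ex)

lemma simple_Obj: "simple w \<in> Obj X"
 using simple intervalD(1) by blast

lemma cl_simple:
 assumes "1 \<le> w" "w < n"
 shows "cl (simple w) = en w - en (w - 1)"
proof (rule tail_eqI[OF cl_keys])
 show "supp (en w - en (w - 1)) \<subseteq> {1..n-1}" using assms by (intro diff_keys en_keys) auto
 fix u assume u: "1 \<le> u" "u < n"
 obtain \<gamma> where "interval w w (simple w) \<gamma>" using simple by blast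
 from dm_interval[OF this u] show "tail u (cl (simple w)) = tail u (en w - en (w - 1))"
  using tail_en[OF u(1), of w] tail_en[OF u(1), of "w - 1"] assms by (auto simp: tail_cl[OF simple_Obj u(1)])
qed

text \<open>A section of the class map, which represents \<open>e\<^sub>j\<close> by the composition factors of the interval module
 with support \<open>{1..j}\<close>.\<close>

definition lift where "lift = frag_extend (\<lambda>j. \<Sum>w=1..j. frag_of (simple w))"

lemma lift_simps [simp]: "lift 0 = 0" "lift (a - b) = lift a - lift b" "lift (a + b) = lift a + lift b"
 "lift (en j) = (\<Sum>w=1..j. frag_of (simple w))"
 by (auto simp: lift_def frag_extend_diff frag_extend_add en_def)

lemma lift_keys: "supp (lift c) \<subseteq> Obj X"
proof -
 have "supp (\<Sum>w=1..j. frag_of (simple w)) \<subseteq> Obj X" for j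
  by (rule sum_keys) (simp add: keys_frag_of simple_Obj)
 then show ?thesis unfolding lift_def using keys_frag_extend by fast
qed

lemma Cl_lift: "supp c \<subseteq> {1..n-1} ==> Cl (lift c) = c"
proof (induction c rule: frag_induction)
 case (one j)
 have "Cl (lift (en j)) = en j" if "j < n" for j
  using that
 proof (induction j)
  case (Suc j)
  then show ?case using cl_simple[of "Suc j"] by (simp add: frag_extend_add)
 qed (simp add: en_def)
 from this[of j] one show ?case by (cases j) (auto simp: en_def)
qed (simp_all add: frag_extend_diff)

lemma lift_simple: "[|1 \<le> w; w < n|] ==> lift (cl (simple w)) = frag_of (simple w)"
 by (cases w) (simp_all add: cl_simple)

text \<open>Split off simple quotients at the first vertex of the support until the module is zero; the class of
 a zero module \<open>x\<close> is zero because the identity of \<open>x\<close>, taken twice, is a short exact sequence.\<close>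

lemma lift_cl: "x \<in> Obj X ==> frag_of x - lift (cl x) \<in> ER"
proof (induction "\<Sum>u=1..n-1. dm x u" arbitrary: x rule: less_induct)
 case less
 note x = less.prems
 show ?case
 proof (cases "\<exists>u. dm x u \<noteq> 0")
  case True
  \<comment> \<open>the first vertex of the support\<close>
  define u where "u = (LEAST u. dm x u \<noteq> 0)"
  have du: "dm x u \<noteq> 0" unfolding u_def using True by (rule LeastI_ex)
  then have "1 \<le> u \<and> u < n" using dm_outside[OF x, of u] by (cases "1 \<le> u \<and> u < n") simp_all
  then have u: "1 \<le> u" "u < n" by auto
  have low: "dm x v = 0" if "v < u" for v using not_less_Least[of v "\<lambda>u. dm x u \<noteq> 0"] that by (auto simp: u_def)
  obtain \<gamma> where P: "interval u u (simple u) \<gamma>" using simple by blast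
  obtain f g where s: "short_exact X E f g" "Cod X f = x" "Cod X g = simple u"
   using simple_quotient[OF x u du low P] by blast
  let ?K = "Dom X f"
  have K: "?K \<in> Obj X" using s(1) dom_obj by (simp add: short_exact_def)
  have d: "dm x v = dm ?K v + dm (simple u) v" for v using short_exact_dm[OF s(1)] s(2,3) by simp
  have "(\<Sum>v=1..n-1. dm ?K v) < (\<Sum>v=1..n-1. dm x v)"
   by (rule sum_strict_mono_ex1) (use d dm_interval[OF P u] u in \<open>auto intro!: bexI[of _ u]\<close>)
  from less.hyps[OF this K] have IH: "frag_of ?K - lift (cl ?K) \<in> ER" .
  have "frag_of x - frag_of ?K - frag_of (simple u) \<in> ER" using ER_incl[OF s(1)] s(2,3) by simp
  from ER_diff[OF this ER_diff[OF ER_0 IH]] show ?thesis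
   using cl_add[of x ?K "simple u"] d lift_simple[OF u] by (simp add: algebra_simps)
 next
  case False
  then have z: "cl x = 0" by (simp add: cl_def)
  have V0: "car (V x u) = {\<^bold>0x}" for u using False dm_0_iff[OF x] by blast
  have i: "Ident X x \<in> Homset X x x" by (rule ident[OF x])
  have "short_exact X E (Ident X x) (Ident X x)"
   by (rule short_exactI[OF i i]) (use am_zero[OF i] V0 in auto)
  from ER_incl[OF this] have "frag_of x - frag_of x - frag_of x \<in> ER" using i by (simp add: Homset_def)
  from ER_diff[OF ER_0 this] show ?thesis by (simp add: z)
 qed
qed

lemma ER_iff: "c \<in> ER \<longleftrightarrow> supp c \<subseteq> Obj X \<and> Cl c = 0"
proof
 assume c: "supp c \<subseteq> Obj X \<and> Cl c = 0"
 have "c - lift (Cl c) \<in> ER" if "supp c \<subseteq> Obj X" for c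
  using that
 proof (induction c rule: frag_induction)
  case (diff a b)
  then show ?case using ER_diff[OF diff] by (simp add: frag_extend_diff algebra_simps)
 qed (simp_all add: ER_0 lift_cl)
 from this[of c] c show "c \<in> ER" by simp
qed (use ER_keys ER_Cl in blast)

text \<open>The cosets of the exact relations, indexed by the classes of their elements.\<close>

definition fiber where "fiber d = {c. supp c \<subseteq> Obj X \<and> Cl c = d}"

lemma coset_fiber:
 assumes "supp b \<subseteq> Obj X"
 shows "ER #>\<^bsub>FX\<^esub> b = fiber (Cl b)"
proof -
 have "c \<in> ER #>\<^bsub>FX\<^esub> b \<longleftrightarrow> c \<in> fiber (Cl b)" for c
 proof -
  have "c \<in> ER #>\<^bsub>FX\<^esub> b \<longleftrightarrow> c - b \<in> ER"
   by (auto simp: r_coset_def intro!: bexI[of _ "c - b"])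
  also have "\<dots> \<longleftrightarrow> c \<in> fiber (Cl b)"
   using diff_keys[of c "Obj X" b] add_keys[of "c - b" "Obj X" b] assms by (auto simp: ER_iff fiber_def frag_extend_diff)
  finally show ?thesis .
 qed
 then show ?thesis by blast
qed

lemma fiber_lift: "supp d \<subseteq> {1..n-1} ==> ER #>\<^bsub>FX\<^esub> lift d = fiber d"
 using coset_fiber[OF lift_keys] Cl_lift by simp

lemma Gr_group_carrier: "carrier (Gr_group X E) = fiber ` carrier FN"
proof -
 have "carrier (Gr_group X E) = {ER #>\<^bsub>FX\<^esub> b | b. supp b \<subseteq> Obj X}"
  by (auto simp: Gr_group_def FactGroup_def RCOSETS_def)
 also have "\<dots> = fiber ` carrier FN"
 proof (intro equalityI subsetI)
  fix U assume "U \<in> {ER #>\<^bsub>FX\<^esub> b | b. supp b \<subseteq> Obj X}"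
  then obtain b where "U = fiber (Cl b)" using coset_fiber by auto
  then show "U \<in> fiber ` carrier FN" using Cl_keys by simp
 next
  fix U assume "U \<in> fiber ` carrier FN"
  then obtain d where "supp d \<subseteq> {1..n-1}" "U = fiber d" by auto
  then show "U \<in> {ER #>\<^bsub>FX\<^esub> b | b. supp b \<subseteq> Obj X}" using fiber_lift lift_keys by blast
 qed
 finally show ?thesis .
qed

lemma Gr_group_mult:
 assumes "supp c \<subseteq> {1..n-1}" "supp d \<subseteq> {1..n-1}"
 shows "fiber c \<otimes>\<^bsub>Gr_group X E\<^esub> fiber d = fiber (c + d)"
proof -
 have N: "ER \<lhd> FX" by (rule comm_group.subgroup_imp_normal[OF abelian_free_Abelian_group ER_subgroup])
 show ?thesis
  using normal.rcos_sum[OF N, of "lift c" "lift d"] lift_keys fiber_lift[OF assms(1)] fiber_lift[OF assms(2)]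
   fiber_lift[OF add_keys[OF assms]] by (simp add: Gr_group_def FactGroup_def)
qed

lemma fiber_inj: "[|supp c \<subseteq> {1..n-1}; fiber c = fiber d|] ==> c = d"
 using lift_keys[of c] Cl_lift[of c] by (auto simp: fiber_def set_eq_iff)

lemma fiber_iso: "fiber \<in> iso FN (Gr_group X E)"
proof (rule isoI)
 show "fiber \<in> hom FN (Gr_group X E)"
  using Gr_group_mult Gr_group_carrier by (auto intro!: homI)
 show "bij_betw fiber (carrier FN) (carrier (Gr_group X E))"
  using fiber_inj by (auto simp: bij_betw_def Gr_group_carrier inj_on_def)
qed

section \<open>The action on the Grothendieck group\<close>

text \<open>The linear extension of \<open>e\<^sub>j \<mapsto> e\<^sub>k\<close> with \<open>k = f (j + 1) - 1\<close>; the shift by one appears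
 since the monoid acts on \<open>{1..n}\<close> but the basis has \<open>n - 1\<close> elements, with \<open>e\<^sub>0 = 0\<close>
 corresponding to the fixed point \<open>1\<close>.\<close>

definition nact where "nact f = frag_extend (\<lambda>j. en (f (j + 1) - 1))"

lemma nact_simps [simp]: "nact f 0 = 0" "nact f (a - b) = nact f a - nact f b" "nact f (a + b) = nact f a + nact f b"
 by (simp_all add: nact_def frag_extend_diff frag_extend_add)

lemma nact_en: "[|f \<in> carrier \<C>; j < n|] ==> nact f (en j) = en (f (j + 1) - 1)"
 using catalanD(3)[of f 1] n by (auto simp: nact_def en_def)

lemma frag_en_induct [consumes 1, case_names zero en diff]:
 assumes "supp c \<subseteq> {1..n-1}" "P 0" "\<And>j. [|1 \<le> j; j < n|] ==> P (en j)" "\<And>a b. [|P a; P b|] ==> P (a - b)"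
 shows "P c"
 using assms(1)
proof (induction c rule: frag_induction)
 case (one j)
 then show ?case using assms(3)[of j] by (auto simp: en_def split: if_splits)
qed (use assms in auto)

lemma nact_keys:
 assumes "f \<in> carrier \<C>" "supp c \<subseteq> {1..n-1}"
 shows "supp (nact f c) \<subseteq> {1..n-1}"
 using assms(2)
proof (induction c rule: frag_en_induct)
 case (en j)
 have "f (j + 1) - 1 < n" using catalanD(4)[OF assms(1), of "j + 1"] en by auto
 then show ?case using nact_en[OF assms(1) en(2)] en_keys by simp
qed (simp_all add: diff_keys)

text \<open>On \<open>e\<^sub>j\<close> this is the adjointness of \<open>f\<close> and \<open>gal f\<close> at \<open>j + 1\<close>.\<close>

lemma tail_nact:
 assumes f: "f \<in> carrier \<C>" and c: "supp c \<subseteq> {1..n-1}" and u: "1 \<le> u" "u < n"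
 shows "tail u (nact f c) = tail (gal f u) c"
 using c
proof (induction c rule: frag_en_induct)
 case (en j)
 have g: "1 \<le> gal f u" using gal_bounds(1)[OF f u(1)] u by simp
 have fj: "1 \<le> f (j + 1)" "f (j + 1) \<le> n" using catalanD(2,4)[OF f, of "j + 1"] en by auto
 then show ?case
  using gal_iff[OF f u(1), of "j + 1"] u en tail_en[OF g en(2)] tail_en[OF u(1), of "f (j + 1) - 1"] nact_en[OF f en(2)]
  by auto
qed simp_all

lemma nact_mult:
 assumes f: "f \<in> carrier \<C>" and h: "h \<in> carrier \<C>" and c: "supp c \<subseteq> {1..n-1}"
 shows "nact (f \<otimes>\<^bsub>\<C>\<^esub> h) c = nact f (nact h c)"
 using c
proof (induction c rule: frag_en_induct)
 case (en j)
 have hj: "1 \<le> h (j + 1)" "h (j + 1) \<le> n" using catalanD(2,4)[OF h, of "j + 1"] en by auto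
 then have j: "h (j + 1) - 1 < n" by simp
 have "(f \<otimes>\<^bsub>\<C>\<^esub> h) (j + 1) = f (h (j + 1))" using en by (simp add: catalan_mult compose_def)
 then show ?case using nact_en[OF h en(2)] nact_en[OF f j] nact_en[OF catalan_mult_closed[OF f h] en(2)] hj by simp
qed simp_all

lemma nact_one: "supp c \<subseteq> {1..n-1} ==> nact \<one>\<^bsub>\<C>\<^esub> c = c"
proof (induction c rule: frag_en_induct)
 case (en j)
 then have "\<one>\<^bsub>\<C>\<^esub> (j + 1) = j + 1" by (simp add: catalan_one)
 then show ?case using nact_en[OF monoid.one_closed[OF catalan_is_monoid] en(2)] by simp
qed simp_all

lemma cl_T:
 assumes f: "f \<in> carrier \<C>" and F: "T f F" and x: "x \<in> Obj X"
 shows "cl F$x = nact f (cl x)"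
proof (rule tail_eqI[OF cl_keys nact_keys[OF f cl_keys]])
 fix u assume u: "1 \<le> u" "u < n"
 have "1 \<le> gal f u" using gal_bounds(1)[OF f u(1)] u by simp
 then show "tail u (cl F$x) = tail u (nact f (cl x))"
  using tail_nact[OF f cl_keys u] tail_cl[OF functor_Obj[OF decomp_functor[OF F] x] u(1)] tail_cl[OF x]
   dm_decomp[OF F x u] by simp
qed

lemma OM_functor: "H \<in> OM ==> is_functor X X H"
 using decomp_functor unfolding one_morphisms_iff by blast

lemma cl_direct_sum:
 assumes F: "F \<in> OM" and G: "G \<in> OM" and d: "direct_sum X E H F G" and x: "x \<in> Obj X"
 shows "cl H$x = cl F$x + cl G$x"
proof (rule cl_add)
 fix u assume u: "1 \<le> u" "u < n"
 note f = summands(2)[OF F] and g = summands(2)[OF G]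
 show "dm H$x u = dm F$x u + dm G$x u"
  using dm_decomp[OF decomp_append[OF d f g] x u] dm_decomp[OF f x u] dm_decomp[OF g x u] by simp
qed

text \<open>Dimensions are additive in direct sums of functors, hence the action of the split relations is zero.\<close>

lemma Cl_SR:
 assumes "c \<in> SR" and b: "supp b \<subseteq> Obj X"
 shows "Cl (frag_mult on_obj c b) = 0"
 using assms(1) unfolding split_relations_def
proof (rule generate_free_Abelian_group_induct)
 fix z assume "z \<in> {frag_of H - frag_of F - frag_of G | H F G. H \<in> OM \<and> F \<in> OM \<and> G \<in> OM \<and> direct_sum X E H F G}"
 then obtain H F G where z: "z = frag_of H - frag_of F - frag_of G" and F: "F \<in> OM" and G: "G \<in> OM" and H: "H \<in> OM"
  and d: "direct_sum X E H F G" by blast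
 have "Cl (frag_mult on_obj z b) = 0" using b
  by (induction b rule: frag_induction) (simp_all add: z frag_extend_diff cl_direct_sum[OF F G d])
 then show "supp z \<subseteq> OM \<and> Cl (frag_mult on_obj z b) = 0" using frag_of_diff_keys[OF H F G] z by simp
qed (simp_all add: frag_extend_diff)

lemma Gr_action_fiber:
 assumes f: "f \<in> carrier \<C>" and H: "T f H" and d: "supp d \<subseteq> {1..n-1}"
 shows "Gr_action X E (Gr_ring_class n X E H) (fiber d) = fiber (nact f d)"
proof -
 have HO: "H \<in> OM" by (rule T_OM[OF f H])
 have U: "Gr_ring_class n X E H = {h + frag_of H | h. h \<in> SR}"
  by (auto simp: Gr_ring_class_def a_r_coset_def r_coset_def)
 have e: "ER #>\<^bsub>FX\<^esub> frag_mult on_obj a b = fiber (nact f d)" if a: "a \<in> Gr_ring_class n X E H" and b: "b \<in> fiber d" for a b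
 proof -
  obtain h where h: "h \<in> SR" "a = h + frag_of H" using a unfolding U by blast
  have bO: "supp b \<subseteq> Obj X" and bd: "Cl b = d" using b by (auto simp: fiber_def)
  have "supp a \<subseteq> OM" unfolding h(2) using SR_keys[OF h(1)] HO by (intro add_keys) (auto simp: keys_frag_of)
  then have k: "supp (frag_mult on_obj a b) \<subseteq> Obj X"
   by (rule frag_mult_keys[OF _ bO]) (rule functor_Obj[OF OM_functor])
  have "Cl (frag_mult on_obj (frag_of H) b) = nact f (Cl b)"
   using bO by (induction b rule: frag_induction) (simp_all add: frag_extend_diff cl_T[OF f H])
  then have "Cl (frag_mult on_obj a b) = nact f d" using Cl_SR[OF h(1) bO] by (simp add: h(2) bd frag_extend_add)
  then show ?thesis using coset_fiber[OF k] by simp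
 qed
 have "frag_of H \<in> Gr_ring_class n X E H" unfolding U using SR_0 by (auto intro!: exI[of _ 0])
 moreover have "lift d \<in> fiber d" using lift_keys Cl_lift[OF d] by (simp add: fiber_def)
 ultimately have "(\<Union>a\<in>Gr_ring_class n X E H. \<Union>b\<in>fiber d. ER #>\<^bsub>FX\<^esub> frag_mult on_obj a b) = fiber (nact f d)"
  using e by blast
 moreover have "fiber d \<in> carrier (Gr_group X E)" unfolding Gr_group_carrier using d by simp
 ultimately show ?thesis by (simp add: Gr_action_def)
qed

definition nrep where "nrep f = restrict (nact f) (carrier FN)"

text \<open>The action of the class of any functor that belongs to \<open>f\<close>; by \<open>arep_T\<close> the choice does not matter.\<close>

definition arep where "arep f = Gr_action X E (Gr_ring_class n X E (rep f))"

lemma arep_fiber: "[|f \<in> carrier \<C>; supp d \<subseteq> {1..n-1}|] ==> arep f (fiber d) = fiber (nact f d)"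
 unfolding arep_def by (rule Gr_action_fiber[OF _ rep])

lemma arep_T:
 assumes f: "f \<in> carrier \<C>" and H: "T f H"
 shows "arep f = Gr_action X E (Gr_ring_class n X E H)"
proof (rule extensionalityI[of _ "carrier (Gr_group X E)"])
 fix U assume "U \<in> carrier (Gr_group X E)"
 then obtain d where "supp d \<subseteq> {1..n-1}" "U = fiber d" unfolding Gr_group_carrier by auto
 then show "arep f U = Gr_action X E (Gr_ring_class n X E H) U"
  using arep_fiber[OF f] Gr_action_fiber[OF f H] by simp
qed (simp_all add: arep_def Gr_action_def)

lemma end_monoid_sel [simp]: "carrier (end_monoid G) = hom G G \<inter> extensional (carrier G)"
 "monoid.mult (end_monoid G) = compose (carrier G)" "monoid.one (end_monoid G) = restrict id (carrier G)"
 by (simp_all add: end_monoid_def)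

lemma nrep_representation: "representation \<C> FN nrep"
 unfolding representation_def end_monoid_sel
proof (intro conjI homI; (unfold end_monoid_sel)?)
 show "nrep f \<in> hom FN FN \<inter> extensional (carrier FN)"
  if "f \<in> carrier \<C>" for f
  using nact_keys[OF that] by (auto simp: nrep_def add_keys intro!: homI)
 show "nrep (f \<otimes>\<^bsub>\<C>\<^esub> h) = compose (carrier FN) (nrep f) (nrep h)"
  if "f \<in> carrier \<C>" "h \<in> carrier \<C>" for f h
  using nact_mult[OF that] nact_keys[OF that(2)] by (auto simp: nrep_def compose_def fun_eq_iff)
 show "nrep \<one>\<^bsub>\<C>\<^esub> = restrict id (carrier FN)"
  using nact_one by (auto simp: nrep_def fun_eq_iff)
qed

lemma arep_representation: "representation \<C> (Gr_group X E) arep"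
 unfolding representation_def end_monoid_sel
proof (intro conjI homI; (unfold end_monoid_sel)?)
 have ext: "arep f \<in> extensional (carrier (Gr_group X E))" for f by (simp add: arep_def Gr_action_def)
 have cE: "\<exists>d. supp d \<subseteq> {1..n-1} \<and> U = fiber d" if "U \<in> carrier (Gr_group X E)" for U
  using that unfolding Gr_group_carrier image_iff Bex_def carrier_free_Abelian_group_iff .
 have cI: "fiber d \<in> carrier (Gr_group X E)" if "supp d \<subseteq> {1..n-1}" for d
  using that unfolding Gr_group_carrier by auto
 show "arep f \<in> hom (Gr_group X E) (Gr_group X E) \<inter> extensional (carrier (Gr_group X E))"
  if f: "f \<in> carrier \<C>" for f
 proof (intro IntI ext homI)
  fix U assume "U \<in> carrier (Gr_group X E)"
  then obtain d where d: "supp d \<subseteq> {1..n-1}" "U = fiber d" using cE by blast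
  show "arep f U \<in> carrier (Gr_group X E)" using cI[OF nact_keys[OF f d(1)]] arep_fiber[OF f d(1)] d(2) by simp
  fix U' assume "U' \<in> carrier (Gr_group X E)"
  then obtain d' where d': "supp d' \<subseteq> {1..n-1}" "U' = fiber d'" using cE by blast
  show "arep f (U \<otimes>\<^bsub>Gr_group X E\<^esub> U') = arep f U \<otimes>\<^bsub>Gr_group X E\<^esub> arep f U'"
   using Gr_group_mult[OF d(1) d'(1)] Gr_group_mult[OF nact_keys[OF f d(1)] nact_keys[OF f d'(1)]]
    arep_fiber[OF f d(1)] arep_fiber[OF f d'(1)] arep_fiber[OF f add_keys[OF d(1) d'(1)]] by (simp add: d(2) d'(2))
 qed
 show "arep (f \<otimes>\<^bsub>\<C>\<^esub> h) = compose (carrier (Gr_group X E)) (arep f) (arep h)"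
  if f: "f \<in> carrier \<C>" and h: "h \<in> carrier \<C>" for f h
 proof (rule extensionalityI[OF ext])
  fix U assume U: "U \<in> carrier (Gr_group X E)"
  then obtain d where d: "supp d \<subseteq> {1..n-1}" "U = fiber d" using cE by blast
  show "arep (f \<otimes>\<^bsub>\<C>\<^esub> h) U = compose (carrier (Gr_group X E)) (arep f) (arep h) U"
   using arep_fiber[OF catalan_mult_closed[OF f h] d(1)] arep_fiber[OF h d(1)] arep_fiber[OF f nact_keys[OF h d(1)]]
    nact_mult[OF f h d(1)] U d(2) by (simp add: compose_def)
 qed simp
 show "arep \<one>\<^bsub>\<C>\<^esub> = restrict id (carrier (Gr_group X E))"
 proof (rule extensionalityI[OF ext])
  fix U assume U: "U \<in> carrier (Gr_group X E)"
  then obtain d where d: "supp d \<subseteq> {1..n-1}" "U = fiber d" using cE by blast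
  show "arep \<one>\<^bsub>\<C>\<^esub> U = restrict id (carrier (Gr_group X E)) U"
   using arep_fiber[OF monoid.one_closed[OF catalan_is_monoid] d(1)] nact_one[OF d(1)] U d(2) by simp
 qed simp
qed

lemma arep_nrep_isomorphic: "rep_isomorphic \<C> (Gr_group X E) arep FN nrep"
proof -
 let ?F = "FN"
 let ?\<psi> = "inv_into (carrier ?F) fiber"
 have \<psi>: "?\<psi> (fiber d) = d" if "supp d \<subseteq> {1..n-1}" for d
  using that fiber_iso by (intro inv_into_f_f) (auto simp: iso_def bij_betw_def)
 have "?\<psi> (arep f U) = nrep f (?\<psi> U)" if f: "f \<in> carrier \<C>" and U: "U \<in> carrier (Gr_group X E)" for f U
 proof -
  obtain d where d: "supp d \<subseteq> {1..n-1}" "U = fiber d" using U unfolding Gr_group_carrier by auto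
  show ?thesis using arep_fiber[OF f d(1)] \<psi>[OF d(1)] \<psi>[OF nact_keys[OF f d(1)]] d by (simp add: nrep_def)
 qed
 then show ?thesis
  using group.iso_set_sym[OF group_free_Abelian_group fiber_iso] unfolding rep_isomorphic_def by blast
qed

lemma nrep_alpha:
 assumes i: "1 \<le> i" "i < n" and j: "1 \<le> j" "j < n"
 shows "nrep (alpha n i) (frag_of j) = (if j \<noteq> i then frag_of j else if i = 1 then 0 else frag_of (i - 1))"
 using nact_en[OF alpha_mem[OF i] j(2)] i j by (auto simp: nrep_def en_def alpha_def)

end

theorem theorem1:
  fixes n :: nat
    and Xcat :: "('o, 'm) category"
    and E :: "('o, 'm, 'k::alg_closed_field) amod_functor"
  assumes n: "n \<ge> 1"
    and Xcat: "category Xcat"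
    and E: "is_equivalence Xcat (fdmod (linear_path_algebra n)) E"
  defines "\<C> \<equiv> catalan_monoid n"
    and "\<S> \<equiv> indec_monoid n Xcat E"
  shows
    "((\<forall>U\<in>carrier \<S>. \<forall>V\<in>carrier \<S>. U \<otimes>\<^bsub>\<S>\<^esub> V \<in> carrier \<S>) \<and>
      (\<forall>U\<in>carrier \<S>. \<forall>V\<in>carrier \<S>. \<forall>W\<in>carrier \<S>.
         (U \<otimes>\<^bsub>\<S>\<^esub> V) \<otimes>\<^bsub>\<S>\<^esub> W = U \<otimes>\<^bsub>\<S>\<^esub> (V \<otimes>\<^bsub>\<S>\<^esub> W)))
     \<and>
     (monoid \<S> \<and> (\<exists>\<Phi>\<in>iso \<C> \<S>. \<Phi> \<one>\<^bsub>\<C>\<^esub> = \<one>\<^bsub>\<S>\<^esub>))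
     \<and> \<comment> \<open>the integral monoid ring with the zero of the monoid identified with \<open>0\<close>\<close>
     Gr_ring n Xcat E \<simeq> int_monoid_ring \<C> Quot {c. Poly_Mapping.keys c \<subseteq> {catalan_zero n}}
     \<and>
     (\<exists>\<rho> \<sigma>.
        representation \<C> (Gr_group Xcat E) \<rho> \<and>
        (\<forall>i\<in>{1..n-1}. \<exists>H. acts_as_G n Xcat E i H \<and>
           \<rho> (alpha n i) = Gr_action Xcat E (Gr_ring_class n Xcat E H)) \<and>
        representation \<C> (free_Abelian_group {1..n-1}) \<sigma> \<and>
        (\<forall>i\<in>{1..n-1}. \<forall>j\<in>{1..n-1}.
           \<sigma> (alpha n i) (frag_of j) =
             (if j \<noteq> i then frag_of j else if i = 1 then 0 else frag_of (i - 1))) \<and>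
        rep_isomorphic \<C> (Gr_group Xcat E) \<rho> (free_Abelian_group {1..n-1}) \<sigma>)"
proof -
  interpret X_mod n Xcat E by (rule X_mod.intro[OF n Xcat E])
  interpret S: monoid \<S> unfolding \<S>_def by (rule indec_monoid_monoid)
  have "\<forall>i\<in>{1..n-1}. \<exists>H. acts_as_G n Xcat E i H \<and> arep (alpha n i) = Gr_action Xcat E (Gr_ring_class n Xcat E H)"
  proof
    fix i assume "i \<in> {1..n-1}"
    then have i: "1 \<le> i" "i < n" by auto
    obtain H where H: "acts_as_G n Xcat E i H" using acts_as_G_ex[OF i] by blast
    show "\<exists>H. acts_as_G n Xcat E i H \<and> arep (alpha n i) = Gr_action Xcat E (Gr_ring_class n Xcat E H)"
      using H arep_T[OF alpha_mem[OF i] T_alpha[OF i H]] by blast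
  qed
  moreover have "\<forall>i\<in>{1..n-1}. \<forall>j\<in>{1..n-1}. nrep (alpha n i) (frag_of j) =
      (if j \<noteq> i then frag_of j else if i = 1 then 0 else frag_of (i - 1))"
    using nrep_alpha by auto
  moreover have "\<exists>\<Phi>\<in>iso \<C> \<S>. \<Phi> \<one>\<^bsub>\<C>\<^esub> = \<one>\<^bsub>\<S>\<^esub>"
    unfolding \<C>_def \<S>_def using indec_monoid_iso indec_monoid_one by (intro bexI[of _ cls]) simp_all
  ultimately show ?thesis
    using S.m_assoc S.m_closed S.monoid_axioms Gr_ring_iso arep_representation nrep_representation arep_nrep_isomorphic
    unfolding \<C>_def by (intro conjI exI[of _ arep] exI[of _ nrep] ballI) simp_all
qed

end
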